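(* Let $u\in V^{\Delta_x}_{0,\underline 0}$ be the exact solution of the heat problem with source $f\in L^2(Q)$ and zero initial data. Let $\lambda,\mu>0$. For any $v\in V^{\Delta_x}_{0,\underline 0}$ and $\boldsymbol y\in H^{\mathrm{div}_x,0}(Q)$, and for any $\gamma\in[\tfrac12,+\infty)$ and $\alpha,\beta>0$, the error $e=u-v$ satisfies $$\Big(2-\frac1\gamma\Big)\Big(\lambda\|\nabla_x e\|_Q^2+\mu\|\partial_t e\|_Q^2\Big)+\lambda\|e\|_{\Sigma_T}^2+\mu\|\nabla_x e\|_{\Sigma_T}^2\;\le\;\gamma\Big\{\lambda\,\overline{\mathrm M}^{\mathrm I}(v,\boldsymbol y;\beta)+\mu\,\widetilde{\mathrm M}^{\mathrm I}(v,\boldsymbol y;\alpha)\Big\},$$ where $$\overline{\mathrm M}^{\mathrm I}(v,\boldsymbol y;\beta):=(1+\beta)\|\mathbf r_{\mathrm d}\|_Q^2+\Big(1+\frac1\beta\Big)C_{\mathrm F}^2\|\mathbf r_{\mathrm{eq}}\|_Q^2,\qquad \widetilde{\mathrm M}^{\mathrm I}(v,\boldsymbol y;\alpha):=(1+\alpha)\|\mathrm{div}_x\mathbf r_{\mathrm d}\|_Q^2+\Big(1+\frac1\alpha\Big)\|\mathbf r_{\mathrm{eq}}\|_Q^2,$$ and the residuals are $$\mathbf r_{\mathrm{eq}}:=f-\partial_t v+\mathrm{div}_x\boldsymbol y,\qquad \mathbf r_{\mathrm d}:=\boldsymbol y-\nabla_x v .$$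
   Context: Let $\Omega\subset\mathbb R^d$, $d\in\{1,2,3\}$, be a bounded Lipschitz domain, $0<T<\infty$, $Q=\Omega\times(0,T)$, $\Sigma=\partial\Omega\times(0,T)$, $\Sigma_0=\Omega\times\{0\}$, $\Sigma_T=\Omega\times\{T\}$. The operators $\nabla_x,\Delta_x,\mathrm{div}_x$ act in the spatial variables only. $\|\cdot\|_Q$ and $\|\cdot\|_{\Sigma_T}$ are the $L^2(Q)$- and $L^2(\Sigma_T)$-norms (scalar or vector valued); on $\Sigma_T$ one takes the value at $t=T$. Function spaces (boundary values in the sense of traces): - $H^{1,0}_0(Q)=\{w\in L^2(Q): \nabla_x w\in[L^2(Q)]^d,\ w|_\Sigma=0\}$. - $V^1_0=\{w\in H^1(Q): w|_\Sigma=0\}$. - $V^{\Delta_x}_{0,\underline 0}=\{w\in V^1_0:\ \Delta_x w\in L^2(Q),\ w|_{\Sigma_0}=0\}$. For $w$ in this space the function $t\mapsto\|\nabla_x w(\cdot,t)\|_\Omega^2$ is absolutely continuous on $[0,T]$, so $\|\nabla_x w\|_{\Sigma_T}$ is well defined. - $H^{\mathrm{div}_x,0}(Q)=\{\boldsymbol y\in[L^2(Q)]^d:\ \mathrm{div}_x\boldsymbol y\in L^2(Q)\}$. Exact solution: for given $f\in L^2(Q)$, $u\in V^{\Delta_x}_{0,\underline 0}$ is the unique function with $\partial_t u-\Delta_x u=f$ in $Q$ (so $u=0$ on $\Sigma$ and $u=0$ on $\Sigma_0$). $C_{\mathrm F}>0$ is a constant in the Friedrichs inequality $\|w\|_Q\le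 C_{\mathrm F}\|\nabla_x w\|_Q$ for all $w\in H^{1,0}_0(Q)$. *)

theory Defs
  imports "HOL-Analysis.Analysis"
begin

text \<open>
  Points of space-time are pairs \<open>(x, t)\<close> of type \<^typ>\<open>(real ^ 'n) \<times> real\<close>. Elements of
  \<open>L\<^sup>2\<close> are represented by Borel measurable functions, considered up to null sets.
\<close>

section \<open>Square integrable functions\<close>

definition L2 :: "'a measure \<Rightarrow> ('a \<Rightarrow> 'b::euclidean_space) set" where
  "L2 M = {f \<in> borel_measurable M. integrable M (\<lambda>x. (norm (f x))\<^sup>2)}"

definition L2norm :: "'a measure \<Rightarrow> ('a \<Rightarrow> 'b::euclidean_space) \<Rightarrow> real" where
  "L2norm M f = sqrt (\<integral>x. (norm (f x))\<^sup>2 \<partial>M)"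

definition L2_tendsto ::
  "'a measure \<Rightarrow> (nat \<Rightarrow> 'a \<Rightarrow> 'b::euclidean_space) \<Rightarrow> ('a \<Rightarrow> 'b) \<Rightarrow> bool" where
  "L2_tendsto M \<phi> w \<longleftrightarrow>
     (\<forall>k. (\<lambda>z. \<phi> k z - w z) \<in> L2 M) \<and> (\<lambda>k. L2norm M (\<lambda>z. \<phi> k z - w z)) \<longlonglongrightarrow> 0"


section \<open>Smooth functions and test functions\<close>

primrec C_k :: "nat \<Rightarrow> ('a::euclidean_space \<Rightarrow> real) \<Rightarrow> bool" where
  "C_k 0 f \<longleftrightarrow> continuous_on UNIV f"
| "C_k (Suc k) f \<longleftrightarrow>
     (\<forall>x. f differentiable (at x)) \<and> (\<forall>v. C_k k (\<lambda>x. frechet_derivative f (at x) v))"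

definition smooth :: "('a::euclidean_space \<Rightarrow> real) \<Rightarrow> bool" where
  "smooth f \<longleftrightarrow> (\<forall>k. C_k k f)"

definition test_functions :: "'a::euclidean_space set \<Rightarrow> ('a \<Rightarrow> real) set" where
  "test_functions S =
     {\<phi>. smooth \<phi> \<and> compact (closure {z. \<phi> z \<noteq> 0}) \<and> closure {z. \<phi> z \<noteq> 0} \<subseteq> S}"

definition cgrad_x :: "((real ^ 'n) \<times> real \<Rightarrow> real) \<Rightarrow> (real ^ 'n) \<times> real \<Rightarrow> real ^ 'n" where
  "cgrad_x \<phi> z = (\<chi> i. frechet_derivative \<phi> (at z) (axis i 1, 0))"

definition cd_t :: "((real ^ 'n) \<times> real \<Rightarrow> real) \<Rightarrow> (real ^ 'n) \<times> real \<Rightarrow> real" where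
  "cd_t \<phi> z = frechet_derivative \<phi> (at z) (0, 1)"


section \<open>Bounded Lipschitz domains\<close>

text \<open>
  Near each boundary point the domain is, in suitable rotated coordinates, the set of points
  lying above the graph of a Lipschitz function \<open>g\<close>. The direction \<open>\<nu>\<close> is the vertical one and
  the hyperplane orthogonal to \<open>\<nu>\<close> plays the role of \<open>\<real>\<^bsup>d-1\<^esup>\<close>.
\<close>

definition bounded_Lipschitz_domain :: "'a::euclidean_space set \<Rightarrow> bool" where
  "bounded_Lipschitz_domain \<Omega> \<longleftrightarrow>
     open \<Omega> \<and> connected \<Omega> \<and> \<Omega> \<noteq> {} \<and> bounded \<Omega> \<and>
     (\<forall>p\<in>frontier \<Omega>. \<exists>r>0. \<exists>\<nu> g L. norm \<nu> = 1 \<and> L-lipschitz_on {x. x \<bullet> \<nu> = 0} g \<and>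
        \<Omega> \<inter> ball p r = {x \<in> ball p r. g (x - (x \<bullet> \<nu>) *\<^sub>R \<nu>) < x \<bullet> \<nu>})"


section \<open>Hausdorff measure\<close>

definition hausdorff_content :: "nat \<Rightarrow> real \<Rightarrow> 'a::euclidean_space set \<Rightarrow> ennreal" where
  "hausdorff_content m \<delta> A =
     (INF U \<in> {U :: nat \<Rightarrow> 'a set. A \<subseteq> (\<Union>i. U i) \<and> (\<forall>i. bounded (U i) \<and> diameter (U i) \<le> \<delta>)}.
        \<Sum>i. if U i = {} then 0
             else ennreal (unit_ball_vol (real m) * (diameter (U i) / 2) ^ m))"

definition hausdorff_outer :: "nat \<Rightarrow> 'a::euclidean_space set \<Rightarrow> ennreal" where
  "hausdorff_outer m A = (SUP \<delta>\<in>{0<..}. hausdorff_content m \<delta> A)"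

definition hausdorff_measure :: "nat \<Rightarrow> 'a::euclidean_space measure" where
  "hausdorff_measure m = measure_of UNIV (sets borel) (hausdorff_outer m)"

text \<open>
  Borel sets are Caratheodory measurable for \<^const>\<open>hausdorff_outer\<close>, so \<^const>\<open>measure_of\<close>
  does not degenerate to the zero measure; the result is \<open>emeasure_hausdorff_measure\<close> below.
\<close>

lemma hausdorff_content_le:
  assumes "A \<subseteq> (\<Union>i. U i)" "\<And>i. bounded (U i)" "\<And>i. diameter (U i) \<le> \<delta>"
  shows "hausdorff_content m \<delta> A \<le>
    (\<Sum>i. if U i = {} then 0 else ennreal (unit_ball_vol (real m) * (diameter (U i) / 2) ^ m))"
  unfolding hausdorff_content_def using assms by (intro INF_lower) auto

lemma hausdorff_content_antimono:
  assumes "\<delta> \<le> \<delta>'" "A \<subseteq> B" shows "hausdorff_content m \<delta>' A \<le> hausdorff_content m \<delta> B"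
  unfolding hausdorff_content_def
  by (rule INF_superset_mono) (use assms in \<open>auto intro: order_trans\<close>)

lemma hausdorff_content_empty: "\<delta> > 0 \<Longrightarrow> hausdorff_content m \<delta> {} = 0"
  using hausdorff_content_le[of "{}" "\<lambda>_. {}" \<delta> m] by simp

lemma hausdorff_content_countably_subadditive:
  fixes A :: "nat \<Rightarrow> 'a::euclidean_space set"
  assumes "\<delta> > 0"
  shows "hausdorff_content m \<delta> (\<Union>i. A i) \<le> (\<Sum>i. hausdorff_content m \<delta> (A i))"
proof (rule ennreal_le_epsilon)
  fix e :: real
  define w where "w = (\<lambda>U :: 'a set. if U = {} then 0
    else ennreal (unit_ball_vol (real m) * (diameter U / 2) ^ m))"
  let ?O = "hausdorff_content m \<delta>"
  assume "0 < e" "(\<Sum>n. ?O (A n)) < top"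
  then have *: "\<And>n. ?O (A n) < ?O (A n) + e * (1/2)^Suc n"
    by (auto simp add: less_top dest!: ennreal_suminf_lessD)
  have "\<exists>B. A n \<subseteq> (\<Union>i. B i) \<and> (\<forall>i. bounded (B i) \<and> diameter (B i) \<le> \<delta>) \<and>
      (\<Sum>i. w (B i)) \<le> ?O (A n) + e * (1/2)^Suc n" for n
    using *[of n] unfolding hausdorff_content_def w_def INF_less_iff
    by (auto simp: less_imp_le)
  then obtain B where B: "\<And>n. A n \<subseteq> (\<Union>i. B n i)" "\<And>n i. bounded (B n i)"
      "\<And>n i. diameter (B n i) \<le> \<delta>"
      "\<And>n. (\<Sum>i. w (B n i)) \<le> ?O (A n) + e * (1/2)^Suc n"
    by metis
  define C where "C = case_prod B o prod_decode"
  have A_C: "(\<Union>i. A i) \<subseteq> (\<Union>i. C i)"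
    using B(1) by (auto simp add: C_def subset_eq) (metis prod.case prod_encode_inverse)
  have "?O (\<Union>i. A i) \<le> (\<Sum>i. w (C i))"
    unfolding w_def using B by (intro hausdorff_content_le A_C) (auto simp: C_def split_def)
  also have "\<dots> = (\<Sum>n. \<Sum>i. w (B n i))"
    unfolding C_def comp_def using suminf_ennreal_2dimen[of _ "\<lambda>p. w (case_prod B p)"] by simp
  also have "\<dots> \<le> (\<Sum>n. ?O (A n) + e * (1/2) ^ Suc n)"
    by (intro suminf_le B) auto
  also have "... = (\<Sum>n. ?O (A n)) + (\<Sum>n. ennreal e * ennreal ((1/2) ^ Suc n))"
    using \<open>0 < e\<close> by (subst suminf_add[symmetric])
                     (auto simp del: ennreal_suminf_cmult simp add: ennreal_mult[symmetric])
  also have "\<dots> = (\<Sum>n. ?O (A n)) + e"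
    unfolding ennreal_suminf_cmult
    by (subst suminf_ennreal_eq[OF zero_le_power power_half_series]) auto
  finally show "?O (\<Union>i. A i) \<le> (\<Sum>n. ?O (A n)) + e" .
qed

lemma hausdorff_content_le_outer: "\<delta> > 0 \<Longrightarrow> hausdorff_content m \<delta> A \<le> hausdorff_outer m A"
  unfolding hausdorff_outer_def by (rule SUP_upper) auto

lemma hausdorff_outer_mono: "A \<subseteq> B \<Longrightarrow> hausdorff_outer m A \<le> hausdorff_outer m B"
  unfolding hausdorff_outer_def by (rule SUP_mono) (auto intro: hausdorff_content_antimono)

lemma outer_measure_space_hausdorff:
  "outer_measure_space UNIV (hausdorff_outer m :: 'a::euclidean_space set \<Rightarrow> ennreal)"
  unfolding outer_measure_space_def
proof (intro conjI)
  show "positive UNIV (hausdorff_outer m :: 'a set \<Rightarrow> ennreal)"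
    by (auto simp: positive_def hausdorff_outer_def hausdorff_content_empty)
  show "increasing UNIV (hausdorff_outer m :: 'a set \<Rightarrow> ennreal)"
    by (auto simp: increasing_def hausdorff_outer_mono)
  show "countably_subadditive UNIV (hausdorff_outer m :: 'a set \<Rightarrow> ennreal)"
    unfolding countably_subadditive_def
  proof (intro allI impI)
    fix A :: "nat \<Rightarrow> 'a set"
    show "hausdorff_outer m (\<Union>i. A i) \<le> (\<Sum>i. hausdorff_outer m (A i))"
      unfolding hausdorff_outer_def[of m "\<Union>i. A i"]
    proof (rule SUP_least)
      fix \<delta> :: real assume "\<delta> \<in> {0<..}"
      then have "\<delta> > 0" by simp
      have "hausdorff_content m \<delta> (\<Union>i. A i) \<le> (\<Sum>i. hausdorff_content m \<delta> (A i))"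
        by (rule hausdorff_content_countably_subadditive) fact
      also have "\<dots> \<le> (\<Sum>i. hausdorff_outer m (A i))"
        by (intro suminf_le hausdorff_content_le_outer \<open>\<delta> > 0\<close>) auto
      finally show "hausdorff_content m \<delta> (\<Union>i. A i) \<le> (\<Sum>i. hausdorff_outer m (A i))" .
    qed
  qed
qed

lemma hausdorff_outer_separated:
  fixes A B :: "'a::euclidean_space set"
  assumes "\<epsilon> > 0" and sep: "\<And>x y. x \<in> A \<Longrightarrow> y \<in> B \<Longrightarrow> \<epsilon> \<le> dist x y"
  shows "hausdorff_outer m A + hausdorff_outer m B \<le> hausdorff_outer m (A \<union> B)"
proof -
  define w where "w = (\<lambda>U :: 'a set. if U = {} then 0
    else ennreal (unit_ball_vol (real m) * (diameter U / 2) ^ m))"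
  have w0: "w {} = 0" by (simp add: w_def)
  have 1: "hausdorff_content m \<delta> A + hausdorff_content m \<delta> B \<le> hausdorff_content m \<delta> (A \<union> B)"
    if \<delta>: "\<delta> > 0" "\<delta> < \<epsilon>" for \<delta>
    unfolding hausdorff_content_def[of m \<delta> "A \<union> B"]
  proof (rule INF_greatest)
    fix U :: "nat \<Rightarrow> 'a set"
    assume "U \<in> {U. A \<union> B \<subseteq> (\<Union>i. U i) \<and> (\<forall>i. bounded (U i) \<and> diameter (U i) \<le> \<delta>)}"
    then have U: "A \<union> B \<subseteq> (\<Union>i. U i)" "\<And>i. bounded (U i)" "\<And>i. diameter (U i) \<le> \<delta>" by auto
    define V where "V = (\<lambda>D i. if U i \<inter> D \<noteq> {} then U i else {})"
    have V: "hausdorff_content m \<delta> D \<le> (\<Sum>i. w (V D i))" if "D \<subseteq> A \<union> B" for D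
      unfolding w_def
    proof (rule hausdorff_content_le)
      show "D \<subseteq> (\<Union>i. V D i)" using that U(1) unfolding V_def by fastforce
    qed (use U \<delta> in \<open>auto simp: V_def\<close>)
    have le: "w (V A i) + w (V B i) \<le> w (U i)" for i
    proof (cases "U i \<inter> A \<noteq> {} \<and> U i \<inter> B \<noteq> {}")
      case True
      then obtain x y where xy: "x \<in> U i" "x \<in> A" "y \<in> U i" "y \<in> B" by auto
      then have "dist x y \<le> \<delta>"
        using diameter_bounded_bound[OF U(2)[of i] xy(1,3)] U(3)[of i] by linarith
      with sep[OF xy(2,4)] \<delta> show ?thesis by linarith
    qed (auto simp: V_def w0)
    have "hausdorff_content m \<delta> A + hausdorff_content m \<delta> B \<le> (\<Sum>i. w (V A i)) + (\<Sum>i. w (V B i))"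
      by (intro add_mono V) auto
    also have "\<dots> = (\<Sum>i. w (V A i) + w (V B i))"
      by (rule suminf_add) auto
    also have "\<dots> \<le> (\<Sum>i. w (U i))"
      by (intro suminf_le le) auto
    finally show "hausdorff_content m \<delta> A + hausdorff_content m \<delta> B \<le>
      (\<Sum>i. if U i = {} then 0 else ennreal (unit_ball_vol (real m) * (diameter (U i) / 2) ^ m))"
      unfolding w_def .
  qed
  have 2: "hausdorff_content m \<delta> A + hausdorff_content m \<delta>' B \<le> hausdorff_outer m (A \<union> B)"
    if \<delta>: "\<delta> > 0" "\<delta>' > 0" for \<delta> \<delta>'
  proof -
    define d where "d = min (min \<delta> \<delta>') (\<epsilon> / 2)"
    have d: "d > 0" "d < \<epsilon>" "d \<le> \<delta>" "d \<le> \<delta>'" using \<delta> \<open>\<epsilon> > 0\<close> by (auto simp: d_def min_def)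
    have "hausdorff_content m \<delta> A + hausdorff_content m \<delta>' B
        \<le> hausdorff_content m d A + hausdorff_content m d B"
      by (intro add_mono hausdorff_content_antimono d) auto
    also have "\<dots> \<le> hausdorff_content m d (A \<union> B)" by (rule 1) fact+
    also have "\<dots> \<le> hausdorff_outer m (A \<union> B)" by (rule hausdorff_content_le_outer) fact
    finally show ?thesis .
  qed
  have "hausdorff_outer m A + hausdorff_content m \<delta>' B \<le> hausdorff_outer m (A \<union> B)"
    if "\<delta>' > 0" for \<delta>'
    unfolding hausdorff_outer_def[of m A]
    by (subst ennreal_SUP_add_left[symmetric]) (auto intro!: SUP_least 2 that)
  then show ?thesis
    unfolding hausdorff_outer_def[of m B]
    by (subst ennreal_SUP_add_right) (auto intro!: SUP_least)
qed

lemma hausdorff_outer_infdist_separated: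
  assumes "b < a" "\<And>x. x \<in> A \<Longrightarrow> a \<le> infdist x C" "\<And>x. x \<in> B \<Longrightarrow> infdist x C \<le> b"
  shows "hausdorff_outer m A + hausdorff_outer m B \<le> hausdorff_outer m (A \<union> B)"
proof (rule hausdorff_outer_separated[of "a - b"])
  fix x y assume "x \<in> A" "y \<in> B"
  then show "a - b \<le> dist x y"
    using assms(2)[of x] assms(3)[of y] infdist_triangle[of x C y] by linarith
qed (use assms in auto)

lemma closed_in_hausdorff_lambda_system:
  fixes C :: "'a::euclidean_space set"
  assumes C: "closed C"
  shows "C \<in> lambda_system UNIV UNIV (hausdorff_outer m)"
proof -
  let ?H = "hausdorff_outer m :: 'a set \<Rightarrow> ennreal"
  have oms: "positive UNIV ?H" "countably_subadditive UNIV ?H"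
    using outer_measure_space_hausdorff[of m] by (auto simp: outer_measure_space_def)
  have H0: "?H {} = 0" using oms(1) by (simp add: positive_def)
  have Hun: "?H (\<Union>i. X i) \<le> (\<Sum>i. ?H (X i))" for X :: "nat \<Rightarrow> 'a set"
  proof -
    have "?H (\<Union>i. disjointed X i) \<le> (\<Sum>i. ?H (disjointed X i))"
      using oms(2) disjoint_family_disjointed[of X] unfolding countably_subadditive_def by simp
    also have "\<dots> \<le> (\<Sum>i. ?H (X i))"
      by (intro suminf_le hausdorff_outer_mono disjointed_subset) auto
    finally show ?thesis by (simp add: UN_disjointed_eq)
  qed
  have Hun2: "?H (X \<union> Y) \<le> ?H X + ?H Y" for X Y
  proof -
    have "X \<union> Y = (\<Union>i. binaryset X Y i)" by (simp add: UN_binaryset_eq)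
    moreover have "(\<Sum>i. ?H (binaryset X Y i)) = ?H X + ?H Y"
      using suminf_binaryset_eq[of ?H X Y] H0 by simp
    ultimately show ?thesis using Hun[of "binaryset X Y"] by simp
  qed
  have main: "?H (S \<inter> C) + ?H (S - C) \<le> ?H S" if "C \<noteq> {}" "?H S < top" for S
  proof -
    define A where "A = (\<lambda>n. {x \<in> S. 1 / real (Suc n) \<le> infdist x C})"
    define R where "R = (\<lambda>n. A (Suc n) - A n)"
    have A_mono: "A i \<subseteq> A j" if "i \<le> j" for i j
    proof -
      have "1 / real (Suc j) \<le> 1 / real (Suc i)" using that by (simp add: frac_le)
      then show ?thesis by (auto simp: A_def)
    qed
    have A_un: "S - C = (\<Union>n. A n)"
    proof safe
      fix x assume x: "x \<in> S" "x \<notin> C"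
      then have "infdist x C > 0"
        using C \<open>C \<noteq> {}\<close> in_closed_iff_infdist_zero[of C x] infdist_nonneg[of x C]
        by (metis order_less_le)
      then obtain n where "1 / real (Suc n) < infdist x C"
        using reals_Archimedean by (metis inverse_eq_divide)
      with x show "x \<in> (\<Union>n. A n)" by (auto simp: A_def intro!: exI[of _ n])
    next
      fix x n assume x: "x \<in> A n" "x \<in> C"
      have "(0::real) < 1 / real (Suc n)" by simp
      then have "0 < infdist x C" using x(1) unfolding A_def mem_Collect_eq by linarith
      with x(2) show False by simp
    qed (auto simp: A_def)
    have D_split: "S - C \<subseteq> A n \<union> (\<Union>k. R (k + n))" for n
    proof
      fix x assume "x \<in> S - C"
      then have ex: "\<exists>k. x \<in> A k" using A_un by auto
      define k where "k = (LEAST k. x \<in> A k)"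
      have k: "x \<in> A k" "\<And>j. j < k \<Longrightarrow> x \<notin> A j"
        using ex unfolding k_def by (auto intro: LeastI_ex dest: not_less_Least)
      show "x \<in> A n \<union> (\<Union>k. R (k + n))"
      proof (cases "k \<le> n")
        case True then show ?thesis using k A_mono by auto
      next
        case False
        then obtain j where j: "k = Suc (j + n)"
          by (metis add.commute add_Suc_right less_imp_Suc_add not_le)
        then have "x \<in> R (j + n)" using k by (auto simp: R_def)
        then show ?thesis by auto
      qed
    qed
    have R_le: "infdist x C \<le> 1 / real (Suc n)" if "x \<in> R n" for x n
      using that by (auto simp: R_def A_def)
    have par: "(\<Sum>k<n. ?H (R (2 * k + p))) \<le> ?H (\<Union>k<n. R (2 * k + p))" for n p
    proof (induction n)
      case (Suc n)
      have "?H (\<Union>k<n. R (2 * k + p)) + ?H (R (2 * n + p))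
          \<le> ?H ((\<Union>k<n. R (2 * k + p)) \<union> R (2 * n + p))"
      proof (cases "n = 0")
        case False
        show ?thesis
        proof (rule hausdorff_outer_infdist_separated)
          show "1 / real (Suc (2 * n + p)) < 1 / real (2 * n + p)" using False by (simp add: frac_less2)
        next
          fix x assume "x \<in> (\<Union>k<n. R (2 * k + p))"
          then obtain k where k: "k < n" "x \<in> A (Suc (2 * k + p))" by (auto simp: R_def)
          have "Suc (2 * k + p) \<le> 2 * n + p - 1" using k(1) by linarith
          then have "x \<in> A (2 * n + p - 1)" using A_mono k(2) by blast
          then show "1 / real (2 * n + p) \<le> infdist x C" using False by (simp add: A_def of_nat_diff)
        next
          fix x assume "x \<in> R (2 * n + p)"
          then show "infdist x C \<le> 1 / real (Suc (2 * n + p))" by (rule R_le)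
        qed
      qed (simp add: H0)
      moreover have "(\<Union>k<n. R (2 * k + p)) \<union> R (2 * n + p) = (\<Union>k<Suc n. R (2 * k + p))"
        by (auto simp: less_Suc_eq)
      moreover have "(\<Sum>k<Suc n. ?H (R (2 * k + p)))
          \<le> ?H (\<Union>k<n. R (2 * k + p)) + ?H (R (2 * n + p))"
        using add_right_mono[OF Suc.IH, of "?H (R (2 * n + p))"] by simp
      ultimately show ?case by (simp only:)
    qed simp
    have "(\<Union>k<n. R (2 * k + p)) \<subseteq> S" for n p by (auto simp: R_def A_def)
    then have par': "(\<Sum>k. ?H (R (2 * k + p))) \<le> ?H S" for p
      by (intro suminf_le_const order_trans[OF par hausdorff_outer_mono]) auto
    have sumR: "(\<Sum>k<n. ?H (R k)) \<le> ?H S + ?H S" for n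
    proof -
      have "(\<Sum>k<n. ?H (R k)) \<le> (\<Sum>k<2*n. ?H (R k))"
        by (rule sum_mono2) auto
      also have "\<dots> = (\<Sum>k<n. ?H (R (2 * k + 0))) + (\<Sum>k<n. ?H (R (2 * k + 1)))"
        by (induction n) (auto simp: algebra_simps)
      also have "\<dots> \<le> ?H S + ?H S"
        by (intro add_mono order_trans[OF sum_le_suminf par']) auto
      finally show ?thesis .
    qed
    then have "(\<Sum>k. ?H (R k)) \<le> ?H S + ?H S" by (intro suminf_le_const) auto
    also have "?H S + ?H S < top" using \<open>?H S < top\<close> by simp
    finally have fin: "(\<Sum>k. ?H (R k)) < top" .
    have step: "(?H (S \<inter> C) + ?H (S - C)) + (\<Sum>k<n. ?H (R k)) \<le> ?H S + (\<Sum>k. ?H (R k))" for n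
    proof -
      have "?H (S - C) \<le> ?H (A n) + ?H (\<Union>k. R (k + n))"
        using order_trans[OF hausdorff_outer_mono[OF D_split[of n]] Hun2] .
      also have "\<dots> \<le> ?H (A n) + (\<Sum>k. ?H (R (k + n)))" by (intro add_left_mono Hun)
      finally have a: "?H (S - C) \<le> ?H (A n) + (\<Sum>k. ?H (R (k + n)))" .
      have "?H (A n) + ?H (S \<inter> C) \<le> ?H (A n \<union> (S \<inter> C))"
        by (rule hausdorff_outer_infdist_separated[of 0 "1 / real (Suc n)" _ C]) (auto simp: A_def)
      also have "\<dots> \<le> ?H S" by (rule hausdorff_outer_mono) (auto simp: A_def)
      finally have b: "?H (A n) + ?H (S \<inter> C) \<le> ?H S" .
      have c: "(\<Sum>k. ?H (R k)) = (\<Sum>k. ?H (R (k + n))) + (\<Sum>k<n. ?H (R k))"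
        by (rule suminf_offset) simp
      have "(?H (S \<inter> C) + ?H (S - C)) + (\<Sum>k<n. ?H (R k))
          \<le> (?H (S \<inter> C) + (?H (A n) + (\<Sum>k. ?H (R (k + n))))) + (\<Sum>k<n. ?H (R k))"
        by (intro add_mono a order_refl)
      also have "\<dots> = (?H (A n) + ?H (S \<inter> C)) + (\<Sum>k. ?H (R k))"
        unfolding c by (simp add: ac_simps)
      also have "\<dots> \<le> ?H S + (\<Sum>k. ?H (R k))" by (intro add_mono b order_refl)
      finally show ?thesis .
    qed
    have "(?H (S \<inter> C) + ?H (S - C)) + (\<Sum>k. ?H (R k)) \<le> ?H S + (\<Sum>k. ?H (R k))"
      unfolding suminf_eq_SUP[of "\<lambda>k. ?H (R k)"]
      by (subst ennreal_SUP_add_right)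
         (use step in \<open>auto intro!: SUP_least simp only: suminf_eq_SUP[symmetric]\<close>)
    then show ?thesis using fin
      using ennreal_add_left_cancel_le[of "\<Sum>k. ?H (R k)"] by (auto simp: add.commute)
  qed
  have "?H (C \<inter> S) + ?H ((UNIV - C) \<inter> S) = ?H S" for S
  proof -
    have "S = (C \<inter> S) \<union> ((UNIV - C) \<inter> S)" by blast
    then have le: "?H S \<le> ?H (C \<inter> S) + ?H ((UNIV - C) \<inter> S)"
      using Hun2[of "C \<inter> S" "(UNIV - C) \<inter> S"] by argo
    have ge: "?H (C \<inter> S) + ?H ((UNIV - C) \<inter> S) \<le> ?H S"
    proof (cases "C = {} \<or> ?H S = top")
      case False
      then have "?H (S \<inter> C) + ?H (S - C) \<le> ?H S" by (intro main) (auto simp: less_top)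
      moreover have "S \<inter> C = C \<inter> S" "S - C = (UNIV - C) \<inter> S" by auto
      ultimately show ?thesis by simp
    qed (auto simp: H0)
    from ge le show ?thesis by (rule antisym)
  qed
  then show ?thesis unfolding lambda_system_def by blast
qed

lemma emeasure_hausdorff_measure:
  fixes A :: "'a::euclidean_space set"
  assumes "A \<in> sets borel"
  shows "emeasure (hausdorff_measure m) A = hausdorff_outer m A"
proof -
  let ?L = "lambda_system UNIV UNIV (hausdorff_outer m :: 'a set \<Rightarrow> ennreal)"
  have L: "measure_space UNIV ?L (hausdorff_outer m :: 'a set \<Rightarrow> ennreal)"
    using sigma_algebra.caratheodory_lemma[of UNIV UNIV "hausdorff_outer m :: 'a set \<Rightarrow> ennreal"]
      outer_measure_space_hausdorff[of m] sigma_algebra_Pow[of "UNIV :: 'a set"] by simp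
  then have sigL: "sigma_algebra UNIV ?L" by (simp add: measure_space_def)
  have "sigma_sets UNIV {C. closed C} \<subseteq> ?L"
    by (rule sigma_algebra.sigma_sets_subset[OF sigL])
       (auto intro: closed_in_hausdorff_lambda_system)
  then have "sets (borel :: 'a measure) \<subseteq> ?L"
    unfolding borel_eq_closed by simp
  then have ms: "measure_space UNIV (sets (borel :: 'a measure))
      (hausdorff_outer m :: 'a set \<Rightarrow> ennreal)"
    using measure_down[OF L, of "sets (borel :: 'a measure)"]
      sets.sigma_algebra_axioms[of "borel :: 'a measure"] by simp
  have sets: "sets (hausdorff_measure m :: 'a measure) = sets borel"
    unfolding hausdorff_measure_def using sets.sigma_sets_eq[of "borel :: 'a measure"] by simp
  show ?thesis
  proof (rule emeasure_measure_of[OF hausdorff_measure_def])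
    show "positive (sets (hausdorff_measure m)) (hausdorff_outer m :: 'a set \<Rightarrow> ennreal)"
      unfolding sets using ms unfolding measure_space_def by blast
    show "countably_additive (sets (hausdorff_measure m)) (hausdorff_outer m :: 'a set \<Rightarrow> ennreal)"
      unfolding sets using ms unfolding measure_space_def by blast
    show "A \<in> sets (hausdorff_measure m)"
      unfolding sets by (rule assms)
  qed simp
qed


section \<open>The space-time cylinder and the parts of its boundary\<close>

definition cyl :: "(real ^ 'n) set \<Rightarrow> real \<Rightarrow> ((real ^ 'n) \<times> real) set" where
  "cyl \<Omega> T = \<Omega> \<times> {0<..<T}"

definition lebQ :: "(real ^ 'n) set \<Rightarrow> real \<Rightarrow> ((real ^ 'n) \<times> real) measure" where
  "lebQ \<Omega> T = restrict_space lborel (cyl \<Omega> T)"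

text \<open>The surface measure on \<open>\<partial>\<Omega> \<times> (0,T)\<close>.\<close>

definition lateral_measure :: "(real ^ 'n) set \<Rightarrow> real \<Rightarrow> ((real ^ 'n) \<times> real) measure" where
  "lateral_measure \<Omega> T =
     restrict_space (hausdorff_measure (CARD('n) - 1)) (frontier \<Omega>)
       \<Otimes>\<^sub>M restrict_space lborel {0<..<T}"

text \<open>The surface measure on \<open>\<Omega> \<times> {t}\<close>.\<close>

definition slice_measure :: "(real ^ 'n) set \<Rightarrow> real \<Rightarrow> ((real ^ 'n) \<times> real) measure" where
  "slice_measure \<Omega> t = distr (restrict_space lborel \<Omega>) borel (\<lambda>x. (x, t))"


section \<open>Weak derivatives on the cylinder\<close>

definition is_grad_x ::
  "(real ^ 'n) set \<Rightarrow> real \<Rightarrow> ((real ^ 'n) \<times> real \<Rightarrow> real) \<Rightarrow>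
     ((real ^ 'n) \<times> real \<Rightarrow> real ^ 'n) \<Rightarrow> bool" where
  "is_grad_x \<Omega> T w g \<longleftrightarrow> w \<in> L2 (lebQ \<Omega> T) \<and> g \<in> L2 (lebQ \<Omega> T) \<and>
     (\<forall>\<phi>\<in>test_functions (cyl \<Omega> T).
        (\<integral>z. w z *\<^sub>R cgrad_x \<phi> z \<partial>lebQ \<Omega> T) = - (\<integral>z. \<phi> z *\<^sub>R g z \<partial>lebQ \<Omega> T))"

definition is_d_t ::
  "(real ^ 'n) set \<Rightarrow> real \<Rightarrow> ((real ^ 'n) \<times> real \<Rightarrow> real) \<Rightarrow>
     ((real ^ 'n) \<times> real \<Rightarrow> real) \<Rightarrow> bool" where
  "is_d_t \<Omega> T w g \<longleftrightarrow> w \<in> L2 (lebQ \<Omega> T) \<and> g \<in> L2 (lebQ \<Omega> T) \<and>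
     (\<forall>\<phi>\<in>test_functions (cyl \<Omega> T).
        (\<integral>z. w z * cd_t \<phi> z \<partial>lebQ \<Omega> T) = - (\<integral>z. \<phi> z * g z \<partial>lebQ \<Omega> T))"

definition is_div_x ::
  "(real ^ 'n) set \<Rightarrow> real \<Rightarrow> ((real ^ 'n) \<times> real \<Rightarrow> real ^ 'n) \<Rightarrow>
     ((real ^ 'n) \<times> real \<Rightarrow> real) \<Rightarrow> bool" where
  "is_div_x \<Omega> T y g \<longleftrightarrow> y \<in> L2 (lebQ \<Omega> T) \<and> g \<in> L2 (lebQ \<Omega> T) \<and>
     (\<forall>\<phi>\<in>test_functions (cyl \<Omega> T).
        (\<integral>z. y z \<bullet> cgrad_x \<phi> z \<partial>lebQ \<Omega> T) = - (\<integral>z. \<phi> z * g z \<partial>lebQ \<Omega> T))"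

text \<open>
  The weak derivatives are unique up to null sets; the operators below choose a representative
  and are only meaningful when a weak derivative exists in \<open>L\<^sup>2(Q)\<close>.
\<close>

definition grad_x ::
  "(real ^ 'n) set \<Rightarrow> real \<Rightarrow> ((real ^ 'n) \<times> real \<Rightarrow> real) \<Rightarrow> (real ^ 'n) \<times> real \<Rightarrow> real ^ 'n" where
  "grad_x \<Omega> T w = (SOME g. is_grad_x \<Omega> T w g)"

definition d_t ::
  "(real ^ 'n) set \<Rightarrow> real \<Rightarrow> ((real ^ 'n) \<times> real \<Rightarrow> real) \<Rightarrow> (real ^ 'n) \<times> real \<Rightarrow> real" where
  "d_t \<Omega> T w = (SOME g. is_d_t \<Omega> T w g)"

definition div_x ::
  "(real ^ 'n) set \<Rightarrow> real \<Rightarrow> ((real ^ 'n) \<times> real \<Rightarrow> real ^ 'n) \<Rightarrow> (real ^ 'n) \<times> real \<Rightarrow> real" where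
  "div_x \<Omega> T y = (SOME g. is_div_x \<Omega> T y g)"

definition laplace_x ::
  "(real ^ 'n) set \<Rightarrow> real \<Rightarrow> ((real ^ 'n) \<times> real \<Rightarrow> real) \<Rightarrow> (real ^ 'n) \<times> real \<Rightarrow> real" where
  "laplace_x \<Omega> T w = div_x \<Omega> T (grad_x \<Omega> T w)"


section \<open>Function spaces and traces\<close>

definition H10 :: "(real ^ 'n) set \<Rightarrow> real \<Rightarrow> ((real ^ 'n) \<times> real \<Rightarrow> real) set" where
  "H10 \<Omega> T = {w \<in> L2 (lebQ \<Omega> T). \<exists>g. is_grad_x \<Omega> T w g}"

definition H1 :: "(real ^ 'n) set \<Rightarrow> real \<Rightarrow> ((real ^ 'n) \<times> real \<Rightarrow> real) set" where
  "H1 \<Omega> T = {w \<in> H10 \<Omega> T. \<exists>g. is_d_t \<Omega> T w g}"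

definition Hdiv :: "(real ^ 'n) set \<Rightarrow> real \<Rightarrow> ((real ^ 'n) \<times> real \<Rightarrow> real ^ 'n) set" where
  "Hdiv \<Omega> T = {y \<in> L2 (lebQ \<Omega> T). \<exists>g. is_div_x \<Omega> T y g}"

text \<open>Convergence in \<open>H\<^bsup>1,0\<^esup>(Q)\<close> and in \<open>H\<^sup>1(Q)\<close> of smooth functions \<open>\<phi> k\<close> to \<open>w\<close>.\<close>

definition H10_tendsto ::
  "(real ^ 'n) set \<Rightarrow> real \<Rightarrow> (nat \<Rightarrow> (real ^ 'n) \<times> real \<Rightarrow> real) \<Rightarrow>
     ((real ^ 'n) \<times> real \<Rightarrow> real) \<Rightarrow> bool" where
  "H10_tendsto \<Omega> T \<phi> w \<longleftrightarrow>
     L2_tendsto (lebQ \<Omega> T) \<phi> w \<and>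
     L2_tendsto (lebQ \<Omega> T) (\<lambda>k. cgrad_x (\<phi> k)) (grad_x \<Omega> T w)"

definition H1_tendsto ::
  "(real ^ 'n) set \<Rightarrow> real \<Rightarrow> (nat \<Rightarrow> (real ^ 'n) \<times> real \<Rightarrow> real) \<Rightarrow>
     ((real ^ 'n) \<times> real \<Rightarrow> real) \<Rightarrow> bool" where
  "H1_tendsto \<Omega> T \<phi> w \<longleftrightarrow>
     H10_tendsto \<Omega> T \<phi> w \<and> L2_tendsto (lebQ \<Omega> T) (\<lambda>k. cd_t (\<phi> k)) (d_t \<Omega> T w)"

text \<open>
  \<open>g\<close> is the trace of \<open>w\<close> on the part of the boundary with surface measure \<open>\<Sigma>\<close>: the trace
  operator is the continuous extension of the restriction map from functions smooth up to the
  boundary (that is, restrictions of functions smooth on the whole space) to the space whose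
  convergence is \<open>conv\<close>, with values in \<open>L\<^sup>2(\<Sigma>)\<close>.
\<close>

definition has_trace ::
  "((nat \<Rightarrow> 'a \<Rightarrow> real) \<Rightarrow> ('a \<Rightarrow> real) \<Rightarrow> bool) \<Rightarrow> 'a::euclidean_space measure \<Rightarrow>
     ('a \<Rightarrow> real) \<Rightarrow> ('a \<Rightarrow> real) \<Rightarrow> bool" where
  "has_trace conv \<Sigma> w g \<longleftrightarrow> g \<in> L2 \<Sigma> \<and>
     (\<exists>\<phi>. (\<forall>k. smooth (\<phi> k)) \<and> conv \<phi> w \<and> L2_tendsto \<Sigma> \<phi> g)"

definition H10_0 :: "(real ^ 'n) set \<Rightarrow> real \<Rightarrow> ((real ^ 'n) \<times> real \<Rightarrow> real) set" where
  "H10_0 \<Omega> T =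
     {w \<in> H10 \<Omega> T. has_trace (H10_tendsto \<Omega> T) (lateral_measure \<Omega> T) w (\<lambda>_. 0)}"

definition V1_0 :: "(real ^ 'n) set \<Rightarrow> real \<Rightarrow> ((real ^ 'n) \<times> real \<Rightarrow> real) set" where
  "V1_0 \<Omega> T =
     {w \<in> H1 \<Omega> T. has_trace (H1_tendsto \<Omega> T) (lateral_measure \<Omega> T) w (\<lambda>_. 0)}"

definition VDelta_00 :: "(real ^ 'n) set \<Rightarrow> real \<Rightarrow> ((real ^ 'n) \<times> real \<Rightarrow> real) set" where
  "VDelta_00 \<Omega> T =
     {w \<in> V1_0 \<Omega> T. grad_x \<Omega> T w \<in> Hdiv \<Omega> T \<and>
        has_trace (H1_tendsto \<Omega> T) (slice_measure \<Omega> 0) w (\<lambda>_. 0)}"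


section \<open>Norms on \<open>\<Omega> \<times> {T}\<close>\<close>

definition normQ ::
  "(real ^ 'n) set \<Rightarrow> real \<Rightarrow> ((real ^ 'n) \<times> real \<Rightarrow> 'b::euclidean_space) \<Rightarrow> real" where
  "normQ \<Omega> T w = L2norm (lebQ \<Omega> T) w"

definition norm_final ::
  "(real ^ 'n) set \<Rightarrow> real \<Rightarrow> ((real ^ 'n) \<times> real \<Rightarrow> real) \<Rightarrow> real" where
  "norm_final \<Omega> T w =
     L2norm (slice_measure \<Omega> T) (SOME g. has_trace (H1_tendsto \<Omega> T) (slice_measure \<Omega> T) w g)"

text \<open>
  For \<open>w\<close> in \<^const>\<open>VDelta_00\<close> the function \<open>t \<mapsto> \<parallel>\<nabla>\<^sub>xw(\<cdot>,t)\<parallel>\<^sup>2\<close>, defined for almost every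
  \<open>t\<close>, has a representative \<open>N\<close> that is absolutely continuous on \<open>[0,T]\<close>. It is the only
  continuous representative, and its value at \<open>T\<close> is the square of the norm below.
\<close>

definition grad_norm_final ::
  "(real ^ 'n) set \<Rightarrow> real \<Rightarrow> ((real ^ 'n) \<times> real \<Rightarrow> real) \<Rightarrow> real" where
  "grad_norm_final \<Omega> T w = sqrt ((SOME N. continuous_on {0..T} N \<and>
     (AE t in lborel. t \<in> {0<..<T} \<longrightarrow>
        N t = (L2norm (restrict_space lborel \<Omega>) (\<lambda>x. grad_x \<Omega> T w (x, t)))\<^sup>2)) T)"


section \<open>The heat problem, residuals and majorants\<close>

definition exact_solution ::
  "(real ^ 'n) set \<Rightarrow> real \<Rightarrow> ((real ^ 'n) \<times> real \<Rightarrow> real) \<Rightarrow>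
     ((real ^ 'n) \<times> real \<Rightarrow> real) \<Rightarrow> bool" where
  "exact_solution \<Omega> T f u \<longleftrightarrow> u \<in> VDelta_00 \<Omega> T \<and>
     (AE z in lebQ \<Omega> T. d_t \<Omega> T u z - laplace_x \<Omega> T u z = f z)"

definition r_eq ::
  "(real ^ 'n) set \<Rightarrow> real \<Rightarrow> ((real ^ 'n) \<times> real \<Rightarrow> real) \<Rightarrow> ((real ^ 'n) \<times> real \<Rightarrow> real) \<Rightarrow>
     ((real ^ 'n) \<times> real \<Rightarrow> real ^ 'n) \<Rightarrow> (real ^ 'n) \<times> real \<Rightarrow> real" where
  "r_eq \<Omega> T f v y = (\<lambda>z. f z - d_t \<Omega> T v z + div_x \<Omega> T y z)"

definition r_d ::
  "(real ^ 'n) set \<Rightarrow> real \<Rightarrow> ((real ^ 'n) \<times> real \<Rightarrow> real) \<Rightarrow>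
     ((real ^ 'n) \<times> real \<Rightarrow> real ^ 'n) \<Rightarrow> (real ^ 'n) \<times> real \<Rightarrow> real ^ 'n" where
  "r_d \<Omega> T v y = (\<lambda>z. y z - grad_x \<Omega> T v z)"

definition M_bar ::
  "(real ^ 'n) set \<Rightarrow> real \<Rightarrow> real \<Rightarrow> ((real ^ 'n) \<times> real \<Rightarrow> real) \<Rightarrow>
     ((real ^ 'n) \<times> real \<Rightarrow> real) \<Rightarrow> ((real ^ 'n) \<times> real \<Rightarrow> real ^ 'n) \<Rightarrow> real \<Rightarrow> real" where
  "M_bar \<Omega> T C\<^sub>F f v y \<beta> =
     (1 + \<beta>) * (normQ \<Omega> T (r_d \<Omega> T v y))\<^sup>2
     + (1 + 1 / \<beta>) * C\<^sub>F\<^sup>2 * (normQ \<Omega> T (r_eq \<Omega> T f v y))\<^sup>2"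

definition M_tilde ::
  "(real ^ 'n) set \<Rightarrow> real \<Rightarrow> ((real ^ 'n) \<times> real \<Rightarrow> real) \<Rightarrow>
     ((real ^ 'n) \<times> real \<Rightarrow> real) \<Rightarrow> ((real ^ 'n) \<times> real \<Rightarrow> real ^ 'n) \<Rightarrow> real \<Rightarrow> real" where
  "M_tilde \<Omega> T f v y \<alpha> =
     (1 + \<alpha>) * (normQ \<Omega> T (div_x \<Omega> T (r_d \<Omega> T v y)))\<^sup>2
     + (1 + 1 / \<alpha>) * (normQ \<Omega> T (r_eq \<Omega> T f v y))\<^sup>2"

end

theory Submission
  imports Defs
begin

text \<open>
  The error satisfies \<open>e\<^sub>t - \<Delta>e = r\<^sub>e\<^sub>q - div r\<^sub>d\<close>. Testing this with \<open>e\<close> and with \<open>e\<^sub>t\<close> and integrating by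
  parts gives
  \<open>2 \<parallel>\<nabla>e\<parallel>\<^sup>2 + \<parallel>e(T)\<parallel>\<^sup>2 = 2 (r\<^sub>e\<^sub>q, e) + 2 (r\<^sub>d, \<nabla>e)\<close> and
  \<open>2 \<parallel>e\<^sub>t\<parallel>\<^sup>2 + \<parallel>\<nabla>e(T)\<parallel>\<^sup>2 = 2 (r\<^sub>e\<^sub>q - div r\<^sub>d, e\<^sub>t)\<close>,
  and the estimate follows from the inequalities of Cauchy-Schwarz, Friedrichs and Young.

  Two steps need care. The first is the integration by parts of a function with zero lateral trace against a
  field that only has a weak divergence. A Lipschitz domain has, near each frontier point, a
  cone of inward directions; shifting a mollified test function along such a direction makes it admissible,
  and the error is a difference quotient which is bounded by integrals over thin layers at the
  frontier, hence by the trace. The second is \<open>d/dt \<parallel>\<nabla>e\<parallel>\<^sup>2 = -2 (\<Delta>e, e\<^sub>t)\<close> for \<open>e\<close> without any second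
  mixed derivative; it is obtained by testing with symmetric difference quotients in time.
\<close>

section \<open>Square integrable functions: inequalities\<close>

text \<open>The obstacle is the form of the traces: a zero trace only means that some smooth
  sequence converges in \<open>H1_tendsto\<close> while its restrictions tend to zero in L2 of a
  surface measure, and the sequences for the lateral, initial and final traces are unrelated. So
  every identity is first proved for smooth functions with an explicit error controlled by the
  trace, and then passed to the limit. The lateral measure is built from the raw Hausdorff measure.
  It enters through a one-sided estimate: a cover of a piece of the frontier by small sets thickens
  to a cover of a layer of width h by boxes, so an integral over the layer, divided by h, is bounded
  by a constant times a surface integral. Mollification is encoded by correlations. For square
  integrable f and g on the whole space the map from s to the integral of
  \<open>f (z + s) \<bullet> g z\<close> is continuous at 0, and it vanishes at 0 once its averages
  against bumps placed arbitrarily close to 0 vanish. These bumps need not be centred at 0, which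
  leaves room for the inward shift. For translations to make sense, all functions on Q are extended
  by zero.\<close>

lemma L2_I: "f \<in> borel_measurable M \<Longrightarrow> integrable M (\<lambda>x. (norm (f x))\<^sup>2) \<Longrightarrow> f \<in> L2 M"
  by (simp add: L2_def)

lemma L2_measurable: "f \<in> L2 M \<Longrightarrow> f \<in> borel_measurable M"
  by (simp add: L2_def)

lemma L2_integrable: "f \<in> L2 M \<Longrightarrow> integrable M (\<lambda>x. (norm (f x))\<^sup>2)"
  by (simp add: L2_def)

lemma L2norm_nonneg [simp]: "0 \<le> L2norm M f"
  by (simp add: L2norm_def)

lemma L2norm_sq: "(L2norm M f)\<^sup>2 = (\<integral>x. (norm (f x))\<^sup>2 \<partial>M)"
  by (simp add: L2norm_def)

text \<open>The codomains may differ, so a scalar function can dominate a vector field such as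
  \<open>w z *\<^sub>R gradx \<theta> z\<close>.\<close>

lemma L2_dominated:
  fixes f :: "'a \<Rightarrow> 'b::euclidean_space" and g :: "'a \<Rightarrow> 'c::euclidean_space"
  assumes "g \<in> L2 M" "f \<in> borel_measurable M" "\<And>x. x \<in> space M \<Longrightarrow> norm (f x) \<le> c * norm (g x)"
  shows "f \<in> L2 M"
proof (rule L2_I)
  note [measurable] = assms(2)
  have "integrable M (\<lambda>x. c\<^sup>2 * (norm (g x))\<^sup>2)" using L2_integrable[OF assms(1)] by simp
  then show "integrable M (\<lambda>x. (norm (f x))\<^sup>2)"
  proof (rule Bochner_Integration.integrable_bound)
    show "AE x in M. norm ((norm (f x))\<^sup>2) \<le> norm (c\<^sup>2 * (norm (g x))\<^sup>2)"
    proof (rule AE_I2)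
      fix x assume "x \<in> space M"
      then have "(norm (f x))\<^sup>2 \<le> (c * norm (g x))\<^sup>2" using assms(3) by (intro power_mono) auto
      then show "norm ((norm (f x))\<^sup>2) \<le> norm (c\<^sup>2 * (norm (g x))\<^sup>2)"
        by (simp add: power_mult_distrib)
    qed
  qed measurable
qed (rule assms)

lemma L2_scaleR: "f \<in> L2 M \<Longrightarrow> (\<lambda>x. c *\<^sub>R f x) \<in> L2 M"
  by (rule L2_dominated[where c="\<bar>c\<bar>"]) (auto dest: L2_measurable)

lemma L2_uminus: "f \<in> L2 M \<Longrightarrow> (\<lambda>x. - f x) \<in> L2 M"
  using L2_scaleR[of f M "-1"] by simp

lemma L2_bounded_scaleR:
  assumes "f \<in> L2 M" "h \<in> borel_measurable M" "\<And>x. x \<in> space M \<Longrightarrow> \<bar>h x\<bar> \<le> c"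
  shows "(\<lambda>x. h x *\<^sub>R f x) \<in> L2 M"
proof (rule L2_dominated[OF assms(1), where c=c])
  show "(\<lambda>x. h x *\<^sub>R f x) \<in> borel_measurable M"
    using assms(2) L2_measurable[OF assms(1)] by measurable
  fix x assume "x \<in> space M"
  then show "norm (h x *\<^sub>R f x) \<le> c * norm (f x)" using assms(3) by (simp add: mult_right_mono)
qed

lemma L2_bounded_mult:
  fixes f :: "'a \<Rightarrow> real"
  assumes "f \<in> L2 M" "h \<in> borel_measurable M" "\<And>x. x \<in> space M \<Longrightarrow> \<bar>h x\<bar> \<le> c"
  shows "(\<lambda>x. h x * f x) \<in> L2 M"
  using L2_bounded_scaleR[OF assms] by simp

lemma norm_add_sq_le: "(norm (a + b))\<^sup>2 \<le> 2 * (norm a)\<^sup>2 + 2 * (norm (b::'b::real_normed_vector))\<^sup>2"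
proof -
  have "(norm (a + b))\<^sup>2 \<le> (norm a + norm b)\<^sup>2" by (intro power_mono norm_triangle_ineq) auto
  also have "\<dots> \<le> 2 * (norm a)\<^sup>2 + 2 * (norm b)\<^sup>2"
    using sum_squares_bound[of "norm a" "norm b"] by (simp add: power2_sum)
  finally show ?thesis .
qed

lemma L2_add:
  assumes f: "f \<in> L2 M" and g: "g \<in> L2 M"
  shows "(\<lambda>x. f x + g x) \<in> L2 M"
proof (rule L2_I)
  note [measurable] = L2_measurable[OF f] L2_measurable[OF g]
  show "(\<lambda>x. f x + g x) \<in> borel_measurable M" by measurable
  have "integrable M (\<lambda>x. 2 * (norm (f x))\<^sup>2 + 2 * (norm (g x))\<^sup>2)"
    using L2_integrable[OF f] L2_integrable[OF g] by simp
  then show "integrable M (\<lambda>x. (norm (f x + g x))\<^sup>2)"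
    by (rule Bochner_Integration.integrable_bound) (auto intro!: AE_I2 norm_add_sq_le)
qed

lemma L2_diff: "f \<in> L2 M \<Longrightarrow> g \<in> L2 M \<Longrightarrow> (\<lambda>x. f x - g x) \<in> L2 M"
  using L2_add[OF _ L2_uminus, of f M g] by simp

lemma L2_zero: "(\<lambda>x. 0) \<in> L2 M"
  by (rule L2_I) auto

lemma L2_norm_prod_integrable:
  fixes f :: "'a \<Rightarrow> 'b::euclidean_space" and g :: "'a \<Rightarrow> 'c::euclidean_space"
  assumes f: "f \<in> L2 M" and g: "g \<in> L2 M"
  shows "integrable M (\<lambda>x. norm (f x) * norm (g x))"
proof -
  note [measurable] = L2_measurable[OF f] L2_measurable[OF g]
  have "integrable M (\<lambda>x. (norm (f x))\<^sup>2 + (norm (g x))\<^sup>2)"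
    using L2_integrable[OF f] L2_integrable[OF g] by simp
  then show ?thesis
  proof (rule Bochner_Integration.integrable_bound)
    show "AE x in M. norm (norm (f x) * norm (g x)) \<le> norm ((norm (f x))\<^sup>2 + (norm (g x))\<^sup>2)"
    proof (rule AE_I2)
      fix x
      have "norm (f x) * norm (g x) \<le> 2 * norm (f x) * norm (g x)" by simp
      also have "\<dots> \<le> (norm (f x))\<^sup>2 + (norm (g x))\<^sup>2" by (rule sum_squares_bound)
      finally show "norm (norm (f x) * norm (g x)) \<le> norm ((norm (f x))\<^sup>2 + (norm (g x))\<^sup>2)" by simp
    qed
  qed measurable
qed

lemma L2_inner_integrable:
  assumes f: "f \<in> L2 M" and g: "g \<in> L2 M"
  shows "integrable M (\<lambda>x. f x \<bullet> g x)"
proof -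
  note [measurable] = L2_measurable[OF f] L2_measurable[OF g]
  show ?thesis
    by (rule Bochner_Integration.integrable_bound[OF L2_norm_prod_integrable[OF f g]])
       (auto simp: Cauchy_Schwarz_ineq2)
qed

lemma L2_mult_integrable:
  fixes f g :: "'a \<Rightarrow> real"
  assumes f: "f \<in> L2 M" and g: "g \<in> L2 M"
  shows "integrable M (\<lambda>x. f x * g x)"
  using L2_inner_integrable[OF f g] by simp

text \<open>The version for nonnegative integrals is squared and valued in \<open>ennreal\<close>;
  finiteness of both norms brings it back to real numbers.\<close>

lemma L2_Cauchy_Schwarz_norm:
  fixes f :: "'a \<Rightarrow> 'b::euclidean_space" and g :: "'a \<Rightarrow> 'c::euclidean_space"
  assumes f: "f \<in> L2 M" and g: "g \<in> L2 M"
  shows "(\<integral>x. norm (f x) * norm (g x) \<partial>M) \<le> L2norm M f * L2norm M g"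
proof -
  note [measurable] = L2_measurable[OF f] L2_measurable[OF g]
  have i: "ennreal (\<integral>x. norm (f x) * norm (g x) \<partial>M) = (\<integral>\<^sup>+x. ennreal (norm (f x)) * ennreal (norm (g x)) \<partial>M)"
    by (subst nn_integral_eq_integral[OF L2_norm_prod_integrable[OF f g], symmetric])
       (auto simp: ennreal_mult)
  have sq: "(\<integral>\<^sup>+x. (ennreal (norm (h x)))\<^sup>2 \<partial>M) = ennreal ((L2norm M h)\<^sup>2)"
    if "h \<in> L2 M" for h :: "'a \<Rightarrow> 'd::euclidean_space"
    unfolding L2norm_sq using nn_integral_eq_integral[OF L2_integrable[OF that]]
    by (simp add: ennreal_power)
  have "(ennreal (\<integral>x. norm (f x) * norm (g x) \<partial>M))\<^sup>2 \<le> ennreal ((L2norm M f)\<^sup>2) * ennreal ((L2norm M g)\<^sup>2)"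
    unfolding i sq[OF f, symmetric] sq[OF g, symmetric]
    by (rule Cauchy_Schwarz_nn_integral) measurable
  then have "(\<integral>x. norm (f x) * norm (g x) \<partial>M)\<^sup>2 \<le> (L2norm M f * L2norm M g)\<^sup>2"
    by (simp add: ennreal_power ennreal_mult[symmetric] power_mult_distrib)
  then show ?thesis by (rule power2_le_imp_le) simp
qed

lemma L2_Cauchy_Schwarz:
  assumes f: "f \<in> L2 M" and g: "g \<in> L2 M"
  shows "\<bar>\<integral>x. f x \<bullet> g x \<partial>M\<bar> \<le> L2norm M f * L2norm M g"
proof -
  have "\<bar>\<integral>x. f x \<bullet> g x \<partial>M\<bar> \<le> (\<integral>x. \<bar>f x \<bullet> g x\<bar> \<partial>M)"
    by (rule integral_abs_bound)
  also have "\<dots> \<le> (\<integral>x. norm (f x) * norm (g x) \<partial>M)"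
    using L2_inner_integrable[OF f g] L2_norm_prod_integrable[OF f g]
    by (intro integral_mono) (auto simp: Cauchy_Schwarz_ineq2)
  finally show ?thesis using L2_Cauchy_Schwarz_norm[OF f g] by simp
qed

lemma L2_Cauchy_Schwarz_mult:
  fixes f g :: "'a \<Rightarrow> real"
  assumes f: "f \<in> L2 M" and g: "g \<in> L2 M"
  shows "\<bar>\<integral>x. f x * g x \<partial>M\<bar> \<le> L2norm M f * L2norm M g"
  using L2_Cauchy_Schwarz[OF f g] by simp

lemma L2norm_triangle:
  assumes f: "f \<in> L2 M" and g: "g \<in> L2 M"
  shows "L2norm M (\<lambda>x. f x + g x) \<le> L2norm M f + L2norm M g"
proof (rule power2_le_imp_le)
  note i = L2_integrable[OF f] L2_integrable[OF g] L2_inner_integrable[OF f g]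
  have "(L2norm M (\<lambda>x. f x + g x))\<^sup>2 = (\<integral>x. (norm (f x))\<^sup>2 + (norm (g x))\<^sup>2 + 2 * (f x \<bullet> g x) \<partial>M)"
    unfolding L2norm_sq by (simp add: power2_norm_eq_inner algebra_simps inner_commute)
  also have "\<dots> = (L2norm M f)\<^sup>2 + (L2norm M g)\<^sup>2 + 2 * (\<integral>x. f x \<bullet> g x \<partial>M)"
    unfolding L2norm_sq using i by simp
  also have "\<dots> \<le> (L2norm M f + L2norm M g)\<^sup>2"
    using L2_Cauchy_Schwarz[OF f g] by (simp add: power2_sum)
  finally show "(L2norm M (\<lambda>x. f x + g x))\<^sup>2 \<le> (L2norm M f + L2norm M g)\<^sup>2" .
qed simp

lemma L2norm_scaleR: "L2norm M (\<lambda>x. c *\<^sub>R f x) = \<bar>c\<bar> * L2norm M f"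
  by (simp add: L2norm_def power_mult_distrib real_sqrt_mult)

lemma L2norm_uminus: "L2norm M (\<lambda>x. - f x) = L2norm M f"
  by (simp add: L2norm_def)

lemma L2norm_triangle_diff:
  assumes f: "f \<in> L2 M" and g: "g \<in> L2 M"
  shows "L2norm M (\<lambda>x. f x - g x) \<le> L2norm M f + L2norm M g"
  using L2norm_triangle[OF f L2_uminus[OF g]] by (simp add: L2norm_uminus)

lemma L2norm_diff_le:
  assumes f: "f \<in> L2 M" and g: "g \<in> L2 M"
  shows "\<bar>L2norm M f - L2norm M g\<bar> \<le> L2norm M (\<lambda>x. f x - g x)"
  using L2norm_triangle[OF L2_diff[OF f g] g] L2norm_triangle_diff[OF f L2_diff[OF f g]]
  by simp

lemma L2norm_cong_AE:
  assumes "f \<in> borel_measurable M" "g \<in> borel_measurable M" "AE x in M. f x = g x"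
  shows "L2norm M f = L2norm M g"
proof -
  note [measurable] = assms(1,2)
  show ?thesis unfolding L2norm_def
    by (intro arg_cong[where f=sqrt] integral_cong_AE) (use assms(3) in auto)
qed

section \<open>Convergence in L2\<close>

lemma L2_tendsto_L2:
  assumes "L2_tendsto M \<phi> w" "w \<in> L2 M" shows "\<phi> k \<in> L2 M"
  using L2_add[OF _ assms(2), of "\<lambda>z. \<phi> k z - w z"] assms(1) by (simp add: L2_tendsto_def)

lemma L2_tendsto_norm:
  assumes "L2_tendsto M \<phi> w" "w \<in> L2 M"
  shows "(\<lambda>k. L2norm M (\<phi> k)) \<longlonglongrightarrow> L2norm M w"
proof (rule Lim_transform_bound[OF _ _ , where f="\<lambda>k. L2norm M (\<phi> k) - L2norm M w" for k, THEN LIM_zero_cancel])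
  show "\<forall>\<^sub>F k in sequentially. norm (L2norm M (\<phi> k) - L2norm M w) \<le> norm (L2norm M (\<lambda>z. \<phi> k z - w z))"
    using L2norm_diff_le[OF L2_tendsto_L2[OF assms] assms(2)] by (auto intro!: always_eventually)
  show "(\<lambda>k. L2norm M (\<lambda>z. \<phi> k z - w z)) \<longlonglongrightarrow> 0" using assms(1) by (simp add: L2_tendsto_def)
qed

text \<open>The difference of the integrands is \<open>(\<phi> k - w) \<bullet> \<psi> k + w
  \<bullet> (\<psi> k - v)\<close>; Cauchy-Schwarz bounds both parts, and the norms of
  \<open>\<psi> k\<close> converge.\<close>

lemma L2_tendsto_inner:
  assumes \<phi>: "L2_tendsto M \<phi> w" and w: "w \<in> L2 M" and \<psi>: "L2_tendsto M \<psi> v" and v: "v \<in> L2 M"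
  shows "(\<lambda>k. \<integral>x. \<phi> k x \<bullet> \<psi> k x \<partial>M) \<longlonglongrightarrow> (\<integral>x. w x \<bullet> v x \<partial>M)"
proof -
  let ?d = "\<lambda>k x. \<phi> k x - w x" and ?e = "\<lambda>k x. \<psi> k x - v x"
  have dL: "?d k \<in> L2 M" and eL: "?e k \<in> L2 M" for k using \<phi> \<psi> by (auto simp: L2_tendsto_def)
  have "(\<lambda>k. (\<integral>x. \<phi> k x \<bullet> \<psi> k x \<partial>M) - (\<integral>x. w x \<bullet> v x \<partial>M)) \<longlonglongrightarrow> 0"
  proof (rule Lim_transform_bound)
    show "(\<lambda>k. L2norm M (?d k) * L2norm M (\<psi> k) + L2norm M w * L2norm M (?e k)) \<longlonglongrightarrow> 0"
    proof -
      have "(\<lambda>k. L2norm M (?d k) * L2norm M (\<psi> k) + L2norm M w * L2norm M (?e k))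
          \<longlonglongrightarrow> 0 * L2norm M v + L2norm M w * 0"
        using \<phi> \<psi> L2_tendsto_norm[OF \<psi> v] by (intro tendsto_intros) (auto simp: L2_tendsto_def)
      then show ?thesis by simp
    qed
    show "\<forall>\<^sub>F k in sequentially. norm ((\<integral>x. \<phi> k x \<bullet> \<psi> k x \<partial>M) - (\<integral>x. w x \<bullet> v x \<partial>M)) \<le>
      norm (L2norm M (?d k) * L2norm M (\<psi> k) + L2norm M w * L2norm M (?e k))"
    proof (rule always_eventually, rule allI)
      fix k
      have \<psi>L: "\<psi> k \<in> L2 M" and \<phi>L: "\<phi> k \<in> L2 M" using L2_tendsto_L2 assms by auto
      have "(\<integral>x. \<phi> k x \<bullet> \<psi> k x \<partial>M) - (\<integral>x. w x \<bullet> v x \<partial>M) = (\<integral>x. \<phi> k x \<bullet> \<psi> k x - w x \<bullet> v x \<partial>M)"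
        using L2_inner_integrable[OF \<phi>L \<psi>L] L2_inner_integrable[OF w v] by simp
      also have "\<dots> = (\<integral>x. ?d k x \<bullet> \<psi> k x + w x \<bullet> ?e k x \<partial>M)"
        by (intro Bochner_Integration.integral_cong) (auto simp: algebra_simps)
      also have "\<dots> = (\<integral>x. ?d k x \<bullet> \<psi> k x \<partial>M) + (\<integral>x. w x \<bullet> ?e k x \<partial>M)"
        using L2_inner_integrable dL eL \<psi>L w by (intro Bochner_Integration.integral_add) auto
      finally show "norm ((\<integral>x. \<phi> k x \<bullet> \<psi> k x \<partial>M) - (\<integral>x. w x \<bullet> v x \<partial>M)) \<le>
          norm (L2norm M (?d k) * L2norm M (\<psi> k) + L2norm M w * L2norm M (?e k))"
        using L2_Cauchy_Schwarz[OF dL[of k] \<psi>L] L2_Cauchy_Schwarz[OF w eL[of k]] by simp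
    qed
  qed
  then show ?thesis by (rule LIM_zero_cancel)
qed

lemma L2_tendsto_const: "w \<in> L2 M \<Longrightarrow> L2_tendsto M (\<lambda>_. w) w"
  by (simp add: L2_tendsto_def L2_zero L2norm_def)

lemma L2_tendsto_diff:
  assumes "L2_tendsto M \<phi> w" "L2_tendsto M \<psi> v"
  shows "L2_tendsto M (\<lambda>k z. \<phi> k z - \<psi> k z) (\<lambda>z. w z - v z)"
proof -
  have eq: "(\<lambda>z. \<phi> k z - \<psi> k z - (w z - v z)) = (\<lambda>z. (\<phi> k z - w z) - (\<psi> k z - v z))" for k
    by (auto simp: algebra_simps)
  have *: "(\<lambda>z. \<phi> k z - w z) \<in> L2 M" "(\<lambda>z. \<psi> k z - v z) \<in> L2 M" for k
    using assms by (auto simp: L2_tendsto_def)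
  have lim: "(\<lambda>k. L2norm M (\<lambda>z. \<phi> k z - w z) + L2norm M (\<lambda>z. \<psi> k z - v z)) \<longlonglongrightarrow> 0"
    using assms by (auto simp: L2_tendsto_def intro!: tendsto_add_zero)
  show ?thesis unfolding L2_tendsto_def eq
  proof (intro conjI allI)
    show "(\<lambda>z. (\<phi> k z - w z) - (\<psi> k z - v z)) \<in> L2 M" for k
      by (intro L2_diff[OF *(1) *(2)])
    show "(\<lambda>k. L2norm M (\<lambda>z. (\<phi> k z - w z) - (\<psi> k z - v z))) \<longlonglongrightarrow> 0"
      by (rule tendsto_sandwich[OF _ _ tendsto_const lim])
         (auto intro!: always_eventually L2norm_triangle_diff[OF *(1) *(2)])
  qed
qed

lemma L2_tendsto_add:
  assumes "L2_tendsto M \<phi> w" "L2_tendsto M \<psi> v"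
  shows "L2_tendsto M (\<lambda>k z. \<phi> k z + \<psi> k z) (\<lambda>z. w z + v z)"
proof -
  have "L2_tendsto M (\<lambda>k z. - \<psi> k z) (\<lambda>z. - v z)"
    using assms(2) L2_uminus[of "\<lambda>z. \<psi> k z - v z" M for k]
    by (auto simp: L2_tendsto_def L2norm_def norm_minus_commute dest: L2_uminus)
  from L2_tendsto_diff[OF assms(1) this] show ?thesis by simp
qed

lemma L2_tendsto_bounded_scaleR:
  assumes "L2_tendsto M \<phi> w" "h \<in> borel_measurable M" "\<And>x. x \<in> space M \<Longrightarrow> \<bar>h x\<bar> \<le> c"
  shows "L2_tendsto M (\<lambda>k z. h z *\<^sub>R \<phi> k z) (\<lambda>z. h z *\<^sub>R w z)"
proof -
  note [measurable] = assms(2)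
  have *: "(\<lambda>z. \<phi> k z - w z) \<in> L2 M" for k using assms(1) by (auto simp: L2_tendsto_def)
  have m[measurable]: "(\<lambda>z. \<phi> k z - w z) \<in> borel_measurable M" for k using *[of k] by (rule L2_measurable)
  have L: "(\<lambda>z. h z *\<^sub>R (\<phi> k z - w z)) \<in> L2 M" for k
    by (rule L2_bounded_scaleR[OF * assms(2,3)])
  have le: "L2norm M (\<lambda>z. h z *\<^sub>R (\<phi> k z - w z)) \<le> \<bar>c\<bar> * L2norm M (\<lambda>z. \<phi> k z - w z)" for k
  proof -
    have "L2norm M (\<lambda>z. h z *\<^sub>R (\<phi> k z - w z)) \<le> L2norm M (\<lambda>z. c *\<^sub>R (\<phi> k z - w z))"
      unfolding L2norm_def
    proof (intro real_sqrt_le_mono integral_mono)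
      fix x assume "x \<in> space M"
      then have "\<bar>h x\<bar> \<le> \<bar>c\<bar>" using assms(3) by fastforce
      then show "(norm (h x *\<^sub>R (\<phi> k x - w x)))\<^sup>2 \<le> (norm (c *\<^sub>R (\<phi> k x - w x)))\<^sup>2"
        by (intro power_mono) (auto intro: mult_right_mono)
    qed (use L2_integrable[OF L] L2_integrable[OF L2_scaleR[OF *]] in auto)
    then show ?thesis by (simp only: L2norm_scaleR)
  qed
  have "(\<lambda>k. \<bar>c\<bar> * L2norm M (\<lambda>z. \<phi> k z - w z)) \<longlonglongrightarrow> 0"
    using assms(1) by (auto simp: L2_tendsto_def intro!: tendsto_mult_right_zero)
  then have "(\<lambda>k. L2norm M (\<lambda>z. h z *\<^sub>R (\<phi> k z - w z))) \<longlonglongrightarrow> 0"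
    by (rule tendsto_sandwich[OF _ _ tendsto_const, rotated 2]) (auto intro!: always_eventually le)
  with L show ?thesis unfolding L2_tendsto_def by (simp add: algebra_simps)
qed

section \<open>Continuity of translations in the mean\<close>

lemma lborel_distr_plus_right: "distr lborel borel (\<lambda>x. x + s) = (lborel :: 'a::euclidean_space measure)"
proof -
  have "(+) s = (\<lambda>x. x + s)" by (auto simp: add.commute)
  then show ?thesis using lborel_distr_plus[of s] by simp
qed

lemma lborel_integral_shift:
  fixes f :: "'a::euclidean_space \<Rightarrow> 'b::{banach, second_countable_topology}"
  assumes [measurable]: "f \<in> borel_measurable borel"
  shows "(\<integral>x. f (x + s) \<partial>lborel) = (\<integral>x. f x \<partial>lborel)"
  by (subst lborel_distr_plus_right[of s, symmetric], subst integral_distr) auto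

lemma lborel_nn_integral_shift:
  fixes f :: "'a::euclidean_space \<Rightarrow> ennreal"
  assumes [measurable]: "f \<in> borel_measurable borel"
  shows "(\<integral>\<^sup>+x. f (x + s) \<partial>lborel) = (\<integral>\<^sup>+x. f x \<partial>lborel)"
  by (subst lborel_distr_plus_right[of s, symmetric], subst nn_integral_distr) auto

lemma lborel_integrable_shift:
  fixes f :: "'a::euclidean_space \<Rightarrow> 'b::{banach, second_countable_topology}"
  assumes "integrable lborel f"
  shows "integrable lborel (\<lambda>x. f (x + s))"
proof -
  have "integrable (distr lborel borel (\<lambda>x. x + s)) f" using assms by (simp add: lborel_distr_plus_right)
  then show ?thesis by (rule integrable_distr[rotated]) auto
qed

lemma L2_shift: "f \<in> L2 lborel \<Longrightarrow> (\<lambda>x. f (x + s)) \<in> L2 lborel"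
  by (rule L2_I) (auto dest: L2_measurable intro!: lborel_integrable_shift[OF L2_integrable])

lemma L2norm_shift: "f \<in> L2 lborel \<Longrightarrow> L2norm lborel (\<lambda>x. f (x + s)) = L2norm lborel f"
  unfolding L2norm_def
  by (subst lborel_integral_shift[where f="\<lambda>x. (norm (f x))\<^sup>2"]) (auto dest: L2_measurable)

text \<open>For indicators, |a - b| = a + b - 2ab. The first two terms have the same integral for
  every shift, and the integral of the product converges by dominated convergence, since openness
  keeps \<open>x + s n\<close> in U eventually for each x in U.\<close>

lemma L1_translation_open:
  fixes U :: "'a::euclidean_space set"
  assumes "open U" "emeasure lborel U < \<infinity>" and s: "s \<longlonglongrightarrow> 0"
  shows "(\<lambda>n. \<integral>x. \<bar>indicator U (x + s n) - indicator U x\<bar> \<partial>lborel) \<longlonglongrightarrow> (0::real)"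
proof -
  have [measurable]: "U \<in> sets borel" using assms by auto
  have iU: "integrable lborel (indicator U :: 'a \<Rightarrow> real)" using assms by simp
  have iUs: "integrable lborel (\<lambda>x. indicator U (x + r) :: real)" for r
    by (rule lborel_integrable_shift[OF iU])
  have iUU: "integrable lborel (\<lambda>x. indicator U (x + r) * indicator U x :: real)" for r
    by (rule Bochner_Integration.integrable_bound[OF iU]) (auto simp: indicator_def)
  have "(\<lambda>n. \<integral>x. indicator U (x + s n) * indicator U x \<partial>lborel) \<longlonglongrightarrow> (\<integral>x. indicator U x \<partial>lborel :: real)"
  proof (rule integral_dominated_convergence[where w="indicator U"])
    show "AE x in lborel. (\<lambda>n. indicator U (x + s n) * indicator U x) \<longlonglongrightarrow> (indicator U x :: real)"
    proof (rule AE_I2)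
      fix x
      show "(\<lambda>n. indicator U (x + s n) * indicator U x) \<longlonglongrightarrow> (indicator U x :: real)"
      proof (cases "x \<in> U")
        case True
        have "(\<lambda>n. x + s n) \<longlonglongrightarrow> x + 0" by (intro tendsto_intros s)
        then have "\<forall>\<^sub>F n in sequentially. x + s n \<in> U"
          using True \<open>open U\<close> by (auto dest: topological_tendstoD)
        then show ?thesis by (intro tendsto_eventually) (auto elim: eventually_mono simp: True)
      qed simp
    qed
  qed (use iU in \<open>auto simp: indicator_def\<close>)
  then have "(\<lambda>n. 2 * (\<integral>x. indicator U x \<partial>lborel) - 2 * (\<integral>x. indicator U (x + s n) * indicator U x \<partial>lborel))
     \<longlonglongrightarrow> 2 * (\<integral>x. indicator U x \<partial>lborel) - 2 * (\<integral>x. indicator U x \<partial>lborel :: real)"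
    by (intro tendsto_intros)
  moreover have "(\<integral>x. \<bar>indicator U (x + r) - indicator U x\<bar> \<partial>lborel)
     = 2 * (\<integral>x. indicator U x \<partial>lborel) - 2 * (\<integral>x. indicator U (x + r) * indicator U x \<partial>lborel :: real)" for r
  proof -
    have "(\<integral>x. \<bar>indicator U (x + r) - indicator U x\<bar> \<partial>lborel)
       = (\<integral>x. indicator U (x + r) + indicator U x - 2 * (indicator U (x + r) * indicator U x) \<partial>lborel :: real)"
      by (intro Bochner_Integration.integral_cong) (auto simp: indicator_def)
    also have "\<dots> = (\<integral>x. indicator U (x + r) \<partial>lborel) + (\<integral>x. indicator U x \<partial>lborel)
         - 2 * (\<integral>x. indicator U (x + r) * indicator U x \<partial>lborel)"
      using iU iUs iUU by simp
    also have "(\<integral>x. indicator U (x + r) \<partial>lborel) = (\<integral>x. indicator U x \<partial>lborel :: real)"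
      by (rule lborel_integral_shift) auto
    finally show ?thesis by simp
  qed
  ultimately show ?thesis by simp
qed

text \<open>Outer regularity gives an open U around A. The excess \<open>U - A\<close> is paid for
  twice, once translated and once in place, hence the budget e/4 + e/4 + e/2.\<close>

lemma L1_translation_indicator:
  fixes A :: "'a::euclidean_space set"
  assumes A[measurable]: "A \<in> sets borel" and fin: "emeasure lborel A < \<infinity>" and s: "s \<longlonglongrightarrow> 0"
  shows "(\<lambda>n. \<integral>x. \<bar>indicator A (x + s n) - indicator A x\<bar> \<partial>lborel) \<longlonglongrightarrow> (0::real)"
proof (rule LIMSEQ_I)
  fix e :: real assume "e > 0"
  obtain U where U: "open U" "A \<subseteq> U" "emeasure lborel (U - A) < ennreal (e/4)"
    using outer_regular_lborel[OF A, of "e/4"] \<open>e > 0\<close> by auto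
  have [measurable]: "U \<in> sets borel" using U by auto
  have "emeasure lborel U \<le> emeasure lborel A + emeasure lborel (U - A)"
    using emeasure_subadditive[of A lborel "U - A"] U(2) by (simp add: Un_absorb1)
  also have "\<dots> < \<infinity>"
    using fin less_trans[OF U(3) ennreal_less_top] by (simp add: ennreal_add_eq_top less_top)
  finally have fU: "emeasure lborel U < \<infinity>" .
  have fUA: "emeasure lborel (U - A) < \<infinity>" using less_trans[OF U(3) ennreal_less_top] by simp
  have iUA: "integrable lborel (indicator (U - A) :: 'a \<Rightarrow> real)" using fUA by simp
  have mUA: "(\<integral>x. indicator (U - A) x \<partial>lborel) < e/4"
  proof -
    have "emeasure lborel (U - A) = ennreal (measure lborel (U - A))"
      using fUA by (intro emeasure_eq_ennreal_measure) auto
    then show ?thesis using U(3) by (simp add: ennreal_less_iff)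
  qed
  from LIMSEQ_D[OF L1_translation_open[OF U(1) fU s], of "e/2"] \<open>e > 0\<close> obtain N where
    N: "\<And>n. n \<ge> N \<Longrightarrow> norm (\<integral>x. \<bar>indicator U (x + s n) - indicator U x\<bar> \<partial>lborel :: real) < e/2" by auto
  show "\<exists>N. \<forall>n\<ge>N. norm ((\<integral>x. \<bar>indicator A (x + s n) - indicator A x\<bar> \<partial>lborel) - (0::real)) < e"
  proof (intro exI[of _ N] allI impI)
    fix n assume n: "n \<ge> N"
    have iU: "integrable lborel (indicator U :: 'a \<Rightarrow> real)" using fU by simp
    have iA: "integrable lborel (indicator A :: 'a \<Rightarrow> real)" using fin by simp
    note sh = lborel_integrable_shift[OF iU, of "s n"] lborel_integrable_shift[OF iA, of "s n"]
      lborel_integrable_shift[OF iUA, of "s n"]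
    have "(\<integral>x. \<bar>indicator A (x + s n) - indicator A x\<bar> \<partial>lborel) \<le>
      (\<integral>x. \<bar>indicator U (x + s n) - indicator U x\<bar> + (indicator (U - A) (x + s n) + indicator (U - A) x) \<partial>lborel :: real)"
      using U(2) sh iU iA iUA
      by (intro integral_mono integrable_abs Bochner_Integration.integrable_add Bochner_Integration.integrable_diff)
         (assumption | simp add: indicator_def subset_eq)+
    also have "\<dots> = (\<integral>x. \<bar>indicator U (x + s n) - indicator U x\<bar> \<partial>lborel) +
       ((\<integral>x. indicator (U - A) (x + s n) \<partial>lborel) + (\<integral>x. indicator (U - A) x \<partial>lborel))"
      using sh iU iUA by simp
    also have "(\<integral>x. indicator (U - A) (x + s n) \<partial>lborel) = (\<integral>x. indicator (U - A) x \<partial>lborel :: real)"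
      by (rule lborel_integral_shift) auto
    finally have "(\<integral>x. \<bar>indicator A (x + s n) - indicator A x\<bar> \<partial>lborel) < (e::real)"
      using N[OF n] mUA by simp
    moreover have "0 \<le> (\<integral>x. \<bar>indicator A (x + s n) - indicator A x\<bar> \<partial>lborel :: real)" by simp
    ultimately show "norm ((\<integral>x. \<bar>indicator A (x + s n) - indicator A x\<bar> \<partial>lborel) - (0::real)) < e"
      by simp
  qed
qed

text \<open>Induction over integrable functions, starting from indicators. In the limit step the
  approximation error is translation invariant, so one good approximant serves all shifts.\<close>

lemma L1_translation:
  fixes f :: "'a::euclidean_space \<Rightarrow> 'b::{banach, second_countable_topology}"
  assumes f: "integrable lborel f" and s: "s \<longlonglongrightarrow> 0"
  shows "(\<lambda>n. \<integral>x. norm (f (x + s n) - f x) \<partial>lborel) \<longlonglongrightarrow> 0"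
  using f
proof (induction rule: integrable_induct)
  case (base A c)
  have "(\<lambda>n. (\<integral>x. \<bar>indicator A (x + s n) - indicator A x\<bar> \<partial>lborel) * norm c) \<longlonglongrightarrow> 0 * norm c"
    using base by (intro tendsto_intros L1_translation_indicator s) auto
  moreover have "(\<integral>x. norm (indicat_real A (x + s n) *\<^sub>R c - indicat_real A x *\<^sub>R c) \<partial>lborel) =
      (\<integral>x. \<bar>indicator A (x + s n) - indicator A x\<bar> \<partial>lborel) * norm c" for n
    by (simp add: scaleR_diff_left[symmetric])
  ultimately show ?case by simp
next
  case (add f g)
  note sh = lborel_integrable_shift[OF add(1)] lborel_integrable_shift[OF add(2)]
  have lim: "(\<lambda>n. (\<integral>x. norm (f (x + s n) - f x) \<partial>lborel) + (\<integral>x. norm (g (x + s n) - g x) \<partial>lborel)) \<longlonglongrightarrow> 0"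
    using add by (intro tendsto_add_zero)
  show ?case
  proof (rule tendsto_sandwich[OF _ _ tendsto_const lim])
    show "\<forall>\<^sub>F n in sequentially. (\<integral>x. norm (f (x + s n) + g (x + s n) - (f x + g x)) \<partial>lborel)
      \<le> (\<integral>x. norm (f (x + s n) - f x) \<partial>lborel) + (\<integral>x. norm (g (x + s n) - g x) \<partial>lborel)"
    proof (rule always_eventually, rule allI)
      fix n
      have "(\<integral>x. norm (f (x + s n) + g (x + s n) - (f x + g x)) \<partial>lborel) \<le>
        (\<integral>x. norm (f (x + s n) - f x) + norm (g (x + s n) - g x) \<partial>lborel)"
        using add sh by (intro integral_mono) (auto simp: add_diff_add norm_triangle_ineq)
      also have "\<dots> = (\<integral>x. norm (f (x + s n) - f x) \<partial>lborel) + (\<integral>x. norm (g (x + s n) - g x) \<partial>lborel)"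
        using add sh by (intro Bochner_Integration.integral_add) auto
      finally show "(\<integral>x. norm (f (x + s n) + g (x + s n) - (f x + g x)) \<partial>lborel)
        \<le> (\<integral>x. norm (f (x + s n) - f x) \<partial>lborel) + (\<integral>x. norm (g (x + s n) - g x) \<partial>lborel)" .
    qed
  qed (auto intro!: always_eventually)
next
  case (lim f S)
  note [measurable] = borel_measurable_integrable[OF lim(1)] borel_measurable_integrable[OF lim(4)]
  \<comment> \<open>The approximants are bounded by 2|f|, so 3|f| dominates the differences.\<close>
  have c: "(\<lambda>i. \<integral>x. norm (S i x - f x) \<partial>lborel) \<longlonglongrightarrow> (\<integral>x. norm (f x - f x) \<partial>lborel)"
  proof (rule integral_dominated_convergence[where w="\<lambda>x. 3 * norm (f x)"])
    show "AE x in lborel. (\<lambda>i. norm (S i x - f x)) \<longlonglongrightarrow> norm (f x - f x)"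
      using lim(2) by (intro AE_I2 tendsto_intros) auto
    show "AE x in lborel. norm (norm (S i x - f x)) \<le> 3 * norm (f x)" for i
    proof (rule AE_I2)
      fix x
      show "norm (norm (S i x - f x)) \<le> 3 * norm (f x)"
        using lim(3)[of x i] norm_triangle_ineq4[of "S i x" "f x"] by simp
    qed
  qed (use lim(4) in auto)
  show ?case
  proof (rule LIMSEQ_I)
    fix e :: real assume "e > 0"
    have "\<exists>i. (\<integral>x. norm (S i x - f x) \<partial>lborel) < e/4"
      using LIMSEQ_D[OF c, of "e/4"] \<open>e > 0\<close> by fastforce
    then obtain i where i: "(\<integral>x. norm (S i x - f x) \<partial>lborel) < e/4" by blast
    obtain N where N: "\<And>n. n \<ge> N \<Longrightarrow> norm (\<integral>x. norm (S i (x + s n) - S i x) \<partial>lborel) < e/2"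
      using LIMSEQ_D[OF lim(5)[of i], of "e/2"] \<open>e > 0\<close> by auto
    show "\<exists>N. \<forall>n\<ge>N. norm ((\<integral>x. norm (f (x + s n) - f x) \<partial>lborel) - 0) < e"
    proof (intro exI[of _ N] allI impI)
      fix n assume n: "n \<ge> N"
      have iS: "integrable lborel (\<lambda>x. norm (S i x - f x))" using lim by auto
      note sh = lborel_integrable_shift[OF lim(4), of "s n"] lborel_integrable_shift[OF lim(1), of i "s n"]
         lborel_integrable_shift[OF iS, of "s n"]
      have "(\<integral>x. norm (f (x + s n) - f x) \<partial>lborel) \<le>
        (\<integral>x. norm (S i (x + s n) - S i x) + (norm (S i (x + s n) - f (x + s n)) + norm (S i x - f x)) \<partial>lborel)"
      proof (rule integral_mono)
        fix x
        have eq: "f (x + s n) - f x = (S i (x + s n) - S i x) - (S i (x + s n) - f (x + s n)) + (S i x - f x)"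
          by (simp add: algebra_simps)
        show "norm (f (x + s n) - f x) \<le> norm (S i (x + s n) - S i x) + (norm (S i (x + s n) - f (x + s n)) + norm (S i x - f x))"
          unfolding eq by (rule norm_triangle_le, intro order_trans[OF add_right_mono[OF norm_triangle_ineq4]]) simp
      qed (use sh lim iS in auto)
      also have "\<dots> = (\<integral>x. norm (S i (x + s n) - S i x) \<partial>lborel) +
         ((\<integral>x. norm (S i (x + s n) - f (x + s n)) \<partial>lborel) + (\<integral>x. norm (S i x - f x) \<partial>lborel))"
        using sh lim iS by simp
      also have "(\<integral>x. norm (S i (x + s n) - f (x + s n)) \<partial>lborel) = (\<integral>x. norm (S i x - f x) \<partial>lborel)"
        by (rule lborel_integral_shift) measurable
      finally have "(\<integral>x. norm (f (x + s n) - f x) \<partial>lborel) < e" using N[OF n] i by simp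
      moreover have "0 \<le> (\<integral>x. norm (f (x + s n) - f x) \<partial>lborel)" by simp
      ultimately show "norm ((\<integral>x. norm (f (x + s n) - f x) \<partial>lborel) - 0) < e" by simp
    qed
  qed
qed

text \<open>This transfers continuity of translations from L1 to L2: the field |a|a is integrable
  when a is square integrable. The reason is strong monotonicity,
  \<open>2 * ((|a|a - |b|b) \<bullet> (a - b))\<close> being at least
  \<open>(|a| + |b|) * |a - b|^2\<close>, where the defect is
  \<open>(|a| - |b|)^2 * (|a| + |b|)\<close>.\<close>

lemma norm_diff_sq_le:
  fixes a b :: "'b::real_inner"
  shows "(norm (a - b))\<^sup>2 \<le> 2 * norm (norm a *\<^sub>R a - norm b *\<^sub>R b)"
proof (cases "a = b")
  case False
  let ?A = "norm a" and ?B = "norm b"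
  have "(?A *\<^sub>R a - ?B *\<^sub>R b) \<bullet> (a - b) = ?A * ?A\<^sup>2 + ?B * ?B\<^sup>2 - (?A + ?B) * (a \<bullet> b)"
    by (simp add: algebra_simps power2_norm_eq_inner inner_commute)
  moreover have "(norm (a - b))\<^sup>2 = ?A\<^sup>2 + ?B\<^sup>2 - 2 * (a \<bullet> b)"
    by (simp add: power2_norm_eq_inner algebra_simps inner_commute)
  moreover have "(?A - ?B) * (?A\<^sup>2 - ?B\<^sup>2) = (?A - ?B)\<^sup>2 * (?A + ?B)"
    by (simp add: power2_eq_square algebra_simps)
  then have "(?A - ?B) * (?A\<^sup>2 - ?B\<^sup>2) \<ge> 0" by simp
  ultimately have "2 * ((?A *\<^sub>R a - ?B *\<^sub>R b) \<bullet> (a - b)) \<ge> (?A + ?B) * (norm (a - b))\<^sup>2"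
    by (simp add: algebra_simps inner_commute power2_norm_eq_inner)
  moreover have "(?A + ?B) * (norm (a - b))\<^sup>2 \<ge> norm (a - b) * (norm (a - b))\<^sup>2"
    by (intro mult_right_mono norm_triangle_ineq4) auto
  moreover have "(?A *\<^sub>R a - ?B *\<^sub>R b) \<bullet> (a - b) \<le> norm (?A *\<^sub>R a - ?B *\<^sub>R b) * norm (a - b)"
    by (rule norm_cauchy_schwarz)
  ultimately have "norm (a - b) * (norm (a - b))\<^sup>2 \<le> norm (a - b) * (2 * norm (?A *\<^sub>R a - ?B *\<^sub>R b))"
    by (simp add: algebra_simps)
  then show ?thesis using False by simp
qed simp

text \<open>Apply \<open>L1_translation\<close> to the integrable field |f|f and compare by
  \<open>norm_diff_sq_le\<close>.\<close>

lemma L2_translation: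
  assumes f: "f \<in> L2 lborel" and s: "s \<longlonglongrightarrow> 0"
  shows "(\<lambda>n. L2norm lborel (\<lambda>x. f (x + s n) - f x)) \<longlonglongrightarrow> 0"
proof -
  note [measurable] = L2_measurable[OF f]
  let ?F = "\<lambda>x. norm (f x) *\<^sub>R f x"
  have F: "integrable lborel ?F"
    by (rule Bochner_Integration.integrable_bound[OF L2_integrable[OF f]]) (auto simp: power2_eq_square)
  have lim: "(\<lambda>n. sqrt (2 * (\<integral>x. norm (?F (x + s n) - ?F x) \<partial>lborel))) \<longlonglongrightarrow> sqrt (2 * 0)"
    by (intro tendsto_intros L1_translation[OF F s])
  have le: "L2norm lborel (\<lambda>x. f (x + r) - f x) \<le> sqrt (2 * (\<integral>x. norm (?F (x + r) - ?F x) \<partial>lborel))" for r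
  proof -
    have "(\<integral>x. (norm (f (x + r) - f x))\<^sup>2 \<partial>lborel) \<le> (\<integral>x. 2 * norm (?F (x + r) - ?F x) \<partial>lborel)"
      using L2_integrable[OF L2_diff[OF L2_shift[OF f] f]] F lborel_integrable_shift[OF F]
      by (intro integral_mono norm_diff_sq_le) auto
    then show ?thesis unfolding L2norm_def by simp
  qed
  show ?thesis
    by (rule tendsto_sandwich[OF _ _ tendsto_const lim[simplified]]) (auto intro!: always_eventually le)
qed

text \<open>This takes the place of the convergence of mollified functions in all that
  follows.\<close>

lemma L2_inner_translation:
  assumes f: "f \<in> L2 lborel" and g: "g \<in> L2 lborel"
  shows "isCont (\<lambda>s. \<integral>x. f (x + s) \<bullet> g x \<partial>lborel) 0"
  unfolding continuous_at_sequentially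
proof (intro allI impI)
  fix s :: "nat \<Rightarrow> 'a" assume s: "s \<longlonglongrightarrow> 0"
  have L: "L2_tendsto lborel (\<lambda>n x. f (x + s n)) f"
    unfolding L2_tendsto_def using L2_diff[OF L2_shift[OF f] f] L2_translation[OF f s] by auto
  show "((\<lambda>s. \<integral>x. f (x + s) \<bullet> g x \<partial>lborel) \<circ> s) \<longlonglongrightarrow> (\<integral>x. f (x + 0) \<bullet> g x \<partial>lborel)"
    using L2_tendsto_inner[OF L f L2_tendsto_const[OF g] g] by (simp add: comp_def)
qed

section \<open>Differentiable functions and bump functions\<close>

lemma C_k_SucD: "C_k (Suc k) f \<Longrightarrow> C_k k f"
proof (induction k arbitrary: f)
  case 0
  then show ?case
    by (auto intro!: continuous_at_imp_continuous_on differentiable_imp_continuous_within)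
qed auto

lemma C_k_SucI:
  assumes "\<And>x. (f has_derivative f' x) (at x)" "\<And>v. C_k k (\<lambda>x. f' x v)"
  shows "C_k (Suc k) f"
proof -
  have "frechet_derivative f (at x) = f' x" for x using frechet_derivative_at[OF assms(1)[of x]] by simp
  with assms show ?thesis by (auto simp: differentiable_def)
qed

lemma C_k_has_derivative: "C_k (Suc k) f \<Longrightarrow> (f has_derivative frechet_derivative f (at x)) (at x)"
  by (simp add: frechet_derivative_works[symmetric])

lemma C_k_const: "C_k k (\<lambda>_. c)"
proof (induction k arbitrary: c)
  case (Suc k)
  show ?case by (rule C_k_SucI[where f'="\<lambda>_ _. 0"]) (auto simp: Suc)
qed simp

lemma C_k_add: "C_k k f \<Longrightarrow> C_k k g \<Longrightarrow> C_k k (\<lambda>x. f x + g x)"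
proof (induction k arbitrary: f g)
  case (Suc k)
  show ?case
    by (rule C_k_SucI[OF has_derivative_add[OF C_k_has_derivative[OF Suc.prems(1)] C_k_has_derivative[OF Suc.prems(2)]]])
       (use Suc in auto)
qed (auto intro: continuous_intros)

lemma C_k_mult: "C_k k f \<Longrightarrow> C_k k g \<Longrightarrow> C_k k (\<lambda>x. f x * g x)"
proof (induction k arbitrary: f g)
  case (Suc k)
  show ?case
    by (rule C_k_SucI[OF has_derivative_mult[OF C_k_has_derivative[OF Suc.prems(1)] C_k_has_derivative[OF Suc.prems(2)]]])
       (use Suc C_k_SucD[OF Suc.prems(1)] C_k_SucD[OF Suc.prems(2)] in \<open>auto intro!: C_k_add\<close>)
qed (auto intro: continuous_intros)

lemma C_k_cmult: "C_k k f \<Longrightarrow> C_k k (\<lambda>x. c * f x)"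
  by (rule C_k_mult[OF C_k_const])

lemma C_k_diff: "C_k k f \<Longrightarrow> C_k k g \<Longrightarrow> C_k k (\<lambda>x. f x - g x)"
  using C_k_add[OF _ C_k_cmult[of k g "-1"]] by simp

lemma C_k_inner: "C_k k (\<lambda>x. x \<bullet> b)"
proof (cases k)
  case (Suc k)
  show ?thesis unfolding Suc
    by (rule C_k_SucI[where f'="\<lambda>_ v. v \<bullet> b"]) (auto intro!: derivative_eq_intros C_k_const)
qed (auto intro!: continuous_intros)

lemma C_k_quadratic: "C_k k (\<lambda>x::'a::euclidean_space. a + b * (norm (x - c))\<^sup>2)"
proof (cases k)
  case (Suc k)
  have eq: "a + b * (norm (x - c))\<^sup>2 = a + b * ((x - c) \<bullet> (x - c))" for x :: 'a
    by (simp add: power2_norm_eq_inner)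
  have lin: "C_k k (\<lambda>x. b * 2 * ((x - c) \<bullet> v))" for v :: 'a
    unfolding inner_diff_left by (intro C_k_cmult C_k_diff C_k_inner C_k_const)
  show ?thesis unfolding Suc eq
    by (rule C_k_SucI[where f'="\<lambda>x v. b * 2 * ((x - c) \<bullet> v)", OF _ lin])
       (auto intro!: derivative_eq_intros simp: algebra_simps inner_commute)
qed (auto intro!: continuous_intros)

lemma smooth_diff: "smooth f \<Longrightarrow> smooth g \<Longrightarrow> smooth (\<lambda>x. f x - g x)"
  by (simp add: smooth_def C_k_diff)

section \<open>A function that is flat at 0, and smooth bumps\<close>

definition flat :: "nat \<Rightarrow> real \<Rightarrow> real" where
  "flat m s = (if s > 0 then exp (- 1 / s) / s ^ m else 0)"

lemma power_le_fact_exp: "0 \<le> x \<Longrightarrow> x ^ n \<le> fact n * exp (x::real)"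
proof -
  assume "0 \<le> x"
  have "(\<Sum>k\<in>{n}. x ^ k /\<^sub>R fact k) \<le> (\<Sum>k. x ^ k /\<^sub>R fact k)"
    using \<open>0 \<le> x\<close> by (intro sum_le_suminf summable_exp_generic) auto
  then have "x ^ n / fact n \<le> exp x" by (simp add: exp_def divide_inverse mult.commute)
  then show ?thesis by (simp add: field_simps)
qed

lemma flat_nonneg: "0 \<le> flat m s"
  by (simp add: flat_def)

lemma flat_Suc: "flat m s = s * flat (Suc m) s"
  by (simp add: flat_def)

text \<open>Take x = 1/s in \<open>power_le_fact_exp\<close> and multiply by exp(-1/s).\<close>

lemma flat_le: "flat m s \<le> fact m"
proof (cases "s > 0")
  case True
  then have "(1/s) ^ m \<le> fact m * exp (1/s)" by (intro power_le_fact_exp) auto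
  then have "(1/s) ^ m * exp (- (1/s)) \<le> fact m * exp (1/s) * exp (- (1/s))"
    by (intro mult_right_mono) auto
  also have "\<dots> = fact m" by (simp add: exp_minus)
  finally have "(1/s) ^ m * exp (- (1/s)) \<le> fact m" .
  with True show ?thesis by (simp add: flat_def power_one_over field_simps)
qed (simp add: flat_def)

text \<open>The reason for the whole family \<open>flat m\<close>: it is closed under
  differentiation up to linear combination, so smoothness of \<open>flat 0\<close> follows by an
  induction over all m at once.\<close>

lemma has_real_derivative_flat:
  "(flat m has_real_derivative flat (m + 2) s - real m * flat (m + 1) s) (at s)"
proof -
  consider "s > 0" | "s < 0" | "s = 0" by linarith
  then show ?thesis
  proof cases
    case 1
    have "((\<lambda>s. exp (- 1 / s) / s ^ m) has_real_derivative flat (m + 2) s - real m * flat (m + 1) s) (at s)"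
      using 1 by (auto intro!: derivative_eq_intros simp: flat_def power2_eq_square power_add)
        (cases m; simp add: field_simps)
    moreover have "\<forall>\<^sub>F t in nhds s. exp (- 1 / t) / t ^ m = flat m t"
      using eventually_nhds_in_open[of "{0<..}" s] 1 by (auto elim!: eventually_mono simp: flat_def)
    ultimately show ?thesis by (rule DERIV_cong_ev[OF refl _ refl, THEN iffD1, rotated])
  next
    case 2
    have "((\<lambda>_. 0) has_real_derivative flat (m + 2) s - real m * flat (m + 1) s) (at s)"
      using 2 by (simp add: flat_def)
    moreover have "\<forall>\<^sub>F t in nhds s. 0 = flat m t"
      using eventually_nhds_in_open[of "{..<0}" s] 2 by (auto elim!: eventually_mono simp: flat_def)
    ultimately show ?thesis by (rule DERIV_cong_ev[OF refl _ refl, THEN iffD1, rotated])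
  next
    case 3
    have "(\<lambda>h. flat m h / h) \<midarrow>0\<rightarrow> 0"
    proof (rule Lim_null_comparison[where g="\<lambda>h. \<bar>h\<bar> * fact (m+2)"])
      have "norm (flat m h / h) \<le> \<bar>h\<bar> * fact (m + 2)" for h
      proof (cases "h = 0")
        case False
        \<comment> \<open>Two powers of h are traded for a higher index; one of them cancels the
          denominator, the other one tends to 0 against the bounded
          \<open>flat (m + 2)\<close>.\<close>
        have "flat m h / h = h * flat (m + 2) h"
          using False flat_Suc[of m h] flat_Suc[of "Suc m" h] by simp
        then show ?thesis
          using flat_le[of "m+2" h] flat_nonneg[of "m+2" h]
          by (simp add: abs_mult mult_left_mono del: fact_Suc)
      qed simp
      then show "\<forall>\<^sub>F h in at 0. norm (flat m h / h) \<le> \<bar>h\<bar> * fact (m + 2)" by (rule always_eventually[OF allI])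
      show "(\<lambda>h::real. \<bar>h\<bar> * fact (m + 2)) \<midarrow>0\<rightarrow> 0" by (rule tendsto_eq_intros refl | simp)+
    qed
    then show ?thesis unfolding 3 DERIV_def by (simp add: flat_def)
  qed
qed

lemma C_k_flat: "(\<And>k. C_k k f) \<Longrightarrow> C_k k (\<lambda>x. flat m (f x))"
proof (induction k arbitrary: m)
  case 0
  have "continuous_on UNIV f" using 0[of 0] by simp
  moreover have "continuous_on UNIV (flat m)"
    using has_real_derivative_flat[of m] by (meson DERIV_continuous continuous_at_imp_continuous_on)
  ultimately show ?case by (auto intro: continuous_on_compose2)
next
  case (Suc k)
  show ?case
  proof (rule C_k_SucI)
    fix x
    show "((\<lambda>x. flat m (f x)) has_derivative
       (\<lambda>v. (flat (m + 2) (f x) - real m * flat (m + 1) (f x)) * frechet_derivative f (at x) v)) (at x)"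
      using has_derivative_compose[OF C_k_has_derivative[OF Suc.prems[of "Suc 0"]]
          has_real_derivative_flat[of m "f x", unfolded has_field_derivative_def]]
      by (simp add: mult.commute)
  next
    fix v
    show "C_k k (\<lambda>x. (flat (m + 2) (f x) - real m * flat (m + 1) (f x)) * frechet_derivative f (at x) v)"
      using Suc.IH[OF Suc.prems] Suc.prems[of "Suc k"] by (intro C_k_mult C_k_diff C_k_cmult) auto
  qed
qed

text \<open>Left without normalisation: only smoothness, sign and support are used. The squared norm
  keeps the composition smooth at the centre.\<close>

definition bump :: "real \<Rightarrow> 'a::euclidean_space \<Rightarrow> 'a \<Rightarrow> real" where
  "bump r c z = flat 0 (r\<^sup>2 - (norm (z - c))\<^sup>2)"

lemma smooth_bump: "smooth (bump r c)"
  unfolding smooth_def bump_def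
  using C_k_flat[of "\<lambda>z. r\<^sup>2 + (-1) * (norm (z - c))\<^sup>2" _ 0] C_k_quadratic[of _ "r\<^sup>2" "-1" c] by simp

lemma has_derivative_bump:
  "(bump r c has_derivative (\<lambda>v. - 2 * flat 2 (r\<^sup>2 - (norm (z - c))\<^sup>2) * ((z - c) \<bullet> v))) (at z)"
proof -
  have 1: "((\<lambda>z. r\<^sup>2 - (z - c) \<bullet> (z - c)) has_derivative (\<lambda>v. - 2 * ((z - c) \<bullet> v))) (at z)"
    by (auto intro!: derivative_eq_intros simp: inner_commute)
  have "((\<lambda>z. flat 0 (r\<^sup>2 - (z - c) \<bullet> (z - c))) has_derivative
      (\<lambda>v. flat 2 (r\<^sup>2 - (z - c) \<bullet> (z - c)) * (- 2 * ((z - c) \<bullet> v)))) (at z)"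
    using has_derivative_compose[OF 1 has_real_derivative_flat[of 0, unfolded has_field_derivative_def]]
    by (simp add: numeral_2_eq_2)
  then show ?thesis
    unfolding bump_def power2_norm_eq_inner
    by (rule has_derivative_eq_rhs) (simp add: fun_eq_iff)
qed

lemma frechet_derivative_bump:
  "frechet_derivative (bump r c) (at z) v = - 2 * flat 2 (r\<^sup>2 - (norm (z - c))\<^sup>2) * ((z - c) \<bullet> v)"
  using frechet_derivative_at[OF has_derivative_bump[of r c z]] by (simp add: fun_eq_iff)

lemma bump_nonneg: "0 \<le> bump r c z"
  by (simp add: bump_def flat_nonneg)

lemma bump_le_1: "bump r c z \<le> 1"
  using flat_le[of 0] by (simp add: bump_def)

lemma bump_pos_iff:
  assumes "0 < r" shows "0 < bump r c z \<longleftrightarrow> z \<in> ball c r"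
proof -
  have "0 < bump r c z \<longleftrightarrow> (norm (z - c))\<^sup>2 < r\<^sup>2" by (simp add: bump_def flat_def)
  also have "\<dots> \<longleftrightarrow> norm (z - c) < r"
    using assms by (meson norm_ge_zero less_imp_le power2_less_imp_less power_strict_mono zero_less_numeral)
  finally show ?thesis by (simp add: dist_norm norm_minus_commute)
qed

lemma bump_eq_0_iff: "0 < r \<Longrightarrow> bump r c z = 0 \<longleftrightarrow> z \<notin> ball c r"
  using bump_pos_iff[of r c z] bump_nonneg[of r c z] by (auto simp: less_le)

lemma bump_shift: "bump r c (z + w) = bump r (c - w) z"
  by (simp add: bump_def algebra_simps)

lemma continuous_flat: "continuous_on S f \<Longrightarrow> continuous_on S (\<lambda>x. flat m (f x))"
proof -
  assume "continuous_on S f"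
  moreover have "continuous_on UNIV (flat m)"
    using has_real_derivative_flat[of m] by (meson DERIV_continuous continuous_at_imp_continuous_on)
  ultimately show ?thesis by (auto intro: continuous_on_compose2)
qed

lemma continuous_bump: "continuous_on S f \<Longrightarrow> continuous_on S (\<lambda>x. bump r c (f x))"
  unfolding bump_def by (intro continuous_flat continuous_intros)

lemma borel_measurable_flat[measurable]: "flat m \<in> borel_measurable borel"
  by (intro borel_measurable_continuous_onI continuous_flat continuous_intros)

lemma borel_measurable_bump[measurable]: "bump r c \<in> borel_measurable borel"
  by (intro borel_measurable_continuous_onI continuous_bump continuous_intros)

lemma bump_test_function:
  assumes "0 < r" "cball c r \<subseteq> S" shows "bump r c \<in> test_functions S"
proof -
  have "{z. bump r c z \<noteq> 0} = ball c r"
    by (intro set_eqI) (simp only: mem_Collect_eq bump_eq_0_iff[OF assms(1)] not_not)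
  then show ?thesis using assms smooth_bump[of r c] unfolding test_functions_def by simp
qed

lemma integrable_bounded_support:
  fixes f :: "'a::euclidean_space \<Rightarrow> 'b::{banach, second_countable_topology}"
  assumes "f \<in> borel_measurable borel" "bounded S" "\<And>x. norm (f x) \<le> B" "\<And>x. x \<notin> S \<Longrightarrow> f x = 0"
  shows "integrable lborel f"
proof -
  obtain R where R: "S \<subseteq> cball 0 R" using assms(2) unfolding bounded_iff by (metis mem_cball_0 subsetI)
  have fin: "emeasure lborel (cball 0 R :: 'a set) < \<infinity>" by (rule emeasure_lborel_cball_finite)
  have "integrable lborel (\<lambda>x. B * indicator (cball 0 R :: 'a set) x)"
    using fin by (intro integrable_mult_right integrable_real_indicator) auto
  then show ?thesis
  proof (rule Bochner_Integration.integrable_bound)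
    show "AE x in lborel. norm (f x) \<le> norm (B * indicator (cball 0 R) x)"
    proof (rule AE_I2)
      fix x :: 'a
      show "norm (f x) \<le> norm (B * indicator (cball 0 R) x)"
      proof (cases "x \<in> cball 0 R")
        case False
        then have "x \<notin> S" using R by blast
        then show ?thesis using assms(4) by simp
      qed (use assms(3)[of x] in \<open>auto intro: order_trans[OF _ abs_ge_self]\<close>)
    qed
  qed (use assms(1) in auto)
qed

lemma bump_integrable: "0 < r \<Longrightarrow> integrable lborel (bump r c)"
  by (rule integrable_bounded_support[where S="ball c r" and B=1])
     (use bump_nonneg[of r c] bump_le_1[of r c] bump_eq_0_iff[of r c] in auto)

lemma bump_integral_pos:
  assumes "0 < r" shows "0 < (\<integral>z. bump r c z \<partial>lborel)"
proof -
  have "(\<integral>z. bump r c z \<partial>lborel) \<noteq> 0"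
  proof
    assume "(\<integral>z. bump r c z \<partial>lborel) = 0"
    then have "AE z in lborel. bump r c z = 0"
      using integral_nonneg_eq_0_iff_AE[OF bump_integrable[OF assms]] bump_nonneg[of r c] by auto
    then have "AE z in lborel. z \<notin> ball c r" using bump_eq_0_iff[OF assms, of c] by (auto simp: ball_def)
    then have "emeasure lborel (ball c r) = 0"
      by (subst (asm) AE_iff_null_sets[symmetric]) (auto simp: null_sets_def)
    moreover have "emeasure lborel (ball c r) \<noteq> 0"
      using open_not_negligible[of "ball c r"] assms
      by (auto simp: negligible_iff_null_sets null_sets_def)
    ultimately show False by simp
  qed
  then show ?thesis using Bochner_Integration.integral_nonneg[of lborel "bump r c"] bump_nonneg[of r c] by (simp add: less_le)
qed

text \<open>A positive value at 0 would persist nearby and give a positive average against a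
  nonnegative bump; the negative case follows by passing to -C. The centre s0 is left free so that
  later the bump can be placed among inward shifts rather than around 0.\<close>

lemma isCont_zero_of_bumps:
  fixes C :: "'a::euclidean_space \<Rightarrow> real"
  assumes C: "isCont C 0"
    and *: "\<And>\<epsilon>. \<epsilon> > 0 \<Longrightarrow> \<exists>s0 r. r > 0 \<and> cball s0 r \<subseteq> ball 0 \<epsilon> \<and>
        integrable lborel (\<lambda>s. bump r s0 s * C s) \<and> (\<integral>s. bump r s0 s * C s \<partial>lborel) = 0"
  shows "C 0 = 0"
proof -
  have le: "C' 0 \<le> 0" if C': "isCont C' 0" and *: "\<And>\<epsilon>. \<epsilon> > 0 \<Longrightarrow> \<exists>s0 r. r > 0 \<and> cball s0 r \<subseteq> ball 0 \<epsilon> \<and>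
        integrable lborel (\<lambda>s. bump r s0 s * C' s) \<and> (\<integral>s. bump r s0 s * C' s \<partial>lborel) = 0"
    for C' :: "'a \<Rightarrow> real"
  proof (rule ccontr)
    assume "\<not> C' 0 \<le> 0"
    then have "\<forall>\<^sub>F s in nhds 0. C' s > C' 0 / 2"
      using C' by (intro order_tendstoD(1)[of C' "C' 0"]) (auto simp: isCont_def tendsto_nhds_iff)
    then obtain \<epsilon> where \<epsilon>: "\<epsilon> > 0" "\<And>s. s \<in> ball 0 \<epsilon> \<Longrightarrow> C' s > C' 0 / 2"
      by (auto simp: eventually_nhds_metric dist_commute)
    from *[OF \<epsilon>(1)] obtain s0 r where r: "r > 0" "cball s0 r \<subseteq> ball 0 \<epsilon>"
      "integrable lborel (\<lambda>s. bump r s0 s * C' s)" "(\<integral>s. bump r s0 s * C' s \<partial>lborel) = 0" by blast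
    have "(\<integral>s. bump r s0 s * (C' 0 / 2) \<partial>lborel) \<le> (\<integral>s. bump r s0 s * C' s \<partial>lborel)"
    proof (rule integral_mono)
      show "integrable lborel (\<lambda>s. bump r s0 s * (C' 0 / 2))"
        by (intro integrable_mult_left bump_integrable r(1))
      fix s
      show "bump r s0 s * (C' 0 / 2) \<le> bump r s0 s * C' s"
      proof (cases "s \<in> ball s0 r")
        case True
        then have "s \<in> ball 0 \<epsilon>" using r(2) ball_subset_cball by blast
        then show ?thesis using \<epsilon>(2) bump_nonneg[of r s0 s] by (intro mult_left_mono) (auto intro: less_imp_le)
      next
        case False
        then show ?thesis using bump_eq_0_iff[OF r(1), of s0 s] by simp
      qed
    qed fact
    then have "(\<integral>s. bump r s0 s \<partial>lborel) * (C' 0 / 2) \<le> 0" using r(4) by simp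
    with bump_integral_pos[OF r(1), of s0] \<open>\<not> C' 0 \<le> 0\<close> show False
      by (simp add: mult_le_0_iff)
  qed
  have "C 0 \<le> 0" by (rule le[OF C *])
  moreover have "(\<lambda>x. - C x) 0 \<le> 0"
    by (rule le) (use C * in \<open>auto intro: continuous_minus\<close>)
  ultimately show ?thesis by simp
qed

section \<open>Fubini for correlations and the fundamental lemma of the calculus of
  variations\<close>

lemma correlation_integrable:
  fixes f g :: "'a::euclidean_space \<Rightarrow> 'b::euclidean_space"
  assumes f: "f \<in> L2 lborel" and g: "g \<in> L2 lborel" and K: "integrable lborel K"
  shows "integrable (lborel \<Otimes>\<^sub>M lborel) (\<lambda>(s, z). K s * (f (z + s) \<bullet> g z))"
proof -
  note [measurable] = L2_measurable[OF f] L2_measurable[OF g] borel_measurable_integrable[OF K]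
  have nb: "(\<integral>z. norm (K s * (f (z + s) \<bullet> g z)) \<partial>lborel) \<le> \<bar>K s\<bar> * (L2norm lborel f * L2norm lborel g)" for s
  proof -
    have "(\<integral>z. norm (K s * (f (z + s) \<bullet> g z)) \<partial>lborel) \<le> (\<integral>z. \<bar>K s\<bar> * (norm (f (z + s)) * norm (g z)) \<partial>lborel)"
    proof (rule integral_mono)
      show "integrable lborel (\<lambda>z. norm (K s * (f (z + s) \<bullet> g z)))"
        using L2_inner_integrable[OF L2_shift[OF f] g] by auto
      show "integrable lborel (\<lambda>z. \<bar>K s\<bar> * (norm (f (z + s)) * norm (g z)))"
        using L2_norm_prod_integrable[OF L2_shift[OF f] g] by auto
    qed (auto simp: abs_mult Cauchy_Schwarz_ineq2 mult_left_mono)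
    also have "\<dots> \<le> \<bar>K s\<bar> * (L2norm lborel f * L2norm lborel g)"
      using L2_Cauchy_Schwarz_norm[OF L2_shift[OF f, of s] g]
      by (simp add: mult_left_mono L2norm_shift[OF f])
    finally show ?thesis .
  qed
  have i1: "integrable lborel (\<lambda>s. \<integral>z. norm (K s * (f (z + s) \<bullet> g z)) \<partial>lborel)"
  proof (rule Bochner_Integration.integrable_bound)
    show "integrable lborel (\<lambda>s. \<bar>K s\<bar> * (L2norm lborel f * L2norm lborel g))" using K by auto
    show "AE s in lborel. norm (\<integral>z. norm (K s * (f (z + s) \<bullet> g z)) \<partial>lborel) \<le> norm (\<bar>K s\<bar> * (L2norm lborel f * L2norm lborel g))"
      using nb by (intro AE_I2) (auto simp: abs_mult)
  qed measurable
  show ?thesis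
    by (rule lborel_pair.Fubini_integrable)
       (use i1 L2_inner_integrable[OF L2_shift[OF f] g] in \<open>auto simp: split_beta'\<close>)
qed

lemma correlation_Fubini:
  fixes f g :: "'a::euclidean_space \<Rightarrow> 'b::euclidean_space"
  assumes f: "f \<in> L2 lborel" and g: "g \<in> L2 lborel" and K: "integrable lborel K"
  shows "integrable lborel (\<lambda>s. K s * (\<integral>z. f (z + s) \<bullet> g z \<partial>lborel))"
    and "(\<integral>s. K s * (\<integral>z. f (z + s) \<bullet> g z \<partial>lborel) \<partial>lborel) = (\<integral>z. (\<integral>s. K s * (f (z + s) \<bullet> g z) \<partial>lborel) \<partial>lborel)"
proof -
  note i = correlation_integrable[OF assms]
  have eq: "(\<integral>z. K s * (f (z + s) \<bullet> g z) \<partial>lborel) = K s * (\<integral>z. f (z + s) \<bullet> g z \<partial>lborel)" for s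
    by simp
  show "integrable lborel (\<lambda>s. K s * (\<integral>z. f (z + s) \<bullet> g z \<partial>lborel))"
    using lborel_pair.integrable_fst[OF i] by simp
  show "(\<integral>s. K s * (\<integral>z. f (z + s) \<bullet> g z \<partial>lborel) \<partial>lborel) = (\<integral>z. (\<integral>s. K s * (f (z + s) \<bullet> g z) \<partial>lborel) \<partial>lborel)"
    using lborel_pair.Fubini_integral[OF i] by simp
qed

text \<open>Correlating \<open>h\<close> with its restriction to a smaller set is continuous in the shift and
  is annihilated by all small bumps, so it vanishes at shift zero.\<close>

lemma fundamental_lemma_variations:
  fixes h :: "'a::euclidean_space \<Rightarrow> real"
  assumes h: "h \<in> L2 lborel" and S: "open S" "S \<noteq> UNIV"
    and *: "\<And>\<phi>. \<phi> \<in> test_functions S \<Longrightarrow> (\<integral>z. \<phi> z * h z \<partial>lborel) = 0"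
  shows "AE z in lborel. z \<in> S \<longrightarrow> h z = 0"
proof -
  note [measurable] = L2_measurable[OF h]
  \<comment> \<open>These sets exhaust S and have a uniform distance from its complement, so a
    single radius r works for all centres in \<open>K n\<close>.\<close>
  define K where "K n = {z. 1 / real (Suc n) \<le> infdist z (- S)}" for n
  have Kc: "closed (K n)" for n unfolding K_def by (intro closed_Collect_le continuous_intros)
  then have [measurable]: "K n \<in> sets borel" for n by auto
  have "AE z in lborel. z \<in> K n \<longrightarrow> h z = 0" for n
  proof -
    define f where "f z = indicator (K n) z * h z" for z
    have f: "f \<in> L2 lborel" unfolding f_def by (rule L2_bounded_mult[OF h, where c=1]) auto
    let ?C = "\<lambda>s. \<integral>z. h (z + s) \<bullet> f z \<partial>lborel"
    have "?C 0 = 0"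
    proof (rule isCont_zero_of_bumps[OF L2_inner_translation[OF h f]])
      fix \<epsilon> :: real assume "\<epsilon> > 0"
      define r where "r = min \<epsilon> (1 / real (Suc n)) / 2"
      have r: "r > 0" "r < \<epsilon>" "r < 1 / real (Suc n)"
        using \<open>\<epsilon> > 0\<close> by (auto simp: r_def min_def field_simps)
      have z0: "(\<integral>s. bump r 0 s * (h (z + s) \<bullet> f z) \<partial>lborel) = 0" for z
      proof (cases "z \<in> K n")
        case True
        have sub: "cball z r \<subseteq> S"
        proof
          fix w assume "w \<in> cball z r"
          show "w \<in> S"
          proof (rule ccontr)
            assume "w \<notin> S"
            then have "infdist z (- S) \<le> dist z w" by (intro infdist_le) auto
            with True \<open>w \<in> cball z r\<close> r(3) show False by (auto simp: K_def)
          qed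
        qed
        have "(\<integral>s. bump r z s * h s \<partial>lborel) = 0" using *[OF bump_test_function[OF r(1) sub]] .
        moreover have "(\<integral>s. bump r z (s + z) * h (s + z) \<partial>lborel) = (\<integral>s. bump r z s * h s \<partial>lborel)"
          by (rule lborel_integral_shift[of "\<lambda>s. bump r z s * h s"]) measurable
        ultimately have "(\<integral>s. bump r 0 s * h (z + s) \<partial>lborel) = 0"
          by (simp add: bump_shift add.commute)
        moreover have "(\<integral>s. bump r 0 s * (h (z + s) \<bullet> f z) \<partial>lborel) = (\<integral>s. bump r 0 s * h (z + s) \<partial>lborel) * f z"
          by (simp add: mult.assoc[symmetric])
        ultimately show ?thesis by simp
      qed (simp add: f_def)
      show "\<exists>s0 r. r > 0 \<and> cball s0 r \<subseteq> ball 0 \<epsilon> \<and>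
        integrable lborel (\<lambda>s. bump r s0 s * ?C s) \<and> (\<integral>s. bump r s0 s * ?C s \<partial>lborel) = 0"
        using correlation_Fubini[OF h f bump_integrable[OF r(1), of 0]] r z0
        by (intro exI[of _ 0] exI[of _ r]) auto
    qed
    then have "(\<integral>z. (f z)\<^sup>2 \<partial>lborel) = 0"
    proof -
      have "(\<integral>z. (f z)\<^sup>2 \<partial>lborel) = ?C 0"
        by (intro Bochner_Integration.integral_cong) (auto simp: f_def indicator_def power2_eq_square)
      with \<open>?C 0 = 0\<close> show ?thesis by simp
    qed
    moreover have "integrable lborel (\<lambda>z. (f z)\<^sup>2)" using L2_integrable[OF f] by simp
    ultimately have "AE z in lborel. (f z)\<^sup>2 = 0"
      by (subst integral_nonneg_eq_0_iff_AE[symmetric]) auto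
    then show ?thesis by eventually_elim (auto simp: f_def)
  qed
  then have "AE z in lborel. \<forall>n. z \<in> K n \<longrightarrow> h z = 0" by (simp only: AE_all_countable) blast
  then show ?thesis
  proof eventually_elim
    case (elim z)
    show ?case
    proof
      assume "z \<in> S"
      \<comment> \<open>The complement has to be nonempty here: by convention \<open>infdist\<close>
        to the empty set is 0.\<close>
      then have "infdist z (- S) > 0"
        using S infdist_pos_not_in_closed[of "- S" z] by (auto simp: closed_Compl)
      then obtain n where "1 / real (Suc n) < infdist z (- S)" using nat_approx_posE by blast
      then have "z \<in> K n" unfolding K_def by (auto intro: less_imp_le)
      with elim show "h z = 0" by blast
    qed
  qed
qed

section \<open>Continuously differentiable cutoff functions\<close>

lemma C_1_max_sq:
  assumes "C_k (Suc 0) f" shows "C_k (Suc 0) (\<lambda>z. (max 0 (f z))\<^sup>2)"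
proof (rule C_k_SucI)
  have d: "((\<lambda>s::real. (max 0 s)\<^sup>2) has_real_derivative 2 * max 0 s) (at s)" for s
  proof -
    consider "s > 0" | "s < 0" | "s = 0" by linarith
    then show ?thesis
    proof cases
      case 1
      have "((\<lambda>s::real. s\<^sup>2) has_real_derivative 2 * max 0 s) (at s)"
        using 1 by (auto intro!: derivative_eq_intros)
      moreover have "\<forall>\<^sub>F t in nhds s. t\<^sup>2 = (max 0 t)\<^sup>2"
        using eventually_nhds_in_open[of "{0<..}" s] 1 by (auto elim!: eventually_mono)
      ultimately show ?thesis by (rule DERIV_cong_ev[OF refl _ refl, THEN iffD1, rotated])
    next
      case 2
      have "((\<lambda>_. 0) has_real_derivative 2 * max 0 s) (at s)" using 2 by simp
      moreover have "\<forall>\<^sub>F t in nhds s. 0 = (max 0 t)\<^sup>2"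
        using eventually_nhds_in_open[of "{..<0}" s] 2 by (auto elim!: eventually_mono)
      ultimately show ?thesis by (rule DERIV_cong_ev[OF refl _ refl, THEN iffD1, rotated])
    next
      case 3
      have "(\<lambda>h::real. (max 0 h)\<^sup>2 / h) \<midarrow>0\<rightarrow> 0"
      proof (rule Lim_null_comparison[where g="\<lambda>h. \<bar>h\<bar>"])
        show "\<forall>\<^sub>F h in at 0. norm ((max 0 h)\<^sup>2 / h) \<le> \<bar>h::real\<bar>"
          by (rule always_eventually) (auto simp: max_def power2_eq_square)
      qed (rule tendsto_eq_intros refl | simp)+
      then show ?thesis unfolding 3 DERIV_def by simp
    qed
  qed
  fix x
  show "((\<lambda>z. (max 0 (f z))\<^sup>2) has_derivative (\<lambda>v. 2 * max 0 (f x) * frechet_derivative f (at x) v)) (at x)"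
    using has_derivative_compose[OF C_k_has_derivative[OF assms] d[of "f x", unfolded has_field_derivative_def]] .
next
  fix v
  show "C_k 0 (\<lambda>x. 2 * max 0 (f x) * frechet_derivative f (at x) v)"
    using assms C_k_SucD[OF assms] by (auto intro!: continuous_intros)
qed

text \<open>A step from 0 to 1 that is continuously differentiable, composed of two squared positive
  parts. One derivative is enough, because cutoffs only multiply the function being integrated by
  parts, while the weak divergence is tested with bumps.\<close>

definition cutoff :: "real \<Rightarrow> real" where
  "cutoff u = 1 - (max 0 (1 - (max 0 u)\<^sup>2))\<^sup>2"

lemma C_1_cutoff: "C_k (Suc 0) f \<Longrightarrow> C_k (Suc 0) (\<lambda>z. cutoff (f z))"
  unfolding cutoff_def by (intro C_k_diff C_1_max_sq C_k_const)

lemma cutoff_0: "u \<le> 0 \<Longrightarrow> cutoff u = 0"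
  by (simp add: cutoff_def)

lemma cutoff_1: "u \<ge> 1 \<Longrightarrow> cutoff u = 1"
  by (simp add: cutoff_def)

lemma cutoff_bounds: "0 \<le> cutoff u" "cutoff u \<le> 1"
proof -
  have "(max 0 (1 - (max 0 u)\<^sup>2))\<^sup>2 \<le> 1\<^sup>2" by (intro power_mono) auto
  then show "0 \<le> cutoff u" by (simp add: cutoff_def)
qed (simp add: cutoff_def)

section \<open>Lipschitz domains near the boundary\<close>

definition inner_cone :: "'a::euclidean_space set \<Rightarrow> 'a \<Rightarrow> real \<Rightarrow> 'a \<Rightarrow> bool" where
  "inner_cone \<Omega> p r c \<longleftrightarrow> 0 < r \<and>
     (\<forall>x\<in>\<Omega> \<inter> ball p r. \<forall>\<delta> y. 0 < \<delta> \<and> \<delta> < r \<and> y \<in> ball c r \<longrightarrow> x + \<delta> *\<^sub>R y \<in> \<Omega>)"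

lemma inner_coneD:
  "inner_cone \<Omega> p r c \<Longrightarrow> x \<in> \<Omega> \<Longrightarrow> dist p x < r \<Longrightarrow> 0 < \<delta> \<Longrightarrow> \<delta> < r \<Longrightarrow> dist c y < r \<Longrightarrow> x + \<delta> *\<^sub>R y \<in> \<Omega>"
  by (auto simp: inner_cone_def)

lemma norm_orthogonal_part_le:
  assumes "norm \<nu> = 1" shows "norm (w - (w \<bullet> \<nu>) *\<^sub>R \<nu>) \<le> norm w"
proof (rule power2_le_imp_le)
  have "\<nu> \<bullet> \<nu> = 1" using assms by (simp add: norm_eq_1)
  then show "(norm (w - (w \<bullet> \<nu>) *\<^sub>R \<nu>))\<^sup>2 \<le> (norm w)\<^sup>2"
    unfolding power2_norm_eq_inner by (simp add: inner_diff_left inner_diff_right inner_commute)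
qed simp

text \<open>At a frontier point take c = \<nu>. A shift by \<delta> y with y close to \<nu> raises
  the height by at least \<delta>/2, while the tangential displacement is at most \<delta> r, so the
  graph rises by at most L \<delta> r, which is no more than \<delta>/2. The strict inequality of
  the starting point survives.\<close>

lemma Lipschitz_domain_inner_cone:
  assumes "bounded_Lipschitz_domain \<Omega>" "p \<in> closure \<Omega>"
  shows "\<exists>r c. inner_cone \<Omega> p r c \<and> norm c \<le> 1"
proof (cases "p \<in> \<Omega>")
  case True
  with assms obtain r0 where r0: "r0 > 0" "ball p r0 \<subseteq> \<Omega>"
    unfolding bounded_Lipschitz_domain_def open_contains_ball by meson
  define r where "r = min (r0 / 2) 1"
  have r: "0 < r" "r \<le> 1" "2 * r \<le> r0" using r0(1) by (auto simp: r_def)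
  have "x + \<delta> *\<^sub>R y \<in> \<Omega>" if "dist p x < r" "0 < \<delta>" "\<delta> < r" "norm y < r" for x y \<delta>
  proof -
    have "\<delta> * norm y \<le> 1 * r" using that r by (intro mult_mono) auto
    then have "norm (p - x - \<delta> *\<^sub>R y) < r + r"
      using norm_triangle_ineq4[of "p - x" "\<delta> *\<^sub>R y"] that by (simp add: dist_norm)
    then have "x + \<delta> *\<^sub>R y \<in> ball p r0" using r(3) by (simp add: dist_norm algebra_simps)
    then show ?thesis using r0 by blast
  qed
  with r(1) have "inner_cone \<Omega> p r 0" by (auto simp: inner_cone_def)
  then show ?thesis by (intro exI[of _ r] exI[of _ 0]) auto
next
  case False
  with assms have "p \<in> frontier \<Omega>"
    by (auto simp: frontier_def bounded_Lipschitz_domain_def interior_open)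
  with assms obtain r0 \<nu> g L where *: "r0 > 0" "norm \<nu> = 1" "L-lipschitz_on {x. x \<bullet> \<nu> = 0} g"
    "\<Omega> \<inter> ball p r0 = {x \<in> ball p r0. g (x - (x \<bullet> \<nu>) *\<^sub>R \<nu>) < x \<bullet> \<nu>}"
    unfolding bounded_Lipschitz_domain_def by meson
  have L: "L \<ge> 0" using *(3) by (rule lipschitz_on_nonneg)
  \<comment> \<open>The second bound gives L r <= 1/2 and r <= 1/2, hence |y| <= 2. The first keeps
    the shifted point, at distance less than r + 2r from p, in the ball of the chart.\<close>
  define r where "r = min (r0 / 3) (1 / (2 * (L + 1)))"
  have r: "0 < r" "3 * r \<le> r0" "r * (2 * (L + 1)) \<le> 1"
    using *(1) L by (auto simp: r_def min_def field_simps)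
  have rL: "L * r \<le> 1/2" "r \<le> 1/2" using r L by (auto simp: algebra_simps)
      (smt (verit) mult_nonneg_nonneg)+
  have \<nu>\<nu>: "\<nu> \<bullet> \<nu> = 1" using *(2) by (simp add: norm_eq_1)
  have "x + \<delta> *\<^sub>R y \<in> \<Omega>" if x: "x \<in> \<Omega>" "dist p x < r" and \<delta>: "0 < \<delta>" "\<delta> < r" and y: "dist \<nu> y < r" for x y \<delta>
  proof -
    let ?P = "\<lambda>x. x - (x \<bullet> \<nu>) *\<^sub>R \<nu>"
    have P0: "?P w \<bullet> \<nu> = 0" for w by (simp add: inner_diff_left \<nu>\<nu>)
    have ny: "norm y \<le> 2"
      using norm_triangle_sub[of y \<nu>] y *(2) rL by (simp add: dist_norm norm_minus_commute)
    have "\<delta> * norm y \<le> r * 2" using \<delta> ny by (intro mult_mono) auto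
    then have "norm (p - x - \<delta> *\<^sub>R y) < r + 2 * r"
      using norm_triangle_ineq4[of "p - x" "\<delta> *\<^sub>R y"] x(2) \<delta> by (simp add: dist_norm)
    then have in_ball: "x + \<delta> *\<^sub>R y \<in> ball p r0" using r(2) by (simp add: dist_norm algebra_simps)
    have "dist p x < r0" using x(2) r by simp
    then have "x \<in> {x \<in> ball p r0. g (?P x) < x \<bullet> \<nu>}" using x(1) *(4) by (metis IntI mem_ball)
    then have gx: "g (?P x) < x \<bullet> \<nu>" by simp
    have Pdiff: "?P (x + \<delta> *\<^sub>R y) - ?P x = \<delta> *\<^sub>R ?P (y - \<nu>)"
      by (simp add: inner_add_left inner_diff_left \<nu>\<nu> algebra_simps)
    have nP: "norm (?P (y - \<nu>)) \<le> r"
      using norm_orthogonal_part_le[OF *(2), of "y - \<nu>"] y by (simp add: dist_norm norm_minus_commute)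
    have "dist (g (?P (x + \<delta> *\<^sub>R y))) (g (?P x)) \<le> L * dist (?P (x + \<delta> *\<^sub>R y)) (?P x)"
      by (rule lipschitz_onD[OF *(3)]) (simp_all only: mem_Collect_eq P0)
    also have "\<dots> = L * (\<delta> * norm (?P (y - \<nu>)))" using \<delta>(1) unfolding dist_norm Pdiff by simp
    also have "\<dots> \<le> L * (\<delta> * r)" using L \<delta> nP by (intro mult_left_mono) auto
    also have "\<dots> = \<delta> * (L * r)" by simp
    also have "\<dots> \<le> \<delta> * (1/2)" using \<delta> rL by (intro mult_left_mono) auto
    finally have "\<bar>g (?P (x + \<delta> *\<^sub>R y)) - g (?P x)\<bar> \<le> \<delta> * (1/2)" unfolding dist_real_def .
    then have "g (?P (x + \<delta> *\<^sub>R y)) \<le> g (?P x) + \<delta> / 2" by linarith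
    also have "\<dots> < x \<bullet> \<nu> + \<delta> / 2" using gx by simp
    also have "\<dots> \<le> x \<bullet> \<nu> + \<delta> * (y \<bullet> \<nu>)"
    proof -
      have "\<bar>(y - \<nu>) \<bullet> \<nu>\<bar> \<le> norm (y - \<nu>) * norm \<nu>" by (rule Cauchy_Schwarz_ineq2)
      then have "\<bar>y \<bullet> \<nu> - 1\<bar> \<le> 1/2"
        using y rL *(2) by (simp add: inner_diff_left \<nu>\<nu> dist_norm norm_minus_commute)
      then have "1/2 \<le> y \<bullet> \<nu>" by linarith
      then have "\<delta> * (1/2) \<le> \<delta> * (y \<bullet> \<nu>)" using \<delta> by (intro mult_left_mono) auto
      then show ?thesis by simp
    qed
    also have "\<dots> = (x + \<delta> *\<^sub>R y) \<bullet> \<nu>" by (simp add: inner_add_left)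
    finally have "x + \<delta> *\<^sub>R y \<in> {x \<in> ball p r0. g (?P x) < x \<bullet> \<nu>}" using in_ball by simp
    then show ?thesis using *(4) by blast
  qed
  with r(1) have "inner_cone \<Omega> p r \<nu>" by (auto simp: inner_cone_def)
  then show ?thesis using *(2) by (intro exI[of _ r] exI[of _ \<nu>]) auto
qed

section \<open>Layers at the frontier, where the domain differs from its translate\<close>

definition shift_layer :: "'a::euclidean_space set \<Rightarrow> real \<Rightarrow> 'a \<Rightarrow> 'a set" where
  "shift_layer \<Omega> h b = {x. (x - h *\<^sub>R b \<in> \<Omega>) \<noteq> (x \<in> \<Omega>)}"

lemma shift_layer_borel [measurable]: "\<Omega> \<in> sets borel \<Longrightarrow> shift_layer \<Omega> h b \<in> sets borel"
proof -
  assume [measurable]: "\<Omega> \<in> sets borel"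
  have "Measurable.pred borel (\<lambda>x. (x - h *\<^sub>R b \<in> \<Omega>) \<noteq> (x \<in> \<Omega>))" by measurable
  then show ?thesis unfolding shift_layer_def pred_def by simp
qed

text \<open>The segment from x to x - h b meets the domain and its complement, and it is
  connected.\<close>

lemma shift_layer_frontier:
  assumes "x \<in> shift_layer \<Omega> h b" "0 < h"
  obtains s where "0 \<le> s" "s \<le> h" "x - s *\<^sub>R b \<in> frontier \<Omega>"
proof -
  let ?S = "closed_segment x (x - h *\<^sub>R b)"
  have "?S \<inter> \<Omega> \<noteq> {}" "?S - \<Omega> \<noteq> {}" using assms(1) by (auto simp: shift_layer_def)
  then have "?S \<inter> frontier \<Omega> \<noteq> {}" by (intro connected_Int_frontier) auto
  then obtain u where "0 \<le> u" "u \<le> 1" "(1 - u) *\<^sub>R x + u *\<^sub>R (x - h *\<^sub>R b) \<in> frontier \<Omega>"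
    by (auto simp: in_segment)
  moreover have "(1 - u) *\<^sub>R x + u *\<^sub>R (x - h *\<^sub>R b) = x - (u * h) *\<^sub>R b" by (simp add: algebra_simps)
  moreover have "u * h \<le> 1 * h" using \<open>u \<le> 1\<close> \<open>0 < h\<close> by (intro mult_right_mono) auto
  ultimately show ?thesis using assms(2) by (intro that[of "u * h"]) auto
qed

text \<open>The translates of the layer by multiples of a fixed multiple of \<open>h c\<close> are disjoint.\<close>

lemma shift_layer_measure:
  fixes \<Omega> :: "'a::euclidean_space set"
  assumes cone: "inner_cone \<Omega> p r c" and c: "norm c \<le> 1" and \<Omega>[measurable]: "\<Omega> \<in> sets borel"
  obtains C h1 where "0 \<le> C" "0 < h1"
    "\<And>h b. 0 < h \<Longrightarrow> h < h1 \<Longrightarrow> norm (b::'a) \<le> 1 \<Longrightarrow>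
       emeasure lborel (shift_layer \<Omega> h b \<inter> ball p (r/2)) \<le> ennreal (C * h)"
proof -
  have r: "r > 0" using cone by (simp add: inner_cone_def)
  \<comment> \<open>The spacing of the translates is M h. Deviations of size 2h are then at most the
    fraction 2/M = r/2 of any shift length j M h with j >= 1, which fits into the cone.\<close>
  define M where "M = 4 / r"
  have M: "M > 0" "M * r = 4" using r by (auto simp: M_def)
  define V where "V = measure lborel (ball p (3 * r))"
  have Vfin: "emeasure lborel (ball p (3*r)) = ennreal V"
    unfolding V_def using emeasure_lborel_ball_finite[of p "3*r"] by (intro emeasure_eq_ennreal_measure) auto
  define h1 where "h1 = min (r / 2) (r\<^sup>2 / 8)"
  show ?thesis
  proof
    show "0 \<le> V * 8 / r\<^sup>2" by (simp add: V_def)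
    show "0 < h1" using r by (simp add: h1_def)
    fix h b assume h: "0 < h" "h < h1" and b: "norm (b::'a) \<le> 1"
    let ?S = "shift_layer \<Omega> h b \<inter> ball p (r/2)"
    have hr: "h < r/2" "8 * h < r\<^sup>2" using h by (auto simp: h1_def)
    have hb: "norm (h *\<^sub>R b) \<le> h" using b h by (simp add: mult_left_le)
    \<comment> \<open>A layer point x is within h of a point a of the domain. Seen from a, the cone
      around \<delta> c covers the ball of radius h around x + \<delta> c. So both x + \<delta> c
      and its translate by -h b lie in the domain, and the point is not in the layer.\<close>
    have key: "x + (real j * M * h) *\<^sub>R c \<notin> shift_layer \<Omega> h b"
      if x: "x \<in> ?S" and j: "j \<ge> 1" "real j * M * h < r" for x j
    proof -
      define \<delta> where "\<delta> = real j * M * h"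
      have \<delta>: "\<delta> > 0" "\<delta> < r" using j M h by (auto simp: \<delta>_def)
      obtain a where a: "a \<in> \<Omega>" "norm (x - a) \<le> h"
      proof (cases "x \<in> \<Omega>")
        case True then show ?thesis using that[of x] h by simp
      next
        case False
        then have "x - h *\<^sub>R b \<in> \<Omega>" using x by (auto simp: shift_layer_def)
        then show ?thesis using that[of "x - h *\<^sub>R b"] hb by simp
      qed
      have "dist p a \<le> dist p x + dist x a" by (rule dist_triangle)
      then have ap: "dist p a < r" using a(2) x hr by (simp add: dist_norm)
      have w: "w \<in> \<Omega>" if "norm (w - (x + \<delta> *\<^sub>R c)) \<le> h" for w
      proof -
        define y where "y = c + (1/\<delta>) *\<^sub>R (w - (x + \<delta> *\<^sub>R c) + (x - a))"
        have "norm (w - (x + \<delta> *\<^sub>R c) + (x - a)) \<le> 2 * h"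
          using norm_triangle_ineq[of "w - (x + \<delta> *\<^sub>R c)" "x - a"] that a(2) by linarith
        then have "norm (y - c) \<le> (1/\<delta>) * (2 * h)"
          unfolding y_def using \<delta> by (simp add: divide_right_mono)
        also have "\<dots> = 2 / (real j * M)" using h by (simp add: \<delta>_def)
        also have "\<dots> \<le> 2 / (1 * M)" using j M by (intro divide_left_mono mult_right_mono mult_pos_pos) auto
        also have "\<dots> = r / 2" using r by (simp add: M_def)
        also have "\<dots> < r" using r by simp
        finally have "dist c y < r" by (simp add: dist_norm norm_minus_commute)
        then have "a + \<delta> *\<^sub>R y \<in> \<Omega>" using inner_coneD[OF cone a(1) ap \<delta>] by blast
        moreover have "a + \<delta> *\<^sub>R y = w" using \<delta> by (simp add: y_def algebra_simps)
        ultimately show ?thesis by simp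
      qed
      have "x + \<delta> *\<^sub>R c \<in> \<Omega>" "x + \<delta> *\<^sub>R c - h *\<^sub>R b \<in> \<Omega>"
        using h hb by (auto intro!: w)
      then show ?thesis by (auto simp: shift_layer_def \<delta>_def)
    qed
    \<comment> \<open>The number of disjoint translates: at most r^2/(4h), so that the total shift J
      M h stays below r and the cone applies; at least r^2/(8h), since rounding down costs at most 1
      and h < r^2/8. Comparison with the volume of one ball then bounds the layer by a multiple of
      h.\<close>
    define J where "J = nat \<lfloor>r\<^sup>2 / (4 * h)\<rfloor>"
    have J4: "real J \<le> r\<^sup>2 / (4 * h)" unfolding J_def using h r by simp
    have J8: "r\<^sup>2 / (8 * h) \<le> real J"
    proof -
      have "1 \<le> r\<^sup>2 / (8 * h)" using hr h by simp
      moreover have "r\<^sup>2 / (4 * h) = r\<^sup>2 / (8 * h) + r\<^sup>2 / (8 * h)" by (simp add: field_simps)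
      moreover have "r\<^sup>2 / (4 * h) - 1 < real J" unfolding J_def using h r by linarith
      ultimately show ?thesis by linarith
    qed
    have JM: "real J * M * h \<le> r"
    proof -
      have "real J * (M * h) \<le> r\<^sup>2 / (4 * h) * (M * h)" using J4 M h by (intro mult_right_mono) auto
      also have "\<dots> = r" using h r by (simp add: M_def power2_eq_square)
      finally show ?thesis by (simp add: mult.assoc)
    qed
    define A where "A j = {z. z + - ((real j * M * h) *\<^sub>R c) \<in> ?S}" for j :: nat
    have [measurable]: "?S \<in> sets borel" by measurable
    have Am[measurable]: "A j \<in> sets borel" for j
    proof -
      have "Measurable.pred borel (\<lambda>z. z + - ((real j * M * h) *\<^sub>R c) \<in> ?S)" by measurable
      then show ?thesis unfolding A_def pred_def by simp
    qed
    have Aem: "emeasure lborel (A j) = emeasure lborel ?S" for j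
    proof -
      have "emeasure lborel (A j) = (\<integral>\<^sup>+z. indicator ?S (z + - ((real j * M * h) *\<^sub>R c)) \<partial>lborel)"
        by (subst nn_integral_indicator[symmetric], measurable)
           (rule nn_integral_cong, simp only: A_def indicator_def mem_Collect_eq)
      also have "\<dots> = (\<integral>\<^sup>+z. indicator ?S z \<partial>lborel)" by (rule lborel_nn_integral_shift) measurable
      finally show ?thesis by simp
    qed
    have disj: "A i \<inter> A j = {}" if "i < j" "j < J" for i j
    proof (rule ccontr)
      assume "A i \<inter> A j \<noteq> {}"
      then obtain z where z: "z \<in> A i" "z \<in> A j" by blast
      let ?x = "z - (real j * M * h) *\<^sub>R c"
      have "real (j - i) * M * h \<le> real j * M * h" using M h by (intro mult_right_mono) auto
      also have "\<dots> < real J * M * h" using that M h by simp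
      finally have "real (j - i) * M * h < r" using JM by simp
      then have "?x + (real (j - i) * M * h) *\<^sub>R c \<notin> shift_layer \<Omega> h b"
        using z that by (intro key) (auto simp: A_def)
      moreover have "?x + (real (j - i) * M * h) *\<^sub>R c = z - (real i * M * h) *\<^sub>R c"
        using that by (simp add: of_nat_diff algebra_simps)
      ultimately show False using z by (auto simp: A_def)
    qed
    have "disjoint_family_on A {..<J}"
      unfolding disjoint_family_on_def
    proof (intro ballI impI)
      fix m n assume "m \<in> {..<J}" "n \<in> {..<J}" "m \<noteq> n"
      then show "A m \<inter> A n = {}" using disj[of m n] disj[of n m] by (cases m n rule: linorder_cases) auto
    qed
    then have "(\<Sum>j<J. emeasure lborel (A j)) = emeasure lborel (\<Union>j<J. A j)"
      by (intro sum_emeasure) auto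
    also have "\<dots> \<le> emeasure lborel (ball p (3 * r))"
    proof (intro emeasure_mono UN_least subsetI)
      fix j z assume j: "j \<in> {..<J}" and z: "z \<in> A j"
      have "real j * M * h \<le> real J * M * h" using j M h by (intro mult_right_mono) auto
      then have "real j * M * h \<le> r" using JM by linarith
      then have "norm ((real j * M * h) *\<^sub>R c) \<le> r * 1"
        using c M h r unfolding norm_scaleR by (intro mult_mono) auto
      then show "z \<in> ball p (3 * r)"
        using z r norm_triangle_ineq4[of "p - (z - (real j * M * h) *\<^sub>R c)" "(real j * M * h) *\<^sub>R c"]
        by (simp add: A_def dist_norm)
    qed simp
    finally have "ennreal (real J) * emeasure lborel ?S \<le> ennreal V"
      by (simp add: Aem Vfin ennreal_of_nat_eq_real_of_nat)
    moreover have "emeasure lborel ?S < \<infinity>"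
      using emeasure_mono[of ?S "ball p (r/2)" lborel] emeasure_lborel_ball_finite[of p "r/2"]
      by (auto intro: le_less_trans)
    then have em: "emeasure lborel ?S = ennreal (measure lborel ?S)"
      by (intro emeasure_eq_ennreal_measure) auto
    ultimately have "real J * measure lborel ?S \<le> V"
      by (simp add: ennreal_mult[symmetric] V_def)
    then have "r\<^sup>2 / (8 * h) * measure lborel ?S \<le> V"
      using mult_right_mono[OF J8, of "measure lborel ?S"] by simp
    then have "measure lborel ?S \<le> V * 8 / r\<^sup>2 * h" using h r by (simp add: field_simps)
    then show "emeasure lborel ?S \<le> ennreal (V * 8 / r\<^sup>2 * h)" unfolding em by (rule ennreal_leI)
  qed
qed

section \<open>Tubes over a set of finite Hausdorff measure\<close>

definition tube_const :: "'a::euclidean_space itself \<Rightarrow> real" where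
  "tube_const _ = 3 * 4 ^ (DIM('a) - 1) / unit_ball_vol (real (DIM('a) - 1))"

lemma tube_const_pos: "0 < tube_const TYPE('a::euclidean_space)"
  unfolding tube_const_def by (simp add: unit_ball_vol_pos)

text \<open>Each set of a cover by sets of diameter at most \<open>h\<close> is replaced by a coordinate box.\<close>

lemma tube_cover:
  fixes A :: "'a::euclidean_space set"
  assumes fin: "hausdorff_outer (DIM('a) - 1) A \<le> ennreal H" and "0 \<le> H"
    and b: "b \<in> Basis" and h: "0 < h" and e: "0 < e"
  obtains W where "W \<in> sets borel" "\<And>p s. p \<in> A \<Longrightarrow> 0 \<le> s \<Longrightarrow> s \<le> h \<Longrightarrow> p + s *\<^sub>R b \<in> W"
    "emeasure lborel W \<le> ennreal (tube_const TYPE('a) * h * (H + e))"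
proof -
  let ?m = "DIM('a) - 1"
  define w where "w U = (if U = {} then 0 else ennreal (unit_ball_vol (real ?m) * (diameter U / 2) ^ ?m))"
    for U :: "'a set"
  have "hausdorff_content ?m h A \<le> ennreal H"
    using hausdorff_content_le_outer[OF h] fin by (rule order_trans)
  also have "\<dots> < ennreal (H + e)" using \<open>0 \<le> H\<close> e by (simp add: ennreal_lessI)
  finally obtain U where U: "A \<subseteq> (\<Union>i. U i)" "\<And>i. bounded (U i)" "\<And>i. diameter (U i) \<le> h"
    "(\<Sum>i. w (U i)) < ennreal (H + e)"
    unfolding hausdorff_content_def INF_less_iff w_def by (auto simp: Bex_def)
  \<comment> \<open>The choice is arbitrary when \<open>U i\<close> is empty; the corresponding box
    is then empty as well.\<close>
  define x where "x i = (SOME x. x \<in> U i)" for i :: nat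
  define d where "d i = diameter (U i)" for i
  have d0: "0 \<le> d i" for i unfolding d_def using U(2) by (rule diameter_ge_0)
  define B where "B i = (if U i = {} then {} else
      cbox (x i - d i *\<^sub>R One) (x i + d i *\<^sub>R One + h *\<^sub>R b))" for i
  have Bem: "emeasure lborel (B i) \<le> ennreal (tube_const TYPE('a) * h) * w (U i)" for i
  proof (cases "U i = {}")
    case False
    have ne: "(x i - d i *\<^sub>R One) \<bullet> k \<le> (x i + d i *\<^sub>R One + h *\<^sub>R b) \<bullet> k" if "k \<in> Basis" for k
      using that d0[of i] h b by (simp add: inner_diff_left inner_add_left inner_Basis)
    have "emeasure lborel (B i) = ennreal (\<Prod>k\<in>Basis. (x i + d i *\<^sub>R One + h *\<^sub>R b - (x i - d i *\<^sub>R One)) \<bullet> k)"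
      unfolding B_def using False by (simp add: emeasure_lborel_cbox[OF ne])
    also have "(\<Prod>k\<in>Basis. (x i + d i *\<^sub>R One + h *\<^sub>R b - (x i - d i *\<^sub>R One)) \<bullet> k)
      = (\<Prod>k\<in>Basis. 2 * d i + h * (if k = b then 1 else 0))"
      using b by (intro prod.cong) (auto simp: inner_diff_left inner_add_left inner_Basis)
    also have "\<dots> = (2 * d i + h) * (\<Prod>k\<in>Basis - {b}. 2 * d i)"
      using b by (subst prod.remove[OF finite_Basis b]) (auto intro!: prod.cong)
    also have "(\<Prod>k\<in>Basis - {b}. 2 * d i) = (2 * d i) ^ ?m"
      using b by (simp add: card_Diff_singleton)
    also have "ennreal ((2 * d i + h) * (2 * d i) ^ ?m) \<le> ennreal ((3 * h) * (2 * d i) ^ ?m)"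
      using d0[of i] U(3)[of i] h by (intro ennreal_leI mult_right_mono) (auto simp: d_def)
    \<comment> \<open>The origin of \<open>tube_const\<close>: the long edge is at most 3h because d
      <= h, and each of the other edges is 2d = 4 (d/2), where (d/2)^m times the volume of the unit
      ball is the weight of the set in the Hausdorff content.\<close>
    also have "(3 * h) * (2 * d i) ^ ?m = tube_const TYPE('a) * h * (unit_ball_vol (real ?m) * (d i / 2) ^ ?m)"
    proof -
      have "(2 * d i) ^ ?m = (4 * (d i / 2)) ^ ?m" by simp
      also have "\<dots> = 4 ^ ?m * (d i / 2) ^ ?m" by (rule power_mult_distrib)
      finally have "(2 * d i) ^ ?m = 4 ^ ?m * (d i / 2) ^ ?m" .
      moreover have "unit_ball_vol (real ?m) \<noteq> 0" using unit_ball_vol_pos[of "real ?m"] by linarith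
      ultimately show ?thesis by (simp add: tube_const_def)
    qed
    also have "ennreal \<dots> = ennreal (tube_const TYPE('a) * h) * w (U i)"
      using False h tube_const_pos[where 'a='a] d0[of i]
      by (subst ennreal_mult) (auto simp: w_def d_def)
    finally show ?thesis .
  qed (simp add: B_def)
  show ?thesis
  proof
    show "(\<Union>i. B i) \<in> sets borel" by (auto simp: B_def)
    fix p s assume p: "p \<in> A" and s: "0 \<le> s" "s \<le> h"
    then obtain i where i: "p \<in> U i" using U(1) by blast
    then have xi: "x i \<in> U i" unfolding x_def by (rule someI)
    have "dist p (x i) \<le> d i" unfolding d_def by (rule diameter_bounded_bound[OF U(2) i xi])
    then have "\<bar>(p - x i) \<bullet> k\<bar> \<le> d i" if "k \<in> Basis" for k
      using Basis_le_norm[OF that, of "p - x i"] by (simp add: dist_norm)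
    then have le: "x i \<bullet> k - d i \<le> p \<bullet> k" "p \<bullet> k \<le> x i \<bullet> k + d i" if "k \<in> Basis" for k
      using that by (force simp: inner_diff_left abs_le_iff)+
    have "p + s *\<^sub>R b \<in> cbox (x i - d i *\<^sub>R One) (x i + d i *\<^sub>R One + h *\<^sub>R b)"
      unfolding mem_box
    proof (intro ballI)
      fix k :: 'a assume k: "k \<in> Basis"
      show "(x i - d i *\<^sub>R One) \<bullet> k \<le> (p + s *\<^sub>R b) \<bullet> k \<and> (p + s *\<^sub>R b) \<bullet> k \<le> (x i + d i *\<^sub>R One + h *\<^sub>R b) \<bullet> k"
        using le[OF k] s h k b by (auto simp: inner_diff_left inner_add_left inner_Basis)
    qed
    then show "p + s *\<^sub>R b \<in> (\<Union>i. B i)" using i by (auto simp: B_def)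
  next
    have "emeasure lborel (\<Union>i. B i) \<le> (\<Sum>i. emeasure lborel (B i))"
      by (rule emeasure_subadditive_countably) (auto simp: B_def)
    also have "\<dots> \<le> (\<Sum>i. ennreal (tube_const TYPE('a) * h) * w (U i))"
      by (intro suminf_le Bem) auto
    also have "\<dots> = ennreal (tube_const TYPE('a) * h) * (\<Sum>i. w (U i))" by simp
    also have "\<dots> \<le> ennreal (tube_const TYPE('a) * h) * ennreal (H + e)"
      using U(4) by (intro mult_left_mono) auto
    also have "\<dots> = ennreal (tube_const TYPE('a) * h * (H + e))"
      using tube_const_pos[where 'a='a] h \<open>0 \<le> H\<close> e by (subst ennreal_mult[symmetric]) auto
    finally show "emeasure lborel (\<Union>i. B i) \<le> ennreal (tube_const TYPE('a) * h * (H + e))" .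
  qed
qed

text \<open>The sum counts the positive multiples of e up to y, at most N of them: a discrete layer
  cake formula. With \<open>step_sum_ge\<close> it recovers y up to an error e.\<close>

lemma step_sum_le:
  assumes "0 < e" "0 \<le> (y::real)"
  shows "(\<Sum>i\<in>{1..N}. e * of_bool (real i * e \<le> y)) \<le> y"
proof -
  define k where "k = nat \<lfloor>y / e\<rfloor>"
  have k: "real i * e \<le> y \<Longrightarrow> i \<le> k" for i :: nat
    using assms by (simp add: k_def le_nat_floor field_simps)
  have "(\<Sum>i\<in>{1..N}. e * of_bool (real i * e \<le> y)) \<le> (\<Sum>i\<in>{1..k}. e)"
  proof -
    have "(\<Sum>i\<in>{1..N}. e * of_bool (real i * e \<le> y)) = (\<Sum>i\<in>{i\<in>{1..N}. real i * e \<le> y}. e)"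
      unfolding sum.inter_filter[OF finite_atLeastAtMost] by (rule sum.cong) (simp_all only: of_bool_def split: if_split, simp)
    also have "\<dots> \<le> (\<Sum>i\<in>{1..k}. e)" using k assms by (intro sum_mono2) auto
    finally show ?thesis .
  qed
  also have "\<dots> = real k * e" by simp
  also have "\<dots> \<le> y / e * e" unfolding k_def using assms by (intro mult_right_mono) auto
  also have "\<dots> = y" using assms by simp
  finally show ?thesis .
qed

text \<open>The condition y <= N e ensures that truncation at N loses no multiple.\<close>

lemma step_sum_ge:
  assumes "0 < e" "0 \<le> (y::real)" "y \<le> real N * e"
  shows "y \<le> e + (\<Sum>i\<in>{1..N}. e * of_bool (real i * e \<le> y))"
proof -
  define k where "k = nat \<lfloor>y / e\<rfloor>"
  have y: "y / e < real k + 1" "real k \<le> y / e" unfolding k_def using assms by (simp_all; linarith)+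
  have kN: "k \<le> N"
  proof -
    have "real k \<le> real N" using y(2) assms by (smt (verit) divide_le_eq)
    then show ?thesis by simp
  qed
  have ke: "real i * e \<le> y" if "i \<le> k" for i
  proof -
    have "real i * e \<le> real k * e" using that assms by (intro mult_right_mono) auto
    also have "\<dots> \<le> y" using y(2) assms by (simp add: field_simps)
    finally show ?thesis .
  qed
  have "y < e + real k * e" using y(1) assms by (simp add: field_simps)
  also have "real k * e = (\<Sum>i\<in>{1..k}. e * of_bool (real i * e \<le> y))" using ke by simp
  also have "\<dots> \<le> (\<Sum>i\<in>{1..N}. e * of_bool (real i * e \<le> y))"
    using kN assms by (intro sum_mono2) auto
  finally show ?thesis by simp
qed

lemma sets_hausdorff_measure [measurable_cong, simp]: "sets (hausdorff_measure m :: 'a::euclidean_space measure) = sets borel"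
  unfolding hausdorff_measure_def using sets.sigma_sets_eq[of "borel :: 'a measure"] by simp

text \<open>A point of the layer is reached from a frontier point by moving at most h along b, and
  uniform continuity makes \<Phi> nearly equal at both. So the layer cake decomposition of \<Phi> on
  the layer is dominated by tubes over the superlevel sets of \<Phi> on the frontier, and
  \<open>tube_cover\<close> measures these tubes.\<close>

lemma shift_layer_integral:
  fixes \<Omega> :: "'a::euclidean_space set"
  assumes \<Omega>[measurable]: "\<Omega> \<in> sets borel" and cont: "continuous_on UNIV \<Phi>" and \<Phi>0: "\<And>x. 0 \<le> \<Phi> x"
    and em: "\<And>h. 0 < h \<Longrightarrow> h < h1 \<Longrightarrow> emeasure lborel (shift_layer \<Omega> h b \<inter> ball p \<rho>) \<le> ennreal (C * h)"
    and h1: "0 < h1" and C: "0 \<le> C" and b: "b \<in> Basis" and \<epsilon>: "0 < \<epsilon>"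
    and J: "(\<integral>\<^sup>+q. ennreal (\<Phi> q) * indicator (frontier \<Omega>) q \<partial>hausdorff_measure (DIM('a) - 1)) \<le> ennreal J" "0 \<le> J"
  shows "\<exists>h0>0. \<forall>h. 0 < h \<and> h < h0 \<longrightarrow>
    (\<integral>\<^sup>+x. ennreal (\<Phi> x) * indicator (shift_layer \<Omega> h b \<inter> ball p \<rho>) x \<partial>lborel)
      \<le> ennreal (h * (tube_const TYPE('a) * J + \<epsilon>))"
proof -
  let ?H = "hausdorff_measure (DIM('a) - 1) :: 'a measure" and ?K = "tube_const TYPE('a)"
  have K: "?K > 0" by (rule tube_const_pos)
  have [measurable]: "\<Phi> \<in> borel_measurable borel" by (rule borel_measurable_continuous_onI[OF cont])
  \<comment> \<open>The error totals h e (2C + K): the pointwise loss 2e on a layer of volume at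
    most C h, and the slack of the tubes, at most K h e altogether.\<close>
  define e where "e = \<epsilon> / (2 * C + ?K)"
  have den: "2 * C + ?K > 0" using C K by linarith
  have e: "e > 0" "e * (2 * C + ?K) = \<epsilon>" using \<epsilon> den by (auto simp: e_def)
  \<comment> \<open>The enlarged radius leaves room for frontier points q at distance h < 1 from the
    ball.\<close>
  have unif: "uniformly_continuous_on (cball p (\<rho> + 1)) \<Phi>"
    by (intro compact_uniformly_continuous continuous_on_subset[OF cont]) auto
  then obtain d where d: "d > 0" "\<And>x x'. x \<in> cball p (\<rho> + 1) \<Longrightarrow> x' \<in> cball p (\<rho> + 1) \<Longrightarrow> dist x' x < d \<Longrightarrow> dist (\<Phi> x') (\<Phi> x) < e"
    using e(1) unfolding uniformly_continuous_on_def by blast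
  have "bounded (\<Phi> ` cball p (\<rho> + 1))"
    by (intro compact_imp_bounded compact_continuous_image continuous_on_subset[OF cont]) auto
  then obtain Mx where Mx: "\<And>x. x \<in> cball p (\<rho> + 1) \<Longrightarrow> \<bar>\<Phi> x\<bar> \<le> Mx"
    unfolding bounded_iff by (metis imageI real_norm_def)
  obtain N where "Mx / e < real N" using reals_Archimedean2 by blast
  then have N: "Mx \<le> real N * e" using e(1) by (simp add: field_simps)
  define A where "A i = {q \<in> frontier \<Omega>. real i * e \<le> \<Phi> q}" for i :: nat
  have A[measurable]: "A i \<in> sets borel" for i
  proof -
    have "A i = frontier \<Omega> \<inter> {q. real i * e \<le> \<Phi> q}" by (auto simp: A_def)
    moreover have "closed {q. real i * e \<le> \<Phi> q}" by (intro closed_Collect_le cont continuous_intros)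
    ultimately show ?thesis by (metis borel_closed closed_Int frontier_closed)
  qed
  have HA: "(\<Sum>i\<in>{1..N}. ennreal e * hausdorff_outer (DIM('a) - 1) (A i)) \<le> ennreal J"
  proof -
    have "(\<Sum>i\<in>{1..N}. ennreal e * hausdorff_outer (DIM('a) - 1) (A i)) = (\<Sum>i\<in>{1..N}. ennreal e * emeasure ?H (A i))"
      by (intro sum.cong arg_cong2[where f="(*)"] emeasure_hausdorff_measure[symmetric] A refl)
    also have "\<dots> = (\<integral>\<^sup>+q. (\<Sum>i\<in>{1..N}. ennreal e * indicator (A i) q) \<partial>?H)"
      by (subst nn_integral_sum) (auto simp: nn_integral_cmult_indicator)
    also have "\<dots> \<le> (\<integral>\<^sup>+q. ennreal (\<Phi> q) * indicator (frontier \<Omega>) q \<partial>?H)"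
    proof (rule nn_integral_mono)
      fix q
      show "(\<Sum>i\<in>{1..N}. ennreal e * indicator (A i) q) \<le> ennreal (\<Phi> q) * indicator (frontier \<Omega>) q"
      proof (cases "q \<in> frontier \<Omega>")
        case True
        have "(\<Sum>i\<in>{1..N}. ennreal e * indicator (A i) q) = (\<Sum>i\<in>{1..N}. ennreal (e * of_bool (real i * e \<le> \<Phi> q)))"
          using True by (intro sum.cong) (auto simp: A_def indicator_def)
        also have "\<dots> = ennreal (\<Sum>i\<in>{1..N}. e * of_bool (real i * e \<le> \<Phi> q))"
          using e(1) by (intro sum_ennreal) auto
        also have "\<dots> \<le> ennreal (\<Phi> q)" by (intro ennreal_leI step_sum_le e \<Phi>0)
        finally show ?thesis using True by simp
      next
        case False
        then have "(\<Sum>i\<in>{1..N}. ennreal e * indicator (A i) q) = 0" by (intro sum.neutral) (auto simp: A_def)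
        then show ?thesis by (simp only: zero_le)
      qed
    qed
    also note J(1)
    finally show ?thesis .
  qed
  \<comment> \<open>Levels start at i = 1. A Chebyshev estimate bounds the Hausdorff measure of a
    superlevel set only for a positive level; \<open>A 0\<close> would be the whole
    frontier.\<close>
  have fin: "hausdorff_outer (DIM('a) - 1) (A i) < \<infinity>" if "i \<in> {1..N}" for i
  proof -
    have "ennreal e * hausdorff_outer (DIM('a) - 1) (A i) \<le> ennreal J"
      using HA by (rule order_trans[rotated]) (intro member_le_sum that; simp)
    then have "ennreal e * hausdorff_outer (DIM('a) - 1) (A i) \<noteq> \<infinity>" by (auto simp: top_unique)
    then show ?thesis using e(1) by (auto simp: ennreal_mult_eq_top_iff less_top)
  qed
  define \<eta> where "\<eta> i = enn2real (hausdorff_outer (DIM('a) - 1) (A i))" for i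
  have \<eta>0: "0 \<le> \<eta> i" for i by (simp add: \<eta>_def)
  have \<eta>: "hausdorff_outer (DIM('a) - 1) (A i) = ennreal (\<eta> i)" if "i \<in> {1..N}" for i
    using fin[OF that] by (simp add: \<eta>_def less_top)
  have \<eta>sum: "(\<Sum>i\<in>{1..N}. e * \<eta> i) \<le> J"
  proof -
    have "ennreal (\<Sum>i\<in>{1..N}. e * \<eta> i) = (\<Sum>i\<in>{1..N}. ennreal (e * \<eta> i))"
      using e(1) \<eta>0 by (intro sum_ennreal[symmetric]) auto
    also have "\<dots> = (\<Sum>i\<in>{1..N}. ennreal e * hausdorff_outer (DIM('a) - 1) (A i))"
      using e(1) \<eta>0 by (intro sum.cong refl) (simp only: \<eta> ennreal_mult less_imp_le)
    also note HA
    finally show ?thesis using J(2) by (simp only: ennreal_le_iff)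
  qed
  \<comment> \<open>N tubes with this slack have total slack below 1.\<close>
  define e2 where "e2 = 1 / (real N + 1)"
  have e2: "e2 > 0" "real N * e2 \<le> 1" by (auto simp: e2_def field_simps)
  define h0 where "h0 = min h1 (min d 1)"
  show ?thesis
  proof (intro exI[of _ h0] conjI allI impI)
    show "h0 > 0" using h1 d(1) by (simp add: h0_def)
    fix h assume "0 < h \<and> h < h0"
    then have h: "0 < h" "h < h1" "h < d" "h < 1" by (auto simp: h0_def)
    let ?S = "shift_layer \<Omega> h b \<inter> ball p \<rho>"
    have "\<exists>W. W \<in> sets borel \<and> (\<forall>p s. p \<in> A i \<longrightarrow> 0 \<le> s \<longrightarrow> s \<le> h \<longrightarrow> p + s *\<^sub>R b \<in> W) \<and>
        emeasure lborel W \<le> ennreal (?K * h * (\<eta> i + e2))" if "i \<in> {1..N}" for i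
      using tube_cover[OF eq_refl[OF \<eta>[OF that]] \<eta>0 b h(1) e2(1)] by metis
    then obtain W where W: "\<And>i. i \<in> {1..N} \<Longrightarrow> W i \<in> sets borel"
      "\<And>i p s. i \<in> {1..N} \<Longrightarrow> p \<in> A i \<Longrightarrow> 0 \<le> s \<Longrightarrow> s \<le> h \<Longrightarrow> p + s *\<^sub>R b \<in> W i"
      "\<And>i. i \<in> {1..N} \<Longrightarrow> emeasure lborel (W i) \<le> ennreal (?K * h * (\<eta> i + e2))" by metis
    have "(\<integral>\<^sup>+x. ennreal (\<Phi> x) * indicator ?S x \<partial>lborel)
      \<le> (\<integral>\<^sup>+x. ennreal (2 * e) * indicator ?S x + (\<Sum>i\<in>{1..N}. ennreal e * indicator (W i) x) \<partial>lborel)"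
    proof (rule nn_integral_mono)
      fix x
      show "ennreal (\<Phi> x) * indicator ?S x \<le> ennreal (2 * e) * indicator ?S x + (\<Sum>i\<in>{1..N}. ennreal e * indicator (W i) x)"
      proof (cases "x \<in> ?S")
        case True
        \<comment> \<open>Carry x back to a frontier point q = x - s b. Whenever \<Phi> q >= i e,
          the point q belongs to \<open>A i\<close>, and hence x to the tube
          \<open>W i\<close>.\<close>
        then obtain s where s: "0 \<le> s" "s \<le> h" "x - s *\<^sub>R b \<in> frontier \<Omega>"
          using shift_layer_frontier h(1) by blast
        define q where "q = x - s *\<^sub>R b"
        have dq: "dist x q \<le> h" using s b by (simp add: q_def dist_norm)
        have "dist p q \<le> dist p x + dist x q" by (rule dist_triangle)
        then have "q \<in> cball p (\<rho> + 1)" "x \<in> cball p (\<rho> + 1)" using True dq h by auto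
        then have "dist (\<Phi> x) (\<Phi> q) < e" "\<bar>\<Phi> q\<bar> \<le> Mx" using d(2)[of q x] Mx dq h by auto
        then have "\<Phi> x \<le> \<Phi> q + e" "\<Phi> q \<le> real N * e" using N by (auto simp: dist_real_def)
        with step_sum_ge[OF e(1) \<Phi>0, of q N]
        have "\<Phi> x \<le> 2 * e + (\<Sum>i\<in>{1..N}. e * of_bool (real i * e \<le> \<Phi> q))" by linarith
        then have "ennreal (\<Phi> x) \<le> ennreal (2 * e) + ennreal (\<Sum>i\<in>{1..N}. e * of_bool (real i * e \<le> \<Phi> q))"
        proof -
          assume "\<Phi> x \<le> 2 * e + (\<Sum>i\<in>{1..N}. e * of_bool (real i * e \<le> \<Phi> q))"
          moreover have "0 \<le> (\<Sum>i\<in>{1..N}. e * of_bool (real i * e \<le> \<Phi> q))" using e(1) by (intro sum_nonneg) auto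
          moreover have "0 \<le> 2 * e" using e(1) by simp
          ultimately show ?thesis by (metis ennreal_leI ennreal_plus)
        qed
        also have "ennreal (\<Sum>i\<in>{1..N}. e * of_bool (real i * e \<le> \<Phi> q)) = (\<Sum>i\<in>{1..N}. ennreal (e * of_bool (real i * e \<le> \<Phi> q)))"
          using e(1) by (intro sum_ennreal[symmetric]) auto
        also have "\<dots> \<le> (\<Sum>i\<in>{1..N}. ennreal e * indicator (W i) x)"
        proof (rule sum_mono)
          fix i assume i: "i \<in> {1..N}"
          show "ennreal (e * of_bool (real i * e \<le> \<Phi> q)) \<le> ennreal e * indicator (W i) x"
          proof (cases "real i * e \<le> \<Phi> q")
            case True
            then have "q \<in> A i" using s by (simp add: A_def q_def)
            then have "x \<in> W i" using W(2)[OF i _ s(1,2), of q] by (simp add: q_def)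
            then show ?thesis by (simp add: True)
          qed simp
        qed
        finally show ?thesis using True by (simp add: add_left_mono)
      qed simp
    qed
    also have "\<dots> = ennreal (2 * e) * emeasure lborel ?S + (\<Sum>i\<in>{1..N}. ennreal e * emeasure lborel (W i))"
    proof -
      have [measurable]: "?S \<in> sets borel" by measurable
      have Wm: "W i \<in> sets lborel" if "i \<in> {1..N}" for i using W(1)[OF that] by simp
      have Wi: "(\<lambda>x. ennreal e * indicator (W i) x) \<in> borel_measurable lborel" if "i \<in> {1..N}" for i
        using Wm[OF that] by (intro borel_measurable_times_ennreal borel_measurable_indicator) auto
      have "(\<integral>\<^sup>+x. ennreal (2 * e) * indicator ?S x + (\<Sum>i\<in>{1..N}. ennreal e * indicator (W i) x) \<partial>lborel)
        = (\<integral>\<^sup>+x. ennreal (2 * e) * indicator ?S x \<partial>lborel) + (\<integral>\<^sup>+x. (\<Sum>i\<in>{1..N}. ennreal e * indicator (W i) x) \<partial>lborel)"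
        by (intro nn_integral_add borel_measurable_sum Wi) measurable
      also have "(\<integral>\<^sup>+x. (\<Sum>i\<in>{1..N}. ennreal e * indicator (W i) x) \<partial>lborel) = (\<Sum>i\<in>{1..N}. \<integral>\<^sup>+x. ennreal e * indicator (W i) x \<partial>lborel)"
        by (intro nn_integral_sum Wi)
      also have "\<dots> = (\<Sum>i\<in>{1..N}. ennreal e * emeasure lborel (W i))"
        by (intro sum.cong refl nn_integral_cmult_indicator Wm)
      also have "(\<integral>\<^sup>+x. ennreal (2 * e) * indicator ?S x \<partial>lborel) = ennreal (2 * e) * emeasure lborel ?S"
        by (intro nn_integral_cmult_indicator) measurable
      finally show ?thesis .
    qed
    also have "\<dots> \<le> ennreal (2 * e) * ennreal (C * h) + (\<Sum>i\<in>{1..N}. ennreal e * ennreal (?K * h * (\<eta> i + e2)))"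
      using h by (intro add_mono mult_left_mono sum_mono em W(3)) auto
    also have "\<dots> = ennreal (2 * e * (C * h) + (\<Sum>i\<in>{1..N}. e * (?K * h * (\<eta> i + e2))))"
      using e C h K \<eta>0 e2(1)
      by (simp add: ennreal_mult[symmetric] sum_ennreal ennreal_plus[symmetric] sum_nonneg del: ennreal_plus)
    also have "\<dots> \<le> ennreal (h * (?K * J + \<epsilon>))"
    proof (rule ennreal_leI)
      have "(\<Sum>i\<in>{1..N}. e * (?K * h * (\<eta> i + e2))) = ?K * h * (\<Sum>i\<in>{1..N}. e * \<eta> i) + ?K * h * e * (real N * e2)"
        by (simp add: algebra_simps sum.distrib sum_distrib_left)
      also have "\<dots> \<le> ?K * h * J + ?K * h * e * 1"
        using K h e \<eta>sum e2 by (intro add_mono mult_left_mono) auto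
      finally have "2 * e * (C * h) + (\<Sum>i\<in>{1..N}. e * (?K * h * (\<eta> i + e2))) \<le> h * (?K * J + e * (2 * C + ?K))"
        by (simp add: algebra_simps)
      then show "2 * e * (C * h) + (\<Sum>i\<in>{1..N}. e * (?K * h * (\<eta> i + e2))) \<le> h * (?K * J + \<epsilon>)"
        unfolding e(2) .
    qed
    finally show "(\<integral>\<^sup>+x. ennreal (\<Phi> x) * indicator ?S x \<partial>lborel) \<le> ennreal (h * (?K * J + \<epsilon>))" .
  qed
qed

section \<open>Difference quotients and the boundary term for smooth functions\<close>

lemma frechet_derivative_outside:
  assumes "\<And>z. z \<notin> S \<Longrightarrow> F z = (0::real)" "z \<notin> closure S"
  shows "frechet_derivative F (at z) w = 0"
proof -
  have "\<forall>\<^sub>F y in nhds z. 0 = F y"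
  proof (rule eventually_mono[OF eventually_nhds_in_open[of "- closure S" z]])
    fix y assume "y \<in> - closure S"
    then have "y \<notin> S" using closure_subset[of S] by blast
    then show "0 = F y" using assms(1) by simp
  qed (use assms(2) in auto)
  then have "(F has_derivative (\<lambda>_. 0)) (at z)"
    by (intro has_derivative_transform_eventually[OF has_derivative_const[of 0]])
       (auto simp: eventually_at_filter elim: eventually_mono dest: eventually_nhds_x_imp_x)
  then show ?thesis using frechet_derivative_at by (metis)
qed

text \<open>Dominated convergence: by the mean value theorem the quotients are bounded by the
  maximum of the derivative, and as h is bounded their supports stay in one ball.\<close>

lemma difference_quotient_integral:
  fixes F :: "'a::euclidean_space \<Rightarrow> real"
  assumes F: "C_k (Suc 0) F" and S: "bounded S" "\<And>z. z \<notin> S \<Longrightarrow> F z = 0"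
    and Q[measurable]: "Q \<in> sets borel" and h: "\<And>n. 0 < h n" "h \<longlonglongrightarrow> 0"
  shows "integrable lborel (\<lambda>z. indicator Q z * frechet_derivative F (at z) w)"
   and "(\<lambda>n. \<integral>z. indicator Q z * ((F (z + h n *\<^sub>R w) - F z) / h n) \<partial>lborel)
        \<longlonglongrightarrow> (\<integral>z. indicator Q z * frechet_derivative F (at z) w \<partial>lborel)"
proof -
  let ?D = "\<lambda>z. frechet_derivative F (at z) w"
  have cD: "continuous_on UNIV ?D" using F by simp
  have cF: "continuous_on UNIV F" using C_k_SucD[OF F] by simp
  have [measurable]: "F \<in> borel_measurable borel" "?D \<in> borel_measurable borel"
    using borel_measurable_continuous_onI cD cF by auto
  have D0: "?D z = 0" if "z \<notin> closure S" for z
    by (rule frechet_derivative_outside[OF S(2) that])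
  obtain B where B: "\<And>z. \<bar>?D z\<bar> \<le> B"
  proof -
    have "bounded (?D ` closure S)"
      using S(1) by (intro compact_imp_bounded compact_continuous_image continuous_on_subset[OF cD]) auto
    then obtain B where B: "\<And>z. z \<in> closure S \<Longrightarrow> \<bar>?D z\<bar> \<le> B" by (auto simp: bounded_iff)
    have "\<bar>?D z\<bar> \<le> max B 0" for z using B[of z] D0[of z] by (cases "z \<in> closure S") (auto simp: max_def)
    then show ?thesis by (rule that)
  qed
  have lip: "\<bar>F (z + s *\<^sub>R w) - F z\<bar> \<le> s * B" if "0 < s" for s z
  proof -
    have "((\<lambda>t. F (z + t *\<^sub>R w)) has_real_derivative ?D (z + t *\<^sub>R w)) (at t)" for t
    proof -
      have "((\<lambda>t. F (z + t *\<^sub>R w)) has_derivative (\<lambda>u. frechet_derivative F (at (z + t *\<^sub>R w)) (u *\<^sub>R w))) (at t)"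
        by (rule has_derivative_compose[OF _ C_k_has_derivative[OF F]]) (auto intro!: derivative_eq_intros)
      moreover have "frechet_derivative F (at (z + t *\<^sub>R w)) (u *\<^sub>R w) = ?D (z + t *\<^sub>R w) * u" for u
        using has_derivative_linear[OF C_k_has_derivative[OF F]] by (simp add: linear_cmul)
      ultimately show ?thesis by (simp add: has_field_derivative_def)
    qed
    then have "\<exists>t. 0 < t \<and> t < s \<and> F (z + s *\<^sub>R w) - F (z + 0 *\<^sub>R w) = (s - 0) * ?D (z + t *\<^sub>R w)"
      by (intro MVT2 that)
    then obtain t where "F (z + s *\<^sub>R w) - F (z + 0 *\<^sub>R w) = (s - 0) * ?D (z + t *\<^sub>R w)" by blast
    then show ?thesis using B[of "z + t *\<^sub>R w"] that by (simp add: abs_mult)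
  qed
  obtain H where H: "\<And>n. h n \<le> H"
    using convergent_imp_Bseq[of h] h(2) unfolding convergent_def Bseq_def by (auto simp: abs_le_iff)
  have B0: "0 \<le> B" using B[of 0] by linarith
  have H0: "0 < H" using H[of 0] h(1)[of 0] by linarith
  obtain R where R: "\<And>z. z \<in> S \<Longrightarrow> norm z \<le> R" using S(1) by (auto simp: bounded_iff)
  define R' where "R' = R + H * norm w"
  have out: "F (z + h n *\<^sub>R w) - F z = 0" if "z \<notin> cball 0 R'" for z n
  proof -
    have nz: "norm z > R'" using that by simp
    have hw: "norm (h n *\<^sub>R w) \<le> H * norm w" using H[of n] h(1)[of n] by (simp add: mult_right_mono)
    have "z \<notin> S" using R[of z] nz H0 by (auto simp: R'_def) (smt (verit) mult_nonneg_nonneg norm_ge_zero)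
    moreover have "z + h n *\<^sub>R w \<notin> S"
      using R[of "z + h n *\<^sub>R w"] nz hw norm_triangle_ineq4[of "z + h n *\<^sub>R w" "h n *\<^sub>R w"]
      by (auto simp: R'_def)
    ultimately show ?thesis using S(2) by simp
  qed
  show int: "integrable lborel (\<lambda>z. indicator Q z * ?D z)"
    by (rule integrable_bounded_support[where S="closure S" and B=B])
       (use S(1) B D0 B0 in \<open>auto simp: indicator_def\<close>)
  show "(\<lambda>n. \<integral>z. indicator Q z * ((F (z + h n *\<^sub>R w) - F z) / h n) \<partial>lborel)
        \<longlonglongrightarrow> (\<integral>z. indicator Q z * ?D z \<partial>lborel)"
  proof (rule integral_dominated_convergence[where w="\<lambda>z. B * indicator (cball 0 R') z"])
    show "integrable lborel (\<lambda>z. B * indicator (cball 0 R' :: 'a set) z)"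
      using emeasure_lborel_cball_finite[of "0::'a" R'] by (intro integrable_mult_right integrable_real_indicator) auto
    show "AE z in lborel. (\<lambda>n. indicator Q z * ((F (z + h n *\<^sub>R w) - F z) / h n)) \<longlonglongrightarrow> indicator Q z * ?D z"
    proof (rule AE_I2)
      fix z
      have "((\<lambda>t. F (z + t *\<^sub>R w)) has_derivative (\<lambda>u. frechet_derivative F (at (z + 0 *\<^sub>R w)) (u *\<^sub>R w))) (at 0)"
        by (rule has_derivative_compose[OF _ C_k_has_derivative[OF F]]) (auto intro!: derivative_eq_intros)
      then have "((\<lambda>t. F (z + t *\<^sub>R w)) has_real_derivative ?D z) (at 0)"
        using has_derivative_linear[OF C_k_has_derivative[OF F]]
        by (simp add: has_field_derivative_def linear_cmul mult.commute[of _ "?D z"] mult_commute_abs)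
      then have "(\<lambda>t. (F (z + t *\<^sub>R w) - F z) / t) \<midarrow>0\<rightarrow> ?D z" by (simp add: DERIV_def)
      then have "(\<lambda>n. (F (z + h n *\<^sub>R w) - F z) / h n) \<longlonglongrightarrow> ?D z"
      proof (rule filterlim_compose)
        show "filterlim h (at 0) sequentially"
          using h(2) less_imp_neq[OF h(1)] by (auto simp: filterlim_at intro!: always_eventually)
      qed
      then show "(\<lambda>n. indicator Q z * ((F (z + h n *\<^sub>R w) - F z) / h n)) \<longlonglongrightarrow> indicator Q z * ?D z"
        by (intro tendsto_intros)
    qed
    show "AE z in lborel. norm (indicator Q z * ((F (z + h n *\<^sub>R w) - F z) / h n)) \<le> B * indicator (cball 0 R') z" for n
    proof (rule AE_I2)
      fix z
      have "\<bar>F (z + h n *\<^sub>R w) - F z\<bar> / h n \<le> B"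
        using lip[OF h(1), of z n] h(1)[of n] by (simp add: field_simps)
      then show "norm (indicator Q z * ((F (z + h n *\<^sub>R w) - F z) / h n)) \<le> B * indicator (cball 0 R') z"
        using out[of z n] B0 h(1)[of n] by (cases "z \<in> cball 0 R'") (auto simp: indicator_def)
    qed
  qed measurable
qed

lemma continuous_bounded_on:
  fixes f :: "'a::heine_borel \<Rightarrow> 'b::real_normed_vector"
  assumes "continuous_on UNIV f" "bounded S"
  obtains B where "0 \<le> B" "\<And>z. z \<in> S \<Longrightarrow> norm (f z) \<le> B"
proof -
  have "compact (f ` closure S)"
    using assms by (intro compact_continuous_image) (auto intro: continuous_on_subset)
  then have "bounded (f ` closure S)" by (rule compact_imp_bounded)
  then obtain B where B: "\<forall>y\<in>f ` closure S. norm y \<le> B" unfolding bounded_iff by blast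
  have "norm (f z) \<le> max 0 B" if "z \<in> S" for z
    using B closure_subset[THEN subsetD, OF that] by force
  then show ?thesis by (intro that[of "max 0 B"]) auto
qed

lemma borel_fst: "(fst :: 'a::euclidean_space \<times> 'b::euclidean_space \<Rightarrow> 'a) \<in> borel \<rightarrow>\<^sub>M borel"
  by (intro borel_measurable_continuous_onI continuous_intros)

lemma borel_snd: "(snd :: 'a::euclidean_space \<times> 'b::euclidean_space \<Rightarrow> 'b) \<in> borel \<rightarrow>\<^sub>M borel"
  by (intro borel_measurable_continuous_onI continuous_intros)

lemma nn_integral_lborel_pair:
  fixes f :: "'a::euclidean_space \<times> 'b::euclidean_space \<Rightarrow> ennreal"
  assumes "f \<in> borel_measurable borel"
  shows "(\<integral>\<^sup>+z. f z \<partial>lborel) = (\<integral>\<^sup>+x. \<integral>\<^sup>+t. f (x, t) \<partial>lborel \<partial>lborel)"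
proof -
  have "f \<in> borel_measurable (lborel \<Otimes>\<^sub>M lborel)" using assms by (simp add: lborel_prod)
  from lborel.nn_integral_fst[OF this] show ?thesis by (simp add: lborel_prod)
qed

text \<open>\<open>shift_layer_integral\<close> asks for a continuous function of x alone. The
  integral over the compact interval provides continuity, and the third claim identifies it with the
  inner integral of the lateral measure.\<close>

lemma time_integral_continuous:
  fixes \<psi> :: "'a::euclidean_space \<times> real \<Rightarrow> real"
  assumes \<psi>: "continuous_on UNIV \<psi>"
  shows "continuous_on UNIV (\<lambda>x. integral {s1..s2} (\<lambda>t. (\<psi> (x, t))\<^sup>2))"
    and "0 \<le> integral {s1..s2} (\<lambda>t. (\<psi> (x, t))\<^sup>2)"
    and "(\<integral>\<^sup>+t. ennreal ((\<psi> (x, t))\<^sup>2) * indicator {s1<..<s2} t \<partial>lborel) = ennreal (integral {s1..s2} (\<lambda>t. (\<psi> (x, t))\<^sup>2))"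
proof -
  have c: "continuous_on S (\<lambda>t. (\<psi> (x, t))\<^sup>2)" for x S
    by (intro continuous_intros continuous_on_compose2[OF \<psi>]) auto
  have "continuous_on UNIV (\<lambda>x. integral (cbox s1 s2) (\<lambda>t. (\<psi> (x, t))\<^sup>2))"
    by (intro integral_continuous_on_param) (auto intro!: continuous_intros continuous_on_subset[OF \<psi>] simp: split_beta')
  then show "continuous_on UNIV (\<lambda>x. integral {s1..s2} (\<lambda>t. (\<psi> (x, t))\<^sup>2))" by simp
  have i: "(\<lambda>t. (\<psi> (x, t))\<^sup>2) integrable_on {s1..s2}" by (intro integrable_continuous_real c)
  then show "0 \<le> integral {s1..s2} (\<lambda>t. (\<psi> (x, t))\<^sup>2)" by (rule Henstock_Kurzweil_Integration.integral_nonneg) auto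
  have "((\<lambda>t. (\<psi> (x, t))\<^sup>2) has_integral integral {s1..s2} (\<lambda>t. (\<psi> (x, t))\<^sup>2)) (box s1 s2)"
    unfolding has_integral_open_interval using i by (simp add: has_integral_integral)
  then have "((\<lambda>t. indicator (box s1 s2) t * (\<psi> (x, t))\<^sup>2) has_integral integral {s1..s2} (\<lambda>t. (\<psi> (x, t))\<^sup>2)) UNIV"
    by (subst (asm) has_integral_restrict_UNIV[symmetric]) (simp add: indicator_def of_bool_def if_distrib if_distribR cong: if_cong)
  then have "(\<integral>\<^sup>+t. ennreal (indicator (box s1 s2) t * (\<psi> (x, t))\<^sup>2) \<partial>lborel) = ennreal (integral {s1..s2} (\<lambda>t. (\<psi> (x, t))\<^sup>2))"
    by (intro nn_integral_has_integral_lborel borel_measurable_times borel_measurable_indicator borel_measurable_continuous_onI[OF c]) auto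
  then show "(\<integral>\<^sup>+t. ennreal ((\<psi> (x, t))\<^sup>2) * indicator {s1<..<s2} t \<partial>lborel) = ennreal (integral {s1..s2} (\<lambda>t. (\<psi> (x, t))\<^sup>2))"
    by (simp add: mult.commute ennreal_mult ennreal_indicator)
qed

text \<open>Through Young's inequality \<open>|\<psi>| \<le> \<psi>\<^sup>2/(2\<eta>) + \<eta>/2\<close> the square integral over the frontier controls the boundary term.\<close>

lemma boundary_term:
  fixes \<Omega> :: "'a::euclidean_space set" and F \<psi> :: "'a \<times> real \<Rightarrow> real"
  assumes \<Omega>: "open \<Omega>" and v: "v \<in> Basis"
    and em: "\<And>h. 0 < h \<Longrightarrow> h < h1 \<Longrightarrow> emeasure lborel (shift_layer \<Omega> h v \<inter> ball p \<rho>) \<le> ennreal (C * h)"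
    and h1: "0 < h1" and C: "0 \<le> C" and s: "s1 < s2"
    and \<psi>: "continuous_on UNIV \<psi>" and F: "C_k (Suc 0) F" and B: "0 \<le> B" "\<And>z. \<bar>F z\<bar> \<le> B * \<bar>\<psi> z\<bar>"
    and supp: "\<And>z. z \<notin> ball p \<rho> \<times> {s1<..<s2} \<Longrightarrow> F z = 0"
    and J: "(\<integral>\<^sup>+q. (\<integral>\<^sup>+t. ennreal ((\<psi> (q, t))\<^sup>2) * indicator {s1<..<s2} t \<partial>lborel) * indicator (frontier \<Omega>) q
               \<partial>hausdorff_measure (DIM('a) - 1)) \<le> ennreal J" "0 \<le> J"
    and \<eta>: "0 < \<eta>"
  shows "\<bar>\<integral>z. indicator (\<Omega> \<times> {s1<..<s2}) z * frechet_derivative F (at z) (v, 0) \<partial>lborel\<bar>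
    \<le> B * (tube_const TYPE('a) * J / (2 * \<eta>) + \<eta> * C * (s2 - s1) / 2)"
proof -
  let ?K = "tube_const TYPE('a)"
  define \<Phi> where "\<Phi> x = integral {s1..s2} (\<lambda>t. (\<psi> (x, t))\<^sup>2)" for x
  note \<Phi> = time_integral_continuous[OF \<psi>, where ?s1.0=s1 and ?s2.0=s2, folded \<Phi>_def]
  have [measurable]: "\<Omega> \<in> sets borel" using \<Omega> by auto
  define Q where "Q = \<Omega> \<times> {s1<..<s2}"
  have Qo: "open Q" unfolding Q_def using \<Omega> by (intro open_Times) auto
  then have [measurable]: "Q \<in> sets borel" by auto
  have [measurable]: "F \<in> borel_measurable borel" "\<psi> \<in> borel_measurable borel" "\<Phi> \<in> borel_measurable borel"
    using C_k_SucD[OF F] \<psi> \<Phi>(1) by (auto intro: borel_measurable_continuous_onI)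
  have bS: "bounded (ball p \<rho> \<times> {s1<..<s2})" by (intro bounded_Times) auto
  obtain MF where MF: "\<And>z. \<bar>F z\<bar> \<le> MF"
  proof -
    let ?S = "ball p \<rho> \<times> {s1<..<s2}"
    have "continuous_on UNIV F" using C_k_SucD[OF F] by simp
    then obtain M where "0 \<le> M" and M: "\<And>z. z \<in> ?S \<Longrightarrow> norm (F z) \<le> M"
      using continuous_bounded_on[OF _ bS] by metis
    have "\<bar>F z\<bar> \<le> M" for z
      using M[of z] supp[of z] \<open>0 \<le> M\<close> by (cases "z \<in> ?S") (simp_all del: mem_Times_iff)
    then show ?thesis by (rule that)
  qed
  have iF: "integrable lborel F"
    by (rule integrable_bounded_support[OF _ bS, where B=MF]) (use MF supp in auto)
  have J': "(\<integral>\<^sup>+q. ennreal (\<Phi> q) * indicator (frontier \<Omega>) q \<partial>hausdorff_measure (DIM('a) - 1)) \<le> ennreal J"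
    using J(1) by (simp only: \<Phi>(3))
  have main: "\<bar>\<integral>z. indicator Q z * frechet_derivative F (at z) (v, 0) \<partial>lborel\<bar>
       \<le> B / (2 * \<eta>) * (?K * J + \<epsilon>) + B * \<eta> / 2 * C * (s2 - s1)" if \<epsilon>: "\<epsilon> > 0" for \<epsilon>
  proof -
    obtain h0 where h0: "h0 > 0" "\<And>h. 0 < h \<Longrightarrow> h < h0 \<Longrightarrow>
      (\<integral>\<^sup>+x. ennreal (\<Phi> x) * indicator (shift_layer \<Omega> h v \<inter> ball p \<rho>) x \<partial>lborel) \<le> ennreal (h * (?K * J + \<epsilon>))"
      using shift_layer_integral[OF _ \<Phi>(1,2) em h1 C v \<epsilon> J' J(2)] by auto
    \<comment> \<open>The offset 2 makes already the first term strictly smaller than both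
      thresholds.\<close>
    define h where "h n = min h0 h1 / real (n + 2)" for n
    have h: "0 < h n" "h n < h0" "h n < h1" for n
    proof -
      have m: "min h0 h1 > 0" using h0 h1 by auto
      then have "h n \<le> min h0 h1 / 2" unfolding h_def by (intro divide_left_mono) auto
      then have "h n < min h0 h1" using m by linarith
      moreover have "0 < h n" using m unfolding h_def by simp
      ultimately have "0 < h n" "h n < min h0 h1" by auto
      then show "0 < h n" "h n < h0" "h n < h1" by auto
    qed
    have hl: "h \<longlonglongrightarrow> 0" unfolding h_def
      using LIMSEQ_ignore_initial_segment[OF lim_const_over_n[of "min h0 h1"], of 2] by simp
    have bound: "\<bar>\<integral>z. indicator Q z * ((F (z + h n *\<^sub>R (v, 0)) - F z) / h n) \<partial>lborel\<bar>
       \<le> B / (2 * \<eta>) * (?K * J + \<epsilon>) + B * \<eta> / 2 * C * (s2 - s1)" for n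
    proof -
      let ?w = "h n *\<^sub>R (v, 0::real)"
      let ?S = "shift_layer \<Omega> (h n) v \<inter> ball p \<rho>"
      have [measurable]: "?S \<in> sets borel" by measurable
      have i1: "integrable lborel (\<lambda>z. indicator Q z * F (z + ?w))"
        by (rule Bochner_Integration.integrable_bound[OF lborel_integrable_shift[OF iF, of ?w]]) (auto simp: indicator_def)
      have i2: "integrable lborel (\<lambda>z. indicator Q z * F z)"
        by (rule Bochner_Integration.integrable_bound[OF iF]) (auto simp: indicator_def)
      have i3: "integrable lborel (\<lambda>z. indicator Q (z - ?w) * F z)"
        by (rule Bochner_Integration.integrable_bound[OF iF]) (auto simp: indicator_def)
      \<comment> \<open>Discrete integration by parts: the shift is moved from F to the indicator of
        Q. Since F vanishes outside the time interval and the shift is purely spatial, the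
        difference of indicators times F lives over the shift layer.\<close>
      let ?G = "\<lambda>z. (indicator Q (z - ?w) - indicator Q z) * F z"
      have "(\<integral>z. indicator Q z * ((F (z + ?w) - F z) / h n) \<partial>lborel)
        = (\<integral>z. (indicator Q z * F (z + ?w) - indicator Q z * F z) / h n \<partial>lborel)"
        by (intro Bochner_Integration.integral_cong) (auto simp: algebra_simps diff_divide_distrib)
      also have "\<dots> = ((\<integral>z. indicator Q z * F (z + ?w) \<partial>lborel) - (\<integral>z. indicator Q z * F z \<partial>lborel)) / h n"
        using i1 i2 by simp
      also have "(\<integral>z. indicator Q z * F (z + ?w) \<partial>lborel) = (\<integral>z. indicator Q (z - ?w) * F z \<partial>lborel)"
        using lborel_integral_shift[of "\<lambda>z. indicator Q (z - ?w) * F z" ?w] by simp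
      also have "(\<integral>z. indicator Q (z - ?w) * F z \<partial>lborel) - (\<integral>z. indicator Q z * F z \<partial>lborel) = (\<integral>z. ?G z \<partial>lborel)"
        using i2 i3 by (simp add: left_diff_distrib)
      finally have eq: "(\<integral>z. indicator Q z * ((F (z + ?w) - F z) / h n) \<partial>lborel) = (\<integral>z. ?G z \<partial>lborel) / h n" .
      have iG: "integrable lborel ?G" using i2 i3 by (simp add: left_diff_distrib)
      have "ennreal \<bar>\<integral>z. ?G z \<partial>lborel\<bar> \<le> (\<integral>\<^sup>+z. ennreal \<bar>?G z\<bar> \<partial>lborel)"
        using integral_norm_bound_ennreal[OF iG] by simp
      also have "\<dots> \<le> (\<integral>\<^sup>+z. (ennreal (B / (2 * \<eta>)) * ennreal ((\<psi> z)\<^sup>2) + ennreal (B * \<eta> / 2)) *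
                   (indicator {s1<..<s2} (snd z) * indicator ?S (fst z)) \<partial>lborel)"
      proof (rule nn_integral_mono)
        fix z :: "'a \<times> real"
        obtain x t where z: "z = (x, t)" by (cases z)
        show "ennreal \<bar>?G z\<bar> \<le> (ennreal (B / (2 * \<eta>)) * ennreal ((\<psi> z)\<^sup>2) + ennreal (B * \<eta> / 2)) *
                   (indicator {s1<..<s2} (snd z) * indicator ?S (fst z))"
        proof (cases "?G z = 0")
          case False
          then have t: "t \<in> {s1<..<s2}" "x \<in> ball p \<rho>" using supp[of z] z by auto
          have "(z - ?w \<in> Q) \<noteq> (z \<in> Q)" using False by (auto simp: indicator_def)
          then have "x \<in> shift_layer \<Omega> (h n) v" using t by (auto simp: shift_layer_def Q_def z)
          moreover have "\<bar>?G z\<bar> \<le> B / (2 * \<eta>) * (\<psi> z)\<^sup>2 + B * \<eta> / 2"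
          proof -
            have "\<bar>?G z\<bar> \<le> 1 * \<bar>F z\<bar>" unfolding abs_mult by (intro mult_right_mono) (auto simp: indicator_def)
            also have "\<dots> \<le> B * \<bar>\<psi> z\<bar>" using B(2) by simp
            also have "\<dots> \<le> B * ((\<psi> z)\<^sup>2 / (2 * \<eta>) + \<eta> / 2)"
            proof (intro mult_left_mono B(1))
              have "2 * \<bar>\<psi> z\<bar> * \<eta> \<le> \<bar>\<psi> z\<bar>\<^sup>2 + \<eta>\<^sup>2" by (rule sum_squares_bound)
              then show "\<bar>\<psi> z\<bar> \<le> (\<psi> z)\<^sup>2 / (2 * \<eta>) + \<eta> / 2" using \<eta> by (simp add: field_simps power2_eq_square)
            qed
            also have "\<dots> = B / (2 * \<eta>) * (\<psi> z)\<^sup>2 + B * \<eta> / 2" by (simp add: algebra_simps)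
            finally show ?thesis .
          qed
          then have "ennreal \<bar>?G z\<bar> \<le> ennreal (B / (2 * \<eta>) * (\<psi> z)\<^sup>2 + B * \<eta> / 2)" by (rule ennreal_leI)
          then have "ennreal \<bar>?G z\<bar> \<le> ennreal (B / (2 * \<eta>)) * ennreal ((\<psi> z)\<^sup>2) + ennreal (B * \<eta> / 2)"
            using B(1) \<eta> by (simp add: ennreal_mult[symmetric])
          ultimately show ?thesis using t z by simp
        next
          case True
          then show ?thesis by (simp only: abs_zero ennreal_0 zero_le)
        qed
      qed
      also have "\<dots> = (\<integral>\<^sup>+x. (\<integral>\<^sup>+t. (ennreal (B / (2 * \<eta>)) * ennreal ((\<psi> (x, t))\<^sup>2) + ennreal (B * \<eta> / 2)) *
                   (indicator {s1<..<s2} t * indicator ?S x) \<partial>lborel) \<partial>lborel)"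
      proof (subst nn_integral_lborel_pair)
        show "(\<lambda>z. (ennreal (B / (2 * \<eta>)) * ennreal ((\<psi> z)\<^sup>2) + ennreal (B * \<eta> / 2)) *
            (indicator {s1<..<s2} (snd z) * indicator ?S (fst z))) \<in> borel_measurable borel"
          by (intro borel_measurable_times_ennreal borel_measurable_add borel_measurable_const
              measurable_compose[OF borel_fst borel_measurable_indicator] measurable_compose[OF borel_snd borel_measurable_indicator]
              measurable_compose[OF _ measurable_ennreal]) measurable
      qed simp
      also have "\<dots> = (\<integral>\<^sup>+x. ennreal (B / (2 * \<eta>)) * (ennreal (\<Phi> x) * indicator ?S x) + ennreal (B * \<eta> / 2 * (s2 - s1)) * indicator ?S x \<partial>lborel)"
      proof (rule nn_integral_cong)
        fix x :: 'a
        have "(\<integral>\<^sup>+t. (ennreal (B / (2 * \<eta>)) * ennreal ((\<psi> (x, t))\<^sup>2) + ennreal (B * \<eta> / 2)) * (indicator {s1<..<s2} t * indicator ?S x) \<partial>lborel)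
          = (\<integral>\<^sup>+t. (ennreal (B / (2 * \<eta>)) * indicator ?S x) * (ennreal ((\<psi> (x, t))\<^sup>2) * indicator {s1<..<s2} t)
              + (ennreal (B * \<eta> / 2) * indicator ?S x) * indicator {s1<..<s2} t \<partial>lborel)"
          by (intro nn_integral_cong) (simp add: algebra_simps)
        also have "\<dots> = (ennreal (B / (2 * \<eta>)) * indicator ?S x) * (\<integral>\<^sup>+t. ennreal ((\<psi> (x, t))\<^sup>2) * indicator {s1<..<s2} t \<partial>lborel)
              + (ennreal (B * \<eta> / 2) * indicator ?S x) * (\<integral>\<^sup>+t. indicator {s1<..<s2} t \<partial>lborel)"
          by (subst nn_integral_add) (auto simp: nn_integral_cmult)
        also have "\<dots> = (ennreal (B / (2 * \<eta>)) * indicator ?S x) * ennreal (\<Phi> x) + (ennreal (B * \<eta> / 2) * indicator ?S x) * ennreal (s2 - s1)"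
          using s by (simp add: \<Phi>(3))
        also have "\<dots> = ennreal (B / (2 * \<eta>)) * (ennreal (\<Phi> x) * indicator ?S x) + ennreal (B * \<eta> / 2 * (s2 - s1)) * indicator ?S x"
        proof -
          have "ennreal (B * \<eta> / 2 * (s2 - s1)) = ennreal (B * \<eta> / 2) * ennreal (s2 - s1)"
            using B(1) \<eta> s by (intro ennreal_mult) auto
          then show ?thesis by (simp only: ac_simps)
        qed
        finally show "(\<integral>\<^sup>+t. (ennreal (B / (2 * \<eta>)) * ennreal ((\<psi> (x, t))\<^sup>2) + ennreal (B * \<eta> / 2)) * (indicator {s1<..<s2} t * indicator ?S x) \<partial>lborel)
          = ennreal (B / (2 * \<eta>)) * (ennreal (\<Phi> x) * indicator ?S x) + ennreal (B * \<eta> / 2 * (s2 - s1)) * indicator ?S x" .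
      qed
      also have "\<dots> = ennreal (B / (2 * \<eta>)) * (\<integral>\<^sup>+x. ennreal (\<Phi> x) * indicator ?S x \<partial>lborel) + ennreal (B * \<eta> / 2 * (s2 - s1)) * emeasure lborel ?S"
      proof -
        have "(\<integral>\<^sup>+x. ennreal (B / (2 * \<eta>)) * (ennreal (\<Phi> x) * indicator ?S x) + ennreal (B * \<eta> / 2 * (s2 - s1)) * indicator ?S x \<partial>lborel)
          = (\<integral>\<^sup>+x. ennreal (B / (2 * \<eta>)) * (ennreal (\<Phi> x) * indicator ?S x) \<partial>lborel) + (\<integral>\<^sup>+x. ennreal (B * \<eta> / 2 * (s2 - s1)) * indicator ?S x \<partial>lborel)"
          by (intro nn_integral_add) measurable
        also have "(\<integral>\<^sup>+x. ennreal (B / (2 * \<eta>)) * (ennreal (\<Phi> x) * indicator ?S x) \<partial>lborel) = ennreal (B / (2 * \<eta>)) * (\<integral>\<^sup>+x. ennreal (\<Phi> x) * indicator ?S x \<partial>lborel)"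
          by (intro nn_integral_cmult) measurable
        also have "(\<integral>\<^sup>+x. ennreal (B * \<eta> / 2 * (s2 - s1)) * indicator ?S x \<partial>lborel) = ennreal (B * \<eta> / 2 * (s2 - s1)) * emeasure lborel ?S"
          by (intro nn_integral_cmult_indicator) measurable
        finally show ?thesis .
      qed
      also have "\<dots> \<le> ennreal (B / (2 * \<eta>)) * ennreal (h n * (?K * J + \<epsilon>)) + ennreal (B * \<eta> / 2 * (s2 - s1)) * ennreal (C * h n)"
        by (intro add_mono mult_left_mono h0(2) em h) auto
      also have "\<dots> = ennreal (h n * (B / (2 * \<eta>) * (?K * J + \<epsilon>) + B * \<eta> / 2 * C * (s2 - s1)))"
      proof -
        have "0 \<le> B / (2 * \<eta>) * (h n * (?K * J + \<epsilon>))" "0 \<le> B * \<eta> / 2 * (s2 - s1) * (C * h n)"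
          "0 \<le> B / (2 * \<eta>)" "0 \<le> h n * (?K * J + \<epsilon>)" "0 \<le> B * \<eta> / 2 * (s2 - s1)" "0 \<le> C * h n"
          using h[of n] B \<eta> s C J(2) \<epsilon> tube_const_pos[where 'a='a] by auto
        then show ?thesis
          by (simp only: ennreal_mult[symmetric] ennreal_plus[symmetric]) (simp add: algebra_simps add_divide_distrib)
      qed
      finally have "\<bar>\<integral>z. ?G z \<partial>lborel\<bar> \<le> h n * (B / (2 * \<eta>) * (?K * J + \<epsilon>) + B * \<eta> / 2 * C * (s2 - s1))"
        by (rule ennreal_le_iff[THEN iffD1, rotated])
           (use h[of n] B \<eta> s C J(2) \<epsilon> tube_const_pos[where 'a='a] in \<open>auto intro!: mult_nonneg_nonneg add_nonneg_nonneg\<close>)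
      then have "\<bar>\<integral>z. ?G z \<partial>lborel\<bar> / h n \<le> B / (2 * \<eta>) * (?K * J + \<epsilon>) + B * \<eta> / 2 * C * (s2 - s1)"
        using h[of n] by (simp add: pos_divide_le_eq mult.commute)
      then show ?thesis unfolding eq using h(1)[of n] by (simp add: abs_divide)
    qed
    have lim: "(\<lambda>n. \<bar>\<integral>z. indicator Q z * ((F (z + h n *\<^sub>R (v, 0)) - F z) / h n) \<partial>lborel\<bar>)
        \<longlonglongrightarrow> \<bar>\<integral>z. indicator Q z * frechet_derivative F (at z) (v, 0) \<partial>lborel\<bar>"
      by (intro tendsto_rabs difference_quotient_integral(2)[OF F bS supp _ h(1) hl]) auto
    show ?thesis by (rule LIMSEQ_le_const2[OF lim]) (use bound in blast)
  qed
  let ?I = "\<bar>\<integral>z. indicator Q z * frechet_derivative F (at z) (v, 0) \<partial>lborel\<bar>"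
  \<comment> \<open>The slack \<epsilon> of the layer estimate is removed while \<eta> stays fixed;
    \<eta> remains a free parameter to be balanced against J.\<close>
  have lim: "((\<lambda>\<epsilon>. B / (2 * \<eta>) * (?K * J + \<epsilon>) + B * \<eta> / 2 * C * (s2 - s1)) \<longlongrightarrow> B / (2 * \<eta>) * (?K * J + 0) + B * \<eta> / 2 * C * (s2 - s1)) (at_right 0)"
    by (intro tendsto_intros)
  have "?I \<le> B / (2 * \<eta>) * (?K * J + 0) + B * \<eta> / 2 * C * (s2 - s1)"
  proof (rule tendsto_lowerbound[OF lim])
    show "\<forall>\<^sub>F \<epsilon> in at_right 0. ?I \<le> B / (2 * \<eta>) * (?K * J + \<epsilon>) + B * \<eta> / 2 * C * (s2 - s1)"
      by (rule eventually_at_rightI[of 0 1]) (rule main, simp_all)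
  qed simp
  also have "\<dots> = B * (?K * J / (2 * \<eta>) + \<eta> * C * (s2 - s1) / 2)" by (simp add: algebra_simps)
  finally show ?thesis unfolding Q_def .
qed

section \<open>Integration by parts for functions with zero lateral trace\<close>

text \<open>The spatial gradient over an arbitrary Euclidean space, assembled from the basis; for
  \<open>real ^ 'n\<close> it is \<open>cgrad_x\<close>.\<close>

definition gradx :: "('a::euclidean_space \<times> real \<Rightarrow> real) \<Rightarrow> 'a \<times> real \<Rightarrow> 'a" where
  "gradx F z = (\<Sum>v\<in>Basis. frechet_derivative F (at z) (v, 0) *\<^sub>R v)"

lemma gradx_inner_Basis: "v \<in> Basis \<Longrightarrow> gradx F z \<bullet> v = frechet_derivative F (at z) (v, 0)"
  by (simp add: gradx_def inner_sum_left inner_Basis if_distrib cong: if_cong)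

lemma gradx_mult:
  assumes "C_k (Suc 0) F" "C_k (Suc 0) G"
  shows "gradx (\<lambda>z. F z * G z) z = F z *\<^sub>R gradx G z + G z *\<^sub>R gradx F z"
proof -
  have "frechet_derivative (\<lambda>z. F z * G z) (at z) =
      (\<lambda>v. F z * frechet_derivative G (at z) v + frechet_derivative F (at z) v * G z)"
    by (rule frechet_derivative_at[symmetric])
       (rule has_derivative_mult[OF C_k_has_derivative[OF assms(1)] C_k_has_derivative[OF assms(2)]])
  then show ?thesis
    by (simp add: gradx_def scaleR_add_left sum.distrib scaleR_sum_right mult.commute)
qed

lemma continuous_gradx: "C_k (Suc 0) F \<Longrightarrow> continuous_on UNIV (gradx F)"
  unfolding gradx_def by (intro continuous_intros) simp

lemma borel_measurable_C_1:
  assumes "C_k (Suc 0) F" shows "F \<in> borel_measurable borel" "gradx F \<in> borel_measurable borel"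
  using C_k_SucD[OF assms] continuous_gradx[OF assms] by (auto intro: borel_measurable_continuous_onI)

lemma norm_fst_le_norm: "norm (fst z) \<le> norm z"
  using norm_fst_le[of "fst z" "snd z"] by simp

lemma norm_snd_le_norm: "norm (snd z) \<le> norm z"
  using norm_snd_le[of "snd z" "fst z"] by simp

lemma L2_tendsto_dominated:
  fixes \<phi> :: "nat \<Rightarrow> 'a \<Rightarrow> 'b::euclidean_space" and \<Phi> :: "nat \<Rightarrow> 'a \<Rightarrow> 'c::euclidean_space"
  assumes "L2_tendsto M \<phi> w" "\<And>k. (\<lambda>z. \<Phi> k z - W z) \<in> borel_measurable M"
    and le: "\<And>k x. x \<in> space M \<Longrightarrow> norm (\<Phi> k x - W x) \<le> c * norm (\<phi> k x - w x)"
  shows "L2_tendsto M \<Phi> W"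
proof -
  have *: "(\<lambda>z. \<phi> k z - w z) \<in> L2 M" for k using assms(1) by (auto simp: L2_tendsto_def)
  have L: "(\<lambda>z. \<Phi> k z - W z) \<in> L2 M" for k
    by (rule L2_dominated[OF *[of k] assms(2) le])
  have le2: "L2norm M (\<lambda>z. \<Phi> k z - W z) \<le> \<bar>c\<bar> * L2norm M (\<lambda>z. \<phi> k z - w z)" for k
  proof -
    have "L2norm M (\<lambda>z. \<Phi> k z - W z) \<le> L2norm M (\<lambda>z. c *\<^sub>R (\<phi> k z - w z))"
      unfolding L2norm_def
    proof (intro real_sqrt_le_mono integral_mono)
      fix x assume "x \<in> space M"
      then have "norm (\<Phi> k x - W x) \<le> \<bar>c\<bar> * norm (\<phi> k x - w x)"
        using le[of x k] by (meson abs_ge_self mult_right_mono norm_ge_zero order_trans)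
      then show "(norm (\<Phi> k x - W x))\<^sup>2 \<le> (norm (c *\<^sub>R (\<phi> k x - w x)))\<^sup>2"
        by (intro power_mono) auto
    qed (use L2_integrable[OF L] L2_integrable[OF L2_scaleR[OF *]] in auto)
    then show ?thesis by (simp only: L2norm_scaleR)
  qed
  have "(\<lambda>k. \<bar>c\<bar> * L2norm M (\<lambda>z. \<phi> k z - w z)) \<longlonglongrightarrow> 0"
    using assms(1) by (auto simp: L2_tendsto_def intro!: tendsto_mult_right_zero)
  then have "(\<lambda>k. L2norm M (\<lambda>z. \<Phi> k z - W z)) \<longlonglongrightarrow> 0"
    by (rule tendsto_sandwich[OF _ _ tendsto_const, rotated 2]) (auto intro!: always_eventually le2)
  with L show ?thesis unfolding L2_tendsto_def by simp
qed

section \<open>Integration by parts near one point of the closure\<close>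

lemma integrable_pair_mult:
  fixes f :: "'a::euclidean_space \<Rightarrow> real" and g :: "'b::euclidean_space \<Rightarrow> real"
  assumes f: "integrable lborel f" and g: "integrable lborel g"
  shows "integrable (lborel \<Otimes>\<^sub>M lborel) (\<lambda>(x, y). f x * g y)"
proof (rule lborel_pair.Fubini_integrable)
  note [measurable] = borel_measurable_integrable[OF f] borel_measurable_integrable[OF g]
  show "(\<lambda>(x, y). f x * g y) \<in> borel_measurable (lborel \<Otimes>\<^sub>M lborel)" by measurable
  have "integrable lborel (\<lambda>x. \<bar>f x\<bar> * (\<integral>y. \<bar>g y\<bar> \<partial>lborel))" using f by (intro integrable_mult_left integrable_abs)
  then show "integrable lborel (\<lambda>x. \<integral>y. norm (case (x, y) of (x, y) \<Rightarrow> f x * g y) \<partial>lborel)"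
    by (simp add: abs_mult)
  show "AE x in lborel. integrable lborel (\<lambda>y. case (x, y) of (x, y) \<Rightarrow> f x * g y)" using g by auto
qed

text \<open>The spatial gradient of \<open>bump\<close> in closed form, which shows that it depends
  on z - c only, is odd in it, and is continuous and bounded.\<close>

definition bump_grad :: "real \<Rightarrow> 'a::euclidean_space \<times> real \<Rightarrow> 'a \<times> real \<Rightarrow> 'a" where
  "bump_grad r c z = (- 2 * flat 2 (r\<^sup>2 - (norm (z - c))\<^sup>2)) *\<^sub>R fst (z - c)"

lemma frechet_derivative_bump_x: "frechet_derivative (bump r c) (at z) (y, 0) = bump_grad r c z \<bullet> y"
proof -
  have "(z - c) \<bullet> (y, 0) = fst (z - c) \<bullet> y" by (simp add: inner_prod_def)
  then show ?thesis unfolding frechet_derivative_bump bump_grad_def by simp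
qed

lemma bump_grad_bounded:
  assumes "0 < r" shows "norm (bump_grad r c z) \<le> 4 * r"
proof (cases "norm (z - c) < r")
  case True
  have "norm (bump_grad r c z) = 2 * flat 2 (r\<^sup>2 - (norm (z - c))\<^sup>2) * norm (fst (z - c))"
    using flat_nonneg[of 2] by (simp add: bump_grad_def abs_mult)
  also have "\<dots> \<le> 2 * fact 2 * r"
    using True norm_fst_le_norm[of "z - c"] flat_nonneg[of 2] flat_le[of 2] assms
    by (intro mult_mono) (auto simp del: fst_diff snd_diff fact_2)
  finally show ?thesis by (simp add: fact_numeral)
next
  case False
  then have "r\<^sup>2 \<le> (norm (z - c))\<^sup>2" using assms by (intro power_mono) auto
  then have "\<not> 0 < r\<^sup>2 - (norm (z - c))\<^sup>2" by simp
  then have "bump_grad r c z = 0" unfolding bump_grad_def flat_def by simp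
  then show ?thesis using assms by simp
qed

lemma continuous_bump_grad: "continuous_on S f \<Longrightarrow> continuous_on S (\<lambda>x. bump_grad r c (f x))"
  unfolding bump_grad_def by (intro continuous_intros continuous_flat)

text \<open>The claim is C 0 = 0 for the correlation C of (q, p) with (G, W), where W = \<theta> w
  and G is its spatial gradient. It suffices to average C against a bump whose support consists of
  inward shifts. For the smooth approximations the order of integration is then exchanged: for each
  fixed z the shifted bump is an admissible test function, so the weak divergence turns the p-term
  into a q-term; for each fixed \<zeta> the remaining z-integral is that of a gradient over Q, which
  is the boundary term and tends to 0 with J.\<close>

lemma local_integration_by_parts:
  fixes \<Omega> :: "'a::euclidean_space set" and q g :: "'a \<times> real \<Rightarrow> 'a" and p w :: "'a \<times> real \<Rightarrow> real"
    and \<psi> :: "nat \<Rightarrow> 'a \<times> real \<Rightarrow> real" and s1 s2 :: real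
  defines "Q \<equiv> \<Omega> \<times> {s1<..<s2}"
  assumes \<Omega>: "open \<Omega>" "bounded \<Omega>" and cone: "inner_cone \<Omega> p0 r c" "norm c \<le> 1" and s: "s1 < s2"
    and q: "q \<in> L2 lborel" "\<And>z. z \<notin> Q \<Longrightarrow> q z = 0" and p: "p \<in> L2 lborel" "\<And>z. z \<notin> Q \<Longrightarrow> p z = 0"
    and weak: "\<And>\<phi>. \<phi> \<in> test_functions Q \<Longrightarrow>
       (\<integral>z. frechet_derivative \<phi> (at z) (q z, 0) \<partial>lborel) = - (\<integral>z. \<phi> z * p z \<partial>lborel)"
    and \<psi>: "\<And>k. C_k (Suc 0) (\<psi> k)"
    and w: "L2_tendsto lborel (\<lambda>k z. indicator Q z * \<psi> k z) w" "w \<in> L2 lborel"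
    and g: "L2_tendsto lborel (\<lambda>k z. indicator Q z *\<^sub>R gradx (\<psi> k) z) g" "g \<in> L2 lborel"
    and J: "\<And>k. (\<integral>\<^sup>+x. (\<integral>\<^sup>+t. ennreal ((\<psi> k (x, t))\<^sup>2) * indicator {s1<..<s2} t \<partial>lborel) * indicator (frontier \<Omega>) x
               \<partial>hausdorff_measure (DIM('a) - 1)) \<le> ennreal (J k)" "\<And>k. 0 \<le> J k" "J \<longlonglongrightarrow> 0"
    and \<theta>: "C_k (Suc 0) \<theta>" "\<And>z. z \<notin> ball p0 (r/2) \<times> {t1..t2} \<Longrightarrow> \<theta> z = 0" and t: "s1 < t1" "t2 < s2"
  shows "(\<integral>z. q z \<bullet> (\<theta> z *\<^sub>R g z + w z *\<^sub>R gradx \<theta> z) \<partial>lborel) + (\<integral>z. p z * (\<theta> z * w z) \<partial>lborel) = 0"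
proof -
  have r: "0 < r" using cone(1) by (simp add: inner_cone_def)
  have Q: "open Q" "bounded Q" unfolding Q_def using \<Omega> by (auto intro: open_Times bounded_Times)
  have [measurable]: "Q \<in> sets borel" "\<Omega> \<in> sets borel" using Q \<Omega> by auto
  note m\<psi>[measurable] = borel_measurable_C_1[OF \<psi>] and m\<theta>[measurable] = borel_measurable_C_1[OF \<theta>(1)]
  note [measurable] = L2_measurable[OF q(1)] L2_measurable[OF p(1)] L2_measurable[OF w(2)] L2_measurable[OF g(2)]
  let ?S = "ball p0 (r/2) \<times> {t1..t2}"
  have bS: "bounded ?S" by (intro bounded_Times) auto
  have cl\<theta>: "continuous_on UNIV \<theta>" using C_k_SucD[OF \<theta>(1)] by simp
  obtain B1 where B1: "0 \<le> B1" "\<And>z. \<bar>\<theta> z\<bar> \<le> B1"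
  proof -
    from continuous_bounded_on[OF cl\<theta> bS] obtain B where B: "0 \<le> B" "\<And>z. z \<in> ?S \<Longrightarrow> norm (\<theta> z) \<le> B" by metis
    have "\<bar>\<theta> z\<bar> \<le> B" for z using B(1) B(2)[of z] \<theta>(2)[of z] by (cases "z \<in> ?S") (simp_all del: mem_Times_iff)
    then show ?thesis using that B(1) by blast
  qed
  obtain B2 where B2: "0 \<le> B2" "\<And>z. norm (gradx \<theta> z) \<le> B2"
  proof -
    from continuous_bounded_on[OF continuous_gradx[OF \<theta>(1)] bounded_closure[OF bS]] obtain B where
      B: "0 \<le> B" "\<And>z. z \<in> closure ?S \<Longrightarrow> norm (gradx \<theta> z) \<le> B" by metis
    have "norm (gradx \<theta> z) \<le> B" for z
    proof (cases "z \<in> closure ?S")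
      case False
      then have "gradx \<theta> z = 0" unfolding gradx_def using frechet_derivative_outside[of ?S \<theta> z] \<theta>(2) False by simp
      then show ?thesis using B(1) by simp
    qed (rule B(2))
    then show ?thesis using that B(1) by blast
  qed
  define G where "G z = \<theta> z *\<^sub>R g z + w z *\<^sub>R gradx \<theta> z" for z
  define W where "W z = \<theta> z * w z" for z
  define Gk where "Gk k z = \<theta> z *\<^sub>R (indicator Q z *\<^sub>R gradx (\<psi> k) z) + (indicator Q z * \<psi> k z) *\<^sub>R gradx \<theta> z" for k z
  define Wk where "Wk k z = \<theta> z * (indicator Q z * \<psi> k z)" for k z
  have [measurable]: "G \<in> borel_measurable borel" "W \<in> borel_measurable borel"
    "Gk k \<in> borel_measurable borel" "Wk k \<in> borel_measurable borel" for k
    unfolding G_def W_def Gk_def Wk_def by measurable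
  have W: "W \<in> L2 lborel" unfolding W_def by (rule L2_bounded_mult[OF w(2)]) (use B1 in auto)
  have Wl: "L2_tendsto lborel Wk W"
    unfolding Wk_def W_def by (rule L2_tendsto_bounded_scaleR[OF w(1), where h=\<theta>, simplified]) (use B1 in auto)
  have wg: "(\<lambda>z. w z *\<^sub>R gradx \<theta> z) \<in> L2 lborel"
    by (rule L2_dominated[OF w(2), where c=B2]) (use B2(2) in \<open>auto simp: mult.commute[of B2] intro!: mult_left_mono\<close>)
  have G: "G \<in> L2 lborel"
    unfolding G_def by (intro L2_add wg L2_bounded_scaleR[OF g(2), where c=B1]) (use B1 in auto)
  have Gl: "L2_tendsto lborel Gk G"
    unfolding Gk_def G_def
  proof (rule L2_tendsto_add)
    show "L2_tendsto lborel (\<lambda>k z. \<theta> z *\<^sub>R indicat_real Q z *\<^sub>R gradx (\<psi> k) z) (\<lambda>z. \<theta> z *\<^sub>R g z)"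
      by (rule L2_tendsto_bounded_scaleR[OF g(1)]) (use B1 in auto)
    show "L2_tendsto lborel (\<lambda>k z. (indicat_real Q z * \<psi> k z) *\<^sub>R gradx \<theta> z) (\<lambda>z. w z *\<^sub>R gradx \<theta> z)"
      by (rule L2_tendsto_dominated[OF w(1), where c=B2])
         (use B2(2) in \<open>auto simp: scaleR_diff_left[symmetric] mult.commute[of B2] intro!: mult_left_mono\<close>)
  qed
  have GkL: "Gk k \<in> L2 lborel" and WkL: "Wk k \<in> L2 lborel" for k
    using L2_tendsto_L2[OF Gl G] L2_tendsto_L2[OF Wl W] by auto
  define C where "C s = (\<integral>z. q (z + s) \<bullet> G z \<partial>lborel) + (\<integral>z. p (z + s) \<bullet> W z \<partial>lborel)" for s
  define Ck where "Ck k s = (\<integral>z. q (z + s) \<bullet> Gk k z \<partial>lborel) + (\<integral>z. p (z + s) \<bullet> Wk k z \<partial>lborel)" for k s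
  define L1 where "L1 = (\<integral>z. norm (q z) \<partial>lborel)"
  have iq: "integrable lborel q" and ip: "integrable lborel p"
  proof -
    have iQ: "(\<lambda>z. indicator Q z :: real) \<in> L2 lborel"
      by (rule L2_I, measurable, rule integrable_bounded_support[OF _ Q(2), where B=1]) (auto simp: indicator_def)
    have "integrable lborel (\<lambda>z. norm (q z))"
      by (rule Bochner_Integration.integrable_bound[OF L2_norm_prod_integrable[OF iQ q(1)]]) (use q(2) in \<open>auto simp: indicator_def\<close>)
    then show "integrable lborel q" by (simp add: integrable_norm_iff)
    have "integrable lborel (\<lambda>z. norm (p z))"
      by (rule Bochner_Integration.integrable_bound[OF L2_norm_prod_integrable[OF iQ p(1)]]) (use p(2) in \<open>auto simp: indicator_def\<close>)
    then show "integrable lborel p" using integrable_norm_iff[of p lborel] by simp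
  qed
  obtain Cm h1 where Cm: "0 \<le> Cm" "0 < h1" "\<And>h b. 0 < h \<Longrightarrow> h < h1 \<Longrightarrow> norm b \<le> 1 \<Longrightarrow>
       emeasure lborel (shift_layer \<Omega> h b \<inter> ball p0 (r/2)) \<le> ennreal (Cm * h)"
    using shift_layer_measure[OF cone] by auto
  \<comment> \<open>The bound for the boundary term is a sum of multiples of J/\<eta> and of \<eta>.
    With \<eta> about sqrt J both tend to 0; the summand 1/(k+1) keeps \<eta> positive when J k =
    0.\<close>
  define \<eta> where "\<eta> k = sqrt (J k) + 1 / real (Suc k)" for k
  have \<eta>: "0 < \<eta> k" for k using J(2)[of k] by (auto simp: \<eta>_def intro!: add_nonneg_pos)
  define E where "E k = B1 * (tube_const TYPE('a) * J k / (2 * \<eta> k) + \<eta> k * Cm * (s2 - s1) / 2)" for k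
  have El: "E \<longlonglongrightarrow> 0"
  proof -
    have sl: "(\<lambda>k. sqrt (J k)) \<longlonglongrightarrow> 0" using tendsto_real_sqrt[OF J(3)] by simp
    have \<eta>l: "\<eta> \<longlonglongrightarrow> 0" unfolding \<eta>_def using tendsto_add[OF sl LIMSEQ_inverse_real_of_nat] by (simp add: inverse_eq_divide)
    have JE: "(\<lambda>k. J k / \<eta> k) \<longlonglongrightarrow> 0"
    proof (rule tendsto_sandwich[OF _ _ tendsto_const sl])
      have "J k / \<eta> k \<le> sqrt (J k)" for k
      proof -
        have "J k = sqrt (J k) * sqrt (J k)" using J(2) by simp
        also have "\<dots> \<le> sqrt (J k) * \<eta> k" using J(2) by (intro mult_left_mono) (auto simp: \<eta>_def)
        finally show ?thesis using \<eta> by (simp add: pos_divide_le_eq)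
      qed
      then show "\<forall>\<^sub>F k in sequentially. J k / \<eta> k \<le> sqrt (J k)" by simp
      show "\<forall>\<^sub>F k in sequentially. 0 \<le> J k / \<eta> k" using J(2) \<eta> by (auto intro!: always_eventually divide_nonneg_pos)
    qed
    have "(\<lambda>k. B1 * (tube_const TYPE('a) / 2 * (J k / \<eta> k) + \<eta> k * Cm * (s2 - s1) / 2)) \<longlonglongrightarrow>
       B1 * (tube_const TYPE('a) / 2 * 0 + 0 * Cm * (s2 - s1) / 2)"
      by (intro tendsto_intros JE \<eta>l) auto
    then show ?thesis unfolding E_def by (simp add: mult.commute)
  qed
  have "C 0 = 0"
  proof (rule isCont_zero_of_bumps)
    show "isCont C 0" unfolding C_def
      by (intro continuous_add L2_inner_translation q p G W)
    fix \<epsilon> :: real assume \<epsilon>: "0 < \<epsilon>"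
    \<comment> \<open>The reach of the shifts has to respect the cone, the prescribed neighbourhood
      of 0, and the margins in time between the support of \<theta> and the ends of the
      interval.\<close>
    define m where "m = min (min r \<epsilon>) (min (t1 - s1) (s2 - t2))"
    have m: "0 < m" "m \<le> r" "m \<le> \<epsilon>" "m \<le> t1 - s1" "m \<le> s2 - t2" using r \<epsilon> t by (auto simp: m_def)
    define \<delta> where "\<delta> = m / (2 + r)"
    \<comment> \<open>With radius \<delta> r/2 around \<delta> c, every spatial shift in the support
      has the form \<delta> y with |y - c| <= r/2, inside the cone.\<close>
    define rr where "rr = \<delta> * r / 2"
    define s0 where "s0 = (\<delta> *\<^sub>R c, 0::real)"
    have "m = \<delta> * (2 + r)" using r by (simp add: \<delta>_def)
    then have m\<delta>: "m = 2 * \<delta> + \<delta> * r" by (simp add: algebra_simps)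
    have \<delta>0: "0 < \<delta>" using m(1) r by (simp add: \<delta>_def)
    have \<delta>r0: "0 < \<delta> * r" using \<delta>0 r by simp
    have \<delta>: "0 < \<delta>" "\<delta> < r" "0 < rr" "\<delta> + rr < \<epsilon>" "rr < t1 - s1" "rr < s2 - t2"
      using m m\<delta> \<delta>0 \<delta>r0 unfolding rr_def by linarith+
    have ns0: "norm s0 \<le> \<delta>" using cone(2) \<delta>0 by (simp add: s0_def mult_left_le)
    have sub\<epsilon>: "cball s0 rr \<subseteq> ball 0 \<epsilon>"
    proof
      fix y assume "y \<in> cball s0 rr"
      then show "y \<in> ball 0 \<epsilon>" using norm_triangle_sub[of y s0] ns0 \<delta> by (simp add: dist_norm norm_minus_commute)
    qed
    \<comment> \<open>The only place where the cone is used: the bump shifted to z + s0 is supported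
      in Q although z may be arbitrarily close to the frontier.\<close>
    have subQ: "cball (z + s0) rr \<subseteq> Q" if z: "z \<in> Q" "z \<in> ?S" for z
    proof
      fix \<zeta> assume "\<zeta> \<in> cball (z + s0) rr"
      then have n: "norm (\<zeta> - (z + s0)) \<le> rr" by (simp add: dist_norm norm_minus_commute)
      have nx: "norm (fst \<zeta> - fst z - \<delta> *\<^sub>R c) \<le> rr" and nt: "\<bar>snd \<zeta> - snd z\<bar> \<le> rr"
        using order_trans[OF norm_fst_le_norm n] order_trans[OF norm_snd_le_norm n]
        by (simp_all add: s0_def diff_diff_eq)
      define y where "y = c + (1/\<delta>) *\<^sub>R (fst \<zeta> - fst z - \<delta> *\<^sub>R c)"
      have "norm (y - c) \<le> (1/\<delta>) * rr" using nx \<delta>0 by (simp add: y_def divide_right_mono)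
      also have "\<dots> = r / 2" using \<delta>0 by (simp add: rr_def)
      also have "\<dots> < r" using r by simp
      finally have "dist c y < r" by (simp add: dist_norm norm_minus_commute)
      moreover have "fst z \<in> \<Omega>" "dist p0 (fst z) < r" using z r by (auto simp: Q_def)
      ultimately have "fst z + \<delta> *\<^sub>R y \<in> \<Omega>" using inner_coneD[OF cone(1)] \<delta> by blast
      moreover have "fst z + \<delta> *\<^sub>R y = fst \<zeta>" using \<delta>0 by (simp add: y_def algebra_simps)
      moreover have "snd \<zeta> \<in> {s1<..<s2}" using nt z(2) \<delta> by auto
      ultimately show "\<zeta> \<in> Q" by (auto simp: Q_def mem_Times_iff)
    qed
    define \<kappa> where "\<kappa> = bump rr s0"
    have \<kappa>i: "integrable lborel \<kappa>" unfolding \<kappa>_def by (rule bump_integrable[OF \<delta>(3)])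
    have \<kappa>01: "0 \<le> \<kappa> z" "\<kappa> z \<le> 1" for z unfolding \<kappa>_def by (rule bump_nonneg bump_le_1)+
    define \<kappa>1 where "\<kappa>1 = bump_grad rr s0"
    have c\<kappa>: "continuous_on UNIV \<kappa>" "continuous_on UNIV \<kappa>1"
      unfolding \<kappa>_def \<kappa>1_def by (intro continuous_bump continuous_bump_grad continuous_intros)+
    have [measurable]: "\<kappa> \<in> borel_measurable borel" "\<kappa>1 \<in> borel_measurable borel"
      using c\<kappa> by (auto intro: borel_measurable_continuous_onI)
    have \<kappa>1b: "norm (\<kappa>1 z) \<le> 4 * rr" for z unfolding \<kappa>1_def by (rule bump_grad_bounded[OF \<delta>(3)])
    have i\<kappa>C: "integrable lborel (\<lambda>s. \<kappa> s * C s)"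
      unfolding C_def distrib_left
      by (intro Bochner_Integration.integrable_add correlation_Fubini(1) q p G W \<kappa>i)
    have i\<kappa>Ck: "integrable lborel (\<lambda>s. \<kappa> s * Ck k s)" for k
      unfolding Ck_def distrib_left
      by (intro Bochner_Integration.integrable_add correlation_Fubini(1) q p GkL WkL \<kappa>i)
    \<comment> \<open>The approximation error of the correlations is uniform in the shift, because
      translations preserve the norms of q and p.\<close>
    have lim1: "(\<lambda>k. \<integral>s. \<kappa> s * Ck k s \<partial>lborel) \<longlonglongrightarrow> (\<integral>s. \<kappa> s * C s \<partial>lborel)"
    proof (rule LIM_zero_cancel, rule Lim_null_comparison)
      let ?d = "\<lambda>k. L2norm lborel q * L2norm lborel (\<lambda>z. Gk k z - G z) + L2norm lborel p * L2norm lborel (\<lambda>z. Wk k z - W z)"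
      have Cd: "\<bar>Ck k s - C s\<bar> \<le> ?d k" for k s
      proof -
        have GL: "(\<lambda>z. Gk k z - G z) \<in> L2 lborel" "(\<lambda>z. Wk k z - W z) \<in> L2 lborel"
          by (intro L2_diff GkL G WkL W)+
        have 1: "(\<integral>z. q (z + s) \<bullet> Gk k z \<partial>lborel) - (\<integral>z. q (z + s) \<bullet> G z \<partial>lborel) = (\<integral>z. q (z + s) \<bullet> (Gk k z - G z) \<partial>lborel)"
          using L2_inner_integrable[OF L2_shift[OF q(1), of s] GkL[of k]] L2_inner_integrable[OF L2_shift[OF q(1), of s] G]
          by (simp add: inner_diff_right)
        have 2: "(\<integral>z. p (z + s) \<bullet> Wk k z \<partial>lborel) - (\<integral>z. p (z + s) \<bullet> W z \<partial>lborel) = (\<integral>z. p (z + s) \<bullet> (Wk k z - W z) \<partial>lborel)"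
          using L2_inner_integrable[OF L2_shift[OF p(1), of s] WkL[of k]] L2_inner_integrable[OF L2_shift[OF p(1), of s] W]
          by (simp add: right_diff_distrib)
        have "Ck k s - C s = (\<integral>z. q (z + s) \<bullet> (Gk k z - G z) \<partial>lborel) + (\<integral>z. p (z + s) \<bullet> (Wk k z - W z) \<partial>lborel)"
          unfolding Ck_def C_def using 1 2 by linarith
        then show ?thesis
          using L2_Cauchy_Schwarz[OF L2_shift[OF q(1), of s] GL(1)] L2_Cauchy_Schwarz[OF L2_shift[OF p(1), of s] GL(2)]
          by (simp add: L2norm_shift[OF q(1)] L2norm_shift[OF p(1)])
      qed
      show "\<forall>\<^sub>F k in sequentially. norm ((\<integral>s. \<kappa> s * Ck k s \<partial>lborel) - (\<integral>s. \<kappa> s * C s \<partial>lborel)) \<le> (\<integral>s. \<kappa> s \<partial>lborel) * ?d k"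
      proof (rule always_eventually, rule allI)
        fix k
        have "(\<integral>s. \<kappa> s * Ck k s \<partial>lborel) - (\<integral>s. \<kappa> s * C s \<partial>lborel) = (\<integral>s. \<kappa> s * Ck k s - \<kappa> s * C s \<partial>lborel)"
          using i\<kappa>C i\<kappa>Ck by simp
        also have "norm \<dots> \<le> (\<integral>s. \<bar>\<kappa> s * Ck k s - \<kappa> s * C s\<bar> \<partial>lborel)" using integral_abs_bound by simp
        also have "\<dots> \<le> (\<integral>s. \<kappa> s * ?d k \<partial>lborel)"
        proof (rule integral_mono)
          show "integrable lborel (\<lambda>s. \<bar>\<kappa> s * Ck k s - \<kappa> s * C s\<bar>)" using i\<kappa>C i\<kappa>Ck by (intro integrable_abs Bochner_Integration.integrable_diff)
          show "integrable lborel (\<lambda>s. \<kappa> s * ?d k)" using \<kappa>i by (intro integrable_mult_left)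
          fix s
          show "\<bar>\<kappa> s * Ck k s - \<kappa> s * C s\<bar> \<le> \<kappa> s * ?d k"
            using Cd[of k s] \<kappa>01[of s] unfolding right_diff_distrib[symmetric] abs_mult by (simp add: mult_left_mono)
        qed
        finally show "norm ((\<integral>s. \<kappa> s * Ck k s \<partial>lborel) - (\<integral>s. \<kappa> s * C s \<partial>lborel)) \<le> (\<integral>s. \<kappa> s \<partial>lborel) * ?d k" by simp
      qed
      have "(\<lambda>k. (\<integral>s. \<kappa> s \<partial>lborel) * ?d k) \<longlonglongrightarrow> (\<integral>s. \<kappa> s \<partial>lborel) * (L2norm lborel q * 0 + L2norm lborel p * 0)"
        using Gl Wl by (intro tendsto_intros) (auto simp: L2_tendsto_def)
      then show "(\<lambda>k. (\<integral>s. \<kappa> s \<partial>lborel) * ?d k) \<longlonglongrightarrow> 0" by simp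
    qed
    have bound: "\<bar>\<integral>s. \<kappa> s * Ck k s \<partial>lborel\<bar> \<le> L1 * (real DIM('a) * E k)" for k
    proof -
      \<comment> \<open>On Q this is the spatial gradient in z of
        \<open>\<psi> k z * \<theta> z * \<kappa> (\<zeta> - z)\<close>; the minus sign comes from z
        entering \<kappa> negatively.\<close>
      define V where "V z \<zeta> = \<kappa> (\<zeta> - z) *\<^sub>R Gk k z - Wk k z *\<^sub>R \<kappa>1 (\<zeta> - z)" for z \<zeta>
      obtain BG where BG: "0 \<le> BG" "\<And>z. norm (Gk k z) \<le> BG * indicator Q z" "\<And>z. \<bar>Wk k z\<bar> \<le> BG * indicator Q z"
      proof -
        have "continuous_on UNIV (\<psi> k)" using C_k_SucD[OF \<psi>] by simp
        from continuous_bounded_on[OF this Q(2)] obtain b1 where b1: "0 \<le> b1" "\<And>z. z \<in> Q \<Longrightarrow> norm (\<psi> k z) \<le> b1" by metis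
        from continuous_bounded_on[OF continuous_gradx[OF \<psi>[of k]] Q(2)] obtain b2 where b2: "0 \<le> b2" "\<And>z. z \<in> Q \<Longrightarrow> norm (gradx (\<psi> k) z) \<le> b2" by metis
        have b: "0 \<le> B1 * b2" "0 \<le> b1 * B2" "0 \<le> B1 * b1" using B1 B2 b1 b2 by auto
        have "norm (Gk k z) \<le> (B1 * b2 + b1 * B2 + B1 * b1) * indicator Q z" for z
        proof (cases "z \<in> Q")
          case True
          have "norm (Gk k z) \<le> \<bar>\<theta> z\<bar> * norm (gradx (\<psi> k) z) + \<bar>\<psi> k z\<bar> * norm (gradx \<theta> z)"
            unfolding Gk_def using True by (intro order_trans[OF norm_triangle_ineq]) simp
          also have "\<dots> \<le> B1 * b2 + b1 * B2" using B1(1) B2(1) b1(1) b2(1) B1(2)[of z] B2(2)[of z] b1(2)[OF True] b2(2)[OF True]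
            by (intro add_mono mult_mono) (simp_all only: norm_ge_zero real_norm_def abs_ge_zero)
          finally show ?thesis using True b by simp
        qed (simp add: Gk_def)
        moreover have "\<bar>Wk k z\<bar> \<le> (B1 * b2 + b1 * B2 + B1 * b1) * indicator Q z" for z
        proof (cases "z \<in> Q")
          case True
          have "\<bar>Wk k z\<bar> \<le> B1 * b1" unfolding Wk_def using True B1(1) mult_mono[OF B1(2)[of z] b1(2)[OF True]] by (simp add: abs_mult)
          then show ?thesis using True b by simp
        qed (simp add: Wk_def)
        ultimately show ?thesis using that[of "B1 * b2 + b1 * B2 + B1 * b1"] b by simp
      qed
      have Vb: "norm (V z \<zeta>) \<le> BG * (1 + 4 * rr) * indicator Q z" for z \<zeta>
      proof -
        have "norm (V z \<zeta>) \<le> \<kappa> (\<zeta> - z) * norm (Gk k z) + \<bar>Wk k z\<bar> * norm (\<kappa>1 (\<zeta> - z))"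
          unfolding V_def using \<kappa>01 by (intro order_trans[OF norm_triangle_ineq4]) simp
        also have "\<dots> \<le> 1 * (BG * indicator Q z) + (BG * indicator Q z) * (4 * rr)"
          using \<kappa>01 \<kappa>1b BG by (intro add_mono mult_mono) auto
        finally show ?thesis by (simp add: algebra_simps)
      qed
      have Vm[measurable]: "(\<lambda>(z, \<zeta>). V z \<zeta>) \<in> borel_measurable (lborel \<Otimes>\<^sub>M lborel)"
        unfolding V_def by measurable
      have Vm1[measurable]: "V z \<in> borel_measurable borel" "(\<lambda>z. V z \<zeta>) \<in> borel_measurable borel" for z \<zeta>
        unfolding V_def by measurable
      have iqV: "integrable (lborel \<Otimes>\<^sub>M lborel) (\<lambda>(z, \<zeta>). q \<zeta> \<bullet> V z \<zeta>)"
      proof (rule Bochner_Integration.integrable_bound)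
        have "integrable lborel (\<lambda>z. BG * (1 + 4 * rr) * indicator Q z)"
          by (intro integrable_mult_right integrable_bounded_support[OF _ Q(2), where B=1]) (auto simp: indicator_def)
        then show "integrable (lborel \<Otimes>\<^sub>M lborel) (\<lambda>(z, \<zeta>). (BG * (1 + 4 * rr) * indicator Q z) * norm (q \<zeta>))"
          using iq by (intro integrable_pair_mult integrable_norm)
        show "AE x in lborel \<Otimes>\<^sub>M lborel. norm (case x of (z, \<zeta>) \<Rightarrow> q \<zeta> \<bullet> V z \<zeta>) \<le> norm (case x of (z, \<zeta>) \<Rightarrow> (BG * (1 + 4 * rr) * indicator Q z) * norm (q \<zeta>))"
        proof (rule AE_I2, clarify)
          fix z \<zeta>
          have "\<bar>q \<zeta> \<bullet> V z \<zeta>\<bar> \<le> norm (q \<zeta>) * norm (V z \<zeta>)" by (rule Cauchy_Schwarz_ineq2)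
          also have "\<dots> \<le> norm (q \<zeta>) * (BG * (1 + 4 * rr) * indicator Q z)" using Vb by (intro mult_left_mono) auto
          finally show "norm (q \<zeta> \<bullet> V z \<zeta>) \<le> norm ((BG * (1 + 4 * rr) * indicator Q z) * norm (q \<zeta>))"
            by (simp add: mult.commute)
        qed
      qed measurable
      have pw: "(\<integral>s. \<kappa> s * (q (z + s) \<bullet> Gk k z) \<partial>lborel) + (\<integral>s. \<kappa> s * (p (z + s) \<bullet> Wk k z) \<partial>lborel) = (\<integral>\<zeta>. q \<zeta> \<bullet> V z \<zeta> \<partial>lborel)" for z
      proof -
        have 1: "(\<integral>s. \<kappa> s * (q (z + s) \<bullet> Gk k z) \<partial>lborel) = (\<integral>\<zeta>. \<kappa> (\<zeta> - z) * (q \<zeta> \<bullet> Gk k z) \<partial>lborel)"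
          using lborel_integral_shift[of "\<lambda>\<zeta>. \<kappa> (\<zeta> - z) * (q \<zeta> \<bullet> Gk k z)" z] by (simp add: add.commute)
        have 2: "(\<integral>s. \<kappa> s * (p (z + s) \<bullet> Wk k z) \<partial>lborel) = (\<integral>\<zeta>. \<kappa> (\<zeta> - z) * p \<zeta> \<partial>lborel) * Wk k z"
        proof -
          have "(\<integral>s. \<kappa> s * (p (z + s) \<bullet> Wk k z) \<partial>lborel) = (\<integral>s. \<kappa> s * p (z + s) * Wk k z \<partial>lborel)" by (simp add: mult.assoc)
          also have "\<dots> = (\<integral>s. \<kappa> s * p (z + s) \<partial>lborel) * Wk k z" by simp
          also have "(\<integral>s. \<kappa> s * p (z + s) \<partial>lborel) = (\<integral>\<zeta>. \<kappa> (\<zeta> - z) * p \<zeta> \<partial>lborel)"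
            using lborel_integral_shift[of "\<lambda>\<zeta>. \<kappa> (\<zeta> - z) * p \<zeta>" z] by (simp add: add.commute)
          finally show ?thesis .
        qed
        have i1: "integrable lborel (\<lambda>\<zeta>. \<kappa> (\<zeta> - z) * (q \<zeta> \<bullet> Gk k z))"
        proof (rule Bochner_Integration.integrable_bound[OF integrable_mult_left[OF integrable_norm[OF iq], of "norm (Gk k z)"]])
          show "AE \<zeta> in lborel. norm (\<kappa> (\<zeta> - z) * (q \<zeta> \<bullet> Gk k z)) \<le> norm (norm (q \<zeta>) * norm (Gk k z))"
          proof (rule AE_I2)
            fix \<zeta>
            have "\<bar>\<kappa> (\<zeta> - z)\<bar> * \<bar>q \<zeta> \<bullet> Gk k z\<bar> \<le> 1 * (norm (q \<zeta>) * norm (Gk k z))"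
              using \<kappa>01 by (intro mult_mono Cauchy_Schwarz_ineq2) auto
            then show "norm (\<kappa> (\<zeta> - z) * (q \<zeta> \<bullet> Gk k z)) \<le> norm (norm (q \<zeta>) * norm (Gk k z))" by (simp add: abs_mult)
          qed
        qed measurable
        have i2: "integrable lborel (\<lambda>\<zeta>. \<kappa>1 (\<zeta> - z) \<bullet> q \<zeta>)"
        proof (rule Bochner_Integration.integrable_bound[OF integrable_mult_right[OF integrable_norm[OF iq], of "4 * rr"]])
          show "AE \<zeta> in lborel. norm (\<kappa>1 (\<zeta> - z) \<bullet> q \<zeta>) \<le> norm (4 * rr * norm (q \<zeta>))"
          proof (rule AE_I2)
            fix \<zeta>
            have "\<bar>\<kappa>1 (\<zeta> - z) \<bullet> q \<zeta>\<bar> \<le> norm (\<kappa>1 (\<zeta> - z)) * norm (q \<zeta>)" by (rule Cauchy_Schwarz_ineq2)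
            also have "\<dots> \<le> 4 * rr * norm (q \<zeta>)" using \<kappa>1b by (intro mult_right_mono) auto
            finally show "norm (\<kappa>1 (\<zeta> - z) \<bullet> q \<zeta>) \<le> norm (4 * rr * norm (q \<zeta>))" by simp
          qed
        qed measurable
        \<comment> \<open>The weak divergence is applied for fixed z. Where \<open>Wk k z\<close> is
          nonzero, z lies in Q and in the support of \<theta>, so the shifted bump is a test
          function by \<open>subQ\<close>; elsewhere both sides vanish.\<close>
        have 3: "(\<integral>\<zeta>. \<kappa> (\<zeta> - z) * p \<zeta> \<partial>lborel) * Wk k z = - (\<integral>\<zeta>. \<kappa>1 (\<zeta> - z) \<bullet> q \<zeta> \<partial>lborel) * Wk k z"
        proof (cases "Wk k z = 0")
          case False
          then have "z \<in> Q" "\<theta> z \<noteq> 0" by (auto simp: Wk_def indicator_def)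
          then have z: "z \<in> Q" "z \<in> ?S" using \<theta>(2) by blast+
          have "bump rr (z + s0) \<in> test_functions Q" by (rule bump_test_function[OF \<delta>(3) subQ[OF z]])
          from weak[OF this] have "(\<integral>\<zeta>. bump_grad rr (z + s0) \<zeta> \<bullet> q \<zeta> \<partial>lborel) = - (\<integral>\<zeta>. bump rr (z + s0) \<zeta> * p \<zeta> \<partial>lborel)"
            by (simp only: frechet_derivative_bump_x)
          moreover have "bump_grad rr (z + s0) \<zeta> = \<kappa>1 (\<zeta> - z)" "bump rr (z + s0) \<zeta> = \<kappa> (\<zeta> - z)" for \<zeta>
            by (simp_all add: \<kappa>1_def \<kappa>_def bump_grad_def bump_def algebra_simps)
          ultimately show ?thesis by simp
        qed simp
        have "(\<integral>\<zeta>. q \<zeta> \<bullet> V z \<zeta> \<partial>lborel) = (\<integral>\<zeta>. \<kappa> (\<zeta> - z) * (q \<zeta> \<bullet> Gk k z) - (\<kappa>1 (\<zeta> - z) \<bullet> q \<zeta>) * Wk k z \<partial>lborel)"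
          by (intro Bochner_Integration.integral_cong) (auto simp: V_def inner_diff_right inner_commute mult.commute)
        also have "\<dots> = (\<integral>\<zeta>. \<kappa> (\<zeta> - z) * (q \<zeta> \<bullet> Gk k z) \<partial>lborel) - (\<integral>\<zeta>. \<kappa>1 (\<zeta> - z) \<bullet> q \<zeta> \<partial>lborel) * Wk k z"
          using i1 i2 by simp
        finally show ?thesis using 1 2 3 by simp
      qed
      note cq = correlation_integrable[OF q(1) GkL[of k] \<kappa>i] and cp = correlation_integrable[OF p(1) WkL[of k] \<kappa>i]
      have "(\<integral>s. \<kappa> s * Ck k s \<partial>lborel) = (\<integral>s. \<kappa> s * (\<integral>z. q (z + s) \<bullet> Gk k z \<partial>lborel) \<partial>lborel) + (\<integral>s. \<kappa> s * (\<integral>z. p (z + s) \<bullet> Wk k z \<partial>lborel) \<partial>lborel)"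
        unfolding Ck_def distrib_left
        by (intro Bochner_Integration.integral_add correlation_Fubini(1) q p GkL WkL \<kappa>i)
      also have "\<dots> = (\<integral>z. (\<integral>s. \<kappa> s * (q (z + s) \<bullet> Gk k z) \<partial>lborel) \<partial>lborel) + (\<integral>z. (\<integral>s. \<kappa> s * (p (z + s) \<bullet> Wk k z) \<partial>lborel) \<partial>lborel)"
        using correlation_Fubini(2)[OF q(1) GkL[of k] \<kappa>i] correlation_Fubini(2)[OF p(1) WkL[of k] \<kappa>i] by simp
      also have "\<dots> = (\<integral>z. (\<integral>s. \<kappa> s * (q (z + s) \<bullet> Gk k z) \<partial>lborel) + (\<integral>s. \<kappa> s * (p (z + s) \<bullet> Wk k z) \<partial>lborel) \<partial>lborel)"
        using lborel_pair.integrable_snd[OF cq] lborel_pair.integrable_snd[OF cp] by simp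
      also have "\<dots> = (\<integral>z. (\<integral>\<zeta>. q \<zeta> \<bullet> V z \<zeta> \<partial>lborel) \<partial>lborel)" by (simp only: pw)
      \<comment> \<open>The exchange leaves q as a mere integrable weight, and all derivatives fall
        on smooth functions of z.\<close>
      also have "\<dots> = (\<integral>\<zeta>. (\<integral>z. q \<zeta> \<bullet> V z \<zeta> \<partial>lborel) \<partial>lborel)"
        using lborel_pair.Fubini_integral[OF iqV] by simp
      finally have eq: "(\<integral>s. \<kappa> s * Ck k s \<partial>lborel) = (\<integral>\<zeta>. (\<integral>z. q \<zeta> \<bullet> V z \<zeta> \<partial>lborel) \<partial>lborel)" .
      have iV: "integrable lborel (\<lambda>z. V z \<zeta>)" for \<zeta>
      proof (rule integrable_bounded_support[OF _ Q(2), where B="BG * (1 + 4 * rr)"])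
        fix z
        have "BG * (1 + 4 * rr) * indicator Q z \<le> BG * (1 + 4 * rr) * 1"
          using BG(1) \<delta>(3) by (intro mult_left_mono) (auto simp: indicator_def)
        with Vb[of z \<zeta>] show "norm (V z \<zeta>) \<le> BG * (1 + 4 * rr)" by simp
        show "V z \<zeta> = 0" if "z \<notin> Q" using Vb[of z \<zeta>] that by simp
      qed measurable
      \<comment> \<open>As a function of z, \<open>\<kappa> (\<zeta> - z)\<close> is again a bump,
        now centred at \<open>\<zeta> - s0\<close>. Since it is at most 1, the product F is bounded
        by \<open>B1 * \<bar>\<psi> k z\<bar>\<close> whatever \<zeta> is, so the bound
        \<open>E k\<close> does not depend on \<zeta>.\<close>
      have VB: "\<bar>(\<integral>z. V z \<zeta> \<partial>lborel) \<bullet> v\<bar> \<le> E k" if v: "v \<in> Basis" for v \<zeta>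
      proof -
        define F where "F z = (\<psi> k z * \<theta> z) * bump rr (\<zeta> - s0) z" for z
        have C1: "C_k (Suc 0) (bump rr (\<zeta> - s0))" using smooth_bump[of rr "\<zeta> - s0"] unfolding smooth_def by blast
        have F1: "C_k (Suc 0) F" unfolding F_def by (intro C_k_mult \<psi> \<theta>(1) C1)
        have Vg: "V z \<zeta> = indicator Q z *\<^sub>R gradx F z" for z
        proof -
          have "bump_grad rr (\<zeta> - s0) z = - \<kappa>1 (\<zeta> - z)" "bump rr (\<zeta> - s0) z = \<kappa> (\<zeta> - z)"
            by (simp_all add: \<kappa>1_def \<kappa>_def bump_grad_def bump_def norm_minus_commute algebra_simps)
          moreover have "gradx (bump rr (\<zeta> - s0)) z = bump_grad rr (\<zeta> - s0) z"
            unfolding gradx_def frechet_derivative_bump_x by (rule euclidean_representation)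
          ultimately show ?thesis
            unfolding F_def gradx_mult[OF C_k_mult[OF \<psi> \<theta>(1)] C1] gradx_mult[OF \<psi> \<theta>(1)] V_def Gk_def Wk_def
            by (simp add: indicator_def algebra_simps)
        qed
        have "(\<integral>z. V z \<zeta> \<partial>lborel) \<bullet> v = (\<integral>z. V z \<zeta> \<bullet> v \<partial>lborel)"
          by (rule integral_inner_left[symmetric]) (use iV in simp)
        also have "\<dots> = (\<integral>z. indicator Q z * frechet_derivative F (at z) (v, 0) \<partial>lborel)"
          unfolding Vg by (simp add: gradx_inner_Basis[OF v])
        also have "\<bar>\<dots>\<bar> \<le> E k" unfolding E_def Q_def
        proof (rule boundary_term[OF \<Omega>(1) v Cm(3) Cm(2,1) s _ F1 B1(1)])
          show "norm v \<le> 1" using v by simp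
          show "continuous_on UNIV (\<psi> k)" using C_k_SucD[OF \<psi>] by simp
          show "\<bar>F z\<bar> \<le> B1 * \<bar>\<psi> k z\<bar>" for z
          proof -
            have "\<bar>F z\<bar> = \<bar>\<theta> z\<bar> * \<bar>\<psi> k z\<bar> * bump rr (\<zeta> - s0) z" by (simp add: F_def abs_mult bump_nonneg mult_ac)
            also have "\<dots> \<le> (B1 * \<bar>\<psi> k z\<bar>) * 1" using B1 by (intro mult_mono bump_le_1) (auto intro: mult_right_mono bump_nonneg)
            finally show ?thesis by simp
          qed
          show "F z = 0" if "z \<notin> ball p0 (r/2) \<times> {s1<..<s2}" for z
          proof -
            have "z \<notin> ?S" using that t by (auto simp: mem_Times_iff)
            then show ?thesis unfolding F_def using \<theta>(2) by simp
          qed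
        qed (use J \<eta> in auto)
        finally show ?thesis .
      qed
      have VN: "norm (\<integral>z. V z \<zeta> \<partial>lborel) \<le> real DIM('a) * E k" for \<zeta>
      proof -
        have "norm (\<integral>z. V z \<zeta> \<partial>lborel) \<le> (\<Sum>v\<in>Basis. \<bar>(\<integral>z. V z \<zeta> \<partial>lborel) \<bullet> v\<bar>)" by (rule norm_le_l1)
        also have "\<dots> \<le> (\<Sum>v\<in>(Basis::'a set). E k)" by (intro sum_mono VB)
        finally show ?thesis by simp
      qed
      have "\<bar>\<integral>\<zeta>. (\<integral>z. q \<zeta> \<bullet> V z \<zeta> \<partial>lborel) \<partial>lborel\<bar> \<le> (\<integral>\<zeta>. \<bar>\<integral>z. q \<zeta> \<bullet> V z \<zeta> \<partial>lborel\<bar> \<partial>lborel)"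
        by (rule integral_abs_bound)
      also have "\<dots> \<le> (\<integral>\<zeta>. norm (q \<zeta>) * (real DIM('a) * E k) \<partial>lborel)"
      proof (rule integral_mono)
        show "integrable lborel (\<lambda>\<zeta>. \<bar>\<integral>z. q \<zeta> \<bullet> V z \<zeta> \<partial>lborel\<bar>)"
          using lborel_pair.integrable_snd[OF iqV] by (intro integrable_abs) simp
        show "integrable lborel (\<lambda>\<zeta>. norm (q \<zeta>) * (real DIM('a) * E k))"
          by (intro integrable_mult_left integrable_norm iq)
        fix \<zeta>
        have "(\<integral>z. q \<zeta> \<bullet> V z \<zeta> \<partial>lborel) = q \<zeta> \<bullet> (\<integral>z. V z \<zeta> \<partial>lborel)" by (rule integral_inner_right) (use iV in simp)
        also have "\<bar>\<dots>\<bar> \<le> norm (q \<zeta>) * norm (\<integral>z. V z \<zeta> \<partial>lborel)" by (rule Cauchy_Schwarz_ineq2)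
        also have "\<dots> \<le> norm (q \<zeta>) * (real DIM('a) * E k)" by (intro mult_left_mono VN) auto
        finally show "\<bar>\<integral>z. q \<zeta> \<bullet> V z \<zeta> \<partial>lborel\<bar> \<le> norm (q \<zeta>) * (real DIM('a) * E k)" .
      qed
      also have "\<dots> = L1 * (real DIM('a) * E k)" unfolding L1_def by simp
      finally show ?thesis unfolding eq .
    qed
    have lim2: "(\<lambda>k. \<integral>s. \<kappa> s * Ck k s \<partial>lborel) \<longlonglongrightarrow> 0"
    proof (rule Lim_null_comparison)
      show "\<forall>\<^sub>F k in sequentially. norm (\<integral>s. \<kappa> s * Ck k s \<partial>lborel) \<le> L1 * (real DIM('a) * E k)"
        using bound by simp
      have "(\<lambda>k. L1 * (real DIM('a) * E k)) \<longlonglongrightarrow> L1 * (real DIM('a) * 0)" by (intro tendsto_intros El)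
      then show "(\<lambda>k. L1 * (real DIM('a) * E k)) \<longlonglongrightarrow> 0" by simp
    qed
    have "(\<integral>s. \<kappa> s * C s \<partial>lborel) = 0" by (rule LIMSEQ_unique[OF lim1 lim2])
    then show "\<exists>s0 r. 0 < r \<and> cball s0 r \<subseteq> ball 0 \<epsilon> \<and> integrable lborel (\<lambda>s. bump r s0 s * C s) \<and> (\<integral>s. bump r s0 s * C s \<partial>lborel) = 0"
      using sub\<epsilon> \<delta>(3) i\<kappa>C unfolding \<kappa>_def by blast
  qed
  then show ?thesis by (simp add: C_def G_def W_def)
qed

section \<open>From local to global: a partition of unity in space and cutoffs in time\<close>

lemma C_k_compose_linear:
  assumes L: "bounded_linear L" shows "C_k k f \<Longrightarrow> C_k k (\<lambda>z. f (L z))"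
proof (induction k arbitrary: f)
  case 0
  then show ?case
    by (auto intro: continuous_on_compose2 linear_continuous_on[OF L])
next
  case (Suc k)
  show ?case
  proof (rule C_k_SucI)
    fix z
    show "((\<lambda>z. f (L z)) has_derivative (\<lambda>v. frechet_derivative f (at (L z)) (L v))) (at z)"
      by (rule has_derivative_compose[OF bounded_linear_imp_has_derivative[OF L] C_k_has_derivative[OF Suc.prems]])
    show "C_k k (\<lambda>z. frechet_derivative f (at (L z)) (L v))" for v
      by (rule Suc.IH) (use Suc.prems in auto)
  qed
qed

lemma frechet_derivative_compose_linear:
  assumes L: "bounded_linear L" and f: "C_k (Suc 0) f"
  shows "frechet_derivative (\<lambda>z. f (L z)) (at z) v = frechet_derivative f (at (L z)) (L v)"
  using frechet_derivative_at[OF has_derivative_compose[OF bounded_linear_imp_has_derivative[OF L] C_k_has_derivative[OF f]], of z]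
  by (simp add: fun_eq_iff)

lemma gradx_add:
  assumes "C_k (Suc 0) F" "C_k (Suc 0) G"
  shows "gradx (\<lambda>z. F z + G z) z = gradx F z + gradx G z"
proof -
  have "frechet_derivative (\<lambda>z. F z + G z) (at z) = (\<lambda>v. frechet_derivative F (at z) v + frechet_derivative G (at z) v)"
    by (rule frechet_derivative_at[symmetric])
       (rule has_derivative_add[OF C_k_has_derivative[OF assms(1)] C_k_has_derivative[OF assms(2)]])
  then show ?thesis by (simp add: gradx_def scaleR_add_left sum.distrib)
qed

text \<open>The local identity is additive in the cutoff \<theta>. Finitely many balls with cones
  cover the compact closure, so spatial cutoffs adding up to 1 on Q reduce the claim to
  \<open>local_integration_by_parts\<close>. The time cutoffs are removed by dominated convergence,
  since they carry no spatial derivative.\<close>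

lemma integration_by_parts_cylinder:
  fixes \<Omega> :: "'a::euclidean_space set" and q g :: "'a \<times> real \<Rightarrow> 'a" and p w :: "'a \<times> real \<Rightarrow> real"
    and \<psi> :: "nat \<Rightarrow> 'a \<times> real \<Rightarrow> real" and s1 s2 :: real
  defines "Q \<equiv> \<Omega> \<times> {s1<..<s2}"
  assumes Lip: "bounded_Lipschitz_domain \<Omega>" and s: "s1 < s2"
    and q: "q \<in> L2 lborel" "\<And>z. z \<notin> Q \<Longrightarrow> q z = 0" and p: "p \<in> L2 lborel" "\<And>z. z \<notin> Q \<Longrightarrow> p z = 0"
    and weak: "\<And>\<phi>. \<phi> \<in> test_functions Q \<Longrightarrow>
       (\<integral>z. frechet_derivative \<phi> (at z) (q z, 0) \<partial>lborel) = - (\<integral>z. \<phi> z * p z \<partial>lborel)"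
    and \<psi>: "\<And>k. C_k (Suc 0) (\<psi> k)"
    and w: "L2_tendsto lborel (\<lambda>k z. indicator Q z * \<psi> k z) w" "w \<in> L2 lborel"
    and g: "L2_tendsto lborel (\<lambda>k z. indicator Q z *\<^sub>R gradx (\<psi> k) z) g" "g \<in> L2 lborel"
    and J: "\<And>k. (\<integral>\<^sup>+x. (\<integral>\<^sup>+t. ennreal ((\<psi> k (x, t))\<^sup>2) * indicator {s1<..<s2} t \<partial>lborel) * indicator (frontier \<Omega>) x
               \<partial>hausdorff_measure (DIM('a) - 1)) \<le> ennreal (J k)" "\<And>k. 0 \<le> J k" "J \<longlonglongrightarrow> 0"
  shows "(\<integral>z. q z \<bullet> g z \<partial>lborel) + (\<integral>z. p z * w z \<partial>lborel) = 0"
proof -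
  have \<Omega>: "open \<Omega>" "bounded \<Omega>" using Lip by (auto simp: bounded_Lipschitz_domain_def)
  have Q: "open Q" "bounded Q" unfolding Q_def using \<Omega> by (auto intro: open_Times bounded_Times)
  have [measurable]: "Q \<in> sets borel" using Q by auto
  \<comment> \<open>The left side of the identity with w replaced by \<theta> w and g by the product
    rule for its gradient; it is additive in \<theta>.\<close>
  define L where "L \<theta> = (\<integral>z. q z \<bullet> (\<theta> z *\<^sub>R g z + w z *\<^sub>R gradx \<theta> z) \<partial>lborel) + (\<integral>z. p z * (\<theta> z * w z) \<partial>lborel)" for \<theta>
  have int: "integrable lborel (\<lambda>z. q z \<bullet> (\<theta> z *\<^sub>R g z + w z *\<^sub>R gradx \<theta> z))"
    "integrable lborel (\<lambda>z. p z * (\<theta> z * w z))" if \<theta>: "C_k (Suc 0) \<theta>" for \<theta>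
  proof -
    note [measurable] = borel_measurable_C_1[OF \<theta>]
    have "continuous_on UNIV \<theta>" using C_k_SucD[OF \<theta>] by simp
    from continuous_bounded_on[OF this Q(2)] obtain B1 where B1: "0 \<le> B1" "\<And>z. z \<in> Q \<Longrightarrow> norm (\<theta> z) \<le> B1" by metis
    from continuous_bounded_on[OF continuous_gradx[OF \<theta>] Q(2)] obtain B2 where B2: "0 \<le> B2" "\<And>z. z \<in> Q \<Longrightarrow> norm (gradx \<theta> z) \<le> B2" by metis
    have b1: "\<bar>indicator Q z * \<theta> z\<bar> \<le> B1" for z using B1 by (auto simp: indicator_def)
    have m: "(\<lambda>z. indicator Q z * \<theta> z) \<in> borel_measurable lborel" by measurable
    have 1: "(\<lambda>z. (indicator Q z * \<theta> z) *\<^sub>R g z) \<in> L2 lborel" by (rule L2_bounded_scaleR[OF g(2) m b1])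
    have 2: "(\<lambda>z. (indicator Q z * \<theta> z) * w z) \<in> L2 lborel" by (rule L2_bounded_mult[OF w(2) m b1])
    have 3: "(\<lambda>z. indicator Q z *\<^sub>R (w z *\<^sub>R gradx \<theta> z)) \<in> L2 lborel"
    proof (rule L2_dominated[OF w(2), where c=B2])
      note [measurable] = L2_measurable[OF w(2)]
      show "(\<lambda>z. indicator Q z *\<^sub>R (w z *\<^sub>R gradx \<theta> z)) \<in> borel_measurable lborel" by measurable
      fix z
      show "norm (indicator Q z *\<^sub>R (w z *\<^sub>R gradx \<theta> z)) \<le> B2 * norm (w z)"
        using B2(1) mult_left_mono[OF B2(2)[of z], of "\<bar>w z\<bar>"] by (cases "z \<in> Q") (simp_all add: mult.commute)
    qed
    have "integrable lborel (\<lambda>z. q z \<bullet> ((indicator Q z * \<theta> z) *\<^sub>R g z + indicator Q z *\<^sub>R (w z *\<^sub>R gradx \<theta> z)))"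
      by (rule L2_inner_integrable[OF q(1) L2_add[OF 1 3]])
    moreover have "q z \<bullet> ((indicator Q z * \<theta> z) *\<^sub>R g z + indicator Q z *\<^sub>R (w z *\<^sub>R gradx \<theta> z)) = q z \<bullet> (\<theta> z *\<^sub>R g z + w z *\<^sub>R gradx \<theta> z)" for z
      using q(2)[of z] by (cases "z \<in> Q") simp_all
    ultimately show "integrable lborel (\<lambda>z. q z \<bullet> (\<theta> z *\<^sub>R g z + w z *\<^sub>R gradx \<theta> z))" by simp
    have "integrable lborel (\<lambda>z. p z * ((indicator Q z * \<theta> z) * w z))" by (rule L2_mult_integrable[OF p(1) 2])
    moreover have "p z * ((indicator Q z * \<theta> z) * w z) = p z * (\<theta> z * w z)" for z
      using p(2)[of z] by (cases "z \<in> Q") simp_all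
    ultimately show "integrable lborel (\<lambda>z. p z * (\<theta> z * w z))" by simp
  qed
  have Ladd: "L (\<lambda>z. F z + G z) = L F + L G" if F: "C_k (Suc 0) F" and G: "C_k (Suc 0) G" for F G
  proof -
    have "(\<integral>z. q z \<bullet> ((F z + G z) *\<^sub>R g z + w z *\<^sub>R gradx (\<lambda>z. F z + G z) z) \<partial>lborel)
      = (\<integral>z. q z \<bullet> (F z *\<^sub>R g z + w z *\<^sub>R gradx F z) + q z \<bullet> (G z *\<^sub>R g z + w z *\<^sub>R gradx G z) \<partial>lborel)"
      unfolding gradx_add[OF F G] by (intro Bochner_Integration.integral_cong) (auto simp: algebra_simps inner_add_right)
    moreover have "(\<integral>z. p z * ((F z + G z) * w z) \<partial>lborel) = (\<integral>z. p z * (F z * w z) + p z * (G z * w z) \<partial>lborel)"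
      by (intro Bochner_Integration.integral_cong) (auto simp: algebra_simps)
    ultimately show ?thesis unfolding L_def using int[OF F] int[OF G] by simp
  qed
  have "\<forall>x\<in>closure \<Omega>. \<exists>rc. inner_cone \<Omega> x (fst rc) (snd rc) \<and> norm (snd rc) \<le> 1"
    using Lipschitz_domain_inner_cone[OF Lip] by fastforce
  then obtain rc where rc: "\<And>x. x \<in> closure \<Omega> \<Longrightarrow> inner_cone \<Omega> x (fst (rc x)) (snd (rc x)) \<and> norm (snd (rc x)) \<le> 1"
    by metis
  define r where "r x = fst (rc x)" for x
  have r: "0 < r x" if "x \<in> closure \<Omega>" for x using rc[OF that] by (simp add: r_def inner_cone_def)
  have cpt: "compact (closure \<Omega>)" using \<Omega> by simp
  obtain D where D: "D \<subseteq> closure \<Omega>" "finite D" "closure \<Omega> \<subseteq> (\<Union>x\<in>D. ball x (r x / 4))"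
    by (rule compactE_image[OF cpt, of "closure \<Omega>" "\<lambda>x. ball x (r x / 4)"]) (use r in force)+
  \<comment> \<open>The coefficients make the argument of \<open>cutoff\<close> equal to 1 at
    distance r/4 and to 0 at distance r/2.\<close>
  define \<beta> where "\<beta> x z = cutoff (4/3 + (- 16 / (3 * (r x)\<^sup>2)) * (norm (fst z - x))\<^sup>2)" for x and z :: "'a \<times> real"
  have \<beta>1: "C_k (Suc 0) (\<beta> x)" for x
    unfolding \<beta>_def by (intro C_1_cutoff C_k_compose_linear[OF bounded_linear_fst, where f="\<lambda>y. 4/3 + (- 16 / (3 * (r x)\<^sup>2)) * (norm (y - x))\<^sup>2"] C_k_quadratic)
  have \<beta>in: "\<beta> x z = 1" if "x \<in> D" "fst z \<in> ball x (r x / 4)" for x z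
  proof -
    have rx: "r x > 0" using r D that by auto
    have "(norm (fst z - x))\<^sup>2 \<le> (r x / 4)\<^sup>2" using that by (intro power_mono) (auto simp: dist_norm norm_minus_commute)
    then have "16 / (3 * (r x)\<^sup>2) * (norm (fst z - x))\<^sup>2 \<le> 16 / (3 * (r x)\<^sup>2) * (r x / 4)\<^sup>2"
      using rx by (intro mult_left_mono) auto
    also have "\<dots> = 1/3" using rx by (simp add: power2_eq_square)
    finally show ?thesis unfolding \<beta>_def by (intro cutoff_1) simp
  qed
  have \<beta>out: "\<beta> x z = 0" if "x \<in> D" "fst z \<notin> ball x (r x / 2)" for x z
  proof -
    have rx: "r x > 0" using r D that by auto
    have "(r x / 2)\<^sup>2 \<le> (norm (fst z - x))\<^sup>2" using that rx by (intro power_mono) (auto simp: dist_norm norm_minus_commute)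
    then have "16 / (3 * (r x)\<^sup>2) * (r x / 2)\<^sup>2 \<le> 16 / (3 * (r x)\<^sup>2) * (norm (fst z - x))\<^sup>2"
      using rx by (intro mult_left_mono) auto
    moreover have "16 / (3 * (r x)\<^sup>2) * (r x / 2)\<^sup>2 = 4/3" using rx by (simp add: power2_eq_square)
    ultimately show ?thesis unfolding \<beta>_def by (intro cutoff_0) simp
  qed
  \<comment> \<open>Within 1/(N (s2 - s1)) of either end the product (t - s1)(s2 - t) is at most
    1/N, so the cutoff vanishes there; at a fixed interior time it equals 1 as soon as N times the
    product reaches 2.\<close>
  define \<eta> where "\<eta> N z = cutoff (real N * ((snd z - s1) * (s2 - snd z)) - 1)" for N :: nat and z :: "'a \<times> real"
  define \<eta>' where "\<eta>' N t = cutoff (real N * ((t - s1) * (s2 - t)) - 1)" for N :: nat and t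
  have \<eta>'1: "C_k (Suc 0) (\<eta>' N)" for N
    unfolding \<eta>'_def
    by (intro C_1_cutoff C_k_diff C_k_mult C_k_const) (use C_k_inner[of _ "1::real"] in simp_all)
  have \<eta>_eq: "\<eta> N = (\<lambda>z. \<eta>' N (snd z))" for N by (auto simp: \<eta>_def \<eta>'_def)
  have \<eta>1: "C_k (Suc 0) (\<eta> N)" for N
    unfolding \<eta>_eq by (rule C_k_compose_linear[OF bounded_linear_snd \<eta>'1])
  have \<eta>grad: "frechet_derivative (\<eta> N) (at z) (v, 0) = 0" for N z v
    unfolding \<eta>_eq frechet_derivative_compose_linear[OF bounded_linear_snd \<eta>'1]
    using has_derivative_linear[OF C_k_has_derivative[OF \<eta>'1]] by (simp add: linear_0)
  have \<eta>out: "\<eta> N z = 0" if "N \<ge> 1" "snd z \<notin> {s1 + 1 / (N * (s2 - s1))..s2 - 1 / (N * (s2 - s1))}" for N z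
  proof -
    let ?a = "snd z - s1" and ?b = "s2 - snd z" and ?l = "s2 - s1"
    have l: "?l > 0" "real N > 0" using s that by auto
    have ab: "?a < 1 / (N * ?l) \<or> ?b < 1 / (N * ?l)" using that(2) by auto
    have "real N * (?a * ?b) \<le> 1"
    proof (rule ccontr)
      assume "\<not> real N * (?a * ?b) \<le> 1"
      then have pos: "1 < real N * (?a * ?b)" by simp
      then have "0 < real N * (?a * ?b)" by linarith
      then have "0 < ?a * ?b" using l(2) by (simp add: zero_less_mult_iff)
      then have "0 < ?a \<and> 0 < ?b" using s by (smt (verit) mult_neg_pos mult_pos_neg zero_less_mult_iff)
      then have pp: "0 < ?a" "0 < ?b" "?a \<le> ?l" "?b \<le> ?l" by auto
      have "?a * ?b \<le> ?l * (1 / (N * ?l))"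
      proof (cases "?a < 1 / (N * ?l)")
        case True
        then have "?a * ?b \<le> 1 / (N * ?l) * ?l" using pp l by (intro mult_mono) auto
        then show ?thesis by (simp add: mult.commute)
      next
        case False
        then have "?b < 1 / (N * ?l)" using ab by simp
        then show ?thesis using pp l by (intro mult_mono) auto
      qed
      also have "\<dots> = 1 / N" using l by simp
      finally have "real N * (?a * ?b) \<le> real N * (1 / N)" using l by (intro mult_left_mono) auto
      then show False using pos l by simp
    qed
    then show ?thesis unfolding \<eta>_def by (intro cutoff_0) simp
  qed
  \<comment> \<open>Adding x to S changes 1 - \<rho> by the term
    \<open>\<beta> x z * \<rho> S z\<close>, which is supported near x. This telescopes the
    partition of unity, and \<rho> D vanishes on Q because one of its factors does.\<close>
  define \<rho> where "\<rho> S z = (\<Prod>x\<in>S. 1 - \<beta> x z)" for S z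
  have \<rho>1: "C_k (Suc 0) (\<rho> S)" if "finite S" for S
    using that
  proof induction
    case empty
    then show ?case unfolding \<rho>_def by (simp only: prod.empty C_k_const)
  next
    case (insert x S)
    have "\<rho> (insert x S) = (\<lambda>z. (1 - \<beta> x z) * \<rho> S z)" using insert by (auto simp: \<rho>_def)
    then show ?case using insert by (simp only:) (intro C_k_mult C_k_diff C_k_const \<beta>1)
  qed
  have zero: "L (\<lambda>z. \<eta> N z * (1 - \<rho> S z)) = 0" if S: "finite S" "S \<subseteq> D" and N: "N \<ge> 1" for S N
    using S
  proof induction
    case empty
    have "frechet_derivative (\<lambda>z::'a \<times> real. 0::real) (at z) = (\<lambda>v. 0)" for z
      by (rule frechet_derivative_at[symmetric]) simp
    then have "gradx (\<lambda>z::'a \<times> real. 0) z = 0" for z by (simp add: gradx_def)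
    then show ?case by (simp add: \<rho>_def L_def)
  next
    case (insert x S)
    then have x: "x \<in> D" "x \<in> closure \<Omega>" using D by auto
    let ?G = "\<lambda>z. \<eta> N z * (\<beta> x z * \<rho> S z)"
    have G1: "C_k (Suc 0) ?G" by (intro C_k_mult \<eta>1 \<beta>1 \<rho>1 insert)
    have F1: "C_k (Suc 0) (\<lambda>z. \<eta> N z * (1 - \<rho> S z))" by (intro C_k_mult C_k_diff C_k_const \<eta>1 \<rho>1 insert)
    have eq: "(\<lambda>z. \<eta> N z * (1 - \<rho> (insert x S) z)) = (\<lambda>z. \<eta> N z * (1 - \<rho> S z) + ?G z)"
      using insert by (auto simp: \<rho>_def algebra_simps)
    have pos: "0 < 1 / (N * (s2 - s1))" using N s by simp
    have "L ?G = 0" unfolding L_def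
    proof (rule local_integration_by_parts[where \<Omega>=\<Omega> and ?s1.0=s1 and ?s2.0=s2 and ?p0.0=x and r="r x" and c="snd (rc x)" and
        ?t1.0="s1 + 1 / (N * (s2 - s1))" and ?t2.0="s2 - 1 / (N * (s2 - s1))",
        OF \<Omega> _ _ s q[unfolded Q_def] p[unfolded Q_def] weak[unfolded Q_def] \<psi> w[unfolded Q_def] g[unfolded Q_def] J G1])
      show "inner_cone \<Omega> x (r x) (snd (rc x))" "norm (snd (rc x)) \<le> 1" using rc[OF x(2)] by (auto simp: r_def)
      show "?G z = 0" if "z \<notin> ball x (r x / 2) \<times> {s1 + 1 / (N * (s2 - s1))..s2 - 1 / (N * (s2 - s1))}" for z
      proof -
        have "fst z \<notin> ball x (r x / 2) \<or> snd z \<notin> {s1 + 1 / (N * (s2 - s1))..s2 - 1 / (N * (s2 - s1))}"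
          using that by (metis mem_Times_iff)
        then show ?thesis using \<beta>out[OF x(1), of z] \<eta>out[OF N, of z] by auto
      qed
    qed (use pos in auto)
    moreover have "L (\<lambda>z. \<eta> N z * (1 - \<rho> S z)) = 0" using insert by auto
    ultimately show ?case unfolding eq Ladd[OF F1 G1] by simp
  qed
  have eqN: "(\<integral>z. \<eta> N z * (q z \<bullet> g z + p z * w z) \<partial>lborel) = 0" if N: "N \<ge> 1" for N
  proof -
    let ?F = "\<lambda>z. \<eta> N z * (1 - \<rho> D z)"
    have F1: "C_k (Suc 0) ?F" by (intro C_k_mult C_k_diff C_k_const \<eta>1 \<rho>1 D)
    have FQ: "?F z = \<eta> N z" if "z \<in> Q" for z
    proof -
      have "fst z \<in> \<Omega>" using that by (auto simp: Q_def)
      then have "fst z \<in> closure \<Omega>" by (rule closure_subset[THEN subsetD])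
      then obtain x where x: "x \<in> D" "fst z \<in> ball x (r x / 4)" using D(3) by blast
      then have "\<rho> D z = 0" unfolding \<rho>_def using \<beta>in[OF x] D(2) x(1) by (intro prod_zero) auto
      then show ?thesis by simp
    qed
    \<comment> \<open>On the open set Q the cutoff coincides with \<eta> N, a function of time
      alone, so its spatial gradient is 0.\<close>
    have gQ: "gradx ?F z = 0" if "z \<in> Q" for z
    proof -
      have "(?F has_derivative frechet_derivative (\<eta> N) (at z)) (at z)"
        by (rule has_derivative_transform_within_open[OF C_k_has_derivative[OF \<eta>1] Q(1) that]) (use FQ in auto)
      then have "frechet_derivative ?F (at z) = frechet_derivative (\<eta> N) (at z)"
        by (rule frechet_derivative_at[symmetric])
      then show ?thesis by (simp add: gradx_def \<eta>grad)
    qed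
    have "0 = L ?F" using zero[OF D(2) _ N] by simp
    also have "\<dots> = (\<integral>z. q z \<bullet> (?F z *\<^sub>R g z + w z *\<^sub>R gradx ?F z) + p z * (?F z * w z) \<partial>lborel)"
      unfolding L_def using int[OF F1] by simp
    also have "\<dots> = (\<integral>z. \<eta> N z * (q z \<bullet> g z + p z * w z) \<partial>lborel)"
    proof (rule Bochner_Integration.integral_cong)
      fix z
      show "q z \<bullet> (?F z *\<^sub>R g z + w z *\<^sub>R gradx ?F z) + p z * (?F z * w z) = \<eta> N z * (q z \<bullet> g z + p z * w z)"
      proof (cases "z \<in> Q")
        case True
        show ?thesis unfolding FQ[OF True] gQ[OF True] by (simp add: algebra_simps)
      next
        case False
        then show ?thesis using q(2) p(2) by simp
      qed
    qed simp
    finally show ?thesis by simp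
  qed
  have igw: "integrable lborel (\<lambda>z. q z \<bullet> g z + p z * w z)"
    using L2_inner_integrable[OF q(1) g(2)] L2_mult_integrable[OF p(1) w(2)] by simp
  have "(\<lambda>N. \<integral>z. \<eta> (Suc N) z * (q z \<bullet> g z + p z * w z) \<partial>lborel) \<longlonglongrightarrow> (\<integral>z. q z \<bullet> g z + p z * w z \<partial>lborel)"
  proof (rule integral_dominated_convergence[where w="\<lambda>z. norm (q z \<bullet> g z + p z * w z)"])
    show "AE z in lborel. (\<lambda>N. \<eta> (Suc N) z * (q z \<bullet> g z + p z * w z)) \<longlonglongrightarrow> q z \<bullet> g z + p z * w z"
    proof (rule AE_I2)
      fix z
      show "(\<lambda>N. \<eta> (Suc N) z * (q z \<bullet> g z + p z * w z)) \<longlonglongrightarrow> q z \<bullet> g z + p z * w z"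
      proof (cases "z \<in> Q")
        case True
        define a where "a = (snd z - s1) * (s2 - snd z)"
        have a: "a > 0" using True by (auto simp: a_def Q_def)
        obtain N0 where N0: "2 / a < real N0" using reals_Archimedean2 by blast
        have "\<eta> (Suc N) z = 1" if "N \<ge> N0" for N
        proof -
          have "2 = 2 / a * a" using a by simp
          also have "\<dots> \<le> real (Suc N) * a" using N0 that a by (intro mult_right_mono) auto
          finally show ?thesis unfolding \<eta>_def a_def[symmetric] by (intro cutoff_1) simp
        qed
        then have "\<forall>\<^sub>F N in sequentially. \<eta> (Suc N) z * (q z \<bullet> g z + p z * w z) = q z \<bullet> g z + p z * w z"
          unfolding eventually_sequentially by auto
        then show ?thesis by (rule tendsto_eventually)
      next
        case False
        then show ?thesis using q(2) p(2) by simp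
      qed
    qed
    show "AE z in lborel. norm (\<eta> (Suc N) z * (q z \<bullet> g z + p z * w z)) \<le> norm (q z \<bullet> g z + p z * w z)" for N
    proof (rule AE_I2)
      fix z
      have "\<bar>\<eta> (Suc N) z\<bar> \<le> 1" unfolding \<eta>_def using cutoff_bounds by simp
      then have "\<bar>\<eta> (Suc N) z\<bar> * \<bar>q z \<bullet> g z + p z * w z\<bar> \<le> 1 * \<bar>q z \<bullet> g z + p z * w z\<bar>" by (intro mult_right_mono) auto
      then show "norm (\<eta> (Suc N) z * (q z \<bullet> g z + p z * w z)) \<le> norm (q z \<bullet> g z + p z * w z)" by (simp add: abs_mult)
    qed
    show "(\<lambda>z. \<eta> (Suc N) z * (q z \<bullet> g z + p z * w z)) \<in> borel_measurable lborel" for N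
      using borel_measurable_C_1(1)[OF \<eta>1] borel_measurable_integrable[OF igw] by simp
  qed (use igw in \<open>auto dest: borel_measurable_integrable\<close>)
  then have "(\<integral>z. q z \<bullet> g z + p z * w z \<partial>lborel) = 0"
    using eqN by (simp add: LIMSEQ_const_iff)
  then show ?thesis using L2_inner_integrable[OF q(1) g(2)] L2_mult_integrable[OF p(1) w(2)] by simp
qed

section \<open>Regularity in time\<close>

lemma borel_measurable_Pair_slice:
  fixes f :: "'a::euclidean_space \<times> 'b::euclidean_space \<Rightarrow> 'c::topological_space"
  assumes "f \<in> borel_measurable borel" shows "(\<lambda>t. f (x, t)) \<in> borel_measurable borel"
proof (rule measurable_compose[OF _ assms])
  show "Pair x \<in> borel \<rightarrow>\<^sub>M borel" by (intro borel_measurable_continuous_onI continuous_intros)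
qed

section \<open>Translations in time\<close>

lemma C_k_translate: "C_k k f \<Longrightarrow> C_k k (\<lambda>z. f (z + a))"
proof (induction k arbitrary: f)
  case 0
  then show ?case by (auto intro!: continuous_intros intro: continuous_on_compose2)
next
  case (Suc k)
  show ?case
  proof (rule C_k_SucI)
    fix z
    have "((\<lambda>z. z + a) has_derivative (\<lambda>v. v)) (at z)" by (auto intro!: derivative_eq_intros)
    from has_derivative_compose[OF this C_k_has_derivative[OF Suc.prems]]
    show "((\<lambda>z. f (z + a)) has_derivative (\<lambda>v. frechet_derivative f (at (z + a)) v)) (at z)" .
    show "C_k k (\<lambda>z. frechet_derivative f (at (z + a)) v)" for v
      by (rule Suc.IH) (use Suc.prems in auto)
  qed
qed

lemma frechet_derivative_translate:
  assumes "C_k (Suc 0) f"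
  shows "frechet_derivative (\<lambda>z. f (z + a)) (at z) = frechet_derivative f (at (z + a))"
proof -
  have "((\<lambda>z. z + a) has_derivative (\<lambda>v. v)) (at z)" by (auto intro!: derivative_eq_intros)
  from has_derivative_compose[OF this C_k_has_derivative[OF assms]]
  show ?thesis by (rule frechet_derivative_at[symmetric])
qed

text \<open>The analogue of \<open>correlation_integrable\<close> for shifts along the time axis
  only: the kernel lives on the real line, and \<sigma> sets the direction and speed of the
  shift.\<close>

lemma time_correlation_integrable:
  fixes f g :: "'a::euclidean_space \<times> real \<Rightarrow> real"
  assumes f: "f \<in> L2 lborel" and g: "g \<in> L2 lborel" and K: "integrable lborel K"
  shows "integrable (lborel \<Otimes>\<^sub>M lborel) (\<lambda>(s, z). K s * (f (z + (0, \<sigma> * s)) * g z))"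
proof -
  note [measurable] = L2_measurable[OF f] L2_measurable[OF g] borel_measurable_integrable[OF K]
  have [measurable]: "(\<lambda>s::real. (0::'a, \<sigma> * s)) \<in> borel_measurable borel"
    by (intro borel_measurable_continuous_onI continuous_intros)
  have nb: "(\<integral>z. norm (K s * (f (z + (0, \<sigma> * s)) * g z)) \<partial>lborel) \<le> \<bar>K s\<bar> * (L2norm lborel f * L2norm lborel g)" for s
  proof -
    have "(\<integral>z. norm (K s * (f (z + (0, \<sigma> * s)) * g z)) \<partial>lborel) = \<bar>K s\<bar> * (\<integral>z. norm (f (z + (0, \<sigma> * s))) * norm (g z) \<partial>lborel)"
      by (simp add: abs_mult)
    also have "\<dots> \<le> \<bar>K s\<bar> * (L2norm lborel f * L2norm lborel g)"
      using L2_Cauchy_Schwarz_norm[OF L2_shift[OF f, of "(0, \<sigma> * s)"] g]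
      by (simp add: mult_left_mono L2norm_shift[OF f])
    finally show ?thesis .
  qed
  have i1: "integrable lborel (\<lambda>s. \<integral>z. norm (K s * (f (z + (0, \<sigma> * s)) * g z)) \<partial>lborel)"
  proof (rule Bochner_Integration.integrable_bound)
    show "integrable lborel (\<lambda>s. \<bar>K s\<bar> * (L2norm lborel f * L2norm lborel g))" using K by auto
    show "AE s in lborel. norm (\<integral>z. norm (K s * (f (z + (0, \<sigma> * s)) * g z)) \<partial>lborel) \<le> norm (\<bar>K s\<bar> * (L2norm lborel f * L2norm lborel g))"
      using nb by (intro AE_I2) (auto simp: abs_mult)
  qed measurable
  show ?thesis
  proof (rule lborel_pair.Fubini_integrable)
    show "integrable lborel (\<lambda>s. \<integral>z. norm (case (s, z) of (s, z) \<Rightarrow> K s * (f (z + (0, \<sigma> * s)) * g z)) \<partial>lborel)"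
      using i1 by simp
    show "AE s in lborel. integrable lborel (\<lambda>z. case (s, z) of (s, z) \<Rightarrow> K s * (f (z + (0, \<sigma> * s)) * g z))"
      using L2_mult_integrable[OF L2_shift[OF f] g] by auto
  qed measurable
qed

text \<open>A time shift of E is still approximated by smooth functions with small lateral values,
  so it may be tested with q on the cylinder of those times at which both functions live. This
  provides correlations of q with its own time shifts in terms of E, with no time derivative of
  q.\<close>

lemma shifted_integration_by_parts:
  fixes \<Omega> :: "'a::euclidean_space set" and q :: "'a \<times> real \<Rightarrow> 'a" and P E :: "'a \<times> real \<Rightarrow> real"
    and \<phi> :: "nat \<Rightarrow> 'a \<times> real \<Rightarrow> real" and T :: real
  defines "Q \<equiv> \<Omega> \<times> {0<..<T}"
  assumes Lip: "bounded_Lipschitz_domain \<Omega>"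
    and q: "q \<in> L2 lborel" "\<And>z. z \<notin> Q \<Longrightarrow> q z = 0" and P: "P \<in> L2 lborel" "\<And>z. z \<notin> Q \<Longrightarrow> P z = 0"
    and weak: "\<And>\<phi>. \<phi> \<in> test_functions Q \<Longrightarrow>
       (\<integral>z. frechet_derivative \<phi> (at z) (q z, 0) \<partial>lborel) = - (\<integral>z. \<phi> z * P z \<partial>lborel)"
    and \<phi>: "\<And>k. C_k (Suc 0) (\<phi> k)"
    and E: "L2_tendsto lborel (\<lambda>k z. indicator Q z * \<phi> k z) E" "E \<in> L2 lborel" "\<And>z. z \<notin> Q \<Longrightarrow> E z = 0"
    and g: "L2_tendsto lborel (\<lambda>k z. indicator Q z *\<^sub>R gradx (\<phi> k) z) g" "g \<in> L2 lborel" "\<And>z. z \<notin> Q \<Longrightarrow> g z = 0"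
    and J: "\<And>k. (\<integral>\<^sup>+x. (\<integral>\<^sup>+t. ennreal ((\<phi> k (x, t))\<^sup>2) * indicator {0<..<T} t \<partial>lborel) * indicator (frontier \<Omega>) x
               \<partial>hausdorff_measure (DIM('a) - 1)) \<le> ennreal (J k)" "\<And>k. 0 \<le> J k" "J \<longlonglongrightarrow> 0"
    and b: "b \<le> T" "b + s \<le> T"
  shows "(\<integral>z. indicator {..<b} (snd z) * (q z \<bullet> g (z + (0, s))) \<partial>lborel)
       = - (\<integral>z. indicator {..<b} (snd z) * (P z * E (z + (0, s))) \<partial>lborel)"
proof -
  have \<Omega>: "open \<Omega>" using Lip by (auto simp: bounded_Lipschitz_domain_def)
  \<comment> \<open>The largest interval ending at b on which both t and t + s are positive; b <= T
    and b + s <= T take care of the upper ends.\<close>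
  define s1 where "s1 = max 0 (- s)"
  define Q' where "Q' = \<Omega> \<times> {s1<..<b}"
  have [measurable]: "Q \<in> sets borel" "Q' \<in> sets borel"
    unfolding Q_def Q'_def using \<Omega> by (auto intro!: borel_open open_Times)
  have Q'Q: "Q' \<subseteq> Q" "z \<in> Q' \<Longrightarrow> z + (0, s) \<in> Q" for z
    using b by (auto simp: Q_def Q'_def s1_def)
  have QQ': "z \<in> Q'" if "snd z < b" "z \<in> Q" "z + (0, s) \<in> Q" for z
    using that by (auto simp: Q_def Q'_def s1_def mem_Times_iff)
  define w where "w z = indicator Q' z * E (z + (0, s))" for z
  define g' where "g' z = indicator Q' z *\<^sub>R g (z + (0, s))" for z
  define q' where "q' z = indicator Q' z *\<^sub>R q z" for z
  define p' where "p' z = indicator Q' z * P z" for z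
  have eq1: "indicator {..<b} (snd z) * (q z \<bullet> g (z + (0, s))) = q' z \<bullet> g' z" for z
  proof (cases "z \<in> Q'")
    case True
    then have "snd z < b" by (auto simp: Q'_def)
    with True show ?thesis by (simp add: q'_def g'_def)
  next
    case False
    then have "\<not> snd z < b \<or> q z = 0 \<or> g (z + (0, s)) = 0" using QQ'[of z] q(2) g(3) by blast
    with False show ?thesis by (auto simp: q'_def)
  qed
  have eq2: "indicator {..<b} (snd z) * (P z * E (z + (0, s))) = p' z * w z" for z
  proof (cases "z \<in> Q'")
    case True
    then have "snd z < b" by (auto simp: Q'_def)
    with True show ?thesis by (simp add: p'_def w_def)
  next
    case False
    then have "\<not> snd z < b \<or> P z = 0 \<or> E (z + (0, s)) = 0" using QQ'[of z] P(2) E(3) by blast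
    with False show ?thesis by (auto simp: p'_def)
  qed
  have "(\<integral>z. q' z \<bullet> g' z \<partial>lborel) + (\<integral>z. p' z * w z \<partial>lborel) = 0"
  proof (cases "s1 < b")
    case False
    then have "Q' = {}" by (auto simp: Q'_def)
    then show ?thesis by (simp add: q'_def p'_def)
  next
    case True
    note [measurable] = borel_measurable_C_1[OF \<phi>] L2_measurable[OF q(1)] L2_measurable[OF P(1)] L2_measurable[OF E(2)] L2_measurable[OF g(2)]
    have i1: "\<bar>indicator Q' z :: real\<bar> \<le> 1" for z by (auto simp: indicator_def)
    have sub: "test_functions Q' \<subseteq> test_functions Q" using Q'Q(1) by (auto simp: test_functions_def)
    have supp: "\<eta> z = 0" "frechet_derivative \<eta> (at z) v = 0" if "\<eta> \<in> test_functions Q'" "z \<notin> Q'" for \<eta> z v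
    proof -
      have "z \<notin> closure {z. \<eta> z \<noteq> 0}" using that by (auto simp: test_functions_def)
      then show "frechet_derivative \<eta> (at z) v = 0" by (intro frechet_derivative_outside[of "{z. \<eta> z \<noteq> 0}"]) auto
      show "\<eta> z = 0" using \<open>z \<notin> closure {z. \<eta> z \<noteq> 0}\<close> closure_subset[of "{z. \<eta> z \<noteq> 0}"] by blast
    qed
    have grad_tr: "gradx (\<lambda>z. \<phi> k (z + (0, s))) z = gradx (\<phi> k) (z + (0, s))" for k z
      by (simp add: gradx_def frechet_derivative_translate[OF \<phi>])
    have shift: "L2_tendsto lborel (\<lambda>k z. f k (z + (0, s))) (\<lambda>z. h (z + (0, s)))"
      if "L2_tendsto lborel f h" for f and h :: "'a \<times> real \<Rightarrow> 'c::euclidean_space"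
    proof -
      have "(\<lambda>z. f k z - h z) \<in> L2 lborel" for k using that by (auto simp: L2_tendsto_def)
      from L2_shift[OF this, of _ "(0, s)"] L2norm_shift[OF this, of _ "(0, s)"] that
      show ?thesis by (simp add: L2_tendsto_def)
    qed
    show ?thesis
    proof (rule integration_by_parts_cylinder[where \<Omega>=\<Omega> and ?s1.0=s1 and ?s2.0=b and \<psi>="\<lambda>k z. \<phi> k (z + (0, s))" and J=J])
      show "q' \<in> L2 lborel" unfolding q'_def by (rule L2_bounded_scaleR[OF q(1) _ i1]) measurable
      show "p' \<in> L2 lborel" unfolding p'_def by (rule L2_bounded_mult[OF P(1) _ i1]) measurable
      show "w \<in> L2 lborel" unfolding w_def by (rule L2_bounded_mult[OF L2_shift[OF E(2)] _ i1]) measurable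
      show "g' \<in> L2 lborel" unfolding g'_def by (rule L2_bounded_scaleR[OF L2_shift[OF g(2)] _ i1]) measurable
      show "C_k (Suc 0) (\<lambda>z. \<phi> k (z + (0, s)))" for k by (intro C_k_translate \<phi>)
      show "q' z = 0" if "z \<notin> \<Omega> \<times> {s1<..<b}" for z using that by (simp add: q'_def Q'_def)
      show "p' z = 0" if "z \<notin> \<Omega> \<times> {s1<..<b}" for z using that by (simp add: p'_def Q'_def)
      show "(\<integral>z. frechet_derivative \<eta> (at z) (q' z, 0) \<partial>lborel) = - (\<integral>z. \<eta> z * p' z \<partial>lborel)"
        if "\<eta> \<in> test_functions (\<Omega> \<times> {s1<..<b})" for \<eta>
      proof -
        have \<eta>: "\<eta> \<in> test_functions Q'" using that by (simp add: Q'_def)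
        have "frechet_derivative \<eta> (at z) (q' z, 0) = frechet_derivative \<eta> (at z) (q z, 0)" for z
          using supp(2)[OF \<eta>, of z] by (cases "z \<in> Q'") (auto simp: q'_def)
        moreover have "\<eta> z * p' z = \<eta> z * P z" for z using supp(1)[OF \<eta>, of z] by (cases "z \<in> Q'") (auto simp: p'_def)
        moreover have "\<eta> \<in> test_functions Q" using \<eta> sub by blast
        ultimately show ?thesis using weak[of \<eta>] by (simp only:)
      qed
      show "L2_tendsto lborel (\<lambda>k z. indicator (\<Omega> \<times> {s1<..<b}) z * \<phi> k (z + (0, s))) w"
      proof -
        have "L2_tendsto lborel (\<lambda>k z. indicator Q' z *\<^sub>R (indicator Q (z + (0, s)) * \<phi> k (z + (0, s)))) (\<lambda>z. indicator Q' z *\<^sub>R E (z + (0, s)))"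
          by (rule L2_tendsto_bounded_scaleR[OF shift[OF E(1)] _ i1]) measurable
        moreover have "indicator Q' z *\<^sub>R (indicator Q (z + (0, s)) * \<phi> k (z + (0, s))) = indicator Q' z * \<phi> k (z + (0, s))" for k z
          using Q'Q(2)[of z] by (cases "z \<in> Q'") auto
        ultimately show ?thesis unfolding w_def[abs_def] Q'_def[symmetric] by (simp only: real_scaleR_def)
      qed
      show "L2_tendsto lborel (\<lambda>k z. indicator (\<Omega> \<times> {s1<..<b}) z *\<^sub>R gradx (\<lambda>z. \<phi> k (z + (0, s))) z) g'"
      proof -
        have "L2_tendsto lborel (\<lambda>k z. indicator Q' z *\<^sub>R (indicator Q (z + (0, s)) *\<^sub>R gradx (\<phi> k) (z + (0, s)))) (\<lambda>z. indicator Q' z *\<^sub>R g (z + (0, s)))"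
          by (rule L2_tendsto_bounded_scaleR[OF shift[OF g(1)] _ i1]) measurable
        moreover have "indicator Q' z *\<^sub>R (indicator Q (z + (0, s)) *\<^sub>R gradx (\<phi> k) (z + (0, s))) = indicator Q' z *\<^sub>R gradx (\<phi> k) (z + (0, s))" for k z
          using Q'Q(2)[of z] by (cases "z \<in> Q'") auto
        ultimately show ?thesis unfolding grad_tr g'_def[abs_def] Q'_def[symmetric] by (simp only:)
      qed
      show "(\<integral>\<^sup>+x. (\<integral>\<^sup>+t. ennreal ((\<phi> k ((x, t) + (0, s)))\<^sup>2) * indicator {s1<..<b} t \<partial>lborel) * indicator (frontier \<Omega>) x
               \<partial>hausdorff_measure (DIM('a) - 1)) \<le> ennreal (J k)" for k
      \<comment> \<open>After the shift the time interval is a part of (0,T), so the lateral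
        integral does not grow.\<close>
      proof (rule order_trans[OF nn_integral_mono J(1)], rule mult_right_mono)
        fix x
        have m: "(\<lambda>t. \<phi> k (x, t)) \<in> borel_measurable borel"
          by (rule borel_measurable_Pair_slice[OF borel_measurable_C_1(1)[OF \<phi>]])
        have "(\<integral>\<^sup>+t. ennreal ((\<phi> k ((x, t) + (0, s)))\<^sup>2) * indicator {s1<..<b} t \<partial>lborel)
          \<le> (\<integral>\<^sup>+t. ennreal ((\<phi> k (x, t + s))\<^sup>2) * indicator {0<..<T} (t + s) \<partial>lborel)"
        proof (rule nn_integral_mono)
          fix t
          have "t + s \<in> {0<..<T}" if "t \<in> {s1<..<b}" using that b by (simp add: s1_def)
          then show "ennreal ((\<phi> k ((x, t) + (0, s)))\<^sup>2) * indicator {s1<..<b} t \<le> ennreal ((\<phi> k (x, t + s))\<^sup>2) * indicator {0<..<T} (t + s)"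
            by (cases "t \<in> {s1<..<b}") simp_all
        qed
        also have "\<dots> = (\<integral>\<^sup>+t. ennreal ((\<phi> k (x, t))\<^sup>2) * indicator {0<..<T} t \<partial>lborel)"
          by (rule lborel_nn_integral_shift[of "\<lambda>t. ennreal ((\<phi> k (x, t))\<^sup>2) * indicator {0<..<T} t"]) (use m in measurable)
        finally show "(\<integral>\<^sup>+t. ennreal ((\<phi> k ((x, t) + (0, s)))\<^sup>2) * indicator {s1<..<b} t \<partial>lborel)
          \<le> (\<integral>\<^sup>+t. ennreal ((\<phi> k (x, t))\<^sup>2) * indicator {0<..<T} t \<partial>lborel)" .
      qed simp
    qed (use Lip True J in auto)
  qed
  then show ?thesis by (simp add: eq1 eq2)
qed

text \<open>The lower limit is minus infinity: for a function extended by zero from Q this is the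
  primitive vanishing at time 0, and it is defined for all times, so shifts can be applied freely.
  Where the integrand is not integrable the Bochner integral is 0 by convention, which happens only
  over a null set of x by \<open>AE_slice_integrable\<close>.\<close>

definition tprim :: "('a::euclidean_space \<times> real \<Rightarrow> real) \<Rightarrow> 'a \<times> real \<Rightarrow> real" where
  "tprim D z = (\<integral>s. indicator {..<snd z} s * D (fst z, s) \<partial>lborel)"

lemma borel_measurable_tprim:
  assumes "D \<in> borel_measurable borel" shows "tprim D \<in> borel_measurable borel"
proof -
  have m: "(\<lambda>(z :: 'a \<times> real, s). indicator {..<snd z} s * D (fst z, s)) \<in> borel_measurable (borel \<Otimes>\<^sub>M lborel)"
  proof -
    have 1: "(\<lambda>(z :: 'a \<times> real, s). D (fst z, s)) \<in> borel_measurable (borel \<Otimes>\<^sub>M (borel :: real measure))"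
    proof -
      have "(\<lambda>p. (fst (fst p), snd p)) \<in> (borel :: (('a \<times> real) \<times> real) measure) \<rightarrow>\<^sub>M borel"
        by (intro borel_measurable_continuous_onI continuous_intros)
      from measurable_compose[OF this assms] show ?thesis by (simp only: split_beta' borel_prod)
    qed
    have 2: "(\<lambda>(z :: 'a \<times> real, s). indicator {..<snd z} s :: real) \<in> borel_measurable (borel \<Otimes>\<^sub>M (borel :: real measure))"
    proof -
      have "open {p :: ('a \<times> real) \<times> real. snd p < snd (fst p)}" by (intro open_Collect_less continuous_intros)
      then have "{p :: ('a \<times> real) \<times> real. snd p < snd (fst p)} \<in> sets borel" by auto
      then have "indicator {p :: ('a \<times> real) \<times> real. snd p < snd (fst p)} \<in> borel_measurable (borel :: (('a \<times> real) \<times> real) measure)"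
        by simp
      moreover have "(\<lambda>(z :: 'a \<times> real, s). indicator {..<snd z} s :: real) = indicator {p :: ('a \<times> real) \<times> real. snd p < snd (fst p)}"
        by (auto simp: indicator_def fun_eq_iff)
      ultimately show ?thesis by (simp add: borel_prod)
    qed
    show ?thesis using borel_measurable_times[OF 2 1] by (simp add: split_beta' cong: measurable_cong_sets)
  qed
  show ?thesis unfolding tprim_def[abs_def]
    by (rule lborel.borel_measurable_lebesgue_integral) (use m in \<open>simp add: split_beta'\<close>)
qed

lemma AE_fst_lborel:
  assumes "AE x in lborel. R x" "{x. \<not> R x} \<in> sets borel"
  shows "AE z in (lborel :: ('a::euclidean_space \<times> 'b::euclidean_space) measure). R (fst z)"
proof -
  have 0: "emeasure lborel {x. \<not> R x} = 0"
    using assms by (subst (asm) AE_iff_measurable[of "{x. \<not> R x}"]) auto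
  have "emeasure (lborel \<Otimes>\<^sub>M lborel) ({x. \<not> R x} \<times> (UNIV::'b set)) = 0"
    using assms(2) 0 by (subst lborel.emeasure_pair_measure_Times) auto
  then have 1: "emeasure lborel ({x. \<not> R x} \<times> (UNIV::'b set)) = 0" by (simp add: lborel_prod)
  have "{x. \<not> R x} \<times> (UNIV::'b set) \<in> sets (lborel \<Otimes>\<^sub>M lborel)" using assms(2) by (intro pair_measureI) auto
  then have 2: "{x. \<not> R x} \<times> (UNIV::'b set) \<in> sets lborel" by (simp only: lborel_prod)
  show ?thesis
    by (rule AE_I'[of "{x. \<not> R x} \<times> UNIV"]) (use 1 2 in \<open>auto simp: null_sets_def\<close>)
qed

lemma AE_snd_neq: "AE z in (lborel :: ('a::euclidean_space \<times> real) measure). snd z \<noteq> b"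
proof -
  have "emeasure (lborel \<Otimes>\<^sub>M lborel) ((UNIV::'a set) \<times> {b}) = 0"
    by (subst lborel.emeasure_pair_measure_Times) auto
  then have 1: "emeasure lborel ((UNIV::'a set) \<times> {b}) = 0" by (simp add: lborel_prod)
  have "(UNIV::'a set) \<times> {b} \<in> sets (lborel \<Otimes>\<^sub>M lborel)" by (intro pair_measureI) auto
  then have 2: "(UNIV::'a set) \<times> {b} \<in> sets lborel" by (simp only: lborel_prod)
  show ?thesis
    by (rule AE_I'[of "UNIV \<times> {b}"]) (use 1 2 in \<open>auto simp: null_sets_def\<close>)
qed

lemma AE_slice_integrable:
  fixes D :: "'a::euclidean_space \<times> real \<Rightarrow> real"
  assumes D: "integrable lborel D"
  shows "AE z in (lborel :: ('a \<times> real) measure). integrable lborel (\<lambda>s. D (fst z, s))"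
proof -
  note [measurable] = borel_measurable_integrable[OF D]
  have m: "D \<in> borel_measurable (lborel \<Otimes>\<^sub>M lborel)" by (simp add: lborel_prod)
  have [measurable]: "(\<lambda>x. \<integral>\<^sup>+s. ennreal \<bar>D (x, s)\<bar> \<partial>lborel) \<in> borel_measurable lborel"
    using m by measurable
  have "(\<integral>\<^sup>+x. (\<integral>\<^sup>+s. ennreal \<bar>D (x, s)\<bar> \<partial>lborel) \<partial>lborel) = (\<integral>\<^sup>+z. ennreal \<bar>D z\<bar> \<partial>lborel)"
    by (subst nn_integral_lborel_pair) auto
  also have "\<dots> < \<infinity>" using D by (simp add: integrable_iff_bounded)
  finally have "AE x in lborel. (\<integral>\<^sup>+s. ennreal \<bar>D (x, s)\<bar> \<partial>lborel) \<noteq> \<infinity>"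
    by (intro nn_integral_noteq_infinite) auto
  then have "AE z in (lborel :: ('a \<times> real) measure). (\<integral>\<^sup>+s. ennreal \<bar>D (fst z, s)\<bar> \<partial>lborel) \<noteq> \<infinity>"
    by (rule AE_fst_lborel) (simp, measurable)
  then show ?thesis
  proof eventually_elim
    case (elim z)
    have "(\<lambda>s. D (fst z, s)) \<in> borel_measurable borel" by (rule borel_measurable_Pair_slice) measurable
    then show ?case using elim by (simp add: integrable_iff_bounded less_top)
  qed
qed

text \<open>Substitution s = t - \<tau>; it writes the increment as an integral of backward
  translates, the form needed for a correlation with kernel
  \<open>indicator {0<..h}\<close>.\<close>

lemma tprim_increment:
  assumes "integrable lborel (\<lambda>s. D (x, s))" "0 \<le> h"
  shows "tprim D (x, t) - tprim D (x, t - h) = (\<integral>\<tau>. indicator {0<..h} \<tau> * D (x, t - \<tau>) \<partial>lborel)"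
proof -
  have i: "integrable lborel (\<lambda>s. indicator {..<r} s * D (x, s))" for r
    using integrable_mult_indicator[OF _ assms(1), of "{..<r}"] by simp
  have "tprim D (x, t) - tprim D (x, t - h) = (\<integral>s. indicator {..<t} s * D (x, s) - indicator {..<t-h} s * D (x, s) \<partial>lborel)"
    unfolding tprim_def using i by simp
  also have "\<dots> = (\<integral>s. indicator {t-h..<t} s * D (x, s) \<partial>lborel)"
    using assms(2) by (intro Bochner_Integration.integral_cong) (auto simp: indicator_def)
  also have "\<dots> = (\<integral>\<tau>. indicator {t-h..<t} (t + (-1) * \<tau>) * D (x, t + (-1) * \<tau>) \<partial>lborel)"
    by (subst lborel_integral_real_affine[where c="-1" and t=t]) auto
  also have "\<dots> = (\<integral>\<tau>. indicator {0<..h} \<tau> * D (x, t - \<tau>) \<partial>lborel)"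
    by (intro Bochner_Integration.integral_cong) (auto simp: indicator_def)
  finally show ?thesis .
qed

text \<open>By Fubini the pairing with W is an integral over \<tau> in (0,h] of pairings with
  translates of D by \<kappa> - \<tau>, each within \<omega> of D in L2. The offset \<kappa> = 0
  gives backward and \<kappa> = h forward increments.\<close>

lemma L2_time_increment:
  fixes D W :: "'a::euclidean_space \<times> real \<Rightarrow> real"
  assumes D: "D \<in> L2 lborel" "integrable lborel D" and W: "W \<in> L2 lborel" and h: "0 < h"
    and \<omega>: "\<And>\<tau>. 0 < \<tau> \<Longrightarrow> \<tau> \<le> h \<Longrightarrow> L2norm lborel (\<lambda>z. D (z + (0, \<kappa> - \<tau>)) - D z) \<le> \<omega>"
  shows "\<bar>(\<integral>z. W z * (tprim D (z + (0, \<kappa>)) - tprim D (z + (0, \<kappa> - h))) \<partial>lborel) - h * (\<integral>z. W z * D z \<partial>lborel)\<bar>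
     \<le> h * (L2norm lborel W * \<omega>)"
proof -
  note [measurable] = L2_measurable[OF D(1)] L2_measurable[OF W]
  have [measurable]: "tprim D \<in> borel_measurable borel" by (rule borel_measurable_tprim) measurable
  define K :: "real \<Rightarrow> real" where "K = indicator {0<..h}"
  have K: "integrable lborel K" unfolding K_def using h by (intro integrable_real_indicator) auto
  \<comment> \<open>Moving the offset \<kappa> onto W leaves a backward increment at z.\<close>
  define W' where "W' z = W (z + (0, - \<kappa>))" for z
  have W': "W' \<in> L2 lborel" unfolding W'_def by (rule L2_shift[OF W])
  note [measurable] = L2_measurable[OF W']
  note cor = time_correlation_integrable[OF D(1) W' K, of "-1"]
  have "(\<integral>z. W z * (tprim D (z + (0, \<kappa>)) - tprim D (z + (0, \<kappa> - h))) \<partial>lborel)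
      = (\<integral>z. W' z * (tprim D z - tprim D (z + (0, - h))) \<partial>lborel)"
  proof -
    have "(\<integral>z. W' (z + (0, \<kappa>)) * (tprim D (z + (0, \<kappa>)) - tprim D (z + (0, \<kappa>) + (0, - h))) \<partial>lborel)
      = (\<integral>z. W' z * (tprim D z - tprim D (z + (0, - h))) \<partial>lborel)"
      by (rule lborel_integral_shift[of "\<lambda>z. W' z * (tprim D z - tprim D (z + (0, - h)))"]) measurable
    then show ?thesis by (simp add: W'_def add.assoc zero_prod_def[symmetric])
  qed
  also have "\<dots> = (\<integral>z. (\<integral>s. K s * (D (z + (0, - 1 * s)) * W' z) \<partial>lborel) \<partial>lborel)"
  proof (rule integral_cong_AE)
    show "AE z in lborel. W' z * (tprim D z - tprim D (z + (0, - h))) = (\<integral>s. K s * (D (z + (0, - 1 * s)) * W' z) \<partial>lborel)"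
      using AE_slice_integrable[OF D(2)]
    proof eventually_elim
      case (elim z)
      obtain x t where z: "z = (x, t)" by (cases z)
      have "tprim D z - tprim D (z + (0, - h)) = (\<integral>\<tau>. K \<tau> * D (x, t - \<tau>) \<partial>lborel)"
        using tprim_increment[of D x h t] elim h by (simp add: z K_def)
      moreover have "(\<integral>s. K s * (D (z + (0, - 1 * s)) * W' z) \<partial>lborel) = (\<integral>s. (K s * D (x, t - s)) * W' z \<partial>lborel)"
        by (simp add: z mult.assoc)
      moreover have "\<dots> = (\<integral>s. K s * D (x, t - s) \<partial>lborel) * W' z" by simp
      ultimately show ?case by simp
    qed
    show "(\<lambda>z. \<integral>s. K s * (D (z + (0, - 1 * s)) * W' z) \<partial>lborel) \<in> borel_measurable lborel"
      using borel_measurable_integrable[OF lborel_pair.integrable_snd[OF cor]] by simp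
  qed measurable
  also have "\<dots> = (\<integral>s. (\<integral>z. K s * (D (z + (0, - 1 * s)) * W' z) \<partial>lborel) \<partial>lborel)"
    by (rule lborel_pair.Fubini_integral[OF cor])
  also have "\<dots> = (\<integral>s. K s * (\<integral>z. W z * D (z + (0, \<kappa> - s)) \<partial>lborel) \<partial>lborel)"
  proof (rule Bochner_Integration.integral_cong)
    fix s
    have "(\<integral>z. D (z + (0, \<kappa>) + (0, - s)) * W' (z + (0, \<kappa>)) \<partial>lborel) = (\<integral>z. D (z + (0, - s)) * W' z \<partial>lborel)"
      by (rule lborel_integral_shift[of "\<lambda>z. D (z + (0, - s)) * W' z"]) measurable
    then show "(\<integral>z. K s * (D (z + (0, - 1 * s)) * W' z) \<partial>lborel) = K s * (\<integral>z. W z * D (z + (0, \<kappa> - s)) \<partial>lborel)"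
      by (simp add: W'_def add.assoc mult.commute zero_prod_def[symmetric])
  qed simp
  finally have eq: "(\<integral>z. W z * (tprim D (z + (0, \<kappa>)) - tprim D (z + (0, \<kappa> - h))) \<partial>lborel)
      = (\<integral>s. K s * (\<integral>z. W z * D (z + (0, \<kappa> - s)) \<partial>lborel) \<partial>lborel)" .
  have iK: "integrable lborel (\<lambda>s. K s * (\<integral>z. W z * D (z + (0, \<kappa> - s)) \<partial>lborel))"
  proof -
    have "(\<integral>z. K s * (D (z + (0, - 1 * s)) * W' z) \<partial>lborel) = K s * (\<integral>z. W z * D (z + (0, \<kappa> - s)) \<partial>lborel)" for s
    proof -
      have "(\<integral>z. D (z + (0, \<kappa>) + (0, - s)) * W' (z + (0, \<kappa>)) \<partial>lborel) = (\<integral>z. D (z + (0, - s)) * W' z \<partial>lborel)"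
        by (rule lborel_integral_shift[of "\<lambda>z. D (z + (0, - s)) * W' z"]) measurable
      then show ?thesis by (simp add: W'_def add.assoc mult.commute zero_prod_def[symmetric])
    qed
    then show ?thesis using lborel_pair.integrable_fst[OF cor] by (simp only:)
  qed
  have hK: "(\<integral>s. K s * c \<partial>lborel) = h * c" for c :: real
    unfolding K_def using h by simp
  have iKc: "integrable lborel (\<lambda>s. K s * c)" for c :: real using K by (intro integrable_mult_left)
  have d: "(\<integral>s. K s * (\<integral>z. W z * D (z + (0, \<kappa> - s)) \<partial>lborel) \<partial>lborel) - h * (\<integral>z. W z * D z \<partial>lborel)
    = (\<integral>s. K s * (\<integral>z. W z * D (z + (0, \<kappa> - s)) \<partial>lborel) - K s * (\<integral>z. W z * D z \<partial>lborel) \<partial>lborel)"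
    unfolding hK[symmetric] using iK iKc by simp
  have "\<bar>(\<integral>s. K s * (\<integral>z. W z * D (z + (0, \<kappa> - s)) \<partial>lborel) \<partial>lborel) - h * (\<integral>z. W z * D z \<partial>lborel)\<bar>
      \<le> (\<integral>s. \<bar>K s * (\<integral>z. W z * D (z + (0, \<kappa> - s)) \<partial>lborel) - K s * (\<integral>z. W z * D z \<partial>lborel)\<bar> \<partial>lborel)"
    unfolding d by (rule integral_abs_bound)
  also have "\<dots> \<le> (\<integral>s. K s * (L2norm lborel W * \<omega>) \<partial>lborel)"
  proof (rule integral_mono)
    fix s
    show "\<bar>K s * (\<integral>z. W z * D (z + (0, \<kappa> - s)) \<partial>lborel) - K s * (\<integral>z. W z * D z \<partial>lborel)\<bar> \<le> K s * (L2norm lborel W * \<omega>)"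
    proof (cases "s \<in> {0<..h}")
      case True
      have "(\<integral>z. W z * D (z + (0, \<kappa> - s)) \<partial>lborel) - (\<integral>z. W z * D z \<partial>lborel) = (\<integral>z. W z * (D (z + (0, \<kappa> - s)) - D z) \<partial>lborel)"
        using L2_mult_integrable[OF W L2_shift[OF D(1), of "(0, \<kappa> - s)"]] L2_mult_integrable[OF W D(1)]
        by (simp add: right_diff_distrib)
      also have "\<bar>\<dots>\<bar> \<le> L2norm lborel W * L2norm lborel (\<lambda>z. D (z + (0, \<kappa> - s)) - D z)"
        by (rule L2_Cauchy_Schwarz_mult[OF W L2_diff[OF L2_shift[OF D(1)] D(1)]])
      also have "\<dots> \<le> L2norm lborel W * \<omega>" using \<omega>[of s] True by (intro mult_left_mono) auto
      finally show ?thesis using True by (simp add: K_def)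
    qed (simp add: K_def)
  qed (use iK iKc in auto)
  also have "\<dots> = h * (L2norm lborel W * \<omega>)" by (rule hK)
  finally show ?thesis unfolding eq .
qed

section \<open>The energy of the gradient as a function of time\<close>

lemma continuous_time_cutoff:
  fixes f :: "'a::euclidean_space \<times> real \<Rightarrow> real"
  assumes f: "integrable lborel f"
  shows "continuous_on UNIV (\<lambda>b. \<integral>z. indicator {..<b} (snd z) * f z \<partial>lborel)"
  unfolding continuous_on_eq_continuous_at[OF open_UNIV] continuous_at_sequentially comp_def
proof (intro ballI allI impI)
  fix b :: real and c :: "nat \<Rightarrow> real" assume c: "c \<longlonglongrightarrow> b"
  note [measurable] = borel_measurable_integrable[OF f]
  have m: "(\<lambda>z. indicator {..<r} (snd z) * f z) \<in> borel_measurable lborel" for r :: real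
    using measurable_compose[OF borel_snd borel_measurable_indicator[of "{..<r}" borel]] by (auto intro!: borel_measurable_times)
  show "(\<lambda>n. \<integral>z. indicator {..<c n} (snd z) * f z \<partial>lborel) \<longlonglongrightarrow> (\<integral>z. indicator {..<b} (snd z) * f z \<partial>lborel)"
  proof (rule integral_dominated_convergence[where w="\<lambda>z. norm (f z)"])
    show "AE z in lborel. (\<lambda>n. indicator {..<c n} (snd z) * f z) \<longlonglongrightarrow> indicator {..<b} (snd z) * f z"
      using AE_snd_neq[of b]
    proof eventually_elim
      case (elim z)
      have "\<forall>\<^sub>F n in sequentially. indicator {..<c n} (snd z) * f z = indicator {..<b} (snd z) * f z"
      proof (cases "snd z < b")
        case True
        from order_tendstoD(1)[OF c this] show ?thesis by eventually_elim (simp add: True)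
      next
        case False
        then have "b < snd z" using elim by simp
        from order_tendstoD(2)[OF c this] show ?thesis by eventually_elim (use False in simp)
      qed
      then show ?case by (rule tendsto_eventually)
    qed
    show "AE z in lborel. norm (indicator {..<c n} (snd z) * f z) \<le> norm (f z)" for n
      by (intro AE_I2) (auto simp: indicator_def)
  qed (use f m in auto)
qed

text \<open>The positive and the negative part of f are densities of two finite measures that agree
  on all rays \<open>{c<..}\<close>, hence everywhere, and densities are unique almost
  everywhere.\<close>

lemma AE_zero_of_tail_integrals:
  fixes f :: "real \<Rightarrow> real"
  assumes f: "integrable lborel f" and *: "\<And>c. (\<integral>t. indicator {c<..} t * f t \<partial>lborel) = 0"
  shows "AE t in lborel. f t = 0"
proof -
  note [measurable] = borel_measurable_integrable[OF f]
  let ?p = "\<lambda>t. ennreal (max 0 (f t))" and ?n = "\<lambda>t. ennreal (max 0 (- f t))"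
  have ip: "integrable lborel (\<lambda>t. max 0 (f t))" "integrable lborel (\<lambda>t. max 0 (- f t))" using f by auto
  have ic: "integrable lborel (\<lambda>t. indicator {c<..} t * g t)" if "integrable lborel g" for c :: real and g :: "real \<Rightarrow> real"
  proof -
    have "{c<..} \<in> sets (lborel :: real measure)" by simp
    from integrable_mult_indicator[OF this that] show ?thesis by simp
  qed
  have em: "emeasure (density lborel (\<lambda>t. ennreal (g t))) {c<..} = ennreal (\<integral>t. indicator {c<..} t * g t \<partial>lborel)"
    if g: "integrable lborel g" "\<And>t. 0 \<le> g t" for c :: real and g
  proof -
    note [measurable] = borel_measurable_integrable[OF g(1)]
    have "emeasure (density lborel (\<lambda>t. ennreal (g t))) {c<..} = (\<integral>\<^sup>+t. ennreal (indicator {c<..} t * g t) \<partial>lborel)"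
      by (subst emeasure_density) (auto intro!: nn_integral_cong simp: indicator_def)
    also have "\<dots> = ennreal (\<integral>t. indicator {c<..} t * g t \<partial>lborel)"
      using g by (intro nn_integral_eq_integral ic) auto
    finally show ?thesis .
  qed
  have "density lborel ?p = density lborel ?n"
  proof (rule measure_eqI_lessThan)
    fix c :: real
    show "emeasure (density lborel ?p) {c<..} < \<infinity>" by (subst em) (use ip in auto)
    have "(\<integral>t. indicator {c<..} t * max 0 (f t) \<partial>lborel) - (\<integral>t. indicator {c<..} t * max 0 (- f t) \<partial>lborel)
      = (\<integral>t. indicator {c<..} t * max 0 (f t) - indicator {c<..} t * max 0 (- f t) \<partial>lborel)"
      using ic[OF ip(1), of c] ic[OF ip(2), of c] by simp
    also have "\<dots> = (\<integral>t. indicator {c<..} t * f t \<partial>lborel)"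
      by (intro Bochner_Integration.integral_cong) (auto simp: max_def)
    finally have "(\<integral>t. indicator {c<..} t * max 0 (f t) \<partial>lborel) = (\<integral>t. indicator {c<..} t * max 0 (- f t) \<partial>lborel)"
      using *[of c] by simp
    then show "emeasure (density lborel ?p) {c<..} = emeasure (density lborel ?n) {c<..}"
      using ip by (simp add: em)
  qed auto
  then have "AE t in lborel. ?p t = ?n t"
    by (intro sigma_finite_measure.density_unique_iff[OF sigma_finite_lborel, THEN iffD1]) auto
  then show ?thesis by eventually_elim (auto simp: max_def split: if_splits)
qed

lemma AE_lborel_shift:
  fixes s :: "'a::euclidean_space"
  assumes "AE x in lborel. R x" shows "AE x in lborel. R (x + s)"
proof -
  obtain N where "{x \<in> space lborel. \<not> R x} \<subseteq> N" "emeasure lborel N = 0" "N \<in> sets lborel"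
    by (rule AE_E[OF assms])
  then have N: "{x. \<not> R x} \<subseteq> N" "N \<in> sets borel" "emeasure lborel N = 0" by simp_all
  have [measurable]: "N \<in> sets borel" by fact
  have "emeasure lborel {x. x + s \<in> N} = (\<integral>\<^sup>+x. indicator N (x + s) \<partial>lborel)"
    by (subst nn_integral_indicator[symmetric], measurable)
       (rule nn_integral_cong, simp only: indicator_def mem_Collect_eq)
  also have "\<dots> = (\<integral>\<^sup>+x. indicator N x \<partial>lborel)" by (rule lborel_nn_integral_shift) measurable
  finally have "emeasure lborel {x. x + s \<in> N} = 0" using N(3) by simp
  then show ?thesis
    by (intro AE_I[where N="{x. x + s \<in> N}"]) (use N(1) in auto)
qed

lemma bounded_support_L2_integrable:
  fixes f :: "'a::euclidean_space \<Rightarrow> 'b::euclidean_space"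
  assumes f: "f \<in> L2 lborel" and S: "S \<in> sets borel" "bounded S" "\<And>z. z \<notin> S \<Longrightarrow> f z = 0"
  shows "integrable lborel f"
proof -
  note [measurable] = L2_measurable[OF f] S(1)
  have iS: "(\<lambda>z. indicator S z :: real) \<in> L2 lborel"
    by (rule L2_I, measurable, rule integrable_bounded_support[OF _ S(2), where B=1]) (auto simp: indicator_def)
  have "integrable lborel (\<lambda>z. norm (f z))"
    by (rule Bochner_Integration.integrable_bound[OF L2_norm_prod_integrable[OF iS f]]) (use S(3) in \<open>auto simp: indicator_def\<close>)
  then show ?thesis using integrable_norm_iff[of f lborel] L2_measurable[OF f] by simp
qed

text \<open>Write S(b, s) for the correlation of q with its shift by s, over times below b. Shifting
  gives S(b, -h) = S(b-h, h), so the increment of the energy is (S(b, 0) - S(b, -h)) + (S(b-h, h) -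
  S(b-h, 0)). By \<open>shifted_integration_by_parts\<close> each bracket contains a time increment
  of E, never one of q, and this is about h D. Hence the time integral of the squared norm of q is
  differentiable with the continuous derivative N, which is therefore that squared norm for almost
  every t.\<close>

lemma gradient_energy_identity:
  fixes \<Omega> :: "'a::euclidean_space set" and q :: "'a \<times> real \<Rightarrow> 'a" and P E D :: "'a \<times> real \<Rightarrow> real"
    and \<phi> :: "nat \<Rightarrow> 'a \<times> real \<Rightarrow> real" and T :: real
  defines "Q \<equiv> \<Omega> \<times> {0<..<T}"
  assumes Lip: "bounded_Lipschitz_domain \<Omega>" and T: "0 < T"
    and q: "q \<in> L2 lborel" "\<And>z. z \<notin> Q \<Longrightarrow> q z = 0" and P: "P \<in> L2 lborel" "\<And>z. z \<notin> Q \<Longrightarrow> P z = 0"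
    and weak: "\<And>\<phi>. \<phi> \<in> test_functions Q \<Longrightarrow>
       (\<integral>z. frechet_derivative \<phi> (at z) (q z, 0) \<partial>lborel) = - (\<integral>z. \<phi> z * P z \<partial>lborel)"
    and \<phi>: "\<And>k. C_k (Suc 0) (\<phi> k)"
    and E: "L2_tendsto lborel (\<lambda>k z. indicator Q z * \<phi> k z) E" "E \<in> L2 lborel" "\<And>z. z \<notin> Q \<Longrightarrow> E z = 0"
    and g: "L2_tendsto lborel (\<lambda>k z. indicator Q z *\<^sub>R gradx (\<phi> k) z) q"
    and J: "\<And>k. (\<integral>\<^sup>+x. (\<integral>\<^sup>+t. ennreal ((\<phi> k (x, t))\<^sup>2) * indicator {0<..<T} t \<partial>lborel) * indicator (frontier \<Omega>) x
               \<partial>hausdorff_measure (DIM('a) - 1)) \<le> ennreal (J k)" "\<And>k. 0 \<le> J k" "J \<longlonglongrightarrow> 0"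
    and D: "D \<in> L2 lborel" "\<And>z. z \<notin> Q \<Longrightarrow> D z = 0"
    and EI: "AE z in lborel. z \<in> Q \<longrightarrow> E z = tprim D z"
  shows "\<exists>N. continuous_on {0..T} N \<and> N T = - 2 * (\<integral>z. P z * D z \<partial>lborel) \<and>
     (AE t in lborel. t \<in> {0<..<T} \<longrightarrow> N t = (\<integral>x. (norm (q (x, t)))\<^sup>2 \<partial>lborel))"
proof -
  have \<Omega>: "open \<Omega>" "bounded \<Omega>" using Lip by (auto simp: bounded_Lipschitz_domain_def)
  have Q: "Q \<in> sets borel" "bounded Q"
    unfolding Q_def using \<Omega> by (auto intro!: borel_open open_Times bounded_Times)
  note [measurable] = Q(1) L2_measurable[OF q(1)] L2_measurable[OF P(1)] L2_measurable[OF E(2)] L2_measurable[OF D(1)]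
  have [measurable]: "tprim D \<in> borel_measurable borel" by (rule borel_measurable_tprim) measurable
  have iD: "integrable lborel D" by (rule bounded_support_L2_integrable[OF D(1) Q D(2)])
  define W where "W b z = indicator {..<b} (snd z) * P z" for b and z :: "'a \<times> real"
  have indm: "(\<lambda>z :: 'a \<times> real. indicator {..<b} (snd z) :: real) \<in> borel_measurable lborel" for b :: real
    using measurable_compose[OF borel_snd borel_measurable_indicator[of "{..<b}" borel]] by simp
  have W: "W b \<in> L2 lborel" for b
    unfolding W_def by (rule L2_bounded_mult[OF P(1) indm, where c=1]) (auto simp: indicator_def)
  note [measurable] = L2_measurable[OF W]
  have Wn: "L2norm lborel (W b) \<le> L2norm lborel P" for b
    unfolding L2norm_def
    by (intro real_sqrt_le_mono integral_mono L2_integrable W P) (auto simp: W_def indicator_def)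
  define Jf where "Jf b = (\<integral>z. indicator {..<b} (snd z) * (norm (q z))\<^sup>2 \<partial>lborel)" for b
  \<comment> \<open>The factor 2 counts the two brackets. With q the gradient of e and P its
    Laplacian, N b is the expected value of the squared gradient norm at time b.\<close>
  define N where "N b = - 2 * (\<integral>z. indicator {..<b} (snd z) * (P z * D z) \<partial>lborel)" for b
  have cJ: "continuous_on UNIV Jf" unfolding Jf_def by (rule continuous_time_cutoff[OF L2_integrable[OF q(1)]])
  have cN: "continuous_on UNIV N" unfolding N_def
    by (intro continuous_intros continuous_time_cutoff[OF L2_mult_integrable[OF P(1) D(1)]])
  have tprim0: "tprim D z = 0" if "snd z \<le> 0" for z
  proof -
    have "indicator {..<snd z} s * D (fst z, s) = 0" for s
      using D(2)[of "(fst z, s)"] that by (auto simp: Q_def indicator_def)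
    then show ?thesis unfolding tprim_def by (simp only: Bochner_Integration.integral_zero)
  qed
  have S: "(\<integral>z. indicator {..<b} (snd z) * (q z \<bullet> q (z + (0, s))) \<partial>lborel)
       = - (\<integral>z. W b z * E (z + (0, s)) \<partial>lborel)" if "b \<le> T" "b + s \<le> T" for b s
    using shifted_integration_by_parts[OF Lip q[unfolded Q_def] P[unfolded Q_def] weak[unfolded Q_def] \<phi> E[unfolded Q_def]
        g[unfolded Q_def] q[unfolded Q_def] J that] by (simp add: W_def mult.assoc)
  \<comment> \<open>The trapezoidal mean appears because one bracket is cut off at b and the other
    at b - h; each contributes one error term.\<close>
  have diff: "\<bar>Jf b - Jf (b - h) - h * ((N b + N (b - h)) / 2)\<bar> \<le> 2 * h * (L2norm lborel P * \<omega>)"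
    if b: "b \<le> T" and h: "0 < h" and \<omega>: "\<And>\<tau>. \<bar>\<tau>\<bar> \<le> h \<Longrightarrow> L2norm lborel (\<lambda>z. D (z + (0, \<tau>)) - D z) \<le> \<omega>" for b h \<omega>
  proof -
    have \<omega>0: "0 \<le> \<omega>" using order_trans[OF L2norm_nonneg \<omega>[of 0]] h by simp
    note iWE = L2_mult_integrable[OF W L2_shift[OF E(2)]] L2_mult_integrable[OF W E(2)]
    have A1: "Jf b = - (\<integral>z. W b z * E z \<partial>lborel)" if "b \<le> T" for b
      using S[of b 0] that by (simp add: Jf_def power2_norm_eq_inner zero_prod_def[symmetric])
    \<comment> \<open>The symmetry S(b, -h) = S(b-h, h), which lets a mixed correlation be
      subtracted and added back.\<close>
    have A3: "(\<integral>z. indicator {..<b - h} (snd z) * (q z \<bullet> q (z + (0, h))) \<partial>lborel)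
       = (\<integral>z. indicator {..<b} (snd z) * (q z \<bullet> q (z + (0, - h))) \<partial>lborel)"
    proof -
      have "(\<integral>z. indicator {..<b} (snd (z + (0, h))) * (q (z + (0, h)) \<bullet> q (z + (0, h) + (0, - h))) \<partial>lborel)
        = (\<integral>z. indicator {..<b} (snd z) * (q z \<bullet> q (z + (0, - h))) \<partial>lborel)"
        by (rule lborel_integral_shift[of "\<lambda>z. indicator {..<b} (snd z) * (q z \<bullet> q (z + (0, - h)))"])
           (intro borel_measurable_times indm[simplified]; measurable)
      moreover have "indicator {..<b} (snd (z + (0, h))) * (q (z + (0, h)) \<bullet> q (z + (0, h) + (0, - h)))
         = indicator {..<b - h} (snd z) * (q z \<bullet> q (z + (0, h)))" for z
        by (simp add: add.assoc zero_prod_def[symmetric] inner_commute indicator_def less_diff_eq)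
      ultimately show ?thesis by simp
    qed
    have "Jf b - Jf (b - h) = - (\<integral>z. W b z * E z \<partial>lborel) + (\<integral>z. W b z * E (z + (0, - h)) \<partial>lborel)
        - (\<integral>z. W (b - h) z * E (z + (0, h)) \<partial>lborel) + (\<integral>z. W (b - h) z * E z \<partial>lborel)"
      using A1[of b] A1[of "b - h"] S[of b "- h"] S[of "b - h" h] A3 b h by simp
    also have "\<dots> = - (\<integral>z. W b z * (E z - E (z + (0, - h))) \<partial>lborel) - (\<integral>z. W (b - h) z * (E (z + (0, h)) - E z) \<partial>lborel)"
      unfolding right_diff_distrib using iWE by simp
    also have "(\<integral>z. W b z * (E z - E (z + (0, - h))) \<partial>lborel) = (\<integral>z. W b z * (tprim D (z + (0, 0)) - tprim D (z + (0, 0 - h))) \<partial>lborel)"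
    proof (rule integral_cong_AE)
      show "AE z in lborel. W b z * (E z - E (z + (0, - h))) = W b z * (tprim D (z + (0, 0)) - tprim D (z + (0, 0 - h)))"
        using EI AE_lborel_shift[OF EI, of "(0, - h)"]
      proof eventually_elim
        case (elim z)
        show ?case
        proof (cases "z \<in> Q")
          case True
          \<comment> \<open>The zero initial value enters here: E extended by zero to negative times
            is still the primitive of D, so no initial energy appears in the identity.\<close>
          have "E (z + (0, - h)) = tprim D (z + (0, - h))"
          proof (cases "z + (0, - h) \<in> Q")
            case False
            then have "snd (z + (0, - h)) \<le> 0" using True h by (auto simp: Q_def)
            then show ?thesis using tprim0 E(3)[OF False] by simp
          qed (use elim in simp)
          then show ?thesis using elim True by (simp add: zero_prod_def[symmetric])
        qed (simp add: W_def P(2))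
      qed
    qed measurable
    also have "(\<integral>z. W (b - h) z * (E (z + (0, h)) - E z) \<partial>lborel) = (\<integral>z. W (b - h) z * (tprim D (z + (0, h)) - tprim D (z + (0, h - h))) \<partial>lborel)"
    proof (rule integral_cong_AE)
      show "AE z in lborel. W (b - h) z * (E (z + (0, h)) - E z) = W (b - h) z * (tprim D (z + (0, h)) - tprim D (z + (0, h - h)))"
        using EI AE_lborel_shift[OF EI, of "(0, h)"]
      proof eventually_elim
        case (elim z)
        show ?case
        proof (cases "z \<in> Q \<and> snd z < b - h")
          case True
          then have "z + (0, h) \<in> Q" using b h by (auto simp: Q_def)
          then show ?thesis using elim True by (simp add: zero_prod_def[symmetric])
        next
          case False
          then have "W (b - h) z = 0" using P(2)[of z] by (auto simp: W_def)
          then show ?thesis by simp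
        qed
      qed
    qed measurable
    finally have eq: "Jf b - Jf (b - h) = - (\<integral>z. W b z * (tprim D (z + (0, 0)) - tprim D (z + (0, 0 - h))) \<partial>lborel)
       - (\<integral>z. W (b - h) z * (tprim D (z + (0, h)) - tprim D (z + (0, h - h))) \<partial>lborel)" .
    have e1: "\<bar>(\<integral>z. W b z * (tprim D (z + (0, 0)) - tprim D (z + (0, 0 - h))) \<partial>lborel) - h * (\<integral>z. W b z * D z \<partial>lborel)\<bar>
        \<le> h * (L2norm lborel (W b) * \<omega>)"
      by (rule L2_time_increment[OF D(1) iD W h]) (use \<omega> in auto)
    have e2: "\<bar>(\<integral>z. W (b - h) z * (tprim D (z + (0, h)) - tprim D (z + (0, h - h))) \<partial>lborel) - h * (\<integral>z. W (b - h) z * D z \<partial>lborel)\<bar>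
        \<le> h * (L2norm lborel (W (b - h)) * \<omega>)"
      by (rule L2_time_increment[OF D(1) iD W h]) (use \<omega> in auto)
    have e3: "h * (L2norm lborel (W c) * \<omega>) \<le> h * (L2norm lborel P * \<omega>)" for c
      using h Wn \<omega>0 by (intro mult_left_mono mult_right_mono) auto
    have NW: "N c = - 2 * (\<integral>z. W c z * D z \<partial>lborel)" for c by (simp add: N_def W_def mult.assoc)
    have "h * ((N b + N (b - h)) / 2) = - (h * (\<integral>z. W b z * D z \<partial>lborel)) - h * (\<integral>z. W (b - h) z * D z \<partial>lborel)"
      unfolding NW by (simp add: field_simps)
    then show ?thesis using e1 e2 e3[of b] e3[of "b - h"] unfolding eq by (simp only: abs_le_iff) linarith
  qed
  have trans: "\<exists>d>0. \<forall>\<tau>. \<bar>\<tau>\<bar> < d \<longrightarrow> L2norm lborel (\<lambda>z. D (z + (0, \<tau>)) - D z) < \<epsilon>" if "\<epsilon> > 0" for \<epsilon>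
  proof -
    have "(\<lambda>\<tau>. L2norm lborel (\<lambda>z. D (z + (0, \<tau>)) - D z)) \<midarrow>0\<rightarrow> 0"
      unfolding LIMSEQ_SEQ_conv[symmetric]
    proof (intro allI impI)
      fix X :: "nat \<Rightarrow> real" assume "(\<forall>n. X n \<noteq> 0) \<and> X \<longlonglongrightarrow> 0"
      then have "(\<lambda>n. (0::'a, X n)) \<longlonglongrightarrow> (0, 0)" by (intro tendsto_intros) auto
      then have "(\<lambda>n. (0::'a, X n)) \<longlonglongrightarrow> 0" by (simp add: zero_prod_def)
      from L2_translation[OF D(1) this] show "(\<lambda>n. L2norm lborel (\<lambda>z. D (z + (0, X n)) - D z)) \<longlonglongrightarrow> 0" .
    qed
    from LIM_D[OF this that] obtain d where d: "d > 0" "\<And>\<tau>. \<tau> \<noteq> 0 \<Longrightarrow> \<bar>\<tau>\<bar> < d \<Longrightarrow> L2norm lborel (\<lambda>z. D (z + (0, \<tau>)) - D z) < \<epsilon>"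
      by auto
    have "L2norm lborel (\<lambda>z. D (z + (0, 0)) - D z) < \<epsilon>" using that by (simp add: zero_prod_def[symmetric] L2norm_def)
    with d show ?thesis by metis
  qed
  have deriv: "(Jf has_real_derivative N b) (at b)" if b: "0 < b" "b < T" for b
    unfolding DERIV_def
  proof (rule LIM_I)
    fix \<epsilon> :: real assume \<epsilon>: "0 < \<epsilon>"
    \<comment> \<open>The added 1 makes division possible when P vanishes.\<close>
    define C where "C = 2 * L2norm lborel P + 1"
    have C: "C > 0" "2 * L2norm lborel P \<le> C" using L2norm_nonneg[of lborel P] by (auto simp: C_def intro: add_nonneg_pos)
    obtain d1 where d1: "d1 > 0" "\<And>\<tau>. \<bar>\<tau>\<bar> < d1 \<Longrightarrow> L2norm lborel (\<lambda>z. D (z + (0, \<tau>)) - D z) < \<epsilon> / (4 * C)"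
      using trans[of "\<epsilon> / (4 * C)"] \<epsilon> C by auto
    have "isCont N b" using cN continuous_on_eq_continuous_at[OF open_UNIV] by blast
    then have "N \<midarrow>b\<rightarrow> N b" by (simp add: isCont_def)
    from LIM_D[OF this, of \<epsilon>] \<epsilon> obtain d2 where d2: "d2 > 0" "\<And>x. x \<noteq> b \<Longrightarrow> \<bar>x - b\<bar> < d2 \<Longrightarrow> \<bar>N x - N b\<bar> < \<epsilon>" by auto
    show "\<exists>s>0. \<forall>h::real. h \<noteq> 0 \<and> norm (h - 0) < s \<longrightarrow> norm ((Jf (b + h) - Jf b) / h - N b) < \<epsilon>"
    proof (intro exI[of _ "min (min d1 d2) (T - b)"] conjI allI impI)
      show "0 < min (min d1 d2) (T - b)" using d1 d2 b by simp
      fix h :: real assume "h \<noteq> 0 \<and> norm (h - 0) < min (min d1 d2) (T - b)"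
      then have h: "h \<noteq> 0" "\<bar>h\<bar> < d1" "\<bar>h\<bar> < d2" "\<bar>h\<bar> < T - b" by auto
      have \<omega>: "L2norm lborel (\<lambda>z. D (z + (0, \<tau>)) - D z) \<le> \<epsilon> / (4 * C)" if "\<bar>\<tau>\<bar> \<le> \<bar>h\<bar>" for \<tau>
        using d1(2)[of \<tau>] that h by simp
      have est: "\<bar>Jf (b + h) - Jf b - h * ((N (b + h) + N b) / 2)\<bar> \<le> 2 * \<bar>h\<bar> * (L2norm lborel P * (\<epsilon> / (4 * C)))"
      proof (cases "h > 0")
        case True
        then show ?thesis using diff[of "b + h" h "\<epsilon> / (4 * C)"] \<omega> h by simp
      next
        case False
        then have "\<bar>Jf b - Jf (b - (- h)) - (- h) * ((N b + N (b - (- h))) / 2)\<bar> \<le> 2 * (- h) * (L2norm lborel P * (\<epsilon> / (4 * C)))"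
          using \<omega> h b by (intro diff) auto
        moreover have "\<bar>Jf (b + h) - Jf b - h * ((N (b + h) + N b) / 2)\<bar> = \<bar>Jf b - Jf (b - (- h)) - (- h) * ((N b + N (b - (- h))) / 2)\<bar>"
        proof -
          have "Jf (b + h) - Jf b - h * ((N (b + h) + N b) / 2) = - (Jf b - Jf (b - (- h)) - (- h) * ((N b + N (b - (- h))) / 2))"
            by (simp add: field_simps)
          then show ?thesis by (simp only: abs_minus_cancel)
        qed
        ultimately show ?thesis using False by simp
      qed
      also have "2 * \<bar>h\<bar> * (L2norm lborel P * (\<epsilon> / (4 * C))) = \<bar>h\<bar> * ((2 * L2norm lborel P) * (\<epsilon> / (4 * C)))" by simp
      also have "\<dots> \<le> \<bar>h\<bar> * (C * (\<epsilon> / (4 * C)))" using C \<epsilon> by (intro mult_left_mono mult_right_mono) auto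
      also have "\<dots> = \<bar>h\<bar> * (\<epsilon> / 4)" using C by simp
      finally have est2: "\<bar>Jf (b + h) - Jf b - h * ((N (b + h) + N b) / 2)\<bar> \<le> \<bar>h\<bar> * (\<epsilon> / 4)" .
      have "(Jf (b + h) - Jf b) / h - (N (b + h) + N b) / 2 = (Jf (b + h) - Jf b - h * ((N (b + h) + N b) / 2)) / h"
        using h by (simp add: field_simps)
      then have "\<bar>(Jf (b + h) - Jf b) / h - (N (b + h) + N b) / 2\<bar> = \<bar>Jf (b + h) - Jf b - h * ((N (b + h) + N b) / 2)\<bar> / \<bar>h\<bar>"
        by (simp add: abs_divide)
      also have "\<dots> \<le> \<epsilon> / 4" using est2 h by (simp add: pos_divide_le_eq mult.commute)
      finally have 1: "\<bar>(Jf (b + h) - Jf b) / h - (N (b + h) + N b) / 2\<bar> \<le> \<epsilon> / 4" .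
      have 2: "\<bar>N (b + h) - N b\<bar> < \<epsilon>" using d2(2)[of "b + h"] h by simp
      show "norm ((Jf (b + h) - Jf b) / h - N b) < \<epsilon>"
      proof -
        have "\<bar>Y - n\<bar> < \<epsilon>" if "\<bar>Y - (n' + n) / 2\<bar> \<le> \<epsilon> / 4" "\<bar>n' - n\<bar> < \<epsilon>" for Y n n' :: real
        proof -
          have "Y - (n' + n) / 2 \<le> \<epsilon> / 4" "- (Y - (n' + n) / 2) \<le> \<epsilon> / 4" "n' - n < \<epsilon>" "n - n' < \<epsilon>"
            using that by linarith+
          then have "Y - n < \<epsilon>" "- (Y - n) < \<epsilon>" using \<epsilon> by (simp_all add: field_simps)
          then show ?thesis by linarith
        qed
        from this[OF 1 2] show ?thesis by simp
      qed
    qed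
  qed
  \<comment> \<open>The derivative is known strictly between 0 and T; continuity of
    \<open>Jf\<close> covers the end points.\<close>
  have FTC: "(\<integral>t. indicator {c..T} t * N t \<partial>lborel) = Jf T - Jf c" if c: "0 \<le> c" "c \<le> T" for c
  proof -
    have "(N has_integral (Jf T - Jf c)) {c..T}"
      using c deriv continuous_on_subset[OF cJ]
      by (intro fundamental_theorem_of_calculus_interior) (auto simp: has_real_derivative_iff_has_vector_derivative)
    moreover have "set_integrable lborel {c..T} N"
      by (intro borel_integrable_atLeastAtMost' continuous_on_subset[OF cN]) auto
    ultimately show ?thesis
      using set_borel_integral_eq_integral(2)[of "{c..T}" N] by (simp add: set_lebesgue_integral_def integral_unique)
  qed
  define M where "M t = (\<integral>x. (norm (q (x, t)))\<^sup>2 \<partial>lborel)" for t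
  have iq2: "integrable (lborel \<Otimes>\<^sub>M lborel) (\<lambda>(x, t). (norm (q (x, t)))\<^sup>2)"
    using L2_integrable[OF q(1)] by (simp add: lborel_prod split_beta')
  have iM: "integrable lborel M" unfolding M_def using lborel_pair.integrable_snd[OF iq2] by simp
  have JM: "Jf b = (\<integral>t. indicator {..<b} t * M t \<partial>lborel)" for b
  proof -
    have "integrable lborel (\<lambda>z. indicator {..<b} (snd z) * (norm (q z))\<^sup>2)"
    proof (rule Bochner_Integration.integrable_bound[OF L2_integrable[OF q(1)]])
      show "(\<lambda>z. indicator {..<b} (snd z) * (norm (q z))\<^sup>2) \<in> borel_measurable lborel"
        by (intro borel_measurable_times indm) measurable
    qed (auto simp: indicator_def)
    then have i: "integrable (lborel \<Otimes>\<^sub>M lborel) (\<lambda>(x, t). indicator {..<b} t * (norm (q (x, t)))\<^sup>2)"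
      by (simp add: lborel_prod split_beta')
    have "(\<integral>t. indicator {..<b} t * M t \<partial>lborel) = (\<integral>t. \<integral>x. indicator {..<b} t * (norm (q (x, t)))\<^sup>2 \<partial>lborel \<partial>lborel)"
      unfolding M_def by simp
    also have "\<dots> = integral\<^sup>L (lborel \<Otimes>\<^sub>M lborel) (\<lambda>(x, t). indicator {..<b} t * (norm (q (x, t)))\<^sup>2)"
      by (rule lborel_pair.integral_snd[OF i])
    also have "\<dots> = Jf b" by (simp add: Jf_def lborel_prod split_beta')
    finally show ?thesis by simp
  qed
  have M0: "M t = 0" if "t \<notin> {0<..<T}" for t
  proof -
    have "q (x, t) = 0" for x using that by (intro q(2)) (auto simp: Q_def)
    then show ?thesis by (simp add: M_def)
  qed
  have [measurable]: "M \<in> borel_measurable borel" "N \<in> borel_measurable borel"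
    using borel_measurable_integrable[OF iM] borel_measurable_continuous_onI[OF cN] by auto
  \<comment> \<open>The tails of M - N vanish because M and N both integrate to the increments of
    \<open>Jf\<close>, the first by Fubini, the second by the fundamental theorem.\<close>
  define f where "f t = indicator {0<..<T} t * (M t - N t)" for t
  have iindN: "integrable lborel (\<lambda>t. indicator {c..T} t * N t)" for c
  proof -
    have "set_integrable lborel {c..T} N"
      by (intro borel_integrable_atLeastAtMost' continuous_on_subset[OF cN]) auto
    then show ?thesis by (simp add: set_integrable_def)
  qed
  have iindM: "integrable lborel (\<lambda>t. indicator {..<c} t * M t)" for c :: real
    using integrable_mult_indicator[OF _ iM, of "{..<c}"] by simp
  have AEne: "AE t in lborel. t \<noteq> (c::real)" for c by (rule AE_lborel_singleton)
  have "integrable lborel (\<lambda>t. indicator {0<..<T} t * M t)" "integrable lborel (\<lambda>t. indicator {0<..<T} t * N t)"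
  proof -
    show "integrable lborel (\<lambda>t. indicator {0<..<T} t * M t)"
      using integrable_mult_indicator[OF _ iM, of "{0<..<T}"] by simp
    show "integrable lborel (\<lambda>t. indicator {0<..<T} t * N t)"
      by (rule Bochner_Integration.integrable_bound[OF iindN[of 0]]) (auto simp: indicator_def)
  qed
  then have if': "integrable lborel f" unfolding f_def right_diff_distrib by simp
  have "(\<integral>t. indicator {c<..} t * f t \<partial>lborel) = 0" for c
  proof (cases "c < T")
    case True
    define c' where "c' = max 0 c"
    have c': "0 \<le> c'" "c' \<le> T" using True T by (auto simp: c'_def)
    have "(\<integral>t. indicator {c<..} t * f t \<partial>lborel)
      = (\<integral>t. (indicator {..<T} t * M t - indicator {..<c'} t * M t) - indicator {c'..T} t * N t \<partial>lborel)"
    proof (rule integral_cong_AE)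
      show "AE t in lborel. indicator {c<..} t * f t = (indicator {..<T} t * M t - indicator {..<c'} t * M t) - indicator {c'..T} t * N t"
        using AEne[of c'] AEne[of T] AEne[of c] AEne[of 0]
      proof eventually_elim
        case (elim t)
        then show ?case using True M0[of t] by (auto simp: f_def c'_def indicator_def)
      qed
    qed (use borel_measurable_integrable[OF if'] in measurable)
    also have "\<dots> = (Jf T - Jf c') - (\<integral>t. indicator {c'..T} t * N t \<partial>lborel)"
      unfolding JM using iindM[of T] iindM[of c'] iindN[of c'] by simp
    finally show ?thesis unfolding FTC[OF c'] by simp
  next
    case False
    then have "indicator {c<..} t * f t = 0" for t by (auto simp: f_def indicator_def)
    then show ?thesis by (simp only: Bochner_Integration.integral_zero)
  qed
  then have "AE t in lborel. f t = 0" by (rule AE_zero_of_tail_integrals[OF if'])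
  then have AE: "AE t in lborel. t \<in> {0<..<T} \<longrightarrow> N t = (\<integral>x. (norm (q (x, t)))\<^sup>2 \<partial>lborel)"
    by eventually_elim (auto simp: f_def M_def)
  have "N T = - 2 * (\<integral>z. P z * D z \<partial>lborel)"
  proof -
    have "indicator {..<T} (snd z) * (P z * D z) = P z * D z" for z
      using P(2)[of z] by (cases "z \<in> Q") (auto simp: Q_def)
    then show ?thesis by (simp only: N_def)
  qed
  with AE cN show ?thesis by (intro exI[of _ N]) (auto intro: continuous_on_subset)
qed

section \<open>Values at the initial and the final time\<close>

definition dtime :: "('a::euclidean_space \<times> real \<Rightarrow> real) \<Rightarrow> 'a \<times> real \<Rightarrow> real" where
  "dtime F z = frechet_derivative F (at z) (0, 1)"

lemma continuous_dtime: "C_k (Suc 0) F \<Longrightarrow> continuous_on UNIV (dtime F)"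
  unfolding dtime_def by simp

lemma dtime_DERIV:
  assumes "C_k (Suc 0) F" shows "((\<lambda>t. F (x, t)) has_real_derivative dtime F (x, t)) (at t)"
proof -
  have "((\<lambda>t. (x, t)) has_derivative (\<lambda>u. (0, u))) (at t)" by (auto intro!: derivative_eq_intros)
  from has_derivative_compose[OF this C_k_has_derivative[OF assms]]
  have "((\<lambda>t. F (x, t)) has_derivative (\<lambda>u. frechet_derivative F (at (x, t)) (0, u))) (at t)" .
  moreover have "frechet_derivative F (at (x, t)) (0, u) = dtime F (x, t) * u" for u
  proof -
    have "frechet_derivative F (at (x, t)) (u *\<^sub>R (0, 1)) = u *\<^sub>R frechet_derivative F (at (x, t)) (0, 1)"
      by (rule linear_cmul[OF has_derivative_linear[OF C_k_has_derivative[OF assms]]])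
    then show ?thesis by (simp add: dtime_def)
  qed
  ultimately show ?thesis by (simp add: has_field_derivative_def)
qed

lemma lborel_FTC:
  fixes F f :: "real \<Rightarrow> real"
  assumes "a \<le> b" "\<And>t. (F has_real_derivative f t) (at t)" "continuous_on UNIV f"
  shows "integrable lborel (\<lambda>t. indicator {a..b} t * f t)" "(\<integral>t. indicator {a..b} t * f t \<partial>lborel) = F b - F a"
proof -
  have s: "set_integrable lborel {a..b} f"
    by (intro borel_integrable_atLeastAtMost' continuous_on_subset[OF assms(3)]) auto
  then show "integrable lborel (\<lambda>t. indicator {a..b} t * f t)" by (simp add: set_integrable_def)
  have "(f has_integral (F b - F a)) {a..b}"
    using assms by (intro fundamental_theorem_of_calculus)
      (auto simp: has_real_derivative_iff_has_vector_derivative[symmetric] intro: has_field_derivative_at_within)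
  then show "(\<integral>t. indicator {a..b} t * f t \<partial>lborel) = F b - F a"
    using set_borel_integral_eq_integral(2)[OF s] by (simp add: set_lebesgue_integral_def integral_unique)
qed

lemma nn_integral_L2norm:
  "f \<in> L2 M \<Longrightarrow> (\<integral>\<^sup>+z. ennreal ((norm (f z))\<^sup>2) \<partial>M) = ennreal ((L2norm M f)\<^sup>2)"
  unfolding L2norm_sq by (intro nn_integral_eq_integral L2_integrable) auto

text \<open>On each vertical line the left side is the square of the integral of
  \<open>dtime F - D\<close> over (a,b), to which Cauchy-Schwarz applies.\<close>

lemma slice_increment:
  fixes F D :: "'a::euclidean_space \<times> real \<Rightarrow> real"
  assumes F: "C_k (Suc 0) F" and D: "D \<in> borel_measurable borel" "\<And>z. snd z \<notin> {0<..<T} \<Longrightarrow> D z = 0"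
    and T: "0 < T" and ab: "0 \<le> a" "a \<le> b" "b \<le> T"
  shows "ennreal ((F (x, b) - F (x, a) - (tprim D (x, b) - tprim D (x, a)))\<^sup>2)
    \<le> ennreal T * (\<integral>\<^sup>+s. indicator {0<..<T} s * ennreal ((dtime F (x, s) - D (x, s))\<^sup>2) \<partial>lborel)"
proof -
  let ?R = "\<integral>\<^sup>+s. indicator {0<..<T} s * ennreal ((dtime F (x, s) - D (x, s))\<^sup>2) \<partial>lborel"
  have cg: "continuous_on UNIV (\<lambda>s. dtime F (x, s))"
    by (rule continuous_on_compose2[OF continuous_dtime[OF F]]) (auto intro!: continuous_intros)
  have [measurable]: "(\<lambda>s. dtime F (x, s)) \<in> borel_measurable borel" by (rule borel_measurable_continuous_onI[OF cg])
  have [measurable]: "(\<lambda>s. D (x, s)) \<in> borel_measurable borel" by (rule borel_measurable_Pair_slice[OF D(1)])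
  define d where "d s = indicator {0<..<T} s * (dtime F (x, s) - D (x, s))" for s
  have [measurable]: "d \<in> borel_measurable borel" unfolding d_def by measurable
  have Rd: "?R = (\<integral>\<^sup>+s. ennreal ((norm (d s))\<^sup>2) \<partial>lborel)"
    by (intro nn_integral_cong) (auto simp: d_def indicator_def)
  show ?thesis
  \<comment> \<open>For an infinite right side there is nothing to show. A finite one makes D
    integrable on this line, so that \<open>tprim\<close> is a genuine primitive there and not the
    default value.\<close>
  proof (cases "?R = \<infinity>")
    case True
    then show ?thesis using T by (simp add: ennreal_mult_top)
  next
    case False
    have d2: "d \<in> L2 lborel"
      by (rule L2_I) (use False in \<open>auto simp: Rd integrable_iff_bounded less_top\<close>)
    have id: "integrable lborel d"
      by (rule bounded_support_L2_integrable[OF d2, where S="{0<..<T}"]) (auto simp: d_def)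
    have idi: "integrable lborel (\<lambda>s. indicator A s * d s)" if "A \<in> sets borel" for A
      using integrable_mult_indicator[OF _ id, of A] that by simp
    have ig: "integrable lborel (\<lambda>s. indicator {0..T} s * dtime F (x, s))"
      using lborel_FTC(1)[of 0 T "\<lambda>t. F (x, t)" "\<lambda>t. dtime F (x, t)"] T dtime_DERIV[OF F] cg by simp
    have AEne: "AE t in lborel. t \<noteq> (c::real)" for c by (rule AE_lborel_singleton)
    have iD: "integrable lborel (\<lambda>s. D (x, s))"
    proof -
      have "integrable lborel (\<lambda>s. indicator {0<..<T} s * dtime F (x, s) - d s)"
        by (intro Bochner_Integration.integrable_diff id Bochner_Integration.integrable_bound[OF ig]) (auto simp: indicator_def)
      moreover have "indicator {0<..<T} s * dtime F (x, s) - d s = D (x, s)" for s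
        using D(2)[of "(x, s)"] by (auto simp: d_def indicator_def)
      ultimately show ?thesis by simp
    qed
    have iDi: "integrable lborel (\<lambda>s. indicator {..<r} s * D (x, s))" for r :: real
      using integrable_mult_indicator[OF _ iD, of "{..<r}"] by simp
    have igab: "integrable lborel (\<lambda>t. indicator {a..b} t * dtime F (x, t))"
      and FTC: "(\<integral>t. indicator {a..b} t * dtime F (x, t) \<partial>lborel) = F (x, b) - F (x, a)"
      using lborel_FTC[of a b "\<lambda>t. F (x, t)" "\<lambda>t. dtime F (x, t)"] ab dtime_DERIV[OF F] cg by auto
    have "F (x, b) - F (x, a) - (tprim D (x, b) - tprim D (x, a))
      = (\<integral>t. indicator {a..b} t * dtime F (x, t) - (indicator {..<b} t * D (x, t) - indicator {..<a} t * D (x, t)) \<partial>lborel)"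
      unfolding FTC[symmetric] tprim_def using igab iDi by simp
    also have "\<dots> = (\<integral>t. indicator {a<..<b} t * d t \<partial>lborel)"
    proof (rule integral_cong_AE)
      show "AE t in lborel. indicator {a..b} t * dtime F (x, t) - (indicator {..<b} t * D (x, t) - indicator {..<a} t * D (x, t)) = indicator {a<..<b} t * d t"
        using AEne[of a] AEne[of b]
        by eventually_elim (use ab in \<open>auto simp: d_def indicator_def\<close>)
    qed measurable
    finally have eq: "F (x, b) - F (x, a) - (tprim D (x, b) - tprim D (x, a)) = (\<integral>t. indicator {a<..<b} t * d t \<partial>lborel)" .
    have I2: "(\<lambda>t. indicator {a<..<b} t :: real) \<in> L2 lborel"
      by (rule L2_I, measurable, rule integrable_bounded_support[where S="{a<..<b}" and B=1]) (auto simp: indicator_def)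
    have "(L2norm lborel (\<lambda>t. indicator {a<..<b} t :: real))\<^sup>2 = b - a"
    proof -
      have "(norm (indicator {a<..<b} t :: real))\<^sup>2 = indicator {a<..<b} t" for t by (simp add: indicator_def)
      then show ?thesis unfolding L2norm_sq using ab by simp
    qed
    moreover have "\<bar>\<integral>t. indicator {a<..<b} t * d t \<partial>lborel\<bar> \<le> L2norm lborel (\<lambda>t. indicator {a<..<b} t :: real) * L2norm lborel d"
      by (rule L2_Cauchy_Schwarz_mult[OF I2 d2])
    then have "\<bar>\<integral>t. indicator {a<..<b} t * d t \<partial>lborel\<bar>\<^sup>2 \<le> (L2norm lborel (\<lambda>t. indicator {a<..<b} t :: real) * L2norm lborel d)\<^sup>2"
      by (intro power_mono) auto
    ultimately have "(\<integral>t. indicator {a<..<b} t * d t \<partial>lborel)\<^sup>2 \<le> (b - a) * (L2norm lborel d)\<^sup>2"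
      by (simp add: power_mult_distrib)
    also have "\<dots> \<le> T * (L2norm lborel d)\<^sup>2" using ab by (intro mult_right_mono) auto
    finally have "ennreal ((\<integral>t. indicator {a<..<b} t * d t \<partial>lborel)\<^sup>2) \<le> ennreal (T * (L2norm lborel d)\<^sup>2)" by (rule ennreal_leI)
    also have "\<dots> = ennreal T * ?R" unfolding Rd nn_integral_L2norm[OF d2] using T by (simp add: ennreal_mult)
    finally show ?thesis unfolding eq .
  qed
qed

lemma square_sum_ennreal: "ennreal ((a + b)\<^sup>2) \<le> 2 * ennreal (a\<^sup>2) + 2 * ennreal ((b::real)\<^sup>2)"
proof -
  have "(a + b)\<^sup>2 \<le> 2 * a\<^sup>2 + 2 * b\<^sup>2" using sum_squares_bound[of a b] by (simp add: power2_sum)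
  then have "ennreal ((a + b)\<^sup>2) \<le> ennreal (2 * a\<^sup>2 + 2 * b\<^sup>2)" by (rule ennreal_leI)
  then show ?thesis by (simp add: ennreal_mult)
qed

text \<open>For smooth F the increments of F - \<open>tprim D\<close> in time are controlled by
  \<open>dtime F - D\<close> alone. Starting from the initial time this identifies E with
  \<open>tprim D\<close>; averaging over the starting time shows that the values at T of every
  admissible sequence converge to those of \<open>tprim D\<close>, so the final trace is unique. The
  last identity is the limit of the fundamental theorem for the square of \<phi> k.\<close>

lemma time_traces:
  fixes \<Omega> :: "'a::euclidean_space set" and E D :: "'a \<times> real \<Rightarrow> real" and \<phi> :: "nat \<Rightarrow> 'a \<times> real \<Rightarrow> real" and T :: real
  defines "Q \<equiv> \<Omega> \<times> {0<..<T}" and "f \<equiv> \<lambda>x. indicator \<Omega> x * tprim D (x, T)"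
  assumes \<Omega>: "open \<Omega>" "bounded \<Omega>" and T: "0 < T"
    and E: "E \<in> L2 lborel" "\<And>z. z \<notin> Q \<Longrightarrow> E z = 0" and D: "D \<in> L2 lborel" "\<And>z. z \<notin> Q \<Longrightarrow> D z = 0"
    and \<phi>: "\<And>k. C_k (Suc 0) (\<phi> k)" "L2_tendsto lborel (\<lambda>k z. indicator Q z * \<phi> k z) E"
      "L2_tendsto lborel (\<lambda>k z. indicator Q z * dtime (\<phi> k) z) D"
    and init: "L2_tendsto lborel (\<lambda>k x. indicator \<Omega> x * \<phi> k (x, 0)) (\<lambda>x. 0)"
  shows "AE z in lborel. z \<in> Q \<longrightarrow> E z = tprim D z"
    and "f \<in> L2 lborel"
    and "\<And>\<psi>. (\<And>k. C_k (Suc 0) (\<psi> k)) \<Longrightarrow> L2_tendsto lborel (\<lambda>k z. indicator Q z * \<psi> k z) E \<Longrightarrow>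
      L2_tendsto lborel (\<lambda>k z. indicator Q z * dtime (\<psi> k) z) D \<Longrightarrow> L2_tendsto lborel (\<lambda>k x. indicator \<Omega> x * \<psi> k (x, T)) f"
    and "(L2norm lborel f)\<^sup>2 = 2 * (\<integral>z. E z * D z \<partial>lborel)"
proof -
  have Qs: "Q \<in> sets borel" "bounded Q"
    unfolding Q_def using \<Omega> by (auto intro!: borel_open open_Times bounded_Times)
  have \<Omega>s: "\<Omega> \<in> sets borel" using \<Omega> by auto
  have Em[measurable]: "E \<in> borel_measurable borel" and Dm[measurable]: "D \<in> borel_measurable borel"
    using L2_measurable[OF E(1)] L2_measurable[OF D(1)] by simp_all
  note [measurable] = Qs(1) \<Omega>s
  have tpm[measurable]: "tprim D \<in> borel_measurable borel" by (rule borel_measurable_tprim) measurable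
  have tpT[measurable]: "(\<lambda>x. tprim D (x, T)) \<in> borel_measurable borel"
    by (rule measurable_compose[OF _ tpm]) (intro borel_measurable_continuous_onI continuous_intros)
  have Dsnd: "D z = 0" if "snd z \<notin> {0<..<T}" for z using that by (intro D(2)) (auto simp: Q_def)
  have tprim0: "tprim D (x, 0) = 0" for x
  proof -
    have "indicator {..<0} s * D (x, s) = 0" for s :: real using Dsnd[of "(x, s)"] by (auto simp: indicator_def)
    then show ?thesis unfolding tprim_def by (simp only: fst_conv snd_conv Bochner_Integration.integral_zero)
  qed
  have C1m: "F \<in> borel_measurable borel" "dtime F \<in> borel_measurable borel" if "C_k (Suc 0) F" for F :: "'a \<times> real \<Rightarrow> real"
    using borel_measurable_C_1(1)[OF that] borel_measurable_continuous_onI[OF continuous_dtime[OF that]] by auto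
  have C1x: "(\<lambda>x. F (x, t)) \<in> borel_measurable borel" if "C_k (Suc 0) F" for F :: "'a \<times> real \<Rightarrow> real" and t
    by (rule measurable_compose[OF _ C1m(1)[OF that]]) (intro borel_measurable_continuous_onI continuous_intros)
  define R where "R F x = (\<integral>\<^sup>+s. indicator {0<..<T} s * ennreal ((dtime F (x, s) - D (x, s))\<^sup>2) \<partial>lborel)" for F x
  have indQ: "indicator Q (x, t) = (indicator \<Omega> x * indicator {0<..<T} t :: ennreal)" for x t
    by (auto simp: Q_def indicator_def)
  have Rm: "R F \<in> borel_measurable lborel" if F: "C_k (Suc 0) F" for F
  proof -
    have "(\<lambda>z. indicator {0<..<T} (snd z) * ennreal ((dtime F z - D z)\<^sup>2)) \<in> borel_measurable borel"
    proof (rule borel_measurable_times_ennreal)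
      note [measurable] = C1m[OF F]
      show "(\<lambda>z. ennreal ((dtime F z - D z)\<^sup>2)) \<in> borel_measurable borel" by measurable
      show "(\<lambda>z::'a \<times> real. indicator {0<..<T} (snd z) :: ennreal) \<in> borel_measurable borel"
        by (rule measurable_compose[OF borel_snd borel_measurable_indicator]) simp
    qed
    then have "(\<lambda>z. indicator {0<..<T} (snd z) * ennreal ((dtime F z - D z)\<^sup>2)) \<in> borel_measurable (lborel \<Otimes>\<^sub>M lborel)"
      by (simp add: lborel_prod)
    from lborel.borel_measurable_nn_integral_fst[OF this] show ?thesis unfolding R_def[abs_def] by simp
  qed
  have RQ: "(\<integral>\<^sup>+x. indicator \<Omega> x * R F x \<partial>lborel) = (\<integral>\<^sup>+z. indicator Q z * ennreal ((dtime F z - D z)\<^sup>2) \<partial>lborel)"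
    if F: "C_k (Suc 0) F" for F
  proof -
    note [measurable] = C1m[OF F]
    have "(\<integral>\<^sup>+z. indicator Q z * ennreal ((dtime F z - D z)\<^sup>2) \<partial>lborel)
      = (\<integral>\<^sup>+x. \<integral>\<^sup>+t. indicator Q (x, t) * ennreal ((dtime F (x, t) - D (x, t))\<^sup>2) \<partial>lborel \<partial>lborel)"
      by (rule nn_integral_lborel_pair) measurable
    also have "\<dots> = (\<integral>\<^sup>+x. indicator \<Omega> x * R F x \<partial>lborel)"
    proof (rule nn_integral_cong)
      fix x
      have m: "(\<lambda>t. indicator {0<..<T} t * ennreal ((dtime F (x, t) - D (x, t))\<^sup>2)) \<in> borel_measurable lborel"
        using borel_measurable_Pair_slice[OF C1m(2)[OF F], of x] borel_measurable_Pair_slice[OF Dm, of x] by measurable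
      have "(\<integral>\<^sup>+t. indicator Q (x, t) * ennreal ((dtime F (x, t) - D (x, t))\<^sup>2) \<partial>lborel)
        = (\<integral>\<^sup>+t. indicator \<Omega> x * (indicator {0<..<T} t * ennreal ((dtime F (x, t) - D (x, t))\<^sup>2)) \<partial>lborel)"
        by (intro nn_integral_cong) (simp add: indQ mult.assoc)
      also have "\<dots> = indicator \<Omega> x * R F x" unfolding R_def by (rule nn_integral_cmult[OF m])
      finally show "(\<integral>\<^sup>+t. indicator Q (x, t) * ennreal ((dtime F (x, t) - D (x, t))\<^sup>2) \<partial>lborel) = indicator \<Omega> x * R F x" .
    qed
    finally show ?thesis by simp
  qed
  have TT: "(\<integral>\<^sup>+t. indicator {0<..<T} t * c \<partial>lborel) = ennreal T * c" for c
    using T by (subst nn_integral_multc) simp_all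
  \<comment> \<open>Increments from time 0, where \<open>tprim D\<close> vanishes, squared and
    integrated over Q; the factor T is the length of the time interval.\<close>
  have initial: "(\<integral>\<^sup>+z. indicator Q z * ennreal ((F z - tprim D z)\<^sup>2) \<partial>lborel)
     \<le> ennreal T * (2 * (\<integral>\<^sup>+x. indicator \<Omega> x * ennreal ((F (x, 0))\<^sup>2) \<partial>lborel) +
         2 * ennreal T * (\<integral>\<^sup>+z. indicator Q z * ennreal ((dtime F z - D z)\<^sup>2) \<partial>lborel))"
    if F: "C_k (Suc 0) F" for F
  proof -
    note [measurable] = C1m[OF F] C1x[OF F] Rm[OF F]
    have "(\<integral>\<^sup>+z. indicator Q z * ennreal ((F z - tprim D z)\<^sup>2) \<partial>lborel)
      = (\<integral>\<^sup>+x. \<integral>\<^sup>+t. indicator Q (x, t) * ennreal ((F (x, t) - tprim D (x, t))\<^sup>2) \<partial>lborel \<partial>lborel)"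
      by (rule nn_integral_lborel_pair) measurable
    also have "\<dots> \<le> (\<integral>\<^sup>+x. \<integral>\<^sup>+t. indicator {0<..<T} t * (indicator \<Omega> x * (2 * ennreal ((F (x, 0))\<^sup>2) + 2 * (ennreal T * R F x))) \<partial>lborel \<partial>lborel)"
    proof (intro nn_integral_mono)
      fix x and t :: real
      show "indicator Q (x, t) * ennreal ((F (x, t) - tprim D (x, t))\<^sup>2) \<le> indicator {0<..<T} t * (indicator \<Omega> x * (2 * ennreal ((F (x, 0))\<^sup>2) + 2 * (ennreal T * R F x)))"
      proof (cases "t \<in> {0<..<T} \<and> x \<in> \<Omega>")
        case True
        then have "ennreal ((F (x, t) - F (x, 0) - (tprim D (x, t) - tprim D (x, 0)))\<^sup>2) \<le> ennreal T * R F x"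
          unfolding R_def by (intro slice_increment F Dsnd T) auto
        then have le: "ennreal ((F (x, t) - F (x, 0) - tprim D (x, t))\<^sup>2) \<le> ennreal T * R F x" by (simp add: tprim0)
        have "ennreal ((F (x, t) - tprim D (x, t))\<^sup>2) = ennreal ((F (x, 0) + (F (x, t) - F (x, 0) - tprim D (x, t)))\<^sup>2)" by simp
        also have "\<dots> \<le> 2 * ennreal ((F (x, 0))\<^sup>2) + 2 * ennreal ((F (x, t) - F (x, 0) - tprim D (x, t))\<^sup>2)"
          by (rule square_sum_ennreal)
        also have "\<dots> \<le> 2 * ennreal ((F (x, 0))\<^sup>2) + 2 * (ennreal T * R F x)"
          by (intro add_left_mono mult_left_mono le) auto
        finally show ?thesis using True by (simp add: indQ)
      next
        case False
        then have "indicator Q (x, t) = (0::ennreal)" by (auto simp: Q_def indicator_def)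
        then show ?thesis by (simp only: mult_zero_left zero_le)
      qed
    qed
    also have "\<dots> = (\<integral>\<^sup>+x. ennreal T * (2 * (indicator \<Omega> x * ennreal ((F (x, 0))\<^sup>2)) + 2 * ennreal T * (indicator \<Omega> x * R F x)) \<partial>lborel)"
      unfolding TT by (intro nn_integral_cong) (simp add: distrib_left mult_ac)
    also have "\<dots> = ennreal T * (2 * (\<integral>\<^sup>+x. indicator \<Omega> x * ennreal ((F (x, 0))\<^sup>2) \<partial>lborel) + 2 * ennreal T * (\<integral>\<^sup>+x. indicator \<Omega> x * R F x \<partial>lborel))"
    proof -
      have m1: "(\<lambda>x. indicator \<Omega> x * ennreal ((F (x, 0))\<^sup>2)) \<in> borel_measurable lborel" by measurable
      have m2: "(\<lambda>x. indicator \<Omega> x * R F x) \<in> borel_measurable lborel" by measurable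
      show ?thesis
        using m1 m2 by (subst nn_integral_cmult, measurable, subst nn_integral_add) (auto simp: nn_integral_cmult)
    qed
    finally show ?thesis unfolding RQ[OF F] .
  qed
  \<comment> \<open>The factor T on the left stems from integrating the final value over all
    starting times t. The bound then involves the distance inside Q and that of the time
    derivatives, but no initial values.\<close>
  have final: "ennreal T * (\<integral>\<^sup>+x. indicator \<Omega> x * ennreal ((F (x, T) - tprim D (x, T))\<^sup>2) \<partial>lborel)
     \<le> 2 * (\<integral>\<^sup>+z. indicator Q z * ennreal ((F z - tprim D z)\<^sup>2) \<partial>lborel) +
         ennreal T * (2 * ennreal T * (\<integral>\<^sup>+z. indicator Q z * ennreal ((dtime F z - D z)\<^sup>2) \<partial>lborel))"
    if F: "C_k (Suc 0) F" for F
  proof -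
    note [measurable] = C1m[OF F] C1x[OF F] Rm[OF F]
    let ?X = "\<lambda>x. ennreal ((F (x, T) - tprim D (x, T))\<^sup>2)"
    have m0: "(\<lambda>x. indicator \<Omega> x * ?X x) \<in> borel_measurable lborel" by measurable
    have "ennreal T * (\<integral>\<^sup>+x. indicator \<Omega> x * ?X x \<partial>lborel) = (\<integral>\<^sup>+x. ennreal T * (indicator \<Omega> x * ?X x) \<partial>lborel)"
      using m0 by (simp add: nn_integral_cmult)
    also have "\<dots> = (\<integral>\<^sup>+x. \<integral>\<^sup>+t. indicator {0<..<T} t * (indicator \<Omega> x * ?X x) \<partial>lborel \<partial>lborel)" unfolding TT ..
    also have "\<dots> \<le> (\<integral>\<^sup>+x. \<integral>\<^sup>+t. 2 * (indicator Q (x, t) * ennreal ((F (x, t) - tprim D (x, t))\<^sup>2)) + indicator {0<..<T} t * (indicator \<Omega> x * (2 * ennreal T * R F x)) \<partial>lborel \<partial>lborel)"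
    proof (intro nn_integral_mono)
      fix x and t :: real
      show "indicator {0<..<T} t * (indicator \<Omega> x * ?X x) \<le> 2 * (indicator Q (x, t) * ennreal ((F (x, t) - tprim D (x, t))\<^sup>2)) + indicator {0<..<T} t * (indicator \<Omega> x * (2 * ennreal T * R F x))"
      proof (cases "t \<in> {0<..<T} \<and> x \<in> \<Omega>")
        case True
        then have le: "ennreal ((F (x, T) - F (x, t) - (tprim D (x, T) - tprim D (x, t)))\<^sup>2) \<le> ennreal T * R F x"
          unfolding R_def by (intro slice_increment F Dsnd T) auto
        have "?X x = ennreal (((F (x, t) - tprim D (x, t)) + (F (x, T) - F (x, t) - (tprim D (x, T) - tprim D (x, t))))\<^sup>2)"
          by (simp add: algebra_simps)
        also have "\<dots> \<le> 2 * ennreal ((F (x, t) - tprim D (x, t))\<^sup>2) + 2 * ennreal ((F (x, T) - F (x, t) - (tprim D (x, T) - tprim D (x, t)))\<^sup>2)"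
          by (rule square_sum_ennreal)
        also have "\<dots> \<le> 2 * ennreal ((F (x, t) - tprim D (x, t))\<^sup>2) + 2 * (ennreal T * R F x)"
          by (intro add_left_mono mult_left_mono le) auto
        finally show ?thesis using True by (simp add: indQ mult.assoc)
      next
        case False
        then have "indicator {0<..<T} t * (indicator \<Omega> x * ?X x) = 0" by (auto simp: indicator_def)
        then show ?thesis by (simp only: zero_le)
      qed
    qed
    also have "\<dots> = (\<integral>\<^sup>+x. 2 * (\<integral>\<^sup>+t. indicator Q (x, t) * ennreal ((F (x, t) - tprim D (x, t))\<^sup>2) \<partial>lborel) + ennreal T * (2 * ennreal T * (indicator \<Omega> x * R F x)) \<partial>lborel)"
    proof (rule nn_integral_cong)
      fix x
      have G: "(\<lambda>z. indicator Q z * ennreal ((F z - tprim D z)\<^sup>2)) \<in> borel_measurable borel" by measurable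
      have m: "(\<lambda>t. indicator Q (x, t) * ennreal ((F (x, t) - tprim D (x, t))\<^sup>2)) \<in> borel_measurable lborel"
        using borel_measurable_Pair_slice[OF G, of x] by simp
      have "(\<integral>\<^sup>+t. 2 * (indicator Q (x, t) * ennreal ((F (x, t) - tprim D (x, t))\<^sup>2)) + indicator {0<..<T} t * (indicator \<Omega> x * (2 * ennreal T * R F x)) \<partial>lborel)
        = (\<integral>\<^sup>+t. 2 * (indicator Q (x, t) * ennreal ((F (x, t) - tprim D (x, t))\<^sup>2)) \<partial>lborel) + (\<integral>\<^sup>+t. indicator {0<..<T} t * (indicator \<Omega> x * (2 * ennreal T * R F x)) \<partial>lborel)"
        using m by (intro nn_integral_add) auto
      then show "(\<integral>\<^sup>+t. 2 * (indicator Q (x, t) * ennreal ((F (x, t) - tprim D (x, t))\<^sup>2)) + indicator {0<..<T} t * (indicator \<Omega> x * (2 * ennreal T * R F x)) \<partial>lborel)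
        = 2 * (\<integral>\<^sup>+t. indicator Q (x, t) * ennreal ((F (x, t) - tprim D (x, t))\<^sup>2) \<partial>lborel) + ennreal T * (2 * ennreal T * (indicator \<Omega> x * R F x))"
        using m unfolding TT by (simp add: nn_integral_cmult mult_ac)
    qed
    also have "\<dots> = 2 * (\<integral>\<^sup>+z. indicator Q z * ennreal ((F z - tprim D z)\<^sup>2) \<partial>lborel) + ennreal T * (2 * ennreal T * (\<integral>\<^sup>+x. indicator \<Omega> x * R F x \<partial>lborel))"
    proof -
      have "(\<lambda>z. indicator Q z * ennreal ((F z - tprim D z)\<^sup>2)) \<in> borel_measurable (lborel \<Otimes>\<^sub>M lborel)" by (simp add: lborel_prod)
      from lborel.borel_measurable_nn_integral_fst[OF this]
      have m1: "(\<lambda>x. \<integral>\<^sup>+t. indicator Q (x, t) * ennreal ((F (x, t) - tprim D (x, t))\<^sup>2) \<partial>lborel) \<in> borel_measurable lborel" .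
      have m2: "(\<lambda>x. indicator \<Omega> x * R F x) \<in> borel_measurable lborel" by measurable
      have "(\<integral>\<^sup>+x. 2 * (\<integral>\<^sup>+t. indicator Q (x, t) * ennreal ((F (x, t) - tprim D (x, t))\<^sup>2) \<partial>lborel) + ennreal T * (2 * ennreal T * (indicator \<Omega> x * R F x)) \<partial>lborel)
        = 2 * (\<integral>\<^sup>+x. \<integral>\<^sup>+t. indicator Q (x, t) * ennreal ((F (x, t) - tprim D (x, t))\<^sup>2) \<partial>lborel \<partial>lborel) + ennreal T * (2 * ennreal T * (\<integral>\<^sup>+x. indicator \<Omega> x * R F x \<partial>lborel))"
        using m1 m2 by (subst nn_integral_add) (auto simp: nn_integral_cmult)
      also have "(\<integral>\<^sup>+x. \<integral>\<^sup>+t. indicator Q (x, t) * ennreal ((F (x, t) - tprim D (x, t))\<^sup>2) \<partial>lborel \<partial>lborel) = (\<integral>\<^sup>+z. indicator Q z * ennreal ((F z - tprim D z)\<^sup>2) \<partial>lborel)"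
        by (rule nn_integral_lborel_pair[symmetric]) measurable
      finally show ?thesis .
    qed
    finally show ?thesis unfolding RQ[OF F] .
  qed
  have nnQ: "(\<integral>\<^sup>+z. indicator Q z * ennreal ((F z - G z)\<^sup>2) \<partial>lborel) = ennreal ((L2norm lborel (\<lambda>z. indicator Q z * F z - G z))\<^sup>2)"
    if "(\<lambda>z. indicator Q z * F z - G z) \<in> L2 lborel" "\<And>z. z \<notin> Q \<Longrightarrow> G z = 0" for F G :: "'a \<times> real \<Rightarrow> real"
  proof -
    have "indicator Q z * ennreal ((F z - G z)\<^sup>2) = ennreal ((norm (indicator Q z * F z - G z))\<^sup>2)" for z
      using that(2)[of z] by (cases "z \<in> Q") auto
    then show ?thesis using nn_integral_L2norm[OF that(1)] by simp
  qed
  define r where "r \<psi> k = (L2norm lborel (\<lambda>z. indicator Q z * \<psi> k z - E z))\<^sup>2" for \<psi> :: "nat \<Rightarrow> 'a \<times> real \<Rightarrow> real" and k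
  define rd where "rd \<psi> k = (L2norm lborel (\<lambda>z. indicator Q z * dtime (\<psi> k) z - D z))\<^sup>2" for \<psi> :: "nat \<Rightarrow> 'a \<times> real \<Rightarrow> real" and k
  have r0: "0 \<le> r \<psi> k" "0 \<le> rd \<psi> k" for \<psi> k by (auto simp: r_def rd_def)
  have rl: "r \<psi> \<longlonglongrightarrow> 0" "rd \<psi> \<longlonglongrightarrow> 0"
    and rE: "(\<integral>\<^sup>+z. indicator Q z * ennreal ((\<psi> k z - E z)\<^sup>2) \<partial>lborel) = ennreal (r \<psi> k)"
    and rD: "(\<integral>\<^sup>+z. indicator Q z * ennreal ((dtime (\<psi> k) z - D z)\<^sup>2) \<partial>lborel) = ennreal (rd \<psi> k)"
    if "L2_tendsto lborel (\<lambda>k z. indicator Q z * \<psi> k z) E" "L2_tendsto lborel (\<lambda>k z. indicator Q z * dtime (\<psi> k) z) D" for \<psi> k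
  proof -
    have "(\<lambda>k. (L2norm lborel (\<lambda>z. indicator Q z * \<psi> k z - E z))\<^sup>2) \<longlonglongrightarrow> 0\<^sup>2"
      using that by (intro tendsto_intros) (auto simp: L2_tendsto_def)
    then show "r \<psi> \<longlonglongrightarrow> 0" unfolding r_def by simp
    have "(\<lambda>k. (L2norm lborel (\<lambda>z. indicator Q z * dtime (\<psi> k) z - D z))\<^sup>2) \<longlonglongrightarrow> 0\<^sup>2"
      using that by (intro tendsto_intros) (auto simp: L2_tendsto_def)
    then show "rd \<psi> \<longlonglongrightarrow> 0" unfolding rd_def by simp
    show "(\<integral>\<^sup>+z. indicator Q z * ennreal ((\<psi> k z - E z)\<^sup>2) \<partial>lborel) = ennreal (r \<psi> k)"
      unfolding r_def by (rule nnQ) (use that E(2) in \<open>auto simp: L2_tendsto_def\<close>)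
    show "(\<integral>\<^sup>+z. indicator Q z * ennreal ((dtime (\<psi> k) z - D z)\<^sup>2) \<partial>lborel) = ennreal (rd \<psi> k)"
      unfolding rd_def by (rule nnQ) (use that D(2) in \<open>auto simp: L2_tendsto_def\<close>)
  qed
  define i0 where "i0 k = (L2norm lborel (\<lambda>x. indicator \<Omega> x * \<phi> k (x, 0)))\<^sup>2" for k
  have i0L: "(\<lambda>x. indicator \<Omega> x * \<phi> k (x, 0)) \<in> L2 lborel" for k using init by (auto simp: L2_tendsto_def)
  have i0l: "i0 \<longlonglongrightarrow> 0"
  proof -
    have "(\<lambda>k. (L2norm lborel (\<lambda>x. indicator \<Omega> x * \<phi> k (x, 0)))\<^sup>2) \<longlonglongrightarrow> 0\<^sup>2"
      using init by (intro tendsto_intros) (auto simp: L2_tendsto_def)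
    then show ?thesis unfolding i0_def by simp
  qed
  have i0e: "(\<integral>\<^sup>+x. indicator \<Omega> x * ennreal ((\<phi> k (x, 0))\<^sup>2) \<partial>lborel) = ennreal (i0 k)" for k
  proof -
    have "indicator \<Omega> x * ennreal ((\<phi> k (x, 0))\<^sup>2) = ennreal ((norm (indicator \<Omega> x * \<phi> k (x, 0)))\<^sup>2)" for x
      by (cases "x \<in> \<Omega>") auto
    then show ?thesis using nn_integral_L2norm[OF i0L[of k]] by (simp add: i0_def)
  qed
  \<comment> \<open>The left side is independent of k, while the right side tends to 0.\<close>
  have "(\<integral>\<^sup>+z. indicator Q z * ennreal ((E z - tprim D z)\<^sup>2) \<partial>lborel) \<le> ennreal (2 * r \<phi> k + 2 * (T * (2 * i0 k + 2 * T * rd \<phi> k)))" for k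
  proof -
    note [measurable] = C1m[OF \<phi>(1)]
    have "(\<integral>\<^sup>+z. indicator Q z * ennreal ((E z - tprim D z)\<^sup>2) \<partial>lborel)
      \<le> (\<integral>\<^sup>+z. 2 * (indicator Q z * ennreal ((\<phi> k z - E z)\<^sup>2)) + 2 * (indicator Q z * ennreal ((\<phi> k z - tprim D z)\<^sup>2)) \<partial>lborel)"
    proof (rule nn_integral_mono)
      fix z
      have "ennreal ((E z - tprim D z)\<^sup>2) = ennreal (((E z - \<phi> k z) + (\<phi> k z - tprim D z))\<^sup>2)" by simp
      also have "\<dots> \<le> 2 * ennreal ((E z - \<phi> k z)\<^sup>2) + 2 * ennreal ((\<phi> k z - tprim D z)\<^sup>2)" by (rule square_sum_ennreal)
      finally show "indicator Q z * ennreal ((E z - tprim D z)\<^sup>2) \<le> 2 * (indicator Q z * ennreal ((\<phi> k z - E z)\<^sup>2)) + 2 * (indicator Q z * ennreal ((\<phi> k z - tprim D z)\<^sup>2))"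
        by (cases "z \<in> Q") (simp_all add: power2_commute[of "E z"])
    qed
    also have "\<dots> = 2 * (\<integral>\<^sup>+z. indicator Q z * ennreal ((\<phi> k z - E z)\<^sup>2) \<partial>lborel) + 2 * (\<integral>\<^sup>+z. indicator Q z * ennreal ((\<phi> k z - tprim D z)\<^sup>2) \<partial>lborel)"
    proof -
      have m1: "(\<lambda>z. indicator Q z * ennreal ((\<phi> k z - E z)\<^sup>2)) \<in> borel_measurable lborel" by measurable
      have m2: "(\<lambda>z. indicator Q z * ennreal ((\<phi> k z - tprim D z)\<^sup>2)) \<in> borel_measurable lborel" by measurable
      show ?thesis using m1 m2 by (subst nn_integral_add) (auto simp: nn_integral_cmult)
    qed
    also have "\<dots> \<le> 2 * ennreal (r \<phi> k) + 2 * (ennreal T * (2 * ennreal (i0 k) + 2 * ennreal T * ennreal (rd \<phi> k)))"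
      using initial[OF \<phi>(1), of k] unfolding rE[OF \<phi>(2,3)] rD[OF \<phi>(2,3)] i0e by (intro add_mono mult_left_mono) auto
    also have "\<dots> = ennreal (2 * r \<phi> k + 2 * (T * (2 * i0 k + 2 * T * rd \<phi> k)))"
      using T r0[of \<phi> k] by (simp add: ennreal_mult i0_def)
    finally show ?thesis .
  qed
  moreover have "(\<lambda>k. ennreal (2 * r \<phi> k + 2 * (T * (2 * i0 k + 2 * T * rd \<phi> k)))) \<longlonglongrightarrow> ennreal (2 * 0 + 2 * (T * (2 * 0 + 2 * T * 0)))"
    by (intro tendsto_ennrealI tendsto_intros rl[OF \<phi>(2,3)] i0l)
  ultimately have "(\<integral>\<^sup>+z. indicator Q z * ennreal ((E z - tprim D z)\<^sup>2) \<partial>lborel) \<le> 0"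
    by (intro LIMSEQ_le_const) auto
  then have "AE z in lborel. indicator Q z * ennreal ((E z - tprim D z)\<^sup>2) = 0"
    by (subst nn_integral_0_iff_AE[symmetric]) auto
  then show EI: "AE z in lborel. z \<in> Q \<longrightarrow> E z = tprim D z"
    by eventually_elim (auto simp: indicator_def)
  have fm[measurable]: "f \<in> borel_measurable lborel" unfolding f_def by measurable
  \<comment> \<open>Once E is identified with \<open>tprim D\<close> by the sequence \<phi>, any
    other sequence converging to E is close to \<open>tprim D\<close> in Q, whatever its initial
    values do.\<close>
  show conv: "L2_tendsto lborel (\<lambda>k x. indicator \<Omega> x * \<psi> k (x, T)) f"
    if \<psi>: "\<And>k. C_k (Suc 0) (\<psi> k)" "L2_tendsto lborel (\<lambda>k z. indicator Q z * \<psi> k z) E"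
      "L2_tendsto lborel (\<lambda>k z. indicator Q z * dtime (\<psi> k) z) D" for \<psi>
  proof -
    note [measurable] = C1m[OF \<psi>(1)] C1x[OF \<psi>(1)]
    let ?d = "\<lambda>k x. indicator \<Omega> x * \<psi> k (x, T) - f x"
    define \<rho> where "\<rho> k = 2 / T * r \<psi> k + 2 * T * rd \<psi> k" for k
    have \<rho>0: "0 \<le> \<rho> k" for k using r0[of \<psi> k] T by (simp add: \<rho>_def)
    have bd: "(\<integral>\<^sup>+x. ennreal ((norm (?d k x))\<^sup>2) \<partial>lborel) \<le> ennreal (\<rho> k)" for k
    proof -
      have "(\<integral>\<^sup>+z. indicator Q z * ennreal ((\<psi> k z - tprim D z)\<^sup>2) \<partial>lborel) = (\<integral>\<^sup>+z. indicator Q z * ennreal ((\<psi> k z - E z)\<^sup>2) \<partial>lborel)"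
        using EI by (intro nn_integral_cong_AE, eventually_elim) (auto simp: indicator_def)
      then have "ennreal T * (\<integral>\<^sup>+x. indicator \<Omega> x * ennreal ((\<psi> k (x, T) - tprim D (x, T))\<^sup>2) \<partial>lborel)
        \<le> 2 * ennreal (r \<psi> k) + ennreal T * (2 * ennreal T * ennreal (rd \<psi> k))"
        using final[OF \<psi>(1), of k] unfolding rE[OF \<psi>(2,3)] rD[OF \<psi>(2,3)] by simp
      also have "\<dots> = ennreal T * ennreal (\<rho> k)"
      proof -
        have "ennreal T * ennreal (\<rho> k) = ennreal (T * \<rho> k)" using T \<rho>0[of k] by (intro ennreal_mult[symmetric]) auto
        also have "T * \<rho> k = 2 * r \<psi> k + T * (2 * T * rd \<psi> k)" using T by (simp add: \<rho>_def field_simps)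
        also have "ennreal \<dots> = 2 * ennreal (r \<psi> k) + ennreal T * (2 * ennreal T * ennreal (rd \<psi> k))"
          using T r0[of \<psi> k] by (simp add: ennreal_mult)
        finally show ?thesis by simp
      qed
      finally have "(\<integral>\<^sup>+x. indicator \<Omega> x * ennreal ((\<psi> k (x, T) - tprim D (x, T))\<^sup>2) \<partial>lborel) \<le> ennreal (\<rho> k)"
        using T by (simp add: ennreal_mult_le_mult_iff)
      moreover have "indicator \<Omega> x * ennreal ((\<psi> k (x, T) - tprim D (x, T))\<^sup>2) = ennreal ((norm (?d k x))\<^sup>2)" for x
        by (cases "x \<in> \<Omega>") (auto simp: f_def)
      ultimately show ?thesis by simp
    qed
    have dL: "?d k \<in> L2 lborel" for k
    proof (rule L2_I)
      show "integrable lborel (\<lambda>x. (norm (?d k x))\<^sup>2)"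
        using le_less_trans[OF bd[of k] ennreal_less_top] by (simp add: integrable_iff_bounded)
    qed measurable
    have "(L2norm lborel (?d k))\<^sup>2 \<le> \<rho> k" for k
      using bd[of k] unfolding nn_integral_L2norm[OF dL] using \<rho>0 by simp
    then have le: "L2norm lborel (?d k) \<le> sqrt (\<rho> k)" for k by (rule real_le_rsqrt)
    have "\<rho> \<longlonglongrightarrow> 2 / T * 0 + 2 * T * 0" unfolding \<rho>_def by (intro tendsto_intros rl[OF \<psi>(2,3)])
    then have "(\<lambda>k. sqrt (\<rho> k)) \<longlonglongrightarrow> 0" using tendsto_real_sqrt by fastforce
    then have "(\<lambda>k. L2norm lborel (?d k)) \<longlonglongrightarrow> 0"
      by (rule tendsto_sandwich[OF _ _ tendsto_const, rotated 2]) (use le in auto)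
    then show ?thesis using dL by (simp add: L2_tendsto_def)
  qed
  have slL: "(\<lambda>x. indicator \<Omega> x * F (x, t)) \<in> L2 lborel" if F: "C_k (Suc 0) F" for F :: "'a \<times> real \<Rightarrow> real" and t
  proof (rule L2_I)
    note [measurable] = C1x[OF F]
    have "continuous_on UNIV F" using C_k_SucD[OF F] by simp
    then have "continuous_on UNIV (\<lambda>x. F (x, t))"
      by (rule continuous_on_compose2) (auto intro!: continuous_intros)
    from continuous_bounded_on[OF this \<Omega>(2)] obtain B where B: "0 \<le> B" "\<And>x. x \<in> \<Omega> \<Longrightarrow> norm (F (x, t)) \<le> B" by metis
    show "integrable lborel (\<lambda>x. (norm (indicator \<Omega> x * F (x, t)))\<^sup>2)"
    proof (rule integrable_bounded_support[OF _ \<Omega>(2), where B="B\<^sup>2"])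
      fix x
      show "norm ((norm (indicator \<Omega> x * F (x, t)))\<^sup>2) \<le> B\<^sup>2"
        using B power_mono[OF B(2)[of x], of 2] by (cases "x \<in> \<Omega>") auto
    qed auto
    show "(\<lambda>x. indicator \<Omega> x * F (x, t)) \<in> borel_measurable lborel" by measurable
  qed
  show fL: "f \<in> L2 lborel"
  proof -
    have "(\<lambda>x. indicator \<Omega> x * \<phi> 0 (x, T) - f x) \<in> L2 lborel" using conv[OF \<phi>] by (auto simp: L2_tendsto_def)
    from L2_diff[OF slL[OF \<phi>(1), of 0 T] this] show ?thesis by simp
  qed
  \<comment> \<open>The antiderivative in time of F times its time derivative is F^2/2, used on each
    line over the domain.\<close>
  have ident: "(L2norm lborel (\<lambda>x. indicator \<Omega> x * F (x, T)))\<^sup>2 - (L2norm lborel (\<lambda>x. indicator \<Omega> x * F (x, 0)))\<^sup>2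
      = 2 * (\<integral>z. (indicator Q z * F z) * (indicator Q z * dtime F z) \<partial>lborel)" if F: "C_k (Suc 0) F" for F
  proof -
    note [measurable] = C1m[OF F]
    have cF: "continuous_on UNIV F" using C_k_SucD[OF F] by simp
    have cG: "continuous_on UNIV (\<lambda>z. F z * dtime F z)" by (intro continuous_intros cF continuous_dtime F)
    from continuous_bounded_on[OF cG Qs(2)] obtain B where B: "0 \<le> B" "\<And>z. z \<in> Q \<Longrightarrow> norm (F z * dtime F z) \<le> B" by metis
    have i: "integrable lborel (\<lambda>z. indicator Q z * (F z * dtime F z))"
      by (rule integrable_bounded_support[OF _ Qs(2), where B=B]) (use B in \<open>auto simp: indicator_def\<close>)
    then have i': "integrable (lborel \<Otimes>\<^sub>M lborel) (\<lambda>(x, t). indicator Q (x, t) * (F (x, t) * dtime F (x, t)))"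
      by (simp add: lborel_prod split_beta')
    have AEne: "AE t in lborel. t \<noteq> (c::real)" for c by (rule AE_lborel_singleton)
    have slice: "(\<integral>t. indicator Q (x, t) * (F (x, t) * dtime F (x, t)) \<partial>lborel) = ((indicator \<Omega> x * F (x, T))\<^sup>2 - (indicator \<Omega> x * F (x, 0))\<^sup>2) / 2" for x
    proof (cases "x \<in> \<Omega>")
      case False
      then have "indicator Q (x, t) * (F (x, t) * dtime F (x, t)) = 0" for t by (auto simp: Q_def)
      then show ?thesis using False by (simp only: Bochner_Integration.integral_zero) simp
    next
      case True
      have c: "continuous_on UNIV (\<lambda>t. F (x, t) * dtime F (x, t))"
        by (rule continuous_on_compose2[OF cG]) (auto intro!: continuous_intros)
      have d: "((\<lambda>t. (F (x, t))\<^sup>2 / 2) has_real_derivative F (x, t) * dtime F (x, t)) (at t)" for t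
        using dtime_DERIV[OF F, of x t] by (auto intro!: derivative_eq_intros)
      have "(\<integral>t. indicator Q (x, t) * (F (x, t) * dtime F (x, t)) \<partial>lborel) = (\<integral>t. indicator {0..T} t * (F (x, t) * dtime F (x, t)) \<partial>lborel)"
      proof (rule integral_cong_AE)
        show "AE t in lborel. indicator Q (x, t) * (F (x, t) * dtime F (x, t)) = indicator {0..T} t * (F (x, t) * dtime F (x, t))"
          using AEne[of 0] AEne[of T] by eventually_elim (use True in \<open>auto simp: Q_def indicator_def\<close>)
        have G: "(\<lambda>z. indicator Q z * (F z * dtime F z)) \<in> borel_measurable borel" by measurable
        show "(\<lambda>t. indicator Q (x, t) * (F (x, t) * dtime F (x, t))) \<in> borel_measurable lborel"
          using borel_measurable_Pair_slice[OF G, of x] by simp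
        show "(\<lambda>t. indicator {0..T} t * (F (x, t) * dtime F (x, t))) \<in> borel_measurable lborel"
          using borel_measurable_continuous_onI[OF c] by simp
      qed
      also have "\<dots> = (F (x, T))\<^sup>2 / 2 - (F (x, 0))\<^sup>2 / 2"
        using T by (intro lborel_FTC(2) d c) auto
      finally show ?thesis using True by (simp add: diff_divide_distrib)
    qed
    have "2 * (\<integral>z. (indicator Q z * F z) * (indicator Q z * dtime F z) \<partial>lborel) = 2 * (\<integral>z. indicator Q z * (F z * dtime F z) \<partial>lborel)"
      by (intro arg_cong[where f="\<lambda>a. 2 * a"] Bochner_Integration.integral_cong) (auto simp: indicator_def)
    also have "\<dots> = 2 * integral\<^sup>L (lborel \<Otimes>\<^sub>M lborel) (\<lambda>(x, t). indicator Q (x, t) * (F (x, t) * dtime F (x, t)))"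
      by (simp add: lborel_prod split_beta')
    also have "\<dots> = 2 * (\<integral>x. (\<integral>t. indicator Q (x, t) * (F (x, t) * dtime F (x, t)) \<partial>lborel) \<partial>lborel)"
      using lborel_pair.integral_fst[OF i'] by simp
    also have "\<dots> = (\<integral>x. (indicator \<Omega> x * F (x, T))\<^sup>2 - (indicator \<Omega> x * F (x, 0))\<^sup>2 \<partial>lborel)" unfolding slice by simp
    also have "\<dots> = (L2norm lborel (\<lambda>x. indicator \<Omega> x * F (x, T)))\<^sup>2 - (L2norm lborel (\<lambda>x. indicator \<Omega> x * F (x, 0)))\<^sup>2"
      unfolding L2norm_sq using L2_integrable[OF slL[OF F, of T]] L2_integrable[OF slL[OF F, of 0]] by simp
    finally show ?thesis by simp
  qed
  have 1: "(\<lambda>k. (L2norm lborel (\<lambda>x. indicator \<Omega> x * \<phi> k (x, T)))\<^sup>2 - i0 k) \<longlonglongrightarrow> (L2norm lborel f)\<^sup>2 - 0"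
    by (intro tendsto_intros i0l L2_tendsto_norm[OF conv[OF \<phi>] fL])
  have 2: "(\<lambda>k. 2 * (\<integral>z. (indicator Q z * \<phi> k z) * (indicator Q z * dtime (\<phi> k) z) \<partial>lborel)) \<longlonglongrightarrow> 2 * (\<integral>z. E z * D z \<partial>lborel)"
    using tendsto_mult_left[OF L2_tendsto_inner[OF \<phi>(2) E(1) \<phi>(3) D(1)], of 2] by simp
  have "(L2norm lborel f)\<^sup>2 - 0 = 2 * (\<integral>z. E z * D z \<partial>lborel)"
    by (rule LIMSEQ_unique[OF 1[unfolded i0_def ident[OF \<phi>(1)]] 2])
  then show "(L2norm lborel f)\<^sup>2 = 2 * (\<integral>z. E z * D z \<partial>lborel)" by simp
qed

section \<open>Weak derivatives and traces on the cylinder\<close>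

text \<open>The bridge between the spaces over \<open>restrict_space\<close> in the statement and
  the functions on the whole space in the lemmas above, where translations are available.\<close>

definition zext :: "'a set \<Rightarrow> ('a \<Rightarrow> 'b::real_vector) \<Rightarrow> 'a \<Rightarrow> 'b" where
  "zext S f z = indicator S z *\<^sub>R f z"

lemma zext_outside: "z \<notin> S \<Longrightarrow> zext S f z = 0"
  by (simp add: zext_def)

lemma zext_diff: "zext S (\<lambda>z. f z - g z) z = zext S f z - zext S g z"
  by (simp add: zext_def algebra_simps)

lemma borel_measurable_zext:
  fixes f :: "'a::euclidean_space \<Rightarrow> 'b::real_normed_vector"
  assumes "S \<in> sets borel"
  shows "f \<in> borel_measurable (restrict_space lborel S) \<longleftrightarrow> zext S f \<in> borel_measurable lborel"
  using borel_measurable_restrict_space_iff[of S lborel f] assms by (simp add: zext_def[abs_def])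

lemma L2_zext:
  fixes f :: "'a::euclidean_space \<Rightarrow> 'b::euclidean_space"
  assumes "S \<in> sets borel"
  shows "f \<in> L2 (restrict_space lborel S) \<longleftrightarrow> zext S f \<in> L2 lborel"
proof -
  have "indicator S z *\<^sub>R (norm (f z))\<^sup>2 = (norm (zext S f z))\<^sup>2" for z by (cases "z \<in> S") (auto simp: zext_def)
  then show ?thesis
    unfolding L2_def using assms by (simp add: borel_measurable_zext integrable_restrict_space)
qed

lemma L2norm_zext:
  fixes f :: "'a::euclidean_space \<Rightarrow> 'b::euclidean_space"
  assumes "S \<in> sets borel"
  shows "L2norm (restrict_space lborel S) f = L2norm lborel (zext S f)"
proof -
  have "indicator S z *\<^sub>R (norm (f z))\<^sup>2 = (norm (zext S f z))\<^sup>2" for z by (cases "z \<in> S") (auto simp: zext_def)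
  then show ?thesis unfolding L2norm_def using assms by (simp add: integral_restrict_space)
qed

lemma L2_tendsto_zext:
  fixes w :: "'a::euclidean_space \<Rightarrow> 'b::euclidean_space"
  assumes "S \<in> sets borel"
  shows "L2_tendsto (restrict_space lborel S) \<phi> w \<longleftrightarrow> L2_tendsto lborel (\<lambda>k. zext S (\<phi> k)) (zext S w)"
  unfolding L2_tendsto_def L2_zext[OF assms] L2norm_zext[OF assms]
  by (simp add: zext_diff[abs_def] zext_diff)

lemma integral_zext:
  fixes f :: "'a::euclidean_space \<Rightarrow> 'b::{banach, second_countable_topology}"
  assumes "S \<in> sets borel"
  shows "(\<integral>z. f z \<partial>restrict_space lborel S) = (\<integral>z. zext S f z \<partial>lborel)"
  using assms by (simp add: integral_restrict_space zext_def)

lemma L2_continuous: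
  fixes f :: "'a::euclidean_space \<Rightarrow> 'b::euclidean_space"
  assumes f: "continuous_on UNIV f" and S: "S \<in> sets borel" "bounded S"
  shows "zext S f \<in> L2 lborel"
proof (rule L2_I)
  have [measurable]: "f \<in> borel_measurable borel" by (rule borel_measurable_continuous_onI[OF f])
  note [measurable] = S(1)
  show m: "zext S f \<in> borel_measurable lborel" unfolding zext_def[abs_def] by measurable
  from continuous_bounded_on[OF f S(2)] obtain B where B: "0 \<le> B" "\<And>x. x \<in> S \<Longrightarrow> norm (f x) \<le> B" by metis
  show "integrable lborel (\<lambda>z. (norm (zext S f z))\<^sup>2)"
  proof (rule integrable_bounded_support[OF _ S(2), where B="B\<^sup>2"])
    show "norm ((norm (zext S f x))\<^sup>2) \<le> B\<^sup>2" for x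
      using B power_mono[OF B(2)[of x], of 2] by (cases "x \<in> S") (auto simp: zext_def)
    show "(\<lambda>z. (norm (zext S f z))\<^sup>2) \<in> borel_measurable borel" using m by simp
  qed (simp add: zext_def)
qed

lemma L2_scaleR_integrable:
  fixes f :: "'a \<Rightarrow> real" and g :: "'a \<Rightarrow> 'b::euclidean_space"
  assumes f: "f \<in> L2 M" and g: "g \<in> L2 M"
  shows "integrable M (\<lambda>x. f x *\<^sub>R g x)"
proof -
  note [measurable] = L2_measurable[OF f] L2_measurable[OF g]
  show ?thesis
    by (rule Bochner_Integration.integrable_bound[OF L2_norm_prod_integrable[OF f g]]) auto
qed

text \<open>Needed because \<open>grad_x\<close> and \<open>d_t\<close> of a difference choose
  representatives that agree with the difference of the choices only almost everywhere.\<close>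

lemma L2_tendsto_cong_AE:
  assumes "L2_tendsto M \<phi> w" "w' \<in> borel_measurable M" "w \<in> borel_measurable M" "AE z in M. w z = w' z"
  shows "L2_tendsto M \<phi> w'"
proof -
  have L: "(\<lambda>z. \<phi> k z - w z) \<in> L2 M" for k using assms(1) by (auto simp: L2_tendsto_def)
  have m: "(\<lambda>z. \<phi> k z - w' z) \<in> borel_measurable M" for k
  proof -
    have "(\<lambda>z. (\<phi> k z - w z) + (w z - w' z)) \<in> borel_measurable M"
      using L2_measurable[OF L[of k]] assms(2,3) by measurable
    then show ?thesis by simp
  qed
  have ae: "AE z in M. (norm (\<phi> k z - w' z))\<^sup>2 = (norm (\<phi> k z - w z))\<^sup>2" for k
    using assms(4) by eventually_elim simp
  have "(\<lambda>z. \<phi> k z - w' z) \<in> L2 M" for k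
  proof (rule L2_I[OF m])
    note [measurable] = m
    show "integrable M (\<lambda>z. (norm (\<phi> k z - w' z))\<^sup>2)"
      by (rule integrable_cong_AE_imp[OF L2_integrable[OF L[of k]]]) (use ae[of k] in auto)
  qed
  moreover have "L2norm M (\<lambda>z. \<phi> k z - w' z) = L2norm M (\<lambda>z. \<phi> k z - w z)" for k
    by (rule L2norm_cong_AE[OF m L2_measurable[OF L]]) (use assms(4) in \<open>eventually_elim; simp\<close>)
  ultimately show ?thesis using assms(1) by (simp add: L2_tendsto_def)
qed

section \<open>Weak derivatives and surface measures expressed by zero extensions\<close>

context
  fixes \<Omega> :: "(real ^ 'n) set" and T :: real
  assumes \<Omega>: "open \<Omega>" "bounded \<Omega>"
begin

lemma open_cyl: "open (cyl \<Omega> T)" and bounded_cyl: "bounded (cyl \<Omega> T)" and cyl_borel: "cyl \<Omega> T \<in> sets borel"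
  unfolding cyl_def using \<Omega> by (auto intro!: open_Times bounded_Times borel_open)

lemmas lebQ_zext =
  L2_zext[OF cyl_borel, folded lebQ_def] L2norm_zext[OF cyl_borel, folded lebQ_def]
  L2_tendsto_zext[OF cyl_borel, folded lebQ_def] integral_zext[OF cyl_borel, folded lebQ_def]
  borel_measurable_zext[OF cyl_borel, folded lebQ_def]

lemma AE_lebQ: "(AE z in lebQ \<Omega> T. R z) \<longleftrightarrow> (AE z in lborel. z \<in> cyl \<Omega> T \<longrightarrow> R z)"
  unfolding lebQ_def by (rule AE_restrict_space_iff) (simp add: cyl_borel)

lemma L2_lebQ_continuous: "continuous_on UNIV f \<Longrightarrow> f \<in> L2 (lebQ \<Omega> T)"
  by (simp add: lebQ_zext L2_continuous cyl_borel bounded_cyl)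

lemma test_function_C_k: "\<phi> \<in> test_functions S \<Longrightarrow> C_k k \<phi>"
  by (simp add: test_functions_def smooth_def)

lemma cgrad_x_eq: "cgrad_x F z = gradx F (z :: (real ^ 'n) \<times> real)"
proof (rule vec_eq_iff[THEN iffD2], rule allI)
  fix i
  have "gradx F z $ i = gradx F z \<bullet> axis i 1" by (simp add: inner_axis)
  also have "\<dots> = frechet_derivative F (at z) (axis i 1, 0)" by (rule gradx_inner_Basis) (simp add: axis_in_Basis_iff)
  finally show "cgrad_x F z $ i = gradx F z $ i" by (simp add: cgrad_x_def)
qed

lemma cd_t_eq: "cd_t F = dtime F"
  by (auto simp: cd_t_def dtime_def)

lemma frechet_derivative_gradx:
  fixes F :: "'a::euclidean_space \<times> real \<Rightarrow> real"
  assumes "C_k (Suc 0) F"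
  shows "frechet_derivative F (at z) (y, 0) = y \<bullet> gradx F z"
proof -
  let ?D = "frechet_derivative F (at z)"
  have lin: "linear ?D" by (rule has_derivative_linear[OF C_k_has_derivative[OF assms]])
  have "(y, 0) = (\<Sum>v\<in>Basis. (y \<bullet> v) *\<^sub>R (v, 0 :: real))"
    by (simp add: prod_eq_iff fst_sum snd_sum euclidean_representation)
  then have "?D (y, 0) = (\<Sum>v\<in>Basis. (y \<bullet> v) * ?D (v, 0))"
    by (simp only: linear_sum[OF lin] linear_cmul[OF lin] real_scaleR_def)
  then show ?thesis by (simp add: gradx_def inner_sum_right mult.commute)
qed

text \<open>The fundamental lemma applied to the zero extension of the difference; the point (0, T)
  shows that the cylinder is not the whole space.\<close>

lemma lebQ_unique:
  fixes g g' :: "(real ^ 'n) \<times> real \<Rightarrow> real"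
  assumes g: "g \<in> L2 (lebQ \<Omega> T)" "g' \<in> L2 (lebQ \<Omega> T)"
    and eq: "\<And>\<phi>. \<phi> \<in> test_functions (cyl \<Omega> T) \<Longrightarrow> (\<integral>z. \<phi> z * g z \<partial>lebQ \<Omega> T) = (\<integral>z. \<phi> z * g' z \<partial>lebQ \<Omega> T)"
  shows "AE z in lebQ \<Omega> T. g z = g' z"
proof -
  let ?h = "zext (cyl \<Omega> T) (\<lambda>z. g z - g' z)"
  have h: "?h \<in> L2 lborel" using L2_diff[OF g] by (simp add: lebQ_zext)
  have "AE z in lborel. z \<in> cyl \<Omega> T \<longrightarrow> ?h z = 0"
  proof (rule fundamental_lemma_variations[OF h open_cyl])
    have "(0, T) \<notin> cyl \<Omega> T" by (simp add: cyl_def)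
    then show "cyl \<Omega> T \<noteq> UNIV" by blast
    fix \<phi> assume \<phi>: "\<phi> \<in> test_functions (cyl \<Omega> T)"
    have "\<phi> \<in> L2 (lebQ \<Omega> T)" using test_function_C_k[OF \<phi>, of 0] by (intro L2_lebQ_continuous) simp
    note i = L2_mult_integrable[OF this g(1)] L2_mult_integrable[OF this g(2)]
    have "(\<integral>z. \<phi> z * ?h z \<partial>lborel) = (\<integral>z. \<phi> z * (g z - g' z) \<partial>lebQ \<Omega> T)"
      unfolding lebQ_zext by (intro Bochner_Integration.integral_cong) (auto simp: zext_def)
    also have "\<dots> = (\<integral>z. \<phi> z * g z \<partial>lebQ \<Omega> T) - (\<integral>z. \<phi> z * g' z \<partial>lebQ \<Omega> T)"
      using i by (simp add: right_diff_distrib)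
    finally show "(\<integral>z. \<phi> z * ?h z \<partial>lborel) = 0" using eq[OF \<phi>] by simp
  qed
  then show ?thesis unfolding AE_lebQ by eventually_elim (auto simp: zext_def)
qed

lemma is_div_x_unique: "is_div_x \<Omega> T y g \<Longrightarrow> is_div_x \<Omega> T y g' \<Longrightarrow> AE z in lebQ \<Omega> T. g z = g' z"
  by (rule lebQ_unique) (auto simp: is_div_x_def)

lemma is_d_t_unique: "is_d_t \<Omega> T w g \<Longrightarrow> is_d_t \<Omega> T w g' \<Longrightarrow> AE z in lebQ \<Omega> T. g z = g' z"
  by (rule lebQ_unique) (auto simp: is_d_t_def)

lemma test_function_L2:
  assumes "\<phi> \<in> test_functions (cyl \<Omega> T)"
  shows "\<phi> \<in> L2 (lebQ \<Omega> T)" "cgrad_x \<phi> \<in> L2 (lebQ \<Omega> T)" "cd_t \<phi> \<in> L2 (lebQ \<Omega> T)"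
  using test_function_C_k[OF assms, of 0] test_function_C_k[OF assms, of "Suc 0"]
  by (auto intro!: L2_lebQ_continuous continuous_gradx continuous_dtime simp: cgrad_x_eq[abs_def] cd_t_eq)

lemma is_grad_x_unique:
  assumes "is_grad_x \<Omega> T w g" "is_grad_x \<Omega> T w g'" shows "AE z in lebQ \<Omega> T. g z = g' z"
proof -
  have L: "g \<in> L2 (lebQ \<Omega> T)" "g' \<in> L2 (lebQ \<Omega> T)" using assms by (auto simp: is_grad_x_def)
  have "AE z in lebQ \<Omega> T. g z \<bullet> b = g' z \<bullet> b" if b: "b \<in> Basis" for b
  proof (rule lebQ_unique)
    have "(\<lambda>z. h z \<bullet> b) \<in> L2 (lebQ \<Omega> T)" if "h \<in> L2 (lebQ \<Omega> T)" for h :: "(real ^ 'n) \<times> real \<Rightarrow> real ^ 'n"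
      by (rule L2_dominated[OF that, where c=1]) (use L2_measurable[OF that] Basis_le_norm[OF b] in auto)
    then show "(\<lambda>z. g z \<bullet> b) \<in> L2 (lebQ \<Omega> T)" "(\<lambda>z. g' z \<bullet> b) \<in> L2 (lebQ \<Omega> T)" using L by auto
    fix \<phi> assume \<phi>: "\<phi> \<in> test_functions (cyl \<Omega> T)"
    have i: "(\<integral>z. \<phi> z * (h z \<bullet> b) \<partial>lebQ \<Omega> T) = (\<integral>z. \<phi> z *\<^sub>R h z \<partial>lebQ \<Omega> T) \<bullet> b" if "h \<in> L2 (lebQ \<Omega> T)" for h :: "(real ^ 'n) \<times> real \<Rightarrow> real ^ 'n"
      using integral_inner_left[of b "lebQ \<Omega> T" "\<lambda>z. \<phi> z *\<^sub>R h z"] L2_scaleR_integrable[OF test_function_L2(1)[OF \<phi>] that] by simp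
    show "(\<integral>z. \<phi> z * (g z \<bullet> b) \<partial>lebQ \<Omega> T) = (\<integral>z. \<phi> z * (g' z \<bullet> b) \<partial>lebQ \<Omega> T)"
    proof -
      have "- (\<integral>z. \<phi> z *\<^sub>R g z \<partial>lebQ \<Omega> T) = - (\<integral>z. \<phi> z *\<^sub>R g' z \<partial>lebQ \<Omega> T)"
        using assms \<phi> unfolding is_grad_x_def by auto
      then show ?thesis unfolding i[OF L(1)] i[OF L(2)] by simp
    qed
  qed
  then have "AE z in lebQ \<Omega> T. \<forall>b\<in>Basis. g z \<bullet> b = g' z \<bullet> b" by (simp add: AE_finite_all)
  then show ?thesis by eventually_elim (auto intro: euclidean_eqI)
qed

lemma is_grad_x_diff:
  assumes "is_grad_x \<Omega> T u gu" "is_grad_x \<Omega> T v gv" shows "is_grad_x \<Omega> T (\<lambda>z. u z - v z) (\<lambda>z. gu z - gv z)"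
  unfolding is_grad_x_def
proof (intro conjI ballI)
  note L = assms[unfolded is_grad_x_def]
  show "(\<lambda>z. u z - v z) \<in> L2 (lebQ \<Omega> T)" "(\<lambda>z. gu z - gv z) \<in> L2 (lebQ \<Omega> T)" using L by (auto intro: L2_diff)
  fix \<phi> assume \<phi>: "\<phi> \<in> test_functions (cyl \<Omega> T)"
  note t = test_function_L2[OF \<phi>]
  have "u \<in> L2 (lebQ \<Omega> T)" "v \<in> L2 (lebQ \<Omega> T)" "gu \<in> L2 (lebQ \<Omega> T)" "gv \<in> L2 (lebQ \<Omega> T)" using L by auto
  note i = L2_scaleR_integrable[OF this(1) t(2)] L2_scaleR_integrable[OF this(2) t(2)]
    L2_scaleR_integrable[OF t(1) this(3)] L2_scaleR_integrable[OF t(1) this(4)]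
  show "(\<integral>z. (u z - v z) *\<^sub>R cgrad_x \<phi> z \<partial>lebQ \<Omega> T) = - (\<integral>z. \<phi> z *\<^sub>R (gu z - gv z) \<partial>lebQ \<Omega> T)"
    using L \<phi> i by (simp add: scaleR_diff_left scaleR_diff_right)
qed

lemma is_d_t_diff:
  assumes "is_d_t \<Omega> T u gu" "is_d_t \<Omega> T v gv" shows "is_d_t \<Omega> T (\<lambda>z. u z - v z) (\<lambda>z. gu z - gv z)"
  unfolding is_d_t_def
proof (intro conjI ballI)
  note L = assms[unfolded is_d_t_def]
  show "(\<lambda>z. u z - v z) \<in> L2 (lebQ \<Omega> T)" "(\<lambda>z. gu z - gv z) \<in> L2 (lebQ \<Omega> T)" using L by (auto intro: L2_diff)
  fix \<phi> assume \<phi>: "\<phi> \<in> test_functions (cyl \<Omega> T)"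
  note t = test_function_L2[OF \<phi>]
  have "u \<in> L2 (lebQ \<Omega> T)" "v \<in> L2 (lebQ \<Omega> T)" "gu \<in> L2 (lebQ \<Omega> T)" "gv \<in> L2 (lebQ \<Omega> T)" using L by auto
  note i = L2_mult_integrable[OF this(1) t(3)] L2_mult_integrable[OF this(2) t(3)]
    L2_mult_integrable[OF t(1) this(3)] L2_mult_integrable[OF t(1) this(4)]
  show "(\<integral>z. (u z - v z) * cd_t \<phi> z \<partial>lebQ \<Omega> T) = - (\<integral>z. \<phi> z * (gu z - gv z) \<partial>lebQ \<Omega> T)"
    using L \<phi> i by (simp add: left_diff_distrib right_diff_distrib)
qed

lemma is_div_x_diff:
  assumes "is_div_x \<Omega> T u gu" "is_div_x \<Omega> T v gv" shows "is_div_x \<Omega> T (\<lambda>z. u z - v z) (\<lambda>z. gu z - gv z)"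
  unfolding is_div_x_def
proof (intro conjI ballI)
  note L = assms[unfolded is_div_x_def]
  show "(\<lambda>z. u z - v z) \<in> L2 (lebQ \<Omega> T)" "(\<lambda>z. gu z - gv z) \<in> L2 (lebQ \<Omega> T)" using L by (auto intro: L2_diff)
  fix \<phi> assume \<phi>: "\<phi> \<in> test_functions (cyl \<Omega> T)"
  note t = test_function_L2[OF \<phi>]
  have "u \<in> L2 (lebQ \<Omega> T)" "v \<in> L2 (lebQ \<Omega> T)" "gu \<in> L2 (lebQ \<Omega> T)" "gv \<in> L2 (lebQ \<Omega> T)" using L by auto
  note i = L2_inner_integrable[OF this(1) t(2)] L2_inner_integrable[OF this(2) t(2)]
    L2_mult_integrable[OF t(1) this(3)] L2_mult_integrable[OF t(1) this(4)]
  show "(\<integral>z. (u z - v z) \<bullet> cgrad_x \<phi> z \<partial>lebQ \<Omega> T) = - (\<integral>z. \<phi> z * (gu z - gv z) \<partial>lebQ \<Omega> T)"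
    using L \<phi> i by (simp add: inner_diff_left right_diff_distrib)
qed

lemma is_div_x_zext:
  assumes y: "is_div_x \<Omega> T y g" and \<phi>: "\<phi> \<in> test_functions (cyl \<Omega> T)"
  shows "(\<integral>z. frechet_derivative \<phi> (at z) (zext (cyl \<Omega> T) y z, 0) \<partial>lborel) = - (\<integral>z. \<phi> z * zext (cyl \<Omega> T) g z \<partial>lborel)"
proof -
  have C: "C_k (Suc 0) \<phi>" by (rule test_function_C_k[OF \<phi>])
  have "frechet_derivative \<phi> (at z) (zext (cyl \<Omega> T) y z, 0) = zext (cyl \<Omega> T) (\<lambda>z. y z \<bullet> cgrad_x \<phi> z) z" for z
    unfolding frechet_derivative_gradx[OF C] by (simp add: zext_def cgrad_x_eq)
  moreover have "\<phi> z * zext (cyl \<Omega> T) g z = zext (cyl \<Omega> T) (\<lambda>z. \<phi> z * g z) z" for z by (simp add: zext_def)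
  moreover have "(\<integral>z. y z \<bullet> cgrad_x \<phi> z \<partial>lebQ \<Omega> T) = - (\<integral>z. \<phi> z * g z \<partial>lebQ \<Omega> T)" using y \<phi> by (simp add: is_div_x_def)
  ultimately show ?thesis by (simp add: lebQ_zext)
qed

text \<open>The time integral is taken as the inner one, so that sigma-finiteness of the Lebesgue
  factor justifies the iterated integral over the product with the Hausdorff measure.\<close>

lemma lateral_nn_integral:
  assumes "\<phi> \<in> L2 (lateral_measure \<Omega> T)"
  shows "(\<integral>\<^sup>+x. (\<integral>\<^sup>+t. ennreal ((\<phi> (x, t))\<^sup>2) * indicator {0<..<T} t \<partial>lborel) * indicator (frontier \<Omega>) x
               \<partial>hausdorff_measure (DIM(real ^ 'n) - 1)) = ennreal ((L2norm (lateral_measure \<Omega> T) \<phi>)\<^sup>2)"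
proof -
  let ?M = "restrict_space (hausdorff_measure (CARD('n) - 1)) (frontier \<Omega>)" and ?N = "restrict_space lborel {0<..<T}"
  interpret N: sigma_finite_measure ?N
    by (rule sigma_finite_measure_restrict_space[OF sigma_finite_lborel]) simp
  have m: "\<phi> \<in> borel_measurable (?M \<Otimes>\<^sub>M ?N)" using L2_measurable[OF assms] by (simp add: lateral_measure_def)
  have "(\<integral>\<^sup>+x. (\<integral>\<^sup>+t. ennreal ((\<phi> (x, t))\<^sup>2) * indicator {0<..<T} t \<partial>lborel) * indicator (frontier \<Omega>) x
               \<partial>hausdorff_measure (DIM(real ^ 'n) - 1)) = (\<integral>\<^sup>+x. (\<integral>\<^sup>+t. ennreal ((\<phi> (x, t))\<^sup>2) \<partial>?N) \<partial>?M)"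
    by (subst nn_integral_restrict_space, simp add: sets_eq_imp_space_eq[OF sets_hausdorff_measure])
       (subst nn_integral_restrict_space, simp_all)
  also have "\<dots> = (\<integral>\<^sup>+z. ennreal ((\<phi> z)\<^sup>2) \<partial>(?M \<Otimes>\<^sub>M ?N))"
    using N.nn_integral_fst[of "\<lambda>z. ennreal ((\<phi> z)\<^sup>2)" ?M] m by simp
  also have "\<dots> = ennreal ((L2norm (lateral_measure \<Omega> T) \<phi>)\<^sup>2)"
    using nn_integral_L2norm[OF assms] by (simp add: lateral_measure_def)
  finally show ?thesis .
qed

lemma slice_measure_L2:
  fixes h :: "(real ^ 'n) \<times> real \<Rightarrow> real"
  assumes m: "h \<in> borel_measurable borel"
  shows "h \<in> L2 (slice_measure \<Omega> t) \<longleftrightarrow> (\<lambda>x. indicator \<Omega> x * h (x, t)) \<in> L2 lborel"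
    and "L2norm (slice_measure \<Omega> t) h = L2norm lborel (\<lambda>x. indicator \<Omega> x * h (x, t))"
proof -
  have \<Omega>b: "\<Omega> \<in> sets borel" using \<Omega> by auto
  have p: "(\<lambda>x. (x, t)) \<in> restrict_space lborel \<Omega> \<rightarrow>\<^sub>M borel"
    by (rule measurable_restrict_space1) (simp add: borel_measurable_continuous_onI continuous_intros)
  have hx: "(\<lambda>x. h (x, t)) \<in> borel_measurable (restrict_space lborel \<Omega>)" by (rule measurable_compose[OF p m])
  have z: "zext \<Omega> (\<lambda>x. h (x, t)) = (\<lambda>x. indicator \<Omega> x * h (x, t))" by (auto simp: zext_def fun_eq_iff)
  have sm: "f \<in> borel_measurable (slice_measure \<Omega> t) \<longleftrightarrow> f \<in> borel_measurable borel" for f :: "_ \<Rightarrow> real"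
    by (simp add: slice_measure_def)
  have "h \<in> L2 (slice_measure \<Omega> t) \<longleftrightarrow> (\<lambda>x. h (x, t)) \<in> L2 (restrict_space lborel \<Omega>)"
    unfolding L2_def mem_Collect_eq sm using m hx
    by (simp add: slice_measure_def integrable_distr_eq[OF p])
  then show "h \<in> L2 (slice_measure \<Omega> t) \<longleftrightarrow> (\<lambda>x. indicator \<Omega> x * h (x, t)) \<in> L2 lborel"
    by (simp add: L2_zext[OF \<Omega>b] z)
  have "L2norm (slice_measure \<Omega> t) h = L2norm (restrict_space lborel \<Omega>) (\<lambda>x. h (x, t))"
    unfolding L2norm_def slice_measure_def using m by (subst integral_distr[OF p]) auto
  then show "L2norm (slice_measure \<Omega> t) h = L2norm lborel (\<lambda>x. indicator \<Omega> x * h (x, t))"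
    by (simp add: L2norm_zext[OF \<Omega>b] z)
qed

lemma slice_measure_L2_tendsto:
  fixes g :: "(real ^ 'n) \<times> real \<Rightarrow> real"
  assumes "\<And>k. \<phi> k \<in> borel_measurable borel" "g \<in> borel_measurable borel"
  shows "L2_tendsto (slice_measure \<Omega> t) \<phi> g \<longleftrightarrow>
     L2_tendsto lborel (\<lambda>k x. indicator \<Omega> x * \<phi> k (x, t)) (\<lambda>x. indicator \<Omega> x * g (x, t))"
proof -
  have m: "(\<lambda>z. \<phi> k z - g z) \<in> borel_measurable borel" for k using assms by measurable
  show ?thesis unfolding L2_tendsto_def slice_measure_L2[OF m] by (simp add: right_diff_distrib)
qed

end

text \<open>A difference at T would persist on an interval to the left of T, which has positive
  measure. This makes the value at T of the chosen function in \<open>grad_norm_final\<close>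
  independent of the choice.\<close>

lemma continuous_AE_eq_right_endpoint:
  fixes f g :: "real \<Rightarrow> real"
  assumes f: "continuous_on {0..T} f" and g: "continuous_on {0..T} g" and T: "0 < T"
    and ae: "AE t in lborel. t \<in> {0<..<T} \<longrightarrow> f t = g t"
  shows "f T = g T"
proof (rule ccontr)
  assume ne: "f T \<noteq> g T"
  have "continuous_on {0..T} (\<lambda>t. f t - g t)" using f g by (intro continuous_intros)
  then obtain d where d: "d > 0" "\<And>t. t \<in> {0..T} \<Longrightarrow> dist t T < d \<Longrightarrow> dist (f t - g t) (f T - g T) < \<bar>f T - g T\<bar>"
    using T ne unfolding continuous_on_iff by (metis atLeastAtMost_iff less_imp_le order_refl zero_less_abs_iff right_minus_eq)
  define a where "a = max 0 (T - d)"
  have a: "a < T" using T d by (simp add: a_def)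
  have "f t \<noteq> g t" if "t \<in> {a<..<T}" for t
    using d(2)[of t] that by (auto simp: a_def dist_real_def)
  moreover have "{a<..<T} \<subseteq> {0<..<T}" by (auto simp: a_def)
  ultimately have "AE t in lborel. t \<notin> {a<..<T}" using ae by (auto elim!: eventually_mono)
  then have "emeasure lborel {a<..<T} = 0"
    by (subst (asm) AE_iff_null_sets[symmetric]) (auto simp: null_sets_def)
  then show False using a by simp
qed

text \<open>Here A and B stand for the norms of the gradient and of the time derivative of the
  error, g and G for the norms at time T, and R, S, Z for the norms of the equation residual, the
  flux residual and the divergence of the latter. Young's inequality with weight \<gamma> absorbs A
  and B into the left side; a second one, with weight \<beta> or \<alpha>, splits the squared sum of
  residual norms.\<close>

lemma final_inequality:
  fixes A B C R S Z g G lam \<mu> \<gamma> \<alpha> \<beta> :: real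
  assumes 1: "2 * A\<^sup>2 + g\<^sup>2 \<le> 2 * A * (C * R + S)" and 2: "2 * B\<^sup>2 + G\<^sup>2 \<le> 2 * B * (R + Z)"
    and pos: "0 < lam" "0 < \<mu>" "0 < \<gamma>" "0 < \<alpha>" "0 < \<beta>"
  shows "(2 - 1 / \<gamma>) * (lam * A\<^sup>2 + \<mu> * B\<^sup>2) + lam * g\<^sup>2 + \<mu> * G\<^sup>2
    \<le> \<gamma> * (lam * ((1 + \<beta>) * S\<^sup>2 + (1 + 1 / \<beta>) * C\<^sup>2 * R\<^sup>2) + \<mu> * ((1 + \<alpha>) * Z\<^sup>2 + (1 + 1 / \<alpha>) * R\<^sup>2))"
proof -
  have Y1: "2 * a * m \<le> a\<^sup>2 / \<gamma> + \<gamma> * m\<^sup>2" for a m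
  proof -
    have "0 \<le> (a - \<gamma> * m)\<^sup>2 / \<gamma>" using pos by simp
    also have "\<dots> = a\<^sup>2 / \<gamma> + \<gamma> * m\<^sup>2 - 2 * a * m" using pos by (simp add: field_simps power2_eq_square)
    finally show ?thesis by simp
  qed
  have Y2: "(x + y)\<^sup>2 \<le> (1 + 1 / \<beta>) * x\<^sup>2 + (1 + \<beta>) * y\<^sup>2" if "\<beta> > 0" for x y \<beta> :: real
  proof -
    have "0 \<le> (x - \<beta> * y)\<^sup>2 / \<beta>" using that by simp
    also have "\<dots> = x\<^sup>2 / \<beta> + \<beta> * y\<^sup>2 - 2 * x * y" using that by (simp add: field_simps power2_eq_square)
    finally show ?thesis by (simp add: power2_sum algebra_simps)
  qed
  have a: "(2 - 1 / \<gamma>) * A\<^sup>2 + g\<^sup>2 \<le> \<gamma> * ((1 + \<beta>) * S\<^sup>2 + (1 + 1 / \<beta>) * C\<^sup>2 * R\<^sup>2)"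
  proof -
    have "(2 - 1 / \<gamma>) * A\<^sup>2 + g\<^sup>2 \<le> \<gamma> * (C * R + S)\<^sup>2"
      using 1 Y1[of A "C * R + S"] by (simp add: left_diff_distrib)
    also have "\<dots> \<le> \<gamma> * ((1 + 1 / \<beta>) * (C * R)\<^sup>2 + (1 + \<beta>) * S\<^sup>2)"
      using pos Y2 by (intro mult_left_mono) auto
    finally show ?thesis by (simp add: power_mult_distrib algebra_simps)
  qed
  have b: "(2 - 1 / \<gamma>) * B\<^sup>2 + G\<^sup>2 \<le> \<gamma> * ((1 + \<alpha>) * Z\<^sup>2 + (1 + 1 / \<alpha>) * R\<^sup>2)"
  proof -
    have "(2 - 1 / \<gamma>) * B\<^sup>2 + G\<^sup>2 \<le> \<gamma> * (R + Z)\<^sup>2"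
      using 2 Y1[of B "R + Z"] by (simp add: left_diff_distrib)
    also have "\<dots> \<le> \<gamma> * ((1 + 1 / \<alpha>) * R\<^sup>2 + (1 + \<alpha>) * Z\<^sup>2)"
      using pos Y2 by (intro mult_left_mono) auto
    finally show ?thesis by (simp add: algebra_simps)
  qed
  have "lam * ((2 - 1 / \<gamma>) * A\<^sup>2 + g\<^sup>2) + \<mu> * ((2 - 1 / \<gamma>) * B\<^sup>2 + G\<^sup>2)
    \<le> lam * (\<gamma> * ((1 + \<beta>) * S\<^sup>2 + (1 + 1 / \<beta>) * C\<^sup>2 * R\<^sup>2)) + \<mu> * (\<gamma> * ((1 + \<alpha>) * Z\<^sup>2 + (1 + 1 / \<alpha>) * R\<^sup>2))"
    using pos a b by (intro add_mono mult_left_mono) auto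
  then show ?thesis by (simp add: algebra_simps)
qed

section \<open>The error majorant\<close>

lemma is_grad_x_grad_x: "is_grad_x \<Omega> T w g \<Longrightarrow> is_grad_x \<Omega> T w (grad_x \<Omega> T w)"
  unfolding grad_x_def by (rule someI[of "is_grad_x \<Omega> T w"])

lemma is_d_t_d_t: "is_d_t \<Omega> T w g \<Longrightarrow> is_d_t \<Omega> T w (d_t \<Omega> T w)"
  unfolding d_t_def by (rule someI[of "is_d_t \<Omega> T w"])

lemma is_div_x_div_x: "is_div_x \<Omega> T y g \<Longrightarrow> is_div_x \<Omega> T y (div_x \<Omega> T y)"
  unfolding div_x_def by (rule someI[of "is_div_x \<Omega> T y"])

lemma VDelta_00D:
  assumes "w \<in> VDelta_00 \<Omega> T"
  shows "is_grad_x \<Omega> T w (grad_x \<Omega> T w)" "is_d_t \<Omega> T w (d_t \<Omega> T w)"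
    "is_div_x \<Omega> T (grad_x \<Omega> T w) (laplace_x \<Omega> T w)"
  using assms unfolding VDelta_00_def V1_0_def H1_def H10_def Hdiv_def laplace_x_def
  by (blast intro: is_grad_x_grad_x is_d_t_d_t is_div_x_div_x)+

lemma H1_tendsto_zext:
  fixes \<Omega> :: "(real ^ 'n) set"
  assumes \<Omega>: "open \<Omega>" "bounded \<Omega>" and \<phi>: "H1_tendsto \<Omega> T \<phi> w"
  shows "L2_tendsto lborel (\<lambda>k. zext (cyl \<Omega> T) (\<phi> k)) (zext (cyl \<Omega> T) w)"
    "L2_tendsto lborel (\<lambda>k. zext (cyl \<Omega> T) (gradx (\<phi> k))) (zext (cyl \<Omega> T) (grad_x \<Omega> T w))"
    "L2_tendsto lborel (\<lambda>k. zext (cyl \<Omega> T) (dtime (\<phi> k))) (zext (cyl \<Omega> T) (d_t \<Omega> T w))"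
  using \<phi> unfolding H1_tendsto_def H10_tendsto_def lebQ_zext[OF \<Omega>] by (simp_all add: cgrad_x_eq[OF \<Omega>, abs_def] cd_t_eq[OF \<Omega>])

lemma smooth_C_1: "smooth F \<Longrightarrow> C_k (Suc 0) F"
  by (simp only: smooth_def)

lemma gradx_diff:
  assumes "C_k (Suc 0) F" "C_k (Suc 0) G"
  shows "gradx (\<lambda>z. F z - G z) z = gradx F z - gradx G z"
proof -
  have "frechet_derivative (\<lambda>z. F z - G z) (at z) = (\<lambda>v. frechet_derivative F (at z) v - frechet_derivative G (at z) v)"
    by (rule frechet_derivative_at[symmetric])
       (rule has_derivative_diff[OF C_k_has_derivative[OF assms(1)] C_k_has_derivative[OF assms(2)]])
  then show ?thesis by (simp add: gradx_def scaleR_diff_left sum_subtractf)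
qed

lemma dtime_diff:
  assumes "C_k (Suc 0) F" "C_k (Suc 0) G"
  shows "dtime (\<lambda>z. F z - G z) z = dtime F z - dtime G z"
proof -
  have "frechet_derivative (\<lambda>z. F z - G z) (at z) = (\<lambda>v. frechet_derivative F (at z) v - frechet_derivative G (at z) v)"
    by (rule frechet_derivative_at[symmetric])
       (rule has_derivative_diff[OF C_k_has_derivative[OF assms(1)] C_k_has_derivative[OF assms(2)]])
  then show ?thesis by (simp add: dtime_def)
qed

text \<open>Linearity is not immediate because the derivatives of u - v are chosen anew; uniqueness
  of weak derivatives links them to the differences of the derivatives of u and v.\<close>

lemma H1_tendsto_diff:
  fixes \<Omega> :: "(real ^ 'n) set"
  assumes \<Omega>: "open \<Omega>" "bounded \<Omega>" and uv: "u \<in> VDelta_00 \<Omega> T" "v \<in> VDelta_00 \<Omega> T"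
    and \<phi>: "H1_tendsto \<Omega> T \<phi> u" "\<And>k. smooth (\<phi> k)" and \<psi>: "H1_tendsto \<Omega> T \<psi> v" "\<And>k. smooth (\<psi> k)"
  shows "H1_tendsto \<Omega> T (\<lambda>k z. \<phi> k z - \<psi> k z) (\<lambda>z. u z - v z)"
proof -
  note Du = VDelta_00D[OF uv(1)] and Dv = VDelta_00D[OF uv(2)]
  have g: "is_grad_x \<Omega> T (\<lambda>z. u z - v z) (\<lambda>z. grad_x \<Omega> T u z - grad_x \<Omega> T v z)"
    by (rule is_grad_x_diff[OF \<Omega> Du(1) Dv(1)])
  then have g': "is_grad_x \<Omega> T (\<lambda>z. u z - v z) (grad_x \<Omega> T (\<lambda>z. u z - v z))"
    by (rule is_grad_x_grad_x)
  have d: "is_d_t \<Omega> T (\<lambda>z. u z - v z) (\<lambda>z. d_t \<Omega> T u z - d_t \<Omega> T v z)"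
    by (rule is_d_t_diff[OF \<Omega> Du(2) Dv(2)])
  then have d': "is_d_t \<Omega> T (\<lambda>z. u z - v z) (d_t \<Omega> T (\<lambda>z. u z - v z))"
    by (rule is_d_t_d_t)
  have C: "C_k (Suc 0) (\<phi> k)" "C_k (Suc 0) (\<psi> k)" for k using \<phi>(2) \<psi>(2) smooth_C_1 by auto
  show ?thesis unfolding H1_tendsto_def H10_tendsto_def
  proof (intro conjI)
    show "L2_tendsto (lebQ \<Omega> T) (\<lambda>k z. \<phi> k z - \<psi> k z) (\<lambda>z. u z - v z)"
      using \<phi>(1) \<psi>(1) by (intro L2_tendsto_diff) (auto simp: H1_tendsto_def H10_tendsto_def)
    have "L2_tendsto (lebQ \<Omega> T) (\<lambda>k z. cgrad_x (\<phi> k) z - cgrad_x (\<psi> k) z) (\<lambda>z. grad_x \<Omega> T u z - grad_x \<Omega> T v z)"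
      using \<phi>(1) \<psi>(1) by (intro L2_tendsto_diff) (auto simp: H1_tendsto_def H10_tendsto_def)
    then show "L2_tendsto (lebQ \<Omega> T) (\<lambda>k. cgrad_x (\<lambda>z. \<phi> k z - \<psi> k z)) (grad_x \<Omega> T (\<lambda>z. u z - v z))"
      unfolding cgrad_x_eq[OF \<Omega>, abs_def] gradx_diff[OF C]
      by (rule L2_tendsto_cong_AE) (use g g' is_grad_x_unique[OF \<Omega> g g'] in \<open>auto simp: is_grad_x_def dest: L2_measurable\<close>)
    have "L2_tendsto (lebQ \<Omega> T) (\<lambda>k z. cd_t (\<phi> k) z - cd_t (\<psi> k) z) (\<lambda>z. d_t \<Omega> T u z - d_t \<Omega> T v z)"
      using \<phi>(1) \<psi>(1) by (intro L2_tendsto_diff) (auto simp: H1_tendsto_def)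
    moreover have "cd_t (\<lambda>z. \<phi> k z - \<psi> k z) = (\<lambda>z. cd_t (\<phi> k) z - cd_t (\<psi> k) z)" for k
      unfolding cd_t_eq[OF \<Omega>] by (rule ext) (rule dtime_diff[OF C])
    ultimately have "L2_tendsto (lebQ \<Omega> T) (\<lambda>k. cd_t (\<lambda>z. \<phi> k z - \<psi> k z)) (\<lambda>z. d_t \<Omega> T u z - d_t \<Omega> T v z)" by simp
    then show "L2_tendsto (lebQ \<Omega> T) (\<lambda>k. cd_t (\<lambda>z. \<phi> k z - \<psi> k z)) (d_t \<Omega> T (\<lambda>z. u z - v z))"
      by (rule L2_tendsto_cong_AE) (use d d' is_d_t_unique[OF \<Omega> d d'] in \<open>auto simp: is_d_t_def dest: L2_measurable\<close>)
  qed
qed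

lemma has_trace_diff:
  fixes \<Omega> :: "(real ^ 'n) set"
  assumes \<Omega>: "open \<Omega>" "bounded \<Omega>" and uv: "u \<in> VDelta_00 \<Omega> T" "v \<in> VDelta_00 \<Omega> T"
    and tr: "has_trace (H1_tendsto \<Omega> T) \<Sigma> u (\<lambda>_. 0)" "has_trace (H1_tendsto \<Omega> T) \<Sigma> v (\<lambda>_. 0)"
  shows "has_trace (H1_tendsto \<Omega> T) \<Sigma> (\<lambda>z. u z - v z) (\<lambda>_. 0)"
proof -
  obtain \<phi> \<psi> where *: "\<And>k. smooth (\<phi> k)" "H1_tendsto \<Omega> T \<phi> u" "L2_tendsto \<Sigma> \<phi> (\<lambda>_. 0)"
     "\<And>k. smooth (\<psi> k)" "H1_tendsto \<Omega> T \<psi> v" "L2_tendsto \<Sigma> \<psi> (\<lambda>_. 0)"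
    using tr unfolding has_trace_def by metis
  have "L2_tendsto \<Sigma> (\<lambda>k z. \<phi> k z - \<psi> k z) (\<lambda>z. 0)" using L2_tendsto_diff[OF *(3,6)] by simp
  then show ?thesis unfolding has_trace_def
    by (intro conjI L2_zero exI[of _ "\<lambda>k z. \<phi> k z - \<psi> k z"] allI smooth_diff *(1,4) H1_tendsto_diff[OF \<Omega> uv *(2,1,5,4)])
qed

theorem theorem1:
  fixes \<Omega> :: "(real ^ 'n) set"
    and T C\<^sub>F lam \<mu> \<gamma> \<alpha> \<beta> :: real
    and f u v e :: "(real ^ 'n) \<times> real \<Rightarrow> real"
    and y :: "(real ^ 'n) \<times> real \<Rightarrow> real ^ 'n"
  assumes "CARD('n) \<in> {1, 2, 3}"
    and "bounded_Lipschitz_domain \<Omega>"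
    and "0 < T"
    and "0 < C\<^sub>F"
    and "\<forall>w\<in>H10_0 \<Omega> T. normQ \<Omega> T w \<le> C\<^sub>F * normQ \<Omega> T (grad_x \<Omega> T w)"
    and "f \<in> L2 (lebQ \<Omega> T)"
    and "exact_solution \<Omega> T f u"
    and "0 < lam" and "0 < \<mu>"
    and "v \<in> VDelta_00 \<Omega> T"
    and "y \<in> Hdiv \<Omega> T"
    and "1 / 2 \<le> \<gamma>"
    and "0 < \<alpha>" and "0 < \<beta>"
    and "e = (\<lambda>z. u z - v z)"
  shows "(2 - 1 / \<gamma>) * (lam * (normQ \<Omega> T (grad_x \<Omega> T e))\<^sup>2 + \<mu> * (normQ \<Omega> T (d_t \<Omega> T e))\<^sup>2)
           + lam * (norm_final \<Omega> T e)\<^sup>2 + \<mu> * (grad_norm_final \<Omega> T e)\<^sup>2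
         \<le> \<gamma> * (lam * M_bar \<Omega> T C\<^sub>F f v y \<beta> + \<mu> * M_tilde \<Omega> T f v y \<alpha>)"
proof -
  have Lip: "bounded_Lipschitz_domain \<Omega>" and T: "0 < T" by fact+
  have \<Omega>: "open \<Omega>" "bounded \<Omega>" using Lip by (auto simp: bounded_Lipschitz_domain_def)
  have u: "u \<in> VDelta_00 \<Omega> T" and v: "v \<in> VDelta_00 \<Omega> T"
    and heat: "AE z in lebQ \<Omega> T. d_t \<Omega> T u z - laplace_x \<Omega> T u z = f z"
    using assms by (auto simp: exact_solution_def)
  note Du = VDelta_00D[OF u] and Dv = VDelta_00D[OF v]
  have e: "e = (\<lambda>z. u z - v z)" by fact
  let ?Q = "cyl \<Omega> T" and ?x = "zext (cyl \<Omega> T)"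
  have Qc: "?Q = \<Omega> \<times> {0<..<T}" by (simp add: cyl_def)
  note zL = lebQ_zext[OF \<Omega>, where T=T]
  have ge: "is_grad_x \<Omega> T e (grad_x \<Omega> T e)"
    unfolding e by (rule is_grad_x_grad_x[OF is_grad_x_diff[OF \<Omega> Du(1) Dv(1)]])
  have de: "is_d_t \<Omega> T e (d_t \<Omega> T e)"
    unfolding e by (rule is_d_t_d_t[OF is_d_t_diff[OF \<Omega> Du(2) Dv(2)]])
  have geq: "AE z in lebQ \<Omega> T. grad_x \<Omega> T e z = grad_x \<Omega> T u z - grad_x \<Omega> T v z"
    using is_grad_x_unique[OF \<Omega> ge[unfolded e] is_grad_x_diff[OF \<Omega> Du(1) Dv(1)]] unfolding e .
  have deq: "AE z in lebQ \<Omega> T. d_t \<Omega> T e z = d_t \<Omega> T u z - d_t \<Omega> T v z"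
    using is_d_t_unique[OF \<Omega> de[unfolded e] is_d_t_diff[OF \<Omega> Du(2) Dv(2)]] unfolding e .
  \<comment> \<open>A concrete representative of the Laplacian of e. The gradient chosen for e
    differs from the difference of gradients on a null set, so its weak divergence has to be
    verified.\<close>
  define lap where "lap z = laplace_x \<Omega> T u z - laplace_x \<Omega> T v z" for z
  have lape: "is_div_x \<Omega> T (grad_x \<Omega> T e) lap"
  proof -
    have d: "is_div_x \<Omega> T (\<lambda>z. grad_x \<Omega> T u z - grad_x \<Omega> T v z) lap"
      unfolding lap_def[abs_def] by (rule is_div_x_diff[OF \<Omega> Du(3) Dv(3)])
    have "(\<integral>z. grad_x \<Omega> T e z \<bullet> cgrad_x \<phi> z \<partial>lebQ \<Omega> T) = (\<integral>z. (grad_x \<Omega> T u z - grad_x \<Omega> T v z) \<bullet> cgrad_x \<phi> z \<partial>lebQ \<Omega> T)"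
      if "\<phi> \<in> test_functions ?Q" for \<phi>
    proof (rule integral_cong_AE)
      note [measurable] = L2_measurable[OF test_function_L2(2)[OF \<Omega> that]]
      have [measurable]: "grad_x \<Omega> T w \<in> borel_measurable (lebQ \<Omega> T)" if "is_grad_x \<Omega> T w (grad_x \<Omega> T w)" for w
        using that by (auto simp: is_grad_x_def dest: L2_measurable)
      note [measurable] = this[OF ge] this[OF Du(1)] this[OF Dv(1)]
      show "(\<lambda>z. grad_x \<Omega> T e z \<bullet> cgrad_x \<phi> z) \<in> borel_measurable (lebQ \<Omega> T)"
        "(\<lambda>z. (grad_x \<Omega> T u z - grad_x \<Omega> T v z) \<bullet> cgrad_x \<phi> z) \<in> borel_measurable (lebQ \<Omega> T)" by measurable
      show "AE z in lebQ \<Omega> T. grad_x \<Omega> T e z \<bullet> cgrad_x \<phi> z = (grad_x \<Omega> T u z - grad_x \<Omega> T v z) \<bullet> cgrad_x \<phi> z"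
        using geq by eventually_elim simp
    qed
    then show ?thesis using d ge unfolding is_div_x_def is_grad_x_def by simp
  qed
  have divy: "is_div_x \<Omega> T y (div_x \<Omega> T y)"
    using assms(11) unfolding Hdiv_def by (blast intro: is_div_x_div_x)
  \<comment> \<open>A representative of the divergence of the flux residual, in which the divergence
    of y cancels pointwise against that in \<open>r_eq\<close>. It agrees almost everywhere with the
    one chosen by \<open>div_x\<close>.\<close>
  define rdd where "rdd z = div_x \<Omega> T y z - laplace_x \<Omega> T v z" for z
  have rd: "is_div_x \<Omega> T (r_d \<Omega> T v y) rdd"
    unfolding r_d_def rdd_def[abs_def] by (rule is_div_x_diff[OF \<Omega> divy Dv(3)])
  have rd': "is_div_x \<Omega> T (r_d \<Omega> T v y) (div_x \<Omega> T (r_d \<Omega> T v y))"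
    by (rule is_div_x_div_x[OF rd])
  define req where "req = r_eq \<Omega> T f v y"
  have reqL: "req \<in> L2 (lebQ \<Omega> T)"
    unfolding req_def r_eq_def using assms(6) Dv(2) divy by (intro L2_add L2_diff) (auto simp: is_d_t_def is_div_x_def)
  have L: "e \<in> L2 (lebQ \<Omega> T)" "grad_x \<Omega> T e \<in> L2 (lebQ \<Omega> T)" "d_t \<Omega> T e \<in> L2 (lebQ \<Omega> T)" "lap \<in> L2 (lebQ \<Omega> T)"
    "r_d \<Omega> T v y \<in> L2 (lebQ \<Omega> T)" "rdd \<in> L2 (lebQ \<Omega> T)"
    using ge de lape rd by (auto simp: is_grad_x_def is_d_t_def is_div_x_def)
  have Lx: "?x e \<in> L2 lborel" "?x (grad_x \<Omega> T e) \<in> L2 lborel" "?x (d_t \<Omega> T e) \<in> L2 lborel" "?x lap \<in> L2 lborel"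
    "?x (r_d \<Omega> T v y) \<in> L2 lborel" "?x rdd \<in> L2 lborel" "?x req \<in> L2 lborel"
    using L reqL unfolding zL by auto
  have x0: "?x h z = 0" if "z \<notin> \<Omega> \<times> {0<..<T}" for h :: "_ \<Rightarrow> 'z::real_vector" and z
    using that by (simp add: zext_outside Qc)
  \<comment> \<open>The divergence of y cancels in req - rdd, which leaves f - \<open>d_t\<close> v
    + \<open>laplace_x\<close> v, and f is replaced by means of the heat equation for u.\<close>
  have residual: "AE z in lborel. ?x (d_t \<Omega> T e) z - ?x lap z = ?x req z - ?x rdd z"
  proof -
    have "AE z in lebQ \<Omega> T. d_t \<Omega> T e z - lap z = req z - rdd z"
      using heat deq by eventually_elim (simp add: lap_def req_def r_eq_def rdd_def)
    then show ?thesis unfolding AE_lebQ[OF \<Omega>] by eventually_elim (auto simp: zext_def indicator_def)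
  qed
  have trl: "has_trace (H1_tendsto \<Omega> T) (lateral_measure \<Omega> T) e (\<lambda>_. 0)"
    unfolding e using u v by (intro has_trace_diff[OF \<Omega>]) (auto simp: VDelta_00_def V1_0_def)
  have tr0: "has_trace (H1_tendsto \<Omega> T) (slice_measure \<Omega> 0) e (\<lambda>_. 0)"
    unfolding e using u v by (intro has_trace_diff[OF \<Omega>]) (auto simp: VDelta_00_def)
  \<comment> \<open>The sequence \<phi> carries the lateral trace and \<psi> below the initial one.
    They may be different, so each lemma is fed with the one it needs.\<close>
  obtain \<phi> where \<phi>: "\<And>k. smooth (\<phi> k)" "H1_tendsto \<Omega> T \<phi> e" "L2_tendsto (lateral_measure \<Omega> T) \<phi> (\<lambda>_. 0)"
    using trl unfolding has_trace_def by blast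
  obtain \<psi> where \<psi>: "\<And>k. smooth (\<psi> k)" "H1_tendsto \<Omega> T \<psi> e" "L2_tendsto (slice_measure \<Omega> 0) \<psi> (\<lambda>_. 0)"
    using tr0 unfolding has_trace_def by blast
  note \<phi>1 = smooth_C_1[OF \<phi>(1)] and \<psi>1 = smooth_C_1[OF \<psi>(1)]
  note \<phi>x = H1_tendsto_zext[OF \<Omega> \<phi>(2)] and \<psi>x = H1_tendsto_zext[OF \<Omega> \<psi>(2)]
  define J where "J k = (L2norm (lateral_measure \<Omega> T) (\<phi> k))\<^sup>2" for k
  have \<phi>L: "\<phi> k \<in> L2 (lateral_measure \<Omega> T)" for k using \<phi>(3) by (simp add: L2_tendsto_def)
  have J: "(\<integral>\<^sup>+x. (\<integral>\<^sup>+t. ennreal ((\<phi> k (x, t))\<^sup>2) * indicator {0<..<T} t \<partial>lborel) * indicator (frontier \<Omega>) x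
               \<partial>hausdorff_measure (DIM(real ^ 'n) - 1)) \<le> ennreal (J k)" for k
    unfolding J_def by (rule eq_refl[OF lateral_nn_integral[OF \<Omega> \<phi>L]])
  have J0: "0 \<le> J k" for k by (simp add: J_def)
  have Jl: "J \<longlonglongrightarrow> 0"
  proof -
    have "(\<lambda>k. (L2norm (lateral_measure \<Omega> T) (\<phi> k))\<^sup>2) \<longlonglongrightarrow> 0\<^sup>2"
      using \<phi>(3) by (intro tendsto_intros) (simp add: L2_tendsto_def)
    then show ?thesis by (simp add: J_def[abs_def])
  qed
  \<comment> \<open>Applied twice: to the gradient of e with divergence \<open>lap\<close>, and to
    the flux residual with divergence \<open>rdd\<close>.\<close>
  have ibp: "(\<integral>z. ?x h z \<bullet> ?x (grad_x \<Omega> T e) z \<partial>lborel) + (\<integral>z. ?x dh z * ?x e z \<partial>lborel) = 0"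
    if h: "is_div_x \<Omega> T h dh" for h dh
  proof (rule integration_by_parts_cylinder[OF Lip T _ x0 _ x0 _ \<phi>1 _ Lx(1) _ Lx(2) J J0 Jl])
    show "?x h \<in> L2 lborel" "?x dh \<in> L2 lborel" using h by (auto simp: is_div_x_def zL)
    show "(\<integral>z. frechet_derivative \<eta> (at z) (?x h z, 0) \<partial>lborel) = - (\<integral>z. \<eta> z * ?x dh z \<partial>lborel)"
      if "\<eta> \<in> test_functions (\<Omega> \<times> {0<..<T})" for \<eta>
      using is_div_x_zext[OF \<Omega> h] that by (simp add: Qc)
    show "L2_tendsto lborel (\<lambda>k z. indicator (\<Omega> \<times> {0<..<T}) z * \<phi> k z) (?x e)"
      using \<phi>x(1) unfolding zext_def[abs_def] Qc by simp
    show "L2_tendsto lborel (\<lambda>k z. indicator (\<Omega> \<times> {0<..<T}) z *\<^sub>R gradx (\<phi> k) z) (?x (grad_x \<Omega> T e))"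
      using \<phi>x(2) unfolding zext_def[abs_def] Qc by simp
  qed
  have C1b: "F \<in> borel_measurable borel" if "C_k (Suc 0) F" for F :: "(real ^ 'n) \<times> real \<Rightarrow> real"
    by (rule borel_measurable_C_1(1)[OF that])
  have init: "L2_tendsto lborel (\<lambda>k x. indicator \<Omega> x * \<psi> k (x, 0)) (\<lambda>x. 0)"
    using \<psi>(3) slice_measure_L2_tendsto[OF \<Omega>, of \<psi> "\<lambda>_. 0" 0] C1b[OF \<psi>1] by simp
  define g where "g x = indicator \<Omega> x * tprim (?x (d_t \<Omega> T e)) (x, T)" for x
  have H1E: "L2_tendsto lborel (\<lambda>k z. indicator (\<Omega> \<times> {0<..<T}) z * \<xi> k z) (?x e)"
    "L2_tendsto lborel (\<lambda>k z. indicator (\<Omega> \<times> {0<..<T}) z * dtime (\<xi> k) z) (?x (d_t \<Omega> T e))"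
    if "H1_tendsto \<Omega> T \<xi> e" for \<xi>
    using H1_tendsto_zext(1,3)[OF \<Omega> that] unfolding zext_def[abs_def] Qc by simp_all
  note time_traces' = time_traces[OF \<Omega> T Lx(1) x0 Lx(3) x0 \<psi>1 H1E[OF \<psi>(2)] init, folded g_def]
  have tt1: "AE z in lborel. z \<in> \<Omega> \<times> {0<..<T} \<longrightarrow> ?x e z = tprim (?x (d_t \<Omega> T e)) z"
    by (rule time_traces'(1))
  have tt2: "g \<in> L2 lborel" by (rule time_traces'(2))
  have tt3: "L2_tendsto lborel (\<lambda>k x. indicator \<Omega> x * \<xi> k (x, T)) g"
    if "\<And>k. C_k (Suc 0) (\<xi> k)" "H1_tendsto \<Omega> T \<xi> e" for \<xi>
    by (rule time_traces'(3)) (use that H1E[OF that(2)] in auto)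
  have tt4: "(L2norm lborel g)\<^sup>2 = 2 * (\<integral>z. ?x e z * ?x (d_t \<Omega> T e) z \<partial>lborel)"
    by (rule time_traces'(4))
  have final: "(norm_final \<Omega> T e)\<^sup>2 = 2 * (\<integral>z. ?x e z * ?x (d_t \<Omega> T e) z \<partial>lborel)"
  proof -
    \<comment> \<open>A candidate for the final trace that is constant in time and Borel on the
      whole space; the slice measure only sees its values over the domain at time T. It shows that
      the choice in \<open>norm_final\<close> is not empty.\<close>
    define G0 where "G0 z = tprim (?x (d_t \<Omega> T e)) (fst z, T)" for z :: "(real ^ 'n) \<times> real"
    have tpm: "tprim (?x (d_t \<Omega> T e)) \<in> borel_measurable borel"
      using L2_measurable[OF Lx(3)] by (intro borel_measurable_tprim) simp
    have G0m: "G0 \<in> borel_measurable borel" unfolding G0_def[abs_def]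
      by (rule measurable_compose[OF _ tpm]) (intro borel_measurable_continuous_onI continuous_intros)
    have G0g: "(\<lambda>x. indicator \<Omega> x * G0 (x, T)) = g" by (auto simp: G0_def g_def)
    have "has_trace (H1_tendsto \<Omega> T) (slice_measure \<Omega> T) e G0"
      unfolding has_trace_def
    proof (intro conjI exI[of _ \<psi>] allI)
      show "G0 \<in> L2 (slice_measure \<Omega> T)" unfolding slice_measure_L2(1)[OF \<Omega> G0m] G0g by (rule tt2)
      show "L2_tendsto (slice_measure \<Omega> T) \<psi> G0"
        unfolding slice_measure_L2_tendsto[OF \<Omega> C1b[OF \<psi>1] G0m] G0g by (rule tt3[OF \<psi>1 \<psi>(2)])
    qed (use \<psi> in auto)
    then have "has_trace (H1_tendsto \<Omega> T) (slice_measure \<Omega> T) e (SOME g. has_trace (H1_tendsto \<Omega> T) (slice_measure \<Omega> T) e g)"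
      by (rule someI[of "has_trace (H1_tendsto \<Omega> T) (slice_measure \<Omega> T) e"])
    \<comment> \<open>The chosen trace comes with its own sequence \<xi>. By \<open>tt3\<close> the
      values of \<xi> at T converge to g as well, so the norm does not depend on the choice.\<close>
    then obtain g' \<xi> where g': "g' = (SOME g. has_trace (H1_tendsto \<Omega> T) (slice_measure \<Omega> T) e g)"
      "g' \<in> L2 (slice_measure \<Omega> T)" "\<And>k. smooth (\<xi> k)" "H1_tendsto \<Omega> T \<xi> e" "L2_tendsto (slice_measure \<Omega> T) \<xi> g'"
      unfolding has_trace_def by blast
    note \<xi>1 = smooth_C_1[OF g'(3)]
    have "(\<lambda>k. L2norm (slice_measure \<Omega> T) (\<xi> k)) \<longlonglongrightarrow> L2norm (slice_measure \<Omega> T) g'"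
      by (rule L2_tendsto_norm[OF g'(5,2)])
    moreover have "(\<lambda>k. L2norm (slice_measure \<Omega> T) (\<xi> k)) \<longlonglongrightarrow> L2norm lborel g"
      unfolding slice_measure_L2(2)[OF \<Omega> C1b[OF \<xi>1]]
      by (rule L2_tendsto_norm[OF tt3[OF \<xi>1 g'(4)] tt2])
    ultimately have "L2norm (slice_measure \<Omega> T) g' = L2norm lborel g" by (rule LIMSEQ_unique)
    then show ?thesis using tt4 by (simp add: norm_final_def g'(1)[symmetric])
  qed
  have "\<exists>N. continuous_on {0..T} N \<and> N T = - 2 * (\<integral>z. ?x lap z * ?x (d_t \<Omega> T e) z \<partial>lborel) \<and>
     (AE t in lborel. t \<in> {0<..<T} \<longrightarrow> N t = (\<integral>x. (norm (?x (grad_x \<Omega> T e) (x, t)))\<^sup>2 \<partial>lborel))"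
  proof (rule gradient_energy_identity[OF Lip T Lx(2) x0 Lx(4) x0 _ \<phi>1 _ Lx(1) x0 _ J J0 Jl Lx(3) x0 tt1])
    show "(\<integral>z. frechet_derivative \<eta> (at z) (?x (grad_x \<Omega> T e) z, 0) \<partial>lborel) = - (\<integral>z. \<eta> z * ?x lap z \<partial>lborel)"
      if "\<eta> \<in> test_functions (\<Omega> \<times> {0<..<T})" for \<eta>
      using is_div_x_zext[OF \<Omega> lape] that by (simp add: Qc)
    show "L2_tendsto lborel (\<lambda>k z. indicator (\<Omega> \<times> {0<..<T}) z * \<phi> k z) (?x e)"
      using \<phi>x(1) unfolding zext_def[abs_def] Qc by simp
    show "L2_tendsto lborel (\<lambda>k z. indicator (\<Omega> \<times> {0<..<T}) z *\<^sub>R gradx (\<phi> k) z) (?x (grad_x \<Omega> T e))"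
      using \<phi>x(2) unfolding zext_def[abs_def] Qc by simp
  qed
  then obtain N where N: "continuous_on {0..T} N" "N T = - 2 * (\<integral>z. ?x lap z * ?x (d_t \<Omega> T e) z \<partial>lborel)"
    "AE t in lborel. t \<in> {0<..<T} \<longrightarrow> N t = (\<integral>x. (norm (?x (grad_x \<Omega> T e) (x, t)))\<^sup>2 \<partial>lborel)" by blast
  have slice: "(\<integral>x. (norm (?x (grad_x \<Omega> T e) (x, t)))\<^sup>2 \<partial>lborel) = (L2norm (restrict_space lborel \<Omega>) (\<lambda>x. grad_x \<Omega> T e (x, t)))\<^sup>2"
    if "t \<in> {0<..<T}" for t
  proof -
    have "?x (grad_x \<Omega> T e) (x, t) = zext \<Omega> (\<lambda>x. grad_x \<Omega> T e (x, t)) x" for x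
      using that by (auto simp: zext_def Qc indicator_def)
    moreover have "\<Omega> \<in> sets borel" using \<Omega> by auto
    ultimately show ?thesis by (simp add: L2norm_zext L2norm_sq)
  qed
  have gfinal: "(grad_norm_final \<Omega> T e)\<^sup>2 = - 2 * (\<integral>z. ?x lap z * ?x (d_t \<Omega> T e) z \<partial>lborel)"
  proof -
    let ?P = "\<lambda>N. continuous_on {0..T} N \<and> (AE t in lborel. t \<in> {0<..<T} \<longrightarrow>
        N t = (L2norm (restrict_space lborel \<Omega>) (\<lambda>x. grad_x \<Omega> T e (x, t)))\<^sup>2)"
    have AEN: "AE t in lborel. t \<in> {0<..<T} \<longrightarrow> N t = (L2norm (restrict_space lborel \<Omega>) (\<lambda>x. grad_x \<Omega> T e (x, t)))\<^sup>2"
      using N(3) by eventually_elim (simp add: slice)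
    with N(1) have "?P N" by blast
    then have P: "?P (SOME N. ?P N)" by (rule someI[of ?P])
    have "(SOME N. ?P N) T = N T"
    proof (rule continuous_AE_eq_right_endpoint[OF conjunct1[OF P] N(1) T])
      show "AE t in lborel. t \<in> {0<..<T} \<longrightarrow> (SOME N. ?P N) t = N t"
        using conjunct2[OF P] AEN by eventually_elim simp
    qed
    \<comment> \<open>Nonnegativity holds almost everywhere, as the values are squared norms, and
      passes to the end point by comparing N with its absolute value. It lets the square cancel the
      square root.\<close>
    moreover have "N T = \<bar>N T\<bar>"
    proof (rule continuous_AE_eq_right_endpoint[OF N(1) _ T])
      show "continuous_on {0..T} (\<lambda>t. \<bar>N t\<bar>)" using N(1) by (intro continuous_intros)
      show "AE t in lborel. t \<in> {0<..<T} \<longrightarrow> N t = \<bar>N t\<bar>" using AEN by eventually_elim simp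
    qed
    ultimately show ?thesis unfolding grad_norm_final_def N(2)[symmetric] by simp
  qed
  define nA nB nR nS nZ where "nA = L2norm lborel (?x (grad_x \<Omega> T e))" and "nB = L2norm lborel (?x (d_t \<Omega> T e))"
    and "nR = L2norm lborel (?x req)" and "nS = L2norm lborel (?x (r_d \<Omega> T v y))" and "nZ = L2norm lborel (?x rdd)"
  have nn: "normQ \<Omega> T (grad_x \<Omega> T e) = nA" "normQ \<Omega> T (d_t \<Omega> T e) = nB" "normQ \<Omega> T (r_eq \<Omega> T f v y) = nR"
    "normQ \<Omega> T (r_d \<Omega> T v y) = nS"
    by (simp_all add: normQ_def zL nA_def nB_def nR_def nS_def req_def)
  have nZ: "normQ \<Omega> T (div_x \<Omega> T (r_d \<Omega> T v y)) = nZ"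
  proof -
    have "L2norm (lebQ \<Omega> T) (div_x \<Omega> T (r_d \<Omega> T v y)) = L2norm (lebQ \<Omega> T) rdd"
      by (rule L2norm_cong_AE) (use rd rd' is_div_x_unique[OF \<Omega> rd' rd] in \<open>auto simp: is_div_x_def dest: L2_measurable\<close>)
    then show ?thesis by (simp add: normQ_def zL nZ_def)
  qed
  have nE: "L2norm lborel (?x e) \<le> C\<^sub>F * nA"
  proof -
    \<comment> \<open>The sequence for the lateral trace in H1 also serves as one for H10, so the
      Friedrichs inequality applies to e.\<close>
    have "e \<in> H10_0 \<Omega> T"
      using L(1) ge trl unfolding H10_0_def H10_def has_trace_def H1_tendsto_def by blast
    then have "normQ \<Omega> T e \<le> C\<^sub>F * normQ \<Omega> T (grad_x \<Omega> T e)" using assms(5) by blast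
    then show ?thesis unfolding nn by (simp add: normQ_def zL)
  qed
  \<comment> \<open>The residual equation multiplied by h and integrated; h will be the zero
    extension of e and of its time derivative.\<close>
  have test: "(\<integral>z. ?x (d_t \<Omega> T e) z * h z \<partial>lborel) - (\<integral>z. ?x lap z * h z \<partial>lborel)
      = (\<integral>z. ?x req z * h z \<partial>lborel) - (\<integral>z. ?x rdd z * h z \<partial>lborel)" if h: "h \<in> L2 lborel" for h
  proof -
    note [measurable] = L2_measurable[OF h] L2_measurable[OF Lx(3)] L2_measurable[OF Lx(4)] L2_measurable[OF Lx(6)] L2_measurable[OF Lx(7)]
    have "(\<integral>z. (?x (d_t \<Omega> T e) z - ?x lap z) * h z \<partial>lborel) = (\<integral>z. (?x req z - ?x rdd z) * h z \<partial>lborel)"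
      by (rule integral_cong_AE) (measurable, use residual in \<open>eventually_elim; simp\<close>)
    then show ?thesis
      using L2_mult_integrable[OF Lx(3) h] L2_mult_integrable[OF Lx(4) h] L2_mult_integrable[OF Lx(6) h] L2_mult_integrable[OF Lx(7) h]
      by (simp add: left_diff_distrib)
  qed
  have I: "(\<integral>z. ?x (grad_x \<Omega> T e) z \<bullet> ?x (grad_x \<Omega> T e) z \<partial>lborel) = nA\<^sup>2"
    "(\<integral>z. ?x (d_t \<Omega> T e) z * ?x (d_t \<Omega> T e) z \<partial>lborel) = nB\<^sup>2"
    unfolding nA_def nB_def L2norm_sq by (simp add: power2_norm_eq_inner, simp add: power2_eq_square)
  have CS: "(\<integral>z. ?x req z * ?x e z \<partial>lborel) \<le> nR * (C\<^sub>F * nA)"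
    "(\<integral>z. ?x (r_d \<Omega> T v y) z \<bullet> ?x (grad_x \<Omega> T e) z \<partial>lborel) \<le> nS * nA"
    "(\<integral>z. ?x req z * ?x (d_t \<Omega> T e) z \<partial>lborel) \<le> nR * nB"
    "- (\<integral>z. ?x rdd z * ?x (d_t \<Omega> T e) z \<partial>lborel) \<le> nZ * nB"
  proof -
    have "(\<integral>z. ?x req z * ?x e z \<partial>lborel) \<le> nR * L2norm lborel (?x e)"
      using L2_Cauchy_Schwarz_mult[OF Lx(7,1)] by (simp add: nR_def)
    also have "\<dots> \<le> nR * (C\<^sub>F * nA)" by (rule mult_left_mono[OF nE]) (simp add: nR_def)
    finally show "(\<integral>z. ?x req z * ?x e z \<partial>lborel) \<le> nR * (C\<^sub>F * nA)" .
    show "(\<integral>z. ?x (r_d \<Omega> T v y) z \<bullet> ?x (grad_x \<Omega> T e) z \<partial>lborel) \<le> nS * nA"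
      using L2_Cauchy_Schwarz[OF Lx(5,2)] by (simp add: nS_def nA_def)
    show "(\<integral>z. ?x req z * ?x (d_t \<Omega> T e) z \<partial>lborel) \<le> nR * nB"
      using L2_Cauchy_Schwarz_mult[OF Lx(7,3)] by (simp add: nR_def nB_def)
    show "- (\<integral>z. ?x rdd z * ?x (d_t \<Omega> T e) z \<partial>lborel) \<le> nZ * nB"
      using L2_Cauchy_Schwarz_mult[OF Lx(6,3)] by (simp add: nZ_def nB_def)
  qed
  have sw: "(\<integral>z. ?x (d_t \<Omega> T e) z * ?x e z \<partial>lborel) = (\<integral>z. ?x e z * ?x (d_t \<Omega> T e) z \<partial>lborel)"
    by (simp add: mult.commute)
  \<comment> \<open>Test with e. The time derivative term is half of the squared final norm, and
    both divergences are integrated by parts, so the flux residual meets the gradient of e.\<close>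
  have 1: "2 * nA\<^sup>2 + (norm_final \<Omega> T e)\<^sup>2 \<le> 2 * nA * (C\<^sub>F * nR + nS)"
    using test[OF Lx(1)] ibp[OF lape] ibp[OF rd] CS(1,2) unfolding final I sw by (simp add: algebra_simps)
  \<comment> \<open>Test with the time derivative of e. The Laplacian term is half of the squared
    final gradient norm, and the divergence of the flux residual stays as it is, which is why it
    appears in \<open>M_tilde\<close>.\<close>
  have 2: "2 * nB\<^sup>2 + (grad_norm_final \<Omega> T e)\<^sup>2 \<le> 2 * nB * (nR + nZ)"
    using test[OF Lx(3)] CS(3,4) unfolding gfinal I by (simp add: algebra_simps)
  have "0 < \<gamma>" using assms(12) by linarith
  from final_inequality[OF 1 2 assms(8,9) this assms(13,14)]
  show ?thesis unfolding M_bar_def M_tilde_def nn nZ .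
qed

end
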